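(* Let $n \geq 1$, let $\rho>0$, and let $\mu = \exp(-V(x))\,dx$ be a probability measure on $\mathbb{R}^n$ with $V : \mathbb{R}^n \to \mathbb{R}$ smooth and $\nabla^2 V \leq \rho\,\mathrm{Id}$ on $\mathbb{R}^n$. Then \[ \forall k \geq 1 \quad \lambda_k(\mathbb{R}^n,|\cdot|,\mu) \leq \lambda_k(\mathbb{R}^n,|\cdot|,\gamma^n_\rho). \]
   Context: $|\cdot|$ denotes the Euclidean metric, and $\gamma^n_\rho$ denotes the $n$-dimensional Gaussian probability measure with covariance $\frac{1}{\rho}\mathrm{Id}$, i.e. with density proportional to $\exp(-\rho|x|^2/2)$. For a measure $\mu = \exp(-V(x))\,dx$ on $\mathbb{R}^n$ with $V$ smooth, the weighted Laplacian is $\Delta_\mu f = \Delta f - \langle \nabla V,\nabla f\rangle$. The operator $-\Delta_\mu$ is positive semi-definite and essentially self-adjoint on $C_c^\infty(\mathbb{R}^n) \subset L^2(\mu)$; the same notation is used for its unique self-adjoint extension. Let $\{E_\lambda\}$ be its spectral decomposition of identity ($E_\lambda$ is the spectral projection onto $(-\infty,\lambda]$). One sets, for $k \geq 1$, \[ \lambda_k(\mathbb{R}^n,|\cdot|,\mu) := \sup\{\lambda \in \mathbb{R} : \dim(\mathrm{Im}(E_\lambda)) < k\}. \] When the spectrum is discrete, $\lambda_1 \leq \lambda_2 \leq \dots$ are the eigenvalues of $-\Delta_\mu$ in non-decreasing order, repeated by multiplicity. *)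

theory Defs
  imports "HOL-Probability.Probability" "HOL-Library.Extended_Nat"
begin

section \<open>Smooth functions and the weighted Laplacian\<close>

definition partial_deriv :: "'a::euclidean_space \<Rightarrow> ('a \<Rightarrow> real) \<Rightarrow> 'a \<Rightarrow> real" where
  "partial_deriv b f x = frechet_derivative f (at x) b"

primrec C_k :: "nat \<Rightarrow> ('a::euclidean_space \<Rightarrow> real) \<Rightarrow> bool" where
  "C_k 0 f \<longleftrightarrow> continuous_on UNIV f"
| "C_k (Suc k) f \<longleftrightarrow> f differentiable_on UNIV \<and> (\<forall>b\<in>Basis. C_k k (partial_deriv b f))"

definition smooth :: "('a::euclidean_space \<Rightarrow> real) \<Rightarrow> bool" where
  "smooth f \<longleftrightarrow> (\<forall>k. C_k k f)"

definition test_function :: "('a::euclidean_space \<Rightarrow> real) \<Rightarrow> bool" where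
  "test_function f \<longleftrightarrow> smooth f \<and> compact (closure {x. f x \<noteq> 0})"

definition grad :: "('a::euclidean_space \<Rightarrow> real) \<Rightarrow> 'a \<Rightarrow> 'a" where
  "grad f x = (\<Sum>b\<in>Basis. partial_deriv b f x *\<^sub>R b)"

definition hessian :: "('a::euclidean_space \<Rightarrow> real) \<Rightarrow> 'a \<Rightarrow> 'a \<Rightarrow> 'a" where
  "hessian f x = frechet_derivative (grad f) (at x)"

definition laplacian :: "('a::euclidean_space \<Rightarrow> real) \<Rightarrow> 'a \<Rightarrow> real" where
  "laplacian f x = (\<Sum>b\<in>Basis. partial_deriv b (partial_deriv b f) x)"

text \<open>The measure \<open>exp (- V x) dx\<close> enters only through its potential \<open>V\<close>.\<close>

definition weighted_measure :: "('a::euclidean_space \<Rightarrow> real) \<Rightarrow> 'a measure" where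
  "weighted_measure V = density lborel (\<lambda>x. ennreal (exp (- V x)))"

definition weighted_laplacian :: "('a::euclidean_space \<Rightarrow> real) \<Rightarrow> ('a \<Rightarrow> real) \<Rightarrow> 'a \<Rightarrow> real" where
  "weighted_laplacian V f x = laplacian f x - grad V x \<bullet> grad f x"

text \<open>\<open>weighted_measure (gaussian_potential \<rho>)\<close> has density
  \<open>(\<rho> / 2\<pi>) powr (n/2) * exp (- \<rho> |x|^2 / 2)\<close>.\<close>

definition gaussian_potential :: "real \<Rightarrow> 'a::euclidean_space \<Rightarrow> real" where
  "gaussian_potential \<rho> x = \<rho> * (norm x)\<^sup>2 / 2 - real DIM('a) / 2 * ln (\<rho> / (2 * pi))"


section \<open>The real Hilbert space of square-integrable functions\<close>

text \<open>Measurable functions modulo equality almost everywhere. For continuous \<open>V\<close> the measure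
  \<open>weighted_measure V\<close> has the same null sets as Lebesgue measure, so one quotient by
  Lebesgue-null sets contains all the spaces \<open>L2 V\<close> as subspaces.\<close>

quotient_type (overloaded) 'a aefun = "'a::euclidean_space \<Rightarrow> real" / partial:
  "\<lambda>f g. f \<in> borel_measurable borel \<and> g \<in> borel_measurable borel \<and> (AE x in lborel. f x = g x)"
proof (rule part_equivpI)
  show "\<exists>f::'a \<Rightarrow> real. f \<in> borel_measurable borel \<and> f \<in> borel_measurable borel \<and>
      (AE x in lborel. f x = f x)"
    by (rule exI[of _ "\<lambda>_. 0"]) simp
  show "symp (\<lambda>f g::'a \<Rightarrow> real. f \<in> borel_measurable borel \<and> g \<in> borel_measurable borel \<and>
      (AE x in lborel. f x = g x))"
    by (rule sympI) (auto elim: AE_mp)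
  show "transp (\<lambda>f g::'a \<Rightarrow> real. f \<in> borel_measurable borel \<and> g \<in> borel_measurable borel \<and>
      (AE x in lborel. f x = g x))"
    by (rule transpI) (auto elim!: eventually_elim2)
qed

instantiation aefun :: (euclidean_space) real_vector
begin

lift_definition zero_aefun :: "'a aefun" is "\<lambda>_. 0" by simp

lift_definition plus_aefun :: "'a aefun \<Rightarrow> 'a aefun \<Rightarrow> 'a aefun" is "\<lambda>f g x. f x + g x"
  by (auto elim!: eventually_elim2)

lift_definition minus_aefun :: "'a aefun \<Rightarrow> 'a aefun \<Rightarrow> 'a aefun" is "\<lambda>f g x. f x - g x"
  by (auto elim!: eventually_elim2)

lift_definition uminus_aefun :: "'a aefun \<Rightarrow> 'a aefun" is "\<lambda>f x. - f x"
  by auto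

lift_definition scaleR_aefun :: "real \<Rightarrow> 'a aefun \<Rightarrow> 'a aefun" is "\<lambda>c f x. c * f x"
  by (auto elim!: eventually_mono)

instance
  by standard (transfer; simp add: algebra_simps)+

end

definition L2 :: "('a::euclidean_space \<Rightarrow> real) \<Rightarrow> 'a aefun set" where
  "L2 V = {u. integrable (weighted_measure V) (\<lambda>x. (rep_aefun u x)\<^sup>2)}"

definition L2_inner :: "('a::euclidean_space \<Rightarrow> real) \<Rightarrow> 'a aefun \<Rightarrow> 'a aefun \<Rightarrow> real" where
  "L2_inner V u v = (\<integral>x. rep_aefun u x * rep_aefun v x \<partial>weighted_measure V)"

definition L2_norm :: "('a::euclidean_space \<Rightarrow> real) \<Rightarrow> 'a aefun \<Rightarrow> real" where
  "L2_norm V u = sqrt (L2_inner V u u)"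


section \<open>Unbounded operators, represented by their graphs\<close>

type_synonym 'a operator = "('a aefun \<times> 'a aefun) set"

definition neg_weighted_laplacian_graph :: "('a::euclidean_space \<Rightarrow> real) \<Rightarrow> 'a operator" where
  "neg_weighted_laplacian_graph V =
     {(abs_aefun f, abs_aefun (\<lambda>x. - weighted_laplacian V f x)) | f. test_function f}"

definition densely_defined :: "('a::euclidean_space \<Rightarrow> real) \<Rightarrow> 'a operator \<Rightarrow> bool" where
  "densely_defined V A \<longleftrightarrow> Domain A \<subseteq> L2 V \<and>
     (\<forall>u\<in>L2 V. \<forall>\<epsilon>>0. \<exists>f\<in>Domain A. L2_norm V (u - f) < \<epsilon>)"

definition adjoint_graph :: "('a::euclidean_space \<Rightarrow> real) \<Rightarrow> 'a operator \<Rightarrow> 'a operator" where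
  "adjoint_graph V A =
     {(u, v). u \<in> L2 V \<and> v \<in> L2 V \<and> (\<forall>(f, g)\<in>A. L2_inner V g u = L2_inner V f v)}"

definition self_adjoint :: "('a::euclidean_space \<Rightarrow> real) \<Rightarrow> 'a operator \<Rightarrow> bool" where
  "self_adjoint V A \<longleftrightarrow> densely_defined V A \<and> A = adjoint_graph V A"

definition self_adjoint_extension ::
    "('a::euclidean_space \<Rightarrow> real) \<Rightarrow> 'a operator \<Rightarrow> 'a operator \<Rightarrow> bool" where
  "self_adjoint_extension V A B \<longleftrightarrow> A \<subseteq> B \<and> self_adjoint V B"


section \<open>Spectral decomposition of the identity\<close>

definition orthogonal_projection ::
    "('a::euclidean_space \<Rightarrow> real) \<Rightarrow> ('a aefun \<Rightarrow> 'a aefun) \<Rightarrow> bool" where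
  "orthogonal_projection V P \<longleftrightarrow>
     (\<forall>u\<in>L2 V. P u \<in> L2 V \<and> P (P u) = P u) \<and>
     (\<forall>u\<in>L2 V. \<forall>v\<in>L2 V. P (u + v) = P u + P v) \<and>
     (\<forall>c. \<forall>u\<in>L2 V. P (c *\<^sub>R u) = c *\<^sub>R P u) \<and>
     (\<forall>u\<in>L2 V. \<forall>v\<in>L2 V. L2_inner V (P u) v = L2_inner V u (P v))"

definition resolution_of_identity ::
    "('a::euclidean_space \<Rightarrow> real) \<Rightarrow> (real \<Rightarrow> 'a aefun \<Rightarrow> 'a aefun) \<Rightarrow> bool" where
  "resolution_of_identity V E \<longleftrightarrow>
     (\<forall>l. orthogonal_projection V (E l)) \<and>
     (\<forall>l m. \<forall>u\<in>L2 V. E l (E m u) = E (min l m) u) \<and>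
     (\<forall>l. \<forall>u\<in>L2 V. ((\<lambda>m. L2_norm V (E m u - E l u)) \<longlongrightarrow> 0) (at_right l)) \<and>
     (\<forall>u\<in>L2 V. ((\<lambda>l. L2_norm V (E l u)) \<longlongrightarrow> 0) at_bot) \<and>
     (\<forall>u\<in>L2 V. ((\<lambda>l. L2_norm V (E l u - u)) \<longlongrightarrow> 0) at_top)"

text \<open>The measure \<open>d\<langle>E\<^sub>l u, u\<rangle>\<close> on the real line.\<close>

definition spectral_measure ::
    "('a::euclidean_space \<Rightarrow> real) \<Rightarrow> (real \<Rightarrow> 'a aefun \<Rightarrow> 'a aefun) \<Rightarrow> 'a aefun \<Rightarrow> real measure" where
  "spectral_measure V E u = interval_measure (\<lambda>l. L2_inner V (E l u) u)"

text \<open>\<open>A = \<integral> l dE\<^sub>l\<close>, for self-adjoint \<open>A\<close>: the domains agree, and so do the quadratic forms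
  there. By polarization this determines \<open>A\<close>.\<close>

definition spectral_decomposition ::
    "('a::euclidean_space \<Rightarrow> real) \<Rightarrow> 'a operator \<Rightarrow> (real \<Rightarrow> 'a aefun \<Rightarrow> 'a aefun) \<Rightarrow> bool" where
  "spectral_decomposition V A E \<longleftrightarrow>
     resolution_of_identity V E \<and>
     Domain A = {u \<in> L2 V. integrable (spectral_measure V E u) (\<lambda>l. l\<^sup>2)} \<and>
     (\<forall>(u, v)\<in>A. L2_inner V v u = (\<integral>l. l \<partial>spectral_measure V E u))"

text \<open>For smooth \<open>V\<close> the self-adjoint extension and its spectral decomposition exist and are unique
  (the projections as maps on \<open>L2 V\<close>; their values outside \<open>L2 V\<close> are irrelevant), so the choices
  made by \<open>SOME\<close> do not affect anything below.\<close>

definition neg_weighted_laplacian :: "('a::euclidean_space \<Rightarrow> real) \<Rightarrow> 'a operator" where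
  "neg_weighted_laplacian V =
     (SOME A. self_adjoint_extension V (neg_weighted_laplacian_graph V) A)"

definition spectral_projection ::
    "('a::euclidean_space \<Rightarrow> real) \<Rightarrow> real \<Rightarrow> 'a aefun \<Rightarrow> 'a aefun" where
  "spectral_projection V = (SOME E. spectral_decomposition V (neg_weighted_laplacian V) E)"

text \<open>\<open>dim\<close> is 0 on infinite-dimensional sets; \<open>edim\<close> is \<open>\<infinity>\<close> there.\<close>

definition edim :: "'b::real_vector set \<Rightarrow> enat" where
  "edim S = (if \<exists>B. finite B \<and> S \<subseteq> span B then enat (dim S) else \<infinity>)"

text \<open>The supremum is taken in \<open>ereal\<close> because \<open>Sup\<close> on \<open>real\<close> is unspecified for unbounded or empty
  sets.\<close>

definition spectral_value :: "('a::euclidean_space \<Rightarrow> real) \<Rightarrow> nat \<Rightarrow> ereal" where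
  "spectral_value V k = Sup (ereal ` {l. edim (spectral_projection V l ` L2 V) < enat k})"

end

theory Submission imports Defs begin

text \<open>Let \<open>L\<close> be the weighted Laplacian of \<open>V\<close> and let \<open>D p = (\<integral>|\<nabla>p|\<^sup>2) / (\<integral>p\<^sup>2)\<close> be the Rayleigh quotient.
  Integrating the Bochner formula gives \<open>(\<integral>|\<nabla>f|\<^sup>2)\<^sup>2 \<le> (\<integral>f\<^sup>2) (\<integral>|\<nabla>\<^sup>2f|\<^sup>2 + \<rho> \<integral>|\<nabla>f|\<^sup>2)\<close>. Applied to a
  polynomial of degree \<open>d\<close>, whose partial derivatives have degree \<open>d - 1\<close>, this shows \<open>D p \<le> d \<rho>\<close> by
  induction on \<open>d\<close>, so the polynomials of degree at most \<open>d\<close> are trial functions for the eigenvalue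
  \<open>d \<rho>\<close>. Since polynomials need not be square-integrable, they are multiplied by a power of
  \<open>1 / (1 + s\<^sup>2 |x|\<^sup>2)\<close>, which costs only an arbitrarily small amount as \<open>s\<close> tends to 0. For the Gaussian
  the bound is attained: the eigenfunctions are the Hermite polynomials, which are complete, and
  those with eigenvalue below \<open>d \<rho>\<close> span exactly the polynomials of degree less than \<open>d\<close>.\<close>

section \<open>Projections and square roots in real Hilbert spaces\<close>

text \<open>The integrated inequality is Cauchy-Schwarz for the pairing of \<open>- L f\<close> with
  \<open>f\<close>; the Hessian of \<open>V\<close> enters through the commutator of a partial
  derivative with \<open>L\<close>. If \<open>D\<close> is at most \<open>(d - 1) * \<rho>\<close>
  on every partial derivative of \<open>p\<close>, the second-order term is at most
  \<open>(d - 1) * \<rho>\<close> times the gradient term, and dividing by the gradient term leaves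
  \<open>d * \<rho>\<close>. The dimension of the polynomial space is only compared, never
  evaluated: the same number bounds the rank of the Gaussian spectral projections and forces a trial
  function into the kernel of those of \<open>V\<close>. The spectrum for \<open>V\<close> may fail
  to be discrete, so that argument starts from a spectral projection assumed to have rank below
  \<open>k\<close>. The operators in the statement are picked by \<open>SOME\<close>, so a
  self-adjoint extension and a spectral resolution must first be shown to exist. Later estimates
  hold for an arbitrary extension and reach it through approximation by test functions. The spectral
  theorem is assembled from operator square roots and negative spectral projections.\<close>

lemma closed_subspace_projection_exists:
  fixes M :: "'h::{real_inner,complete_space} set"
  assumes M: "subspace M" "closed M"
  shows "\<exists>y\<in>M. \<forall>z\<in>M. (x - y) \<bullet> z = 0"
proof -
  define d where "d = infdist x M"
  have ne: "M \<noteq> {}" using M(1) subspace_0 by auto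
  have d_le: "d \<le> norm (x - m)" if "m \<in> M" for m
    using infdist_le[OF that, of x] by (simp add: d_def dist_norm)
  have "\<exists>y\<in>M. norm (x - y) < d + 1 / Suc n" for n :: nat
  proof -
    have "(INF m\<in>M. dist x m) < d + 1 / Suc n" using ne by (simp add: d_def infdist_def)
    moreover have "bdd_below (dist x ` M)" by (rule bdd_belowI2[where m=0]) simp
    ultimately show ?thesis
      using cINF_less_iff[OF ne, of "dist x" "d + 1 / Suc n"] by (simp add: dist_norm)
  qed
  then obtain y where yM: "\<And>n. y n \<in> M" and y: "\<And>n. norm (x - y n) < d + 1 / Suc n"
    by metis
  have d0: "d \<ge> 0" by (simp add: d_def infdist_nonneg)
  \<comment> \<open>The midpoint of \<open>y n\<close> and \<open>y m\<close> is still at distance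
    at least \<open>d\<close> from \<open>x\<close>, so the parallelogram law makes a minimizing
    sequence Cauchy. Of the constant, 2 is due to that law and \<open>2 * d + 1\<close> to expanding
    \<open>(d + 1 / Suc k)\<^sup>2\<close>.\<close>
  have par: "(norm (y n - y m))\<^sup>2 \<le> (4 * d + 2) * (1 / Suc n + 1 / Suc m)" for n m
  proof -
    have "(1/2) *\<^sub>R (y n + y m) \<in> M"
      by (intro subspace_mul[OF M(1)] subspace_add[OF M(1)] yM)
    then have "d \<le> norm (x - (1/2) *\<^sub>R (y n + y m))" by (rule d_le)
    then have mid: "d\<^sup>2 \<le> (norm (x - (1/2) *\<^sub>R (y n + y m)))\<^sup>2" using d0 by (rule power_mono)
    have par: "(norm (y n - y m))\<^sup>2 = 2 * (norm (x - y n))\<^sup>2 + 2 * (norm (x - y m))\<^sup>2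
        - 4 * (norm (x - (1/2) *\<^sub>R (y n + y m)))\<^sup>2"
      by (simp add: power2_norm_eq_inner algebra_simps inner_commute)
    have sq: "(norm (x - y k))\<^sup>2 \<le> d\<^sup>2 + (2 * d + 1) * (1 / Suc k)" for k
    proof -
      have "(norm (x - y k))\<^sup>2 \<le> (d + 1 / Suc k)\<^sup>2" using y[of k] by (intro power_mono) auto
      also have "\<dots> = d\<^sup>2 + 2 * d * (1 / Suc k) + (1 / Suc k) * (1 / Suc k)"
        by (simp add: power2_eq_square algebra_simps)
      also have "(1 / Suc k) * (1 / Suc k) \<le> 1 / Suc k * (1::real)"
        by (intro mult_left_mono) auto
      finally show ?thesis by (simp add: algebra_simps)
    qed
    have "(norm (y n - y m))\<^sup>2 \<le> 2 * (d\<^sup>2 + (2 * d + 1) * (1 / Suc n)) + 2 * (d\<^sup>2 + (2 * d + 1) * (1 / Suc m)) - 4 * d\<^sup>2"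
      unfolding par by (intro diff_mono add_mono mult_left_mono sq mid) auto
    then show ?thesis by (simp add: algebra_simps)
  qed
  have "Cauchy y"
  proof (rule metric_CauchyI)
    fix e :: real assume e: "e > 0"
    define c where "c = 4 * d + 2"
    have c: "c > 0" using d0 by (simp add: c_def)
    obtain N where N: "1 / Suc N < e\<^sup>2 / (2 * c)"
      using reals_Archimedean[of "e\<^sup>2 / (2 * c)"] e c by (auto simp: inverse_eq_divide)
    show "\<exists>N. \<forall>m\<ge>N. \<forall>n\<ge>N. dist (y m) (y n) < e"
    proof (intro exI allI impI)
      fix m n assume mn: "m \<ge> N" "n \<ge> N"
      have "1 / Suc n \<le> 1 / Suc N" "1 / Suc m \<le> 1 / Suc N" using mn by (auto simp: frac_le)
      then have "c * (1 / Suc m + 1 / Suc n) \<le> c * (2 * (1 / Suc N))" using c by (intro mult_left_mono) auto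
      moreover have "1 / Suc N * (2 * c) < e\<^sup>2" using N c by (subst (asm) pos_less_divide_eq) auto
      ultimately have "c * (1 / Suc m + 1 / Suc n) < e\<^sup>2" by (simp add: mult_ac)
      then have "(norm (y m - y n))\<^sup>2 < e\<^sup>2" using par[of m n] unfolding c_def[symmetric] by linarith
      then show "dist (y m) (y n) < e" using e by (simp add: dist_norm power2_less_imp_less)
    qed
  qed
  then obtain z where z: "y \<longlonglongrightarrow> z" using Cauchy_convergent convergent_def by blast
  have zM: "z \<in> M" using M(2) yM z closed_sequentially by blast
  have "(\<lambda>n. norm (x - y n)) \<longlonglongrightarrow> norm (x - z)" by (intro tendsto_intros z)
  moreover have "(\<lambda>n. d + 1 / Suc n) \<longlonglongrightarrow> d + 0"
    by (intro tendsto_intros LIMSEQ_Suc[OF lim_1_over_n])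
  ultimately have zd: "norm (x - z) \<le> d"
    using y by (intro LIMSEQ_le[where Y="\<lambda>n. d + 1 / Suc n"]) (auto intro!: exI[of _ 0] less_imp_le)
  show ?thesis
  proof (intro bexI[OF _ zM] ballI)
    fix w assume w: "w \<in> M"
    show "(x - z) \<bullet> w = 0"
    proof (cases "w = 0")
      case False
      define c where "c = (x - z) \<bullet> w"
      \<comment> \<open>Moving \<open>z\<close> by this multiple of \<open>w\<close> lowers the
        squared distance by \<open>c * c / (w \<bullet> w)\<close>, which minimality forbids unless
        \<open>c = 0\<close>.\<close>
      define t where "t = c / (w \<bullet> w)"
      have ww: "w \<bullet> w > 0" using False by simp
      have "norm (x - z) \<le> norm (x - (z + t *\<^sub>R w))"
        using zd d_le[of "z + t *\<^sub>R w"] M(1) zM w by (auto intro: order_trans simp: subspace_add subspace_mul)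
      then have "(norm (x - z))\<^sup>2 \<le> (norm ((x - z) - t *\<^sub>R w))\<^sup>2" by (simp add: algebra_simps power_mono)
      moreover have "\<dots> = (norm (x - z))\<^sup>2 - 2 * t * c + t * t * (w \<bullet> w)"
        unfolding power2_norm_eq_inner c_def by (simp add: inner_diff_left inner_diff_right inner_commute algebra_simps)
      moreover have "2 * t * c - t * t * (w \<bullet> w) = c * c / (w \<bullet> w)"
        using ww by (simp add: t_def field_simps)
      ultimately have "c * c / (w \<bullet> w) \<le> 0" by linarith
      then show ?thesis using ww unfolding c_def[symmetric]
        by (metis divide_le_0_iff mult_eq_0_iff not_less zero_le_square antisym)
    qed simp
  qed
qed

definition symmetric_op :: "('h::real_inner \<Rightarrow> 'h) \<Rightarrow> bool" where
  "symmetric_op T \<longleftrightarrow> linear T \<and> (\<forall>u v. T u \<bullet> v = u \<bullet> T v)"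

definition projection_op :: "('h::real_inner \<Rightarrow> 'h) \<Rightarrow> bool" where
  "projection_op P \<longleftrightarrow> symmetric_op P \<and> (\<forall>u. P (P u) = P u)"

definition contractive :: "('h::real_normed_vector \<Rightarrow> 'g::real_normed_vector) \<Rightarrow> bool" where
  "contractive T \<longleftrightarrow> linear T \<and> (\<forall>u. norm (T u) \<le> norm u)"

lemma contractive_bounded_linear: "contractive T \<Longrightarrow> bounded_linear T"
  unfolding contractive_def by (auto intro!: bounded_linear_intro[where K=1] simp: linear_add linear_scale)

lemma projection_op_linear: "projection_op P \<Longrightarrow> linear P"
  by (simp add: projection_op_def symmetric_op_def)

lemma projection_op_inner: "projection_op P \<Longrightarrow> P u \<bullet> v = P u \<bullet> P v"
  unfolding projection_op_def symmetric_op_def by metis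

lemma projection_op_norm_sq: "projection_op P \<Longrightarrow> (norm (P u))\<^sup>2 = P u \<bullet> u"
  by (simp add: power2_norm_eq_inner projection_op_inner[of P u u])

lemma projection_op_contractive: "projection_op P \<Longrightarrow> contractive P"
  unfolding contractive_def
proof safe
  assume P: "projection_op P"
  show "linear P" using P by (rule projection_op_linear)
  fix u
  have "(norm (P u))\<^sup>2 \<le> norm (P u) * norm u"
    using projection_op_norm_sq[OF P, of u] norm_cauchy_schwarz[of "P u" u] by simp
  then show "norm (P u) \<le> norm u" by (cases "norm (P u) = 0") (auto simp: power2_eq_square)
qed

lemma projection_op_pythagoras: "projection_op P \<Longrightarrow> (norm (u - P u))\<^sup>2 = (norm u)\<^sup>2 - (norm (P u))\<^sup>2"
  using projection_op_norm_sq[of P u]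
  by (simp add: power2_norm_eq_inner inner_diff_left inner_diff_right inner_commute)

lemma projection_onto_closed_subspace:
  fixes M :: "'h::{real_inner,complete_space} set"
  assumes M: "subspace M" "closed M"
  obtains P where "projection_op P" "\<And>x. P x \<in> M" "\<And>x. x \<in> M \<Longrightarrow> P x = x"
    "\<And>x z. z \<in> M \<Longrightarrow> (x - P x) \<bullet> z = 0" "\<And>x y. y \<in> M \<Longrightarrow> (\<And>z. z \<in> M \<Longrightarrow> (x - y) \<bullet> z = 0) \<Longrightarrow> P x = y"
proof -
  obtain P where PM: "\<And>x. P x \<in> M" and Po: "\<And>x z. z \<in> M \<Longrightarrow> (x - P x) \<bullet> z = 0"
    using closed_subspace_projection_exists[OF M] by metis
  have uniq: "P x = y" if "y \<in> M" "\<And>z. z \<in> M \<Longrightarrow> (x - y) \<bullet> z = 0" for x y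
  proof -
    have m: "P x - y \<in> M" using PM that(1) M(1) by (simp add: subspace_diff)
    have "(P x - y) \<bullet> (P x - y) = (x - y) \<bullet> (P x - y) - (x - P x) \<bullet> (P x - y)"
      by (simp add: inner_diff_left)
    also have "\<dots> = 0" using that(2)[OF m] Po[OF m] by simp
    finally show ?thesis by simp
  qed
  have "linear P"
  proof (rule linearI)
    show "P (x + y) = P x + P y" for x y
    proof (rule uniq)
      show "P x + P y \<in> M" using PM M(1) by (simp add: subspace_add)
      show "(x + y - (P x + P y)) \<bullet> z = 0" if "z \<in> M" for z
        using Po[OF that, of x] Po[OF that, of y] by (simp add: algebra_simps)
    qed
    show "P (c *\<^sub>R x) = c *\<^sub>R P x" for c x
    proof (rule uniq)
      show "c *\<^sub>R P x \<in> M" using PM M(1) by (simp add: subspace_mul)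
      show "(c *\<^sub>R x - c *\<^sub>R P x) \<bullet> z = 0" if "z \<in> M" for z
        using Po[OF that, of x] by (simp add: scaleR_diff_right[symmetric])
    qed
  qed
  moreover have "P u \<bullet> v = u \<bullet> P v" for u v
  proof -
    have "u \<bullet> P v = P u \<bullet> P v" using Po[OF PM[of v], of u] by (simp add: inner_diff_left)
    moreover have "v \<bullet> P u = P v \<bullet> P u" using Po[OF PM[of u], of v] by (simp add: inner_diff_left)
    ultimately show ?thesis by (metis inner_commute)
  qed
  moreover have fix': "P x = x" if "x \<in> M" for x using that by (intro uniq) auto
  ultimately have "projection_op P" using PM by (auto simp: projection_op_def symmetric_op_def)
  then show ?thesis using that PM Po uniq fix' by blast
qed

text \<open>Fixed-point iteration for \<open>Y = (C + Y\<^sup>2) / 2\<close>, which is equivalent to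
  \<open>(1 - Y)\<^sup>2 = 1 - C\<close>. The limit therefore gives a square root
  \<open>1 - Y\<close> of \<open>1 - C\<close>.\<close>

primrec sqrt_iter :: "('h::real_vector \<Rightarrow> 'h) \<Rightarrow> nat \<Rightarrow> 'h \<Rightarrow> 'h" where
  "sqrt_iter C 0 u = 0"
| "sqrt_iter C (Suc n) u = (1/2) *\<^sub>R (C u + sqrt_iter C n (sqrt_iter C n u))"

text \<open>Scalar majorant: the same iteration with \<open>C\<close> replaced by its norm bound
  1.\<close>

primrec sqrt_iter_bound :: "nat \<Rightarrow> real" where
  "sqrt_iter_bound 0 = 0"
| "sqrt_iter_bound (Suc n) = (1 + (sqrt_iter_bound n)\<^sup>2) / 2"

lemma sqrt_iter_bound_range: "0 \<le> sqrt_iter_bound n \<and> sqrt_iter_bound n \<le> 1"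
proof (induction n)
  case (Suc n)
  then have "(sqrt_iter_bound n)\<^sup>2 \<le> 1" by (simp add: power_le_one)
  then show ?case by simp
qed simp

lemma sqrt_iter_bound_mono: "sqrt_iter_bound n \<le> sqrt_iter_bound (Suc n)"
proof -
  have "0 \<le> (sqrt_iter_bound n - 1)\<^sup>2" by simp
  then show ?thesis by (simp add: power2_eq_square algebra_simps)
qed

section \<open>Convergence of the square-root iteration\<close>

context
  fixes C :: "'h::{real_inner,complete_space} \<Rightarrow> 'h"
  assumes C: "contractive C" and C_sym: "symmetric_op C"
begin

lemma C_linear: "linear C" using C by (simp add: contractive_def)

lemma sqrt_iter_linear: "linear (sqrt_iter C n)"
proof (induction n)
  case (Suc n)
  show ?case
    by (rule linearI)
      (simp_all add: linear_add[OF Suc] linear_add[OF C_linear] linear_scale[OF Suc] linear_scale[OF C_linear] algebra_simps)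
qed (simp add: linear_iff)

lemma sqrt_iter_norm: "norm (sqrt_iter C n u) \<le> sqrt_iter_bound n * norm u"
proof (induction n arbitrary: u)
  case (Suc n)
  have "norm (sqrt_iter C (Suc n) u) \<le> (norm (C u) + norm (sqrt_iter C n (sqrt_iter C n u))) / 2"
    by (simp add: norm_triangle_ineq)
  also have "norm (C u) \<le> norm u" using C by (simp add: contractive_def)
  also have "norm (sqrt_iter C n (sqrt_iter C n u)) \<le> sqrt_iter_bound n * norm (sqrt_iter C n u)" by (rule Suc)
  also have "\<dots> \<le> sqrt_iter_bound n * (sqrt_iter_bound n * norm u)"
    using Suc sqrt_iter_bound_range[of n] by (intro mult_left_mono) auto
  finally show ?case by (simp add: power2_eq_square algebra_simps add_divide_distrib)
qed simp

lemma sqrt_iter_commute: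
  assumes "linear S" "\<And>u. S (C u) = C (S u)"
  shows "S (sqrt_iter C n u) = sqrt_iter C n (S u)"
  by (induction n arbitrary: u) (simp_all add: linear_0[OF assms(1)] linear_add[OF assms(1)] linear_scale[OF assms(1)] assms(2))

lemma sqrt_iter_sym: "sqrt_iter C n u \<bullet> v = u \<bullet> sqrt_iter C n v"
  using C_sym by (induction n arbitrary: u v) (simp_all add: inner_add_left inner_add_right symmetric_op_def)

text \<open>Consecutive iterates commute, so a difference of squares factors as
  \<open>(Y - Z) (Y + Z)\<close>. The factors are bounded by the induction hypothesis and the norm
  bound, and the product of the scalar bounds is exactly the next scalar increment.\<close>

lemma sqrt_iter_diff:
  "norm (sqrt_iter C (Suc n) u - sqrt_iter C n u) \<le> (sqrt_iter_bound (Suc n) - sqrt_iter_bound n) * norm u"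
proof (induction n arbitrary: u)
  case 0
  then show ?case using C by (simp add: contractive_def)
next
  case (Suc n)
  let ?Y = "sqrt_iter C (Suc n)" and ?Z = "sqrt_iter C n"
  let ?y = "sqrt_iter_bound (Suc n)" and ?z = "sqrt_iter_bound n"
  have comm: "?Y (?Z u) = ?Z (?Y u)"
    using sqrt_iter_commute[OF sqrt_iter_linear, of n "Suc n" u] sqrt_iter_commute[OF C_linear refl, of n] by metis
  have "sqrt_iter C (Suc (Suc n)) u - ?Y u = (1/2) *\<^sub>R (?Y (?Y u) - ?Z (?Z u))"
    unfolding sqrt_iter.simps(2)[of C "Suc n"] by (simp add: algebra_simps)
  also have "?Y (?Y u) - ?Z (?Z u) = ?Y (?Y u + ?Z u) - ?Z (?Y u + ?Z u)"
    unfolding linear_add[OF sqrt_iter_linear] comm by simp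
  finally have "norm (sqrt_iter C (Suc (Suc n)) u - ?Y u) = norm (?Y (?Y u + ?Z u) - ?Z (?Y u + ?Z u)) / 2" by simp
  also have "\<dots> \<le> (?y - ?z) * norm (?Y u + ?Z u) / 2" using Suc by (simp add: divide_right_mono)
  also have "norm (?Y u + ?Z u) \<le> ?y * norm u + ?z * norm u"
    using norm_triangle_le[OF add_mono[OF sqrt_iter_norm sqrt_iter_norm]] .
  then have "(?y - ?z) * norm (?Y u + ?Z u) / 2 \<le> (?y - ?z) * (?y * norm u + ?z * norm u) / 2"
    using sqrt_iter_bound_mono[of n] by (intro divide_right_mono mult_left_mono) auto
  also have "\<dots> = (sqrt_iter_bound (Suc (Suc n)) - ?y) * norm u"
    unfolding sqrt_iter_bound.simps(2)[of "Suc n"] using sqrt_iter_bound.simps(2)[of n]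
    by (simp add: power2_eq_square field_simps)
  finally show ?case .
qed

lemma sqrt_iter_diff_le:
  "m \<le> n \<Longrightarrow> norm (sqrt_iter C n u - sqrt_iter C m u) \<le> (sqrt_iter_bound n - sqrt_iter_bound m) * norm u"
proof (induction n rule: dec_induct)
  case (step n)
  have "norm (sqrt_iter C (Suc n) u - sqrt_iter C m u)
    \<le> norm (sqrt_iter C (Suc n) u - sqrt_iter C n u) + norm (sqrt_iter C n u - sqrt_iter C m u)"
    using norm_triangle_ineq[of "sqrt_iter C (Suc n) u - sqrt_iter C n u" "sqrt_iter C n u - sqrt_iter C m u"] by simp
  also have "\<dots> \<le> (sqrt_iter_bound (Suc n) - sqrt_iter_bound n) * norm u + (sqrt_iter_bound n - sqrt_iter_bound m) * norm u"
    by (intro add_mono sqrt_iter_diff step)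
  finally show ?case by (simp add: algebra_simps)
qed simp

lemma sqrt_iter_convergent: "convergent (\<lambda>n. sqrt_iter C n u)"
proof -
  have "incseq sqrt_iter_bound" using sqrt_iter_bound_mono by (rule incseq_SucI)
  then have "convergent sqrt_iter_bound"
    using incseq_convergent[of sqrt_iter_bound 1] sqrt_iter_bound_range by (metis convergentI)
  then have cau: "Cauchy (\<lambda>n. sqrt_iter_bound n * norm u)"
    by (intro convergent_Cauchy convergent_mult convergent_const)
  have "Cauchy (\<lambda>n. sqrt_iter C n u)"
  proof (rule metric_CauchyI)
    fix e :: real assume "e > 0"
    then obtain N where N: "\<And>m n. m \<ge> N \<Longrightarrow> n \<ge> N \<Longrightarrow> dist (sqrt_iter_bound m * norm u) (sqrt_iter_bound n * norm u) < e"
      using cau unfolding Cauchy_def by metis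
    have "dist (sqrt_iter C m u) (sqrt_iter C n u) \<le> dist (sqrt_iter_bound m * norm u) (sqrt_iter_bound n * norm u)" for m n
    proof (cases "m \<le> n")
      case True
      then show ?thesis using sqrt_iter_diff_le[OF True, of u]
        by (simp add: dist_norm norm_minus_commute[of "sqrt_iter C m u"] left_diff_distrib)
    next
      case False
      then show ?thesis using sqrt_iter_diff_le[of n m u]
        by (simp add: dist_norm left_diff_distrib)
    qed
    then show "\<exists>N. \<forall>m\<ge>N. \<forall>n\<ge>N. dist (sqrt_iter C m u) (sqrt_iter C n u) < e"
      using N by (meson le_less_trans)
  qed
  then show ?thesis by (rule Cauchy_convergent)
qed

lemma sqrt_complement_exists:
  obtains Y where "contractive Y" "symmetric_op Y" "\<And>u. Y u = (1/2) *\<^sub>R (C u + Y (Y u))"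
    "\<And>S u. bounded_linear S \<Longrightarrow> (\<And>u. S (C u) = C (S u)) \<Longrightarrow> S (Y u) = Y (S u)"
proof -
  define Y where "Y u = lim (\<lambda>n. sqrt_iter C n u)" for u
  have lim: "(\<lambda>n. sqrt_iter C n u) \<longlonglongrightarrow> Y u" for u
    unfolding Y_def using sqrt_iter_convergent by (simp add: convergent_LIMSEQ_iff)
  have lin: "linear Y"
  proof (rule linearI)
    show "Y (u + v) = Y u + Y v" for u v
      by (rule LIMSEQ_unique[OF lim]) (simp add: linear_add[OF sqrt_iter_linear] tendsto_add[OF lim lim])
    show "Y (c *\<^sub>R u) = c *\<^sub>R Y u" for c u
      by (rule LIMSEQ_unique[OF lim]) (simp add: linear_scale[OF sqrt_iter_linear] tendsto_scaleR[OF tendsto_const lim])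
  qed
  have nle: "norm (sqrt_iter C n u) \<le> norm u" for n u
    using sqrt_iter_norm[of n u] sqrt_iter_bound_range[of n] mult_right_mono[of "sqrt_iter_bound n" 1 "norm u"] by auto
  have con: "contractive Y"
    unfolding contractive_def using lin nle by (auto intro!: LIMSEQ_le_const2[OF tendsto_norm[OF lim]])
  have sym: "Y u \<bullet> v = u \<bullet> Y v" for u v
    using LIMSEQ_unique[OF tendsto_inner[OF lim[of u] tendsto_const[of v]]] tendsto_inner[OF tendsto_const[of u] lim[of v]]
    by (simp add: sqrt_iter_sym)
  have "Y u = (1/2) *\<^sub>R (C u + Y (Y u))" for u
  proof -
    \<comment> \<open>Operator and argument both vary with \<open>n\<close>; the uniform contraction
      bound \<open>nle\<close> reduces the double limit to two single ones.\<close>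
    have "(\<lambda>n. sqrt_iter C n (sqrt_iter C n u - Y u)) \<longlonglongrightarrow> 0"
    proof (rule Lim_null_comparison)
      have "(\<lambda>n. norm (sqrt_iter C n u - Y u)) \<longlonglongrightarrow> norm (Y u - Y u)" by (intro tendsto_intros lim)
      then show "(\<lambda>n. norm (sqrt_iter C n u - Y u)) \<longlonglongrightarrow> 0" by simp
      show "\<forall>\<^sub>F n in sequentially. norm (sqrt_iter C n (sqrt_iter C n u - Y u)) \<le> norm (sqrt_iter C n u - Y u)"
        using nle by (intro always_eventually) blast
    qed
    from tendsto_add[OF this lim[of "Y u"]]
    have "(\<lambda>n. sqrt_iter C n (sqrt_iter C n u)) \<longlonglongrightarrow> Y (Y u)"
      by (simp add: linear_diff[OF sqrt_iter_linear])
    then have "(\<lambda>n. sqrt_iter C (Suc n) u) \<longlonglongrightarrow> (1/2) *\<^sub>R (C u + Y (Y u))"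
      unfolding sqrt_iter.simps by (intro tendsto_intros)
    with LIMSEQ_Suc[OF lim[of u]] show ?thesis by (rule LIMSEQ_unique)
  qed
  moreover have "S (Y u) = Y (S u)" if S: "bounded_linear S" and "\<And>u. S (C u) = C (S u)" for S u
  proof -
    have "(\<lambda>n. S (sqrt_iter C n u)) \<longlonglongrightarrow> S (Y u)" by (rule bounded_linear.tendsto[OF S lim])
    moreover have "S (sqrt_iter C n u) = sqrt_iter C n (S u)" for n
      using that by (intro sqrt_iter_commute) (auto simp: bounded_linear.linear)
    ultimately show ?thesis using lim[of "S u"] LIMSEQ_unique by simp
  qed
  ultimately show ?thesis using that[of Y] con sym lin by (simp add: symmetric_op_def)
qed

end

text \<open>The operator \<open>A\<close> in the proof is the absolute value of \<open>T\<close>: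
  with \<open>C = 1 - T\<^sup>2\<close> the iteration gives \<open>Y\<close> with
  \<open>(1 - Y)\<^sup>2 = T\<^sup>2\<close>, and \<open>A = 1 - Y\<close> is nonnegative.
  \<open>E\<close> projects onto the kernel of \<open>A + T\<close>, where \<open>T = - A\<close>.
  On the orthogonal complement \<open>T = A\<close>, and positivity is strict there because
  \<open>A u = 0\<close> would put \<open>u\<close> into that kernel.\<close>

lemma contraction_negative_projection:
  fixes T :: "'h::{real_inner,complete_space} \<Rightarrow> 'h"
  assumes T: "contractive T" and T_sym: "symmetric_op T"
  obtains E where "projection_op E"
    "\<forall>S u. contractive S \<longrightarrow> symmetric_op S \<longrightarrow> (\<forall>u. S (T u) = T (S u)) \<longrightarrow> S (E u) = E (S u)"
    "\<And>u. E u = u \<Longrightarrow> T u \<bullet> u \<le> 0"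
    "\<And>u. E u = 0 \<Longrightarrow> u \<noteq> 0 \<Longrightarrow> T u \<bullet> u > 0"
proof -
  have linT: "linear T" and Tn: "norm (T u) \<le> norm u" for u using T by (auto simp: contractive_def)
  have Ts: "T u \<bullet> v = u \<bullet> T v" for u v using T_sym by (simp add: symmetric_op_def)
  define C where "C u = u - T (T u)" for u
  have "linear C" unfolding C_def by (rule linearI) (simp_all add: linear_add[OF linT] linear_scale[OF linT] algebra_simps)
  moreover have "C u \<bullet> v = u \<bullet> C v" for u v by (simp add: C_def inner_diff_left inner_diff_right Ts)
  moreover have "norm (C u) \<le> norm u" for u
  proof -
    have "(norm (C u))\<^sup>2 = (norm u)\<^sup>2 - 2 * (norm (T u))\<^sup>2 + (norm (T (T u)))\<^sup>2"
      by (simp add: C_def power2_norm_eq_inner inner_diff_left inner_diff_right Ts inner_commute)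
    also have "(norm (T (T u)))\<^sup>2 \<le> (norm (T u))\<^sup>2" using Tn by (intro power_mono) auto
    also have "(norm u)\<^sup>2 - 2 * (norm (T u))\<^sup>2 + (norm (T u))\<^sup>2 \<le> (norm u)\<^sup>2" by simp
    finally have "(norm (C u))\<^sup>2 \<le> (norm u)\<^sup>2" by simp
    then show ?thesis by (rule power2_le_imp_le) simp
  qed
  ultimately have "contractive C" "symmetric_op C" by (auto simp: contractive_def symmetric_op_def)
  then obtain Y where Y: "contractive Y" and Y_sym: "symmetric_op Y"
    and Yeq: "\<And>u. Y u = (1/2) *\<^sub>R (C u + Y (Y u))"
    and Ycom: "\<And>S u. bounded_linear S \<Longrightarrow> (\<And>u. S (C u) = C (S u)) \<Longrightarrow> S (Y u) = Y (S u)"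
    using sqrt_complement_exists[of C] by metis
  have linY: "linear Y" and Yn: "norm (Y u) \<le> norm u" for u using Y by (auto simp: contractive_def)
  have Ys: "Y u \<bullet> v = u \<bullet> Y v" for u v using Y_sym by (simp add: symmetric_op_def)
  define A where "A u = u - Y u" for u
  have linA: "linear A" unfolding A_def by (rule linearI) (simp_all add: linear_add[OF linY] linear_scale[OF linY] algebra_simps)
  have As: "A u \<bullet> v = u \<bullet> A v" for u v by (simp add: A_def inner_diff_left inner_diff_right Ys)
  have A2: "A (A u) = T (T u)" for u
  proof -
    have "2 *\<^sub>R Y u = C u + Y (Y u)" using Yeq[of u] by (metis (no_types) scaleR_scaleR scaleR_one field_sum_of_halves mult_2 nonzero_mult_div_cancel_left zero_neq_numeral times_divide_eq_right mult.right_neutral)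
    then show ?thesis by (simp add: A_def linear_diff[OF linY] C_def algebra_simps scaleR_2)
  qed
  have A0: "A u \<bullet> u \<ge> 0" for u
  proof -
    have "Y u \<bullet> u \<le> norm (Y u) * norm u" by (rule norm_cauchy_schwarz)
    also have "\<dots> \<le> norm u * norm u" using Yn by (intro mult_right_mono) auto
    finally show ?thesis by (simp add: A_def inner_diff_left power2_norm_eq_inner[symmetric] power2_eq_square)
  qed
  have A0': "A u = 0" if "A u \<bullet> u = 0" for u
  proof -
    have "Y u \<bullet> u = u \<bullet> u" using that by (simp add: A_def inner_diff_left)
    moreover have "(norm (Y u))\<^sup>2 \<le> (norm u)\<^sup>2" using Yn by (intro power_mono) auto
    ultimately have "(norm (u - Y u))\<^sup>2 \<le> 0"
      by (simp add: power2_norm_eq_inner inner_diff_left inner_diff_right inner_commute)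
    then show ?thesis by (simp add: A_def)
  qed
  have Acom: "S (A u) = A (S u)" if "bounded_linear S" "\<And>u. S (T u) = T (S u)" for S u
  proof -
    have l: "linear S" using that(1) by (rule bounded_linear.linear)
    have "S (Y u) = Y (S u)" using that by (intro Ycom) (auto simp: C_def linear_diff[OF l])
    then show ?thesis by (simp add: A_def linear_diff[OF l])
  qed
  have AT: "A (T u) = T (A u)" for u using Acom[OF contractive_bounded_linear[OF T]] by simp
  define M where "M = {u. A u + T u = 0}"
  have subM: "subspace M" unfolding M_def subspace_def
    by (auto simp: linear_add[OF linA] linear_add[OF linT] linear_0[OF linA] linear_0[OF linT]
       linear_scale[OF linA] linear_scale[OF linT] scaleR_add_right[symmetric])
      (metis (no_types, lifting) add.left_commute add.right_neutral add.assoc)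
  have "bounded_linear (\<lambda>u. A u + T u)"
    unfolding A_def using contractive_bounded_linear[OF Y] contractive_bounded_linear[OF T]
    by (intro bounded_linear_add bounded_linear_sub bounded_linear_ident)
  then have "continuous_on UNIV (\<lambda>u. A u + T u)" by (rule linear_continuous_on)
  then have clM: "closed M"
    unfolding M_def by (intro closed_Collect_eq continuous_on_const)
  obtain E where E: "projection_op E" and EM: "\<And>x. E x \<in> M" and Efix: "\<And>x. x \<in> M \<Longrightarrow> E x = x"
    and Eo: "\<And>x z. z \<in> M \<Longrightarrow> (x - E x) \<bullet> z = 0"
    and Eu: "\<And>x y. y \<in> M \<Longrightarrow> (\<And>z. z \<in> M \<Longrightarrow> (x - y) \<bullet> z = 0) \<Longrightarrow> E x = y"
    using projection_onto_closed_subspace[OF subM clM] by metis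
  show ?thesis
  proof (rule that[OF E], intro allI impI)
    fix S u assume S: "contractive S" "symmetric_op S" and com': "\<forall>u. S (T u) = T (S u)"
    have com: "\<And>u. S (T u) = T (S u)" using com' by blast
    have l: "linear S" and Ss: "S u \<bullet> v = u \<bullet> S v" for u v using S by (auto simp: symmetric_op_def)
    have SM: "S u \<in> M" if "u \<in> M" for u
    proof -
      have "A (S u) + T (S u) = S (A u + T u)"
        using Acom[OF contractive_bounded_linear[OF S(1)] com] com by (simp add: linear_add[OF l])
      then show ?thesis using that by (simp add: M_def linear_0[OF l])
    qed
    have "E (S u) = S (E u)"
    proof (rule Eu)
      show "S (E u) \<in> M" using SM EM by blast
      show "(S u - S (E u)) \<bullet> z = 0" if "z \<in> M" for z
        using Eo[OF SM[OF that], of u] by (simp add: linear_diff[OF l, symmetric] Ss)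
    qed
    then show "S (E u) = E (S u)" by simp
  next
    fix u assume "E u = u"
    then have "A u + T u = 0" using EM[of u] by (simp add: M_def)
    then have "T u = - A u" by (simp add: add_eq_0_iff)
    then show "T u \<bullet> u \<le> 0" using A0[of u] by simp
  next
    fix u assume Eu0: "E u = 0" and u0: "u \<noteq> 0"
    have o: "u \<bullet> z = 0" if "z \<in> M" for z using Eo[OF that, of u] Eu0 by simp
    \<comment> \<open>\<open>(A + T) (A - T) = A\<^sup>2 - T\<^sup>2 = 0\<close>, so
      \<open>A - T\<close> maps into \<open>M\<close>. As \<open>u\<close> is orthogonal to
      \<open>M\<close> and \<open>A - T\<close> is symmetric, \<open>A u = T u\<close>
      follows.\<close>
    have "A u - T u \<in> M"
      by (simp add: M_def linear_diff[OF linA] linear_diff[OF linT] A2 AT)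
    then have "A w - T w \<in> M" for w
      by (simp add: M_def linear_diff[OF linA] linear_diff[OF linT] A2 AT)
    then have "(A u - T u) \<bullet> w = 0" for w
      using o[of "A w - T w"] by (simp add: inner_diff_left inner_diff_right As Ts)
    from this[of "A u - T u"] have eq: "A u = T u" by simp
    then have "T u \<bullet> u \<ge> 0" using A0[of u] by simp
    moreover have "T u \<bullet> u \<noteq> 0"
    proof
      assume "T u \<bullet> u = 0"
      then have "A u = 0" using A0'[of u] unfolding eq by blast
      then have "u \<in> M" using eq by (simp add: M_def)
      then have "u \<bullet> u = 0" by (rule o)
      then show False using u0 by simp
    qed
    ultimately show "T u \<bullet> u > 0" by simp
  qed
qed

section \<open>Self-adjoint relations and the spectral theorem\<close>

text \<open>Operators stay relations, as in the statement, so questions about domains become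
  questions of membership. The spectral notions are restated here for a Hilbert space that is a
  whole type.\<close>

definition adjoint_rel :: "('h::real_inner \<times> 'h) set \<Rightarrow> ('h \<times> 'h) set" where
  "adjoint_rel A = {(u, v). \<forall>(f, g)\<in>A. g \<bullet> u = f \<bullet> v}"

definition selfadjoint_rel :: "('h::real_inner \<times> 'h) set \<Rightarrow> bool" where
  "selfadjoint_rel A \<longleftrightarrow> (\<forall>u. \<forall>e>0. \<exists>f\<in>Domain A. norm (u - f) < e) \<and> A = adjoint_rel A"

definition projection_resolution :: "(real \<Rightarrow> 'h::real_inner \<Rightarrow> 'h) \<Rightarrow> bool" where
  "projection_resolution E \<longleftrightarrow>
     (\<forall>l. projection_op (E l)) \<and>
     (\<forall>l m u. E l (E m u) = E (min l m) u) \<and>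
     (\<forall>l u. ((\<lambda>m. norm (E m u - E l u)) \<longlongrightarrow> 0) (at_right l)) \<and>
     (\<forall>u. ((\<lambda>l. norm (E l u)) \<longlongrightarrow> 0) at_bot) \<and>
     (\<forall>u. ((\<lambda>l. norm (E l u - u)) \<longlongrightarrow> 0) at_top)"

definition spectral_resolution :: "('h::real_inner \<times> 'h) set \<Rightarrow> (real \<Rightarrow> 'h \<Rightarrow> 'h) \<Rightarrow> bool" where
  "spectral_resolution A E \<longleftrightarrow>
     projection_resolution E \<and>
     Domain A = {u. integrable (interval_measure (\<lambda>l. E l u \<bullet> u)) (\<lambda>l. l\<^sup>2)} \<and>
     (\<forall>(u, v)\<in>A. v \<bullet> u = (\<integral>l. l \<partial>interval_measure (\<lambda>l. E l u \<bullet> u)))"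

lemma selfadjoint_rel_dense:
  "selfadjoint_rel A \<Longrightarrow> e > 0 \<Longrightarrow> \<exists>f g. (f, g) \<in> A \<and> norm (u - f) < e"
  unfolding selfadjoint_rel_def by (meson DomainE)

lemma selfadjoint_rel_symmetric:
  "selfadjoint_rel A \<Longrightarrow> (u, v) \<in> A \<Longrightarrow> (f, g) \<in> A \<Longrightarrow> v \<bullet> f = u \<bullet> g"
  unfolding selfadjoint_rel_def adjoint_rel_def by blast

lemma selfadjoint_relI:
  "selfadjoint_rel A \<Longrightarrow> (\<And>f g. (f, g) \<in> A \<Longrightarrow> g \<bullet> u = f \<bullet> v) \<Longrightarrow> (u, v) \<in> A"
  unfolding selfadjoint_rel_def adjoint_rel_def by blast

lemma selfadjoint_rel_add:
  assumes "selfadjoint_rel A" "(u, v) \<in> A" "(u', v') \<in> A" shows "(u + u', v + v') \<in> A"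
proof (rule selfadjoint_relI[OF assms(1)])
  fix f g assume "(f, g) \<in> A"
  from selfadjoint_rel_symmetric[OF assms(1) this assms(2)] selfadjoint_rel_symmetric[OF assms(1) this assms(3)]
  show "g \<bullet> (u + u') = f \<bullet> (v + v')" by (simp add: inner_add_right)
qed

lemma selfadjoint_rel_scale:
  assumes "selfadjoint_rel A" "(u, v) \<in> A" shows "(c *\<^sub>R u, c *\<^sub>R v) \<in> A"
proof (rule selfadjoint_relI[OF assms(1)])
  fix f g assume "(f, g) \<in> A"
  from selfadjoint_rel_symmetric[OF assms(1) this assms(2)]
  show "g \<bullet> (c *\<^sub>R u) = f \<bullet> (c *\<^sub>R v)" by simp
qed

lemma selfadjoint_rel_diff:
  assumes "selfadjoint_rel A" "(u, v) \<in> A" "(u', v') \<in> A" shows "(u - u', v - v') \<in> A"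
proof (rule selfadjoint_relI[OF assms(1)])
  fix f g assume "(f, g) \<in> A"
  from selfadjoint_rel_symmetric[OF assms(1) this assms(2)] selfadjoint_rel_symmetric[OF assms(1) this assms(3)]
  show "g \<bullet> (u - u') = f \<bullet> (v - v')" by (simp add: inner_diff_right)
qed

lemma selfadjoint_rel_zero: "selfadjoint_rel A \<Longrightarrow> (0, 0) \<in> A"
  by (rule selfadjoint_relI) auto

lemma selfadjoint_rel_limit:
  assumes A: "selfadjoint_rel A" and "\<And>n. (u n, v n) \<in> A" "u \<longlonglongrightarrow> x" "v \<longlonglongrightarrow> y"
  shows "(x, y) \<in> A"
proof (rule selfadjoint_relI[OF A])
  fix f g assume fg: "(f, g) \<in> A"
  have "(\<lambda>n. g \<bullet> u n) \<longlonglongrightarrow> g \<bullet> x" "(\<lambda>n. f \<bullet> v n) \<longlonglongrightarrow> f \<bullet> y"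
    by (intro tendsto_intros assms)+
  moreover have "g \<bullet> u n = f \<bullet> v n" for n using selfadjoint_rel_symmetric[OF A fg assms(2)] .
  ultimately show "g \<bullet> x = f \<bullet> y" using LIMSEQ_unique by auto
qed

text \<open>Identities between projections are checked on the domain, where bounds on the quadratic
  form are available, and carried to all vectors by density.\<close>

lemma dense_operator_zero:
  assumes A: "selfadjoint_rel A" and Q: "contractive Q" "\<And>f g. (f, g) \<in> A \<Longrightarrow> Q f = 0"
  shows "Q u = 0"
proof (rule ccontr)
  assume "Q u \<noteq> 0"
  then obtain f g where fg: "(f, g) \<in> A" "norm (u - f) < norm (Q u)"
    using selfadjoint_rel_dense[OF A, of "norm (Q u)" u] by auto
  have "Q u = Q (u - f)" using Q fg(1) by (simp add: contractive_def linear_diff)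
  then have "norm (Q u) \<le> norm (u - f)" using Q(1) by (simp add: contractive_def)
  then show False using fg by simp
qed

text \<open>If \<open>(0, w)\<close> lies in the relation, symmetry makes \<open>w\<close>
  orthogonal to the dense domain.\<close>

lemma selfadjoint_rel_functional:
  assumes A: "selfadjoint_rel A" and "(u, v) \<in> A" "(u, v') \<in> A" shows "v = v'"
proof (rule ccontr)
  assume ne: "v \<noteq> v'"
  let ?w = "v - v'"
  have w: "(0, ?w) \<in> A" using selfadjoint_rel_diff[OF A assms(2,3)] by simp
  obtain f g where fg: "(f, g) \<in> A" "norm (?w - f) < norm ?w"
    using selfadjoint_rel_dense[OF A, of "norm ?w" ?w] ne by auto
  have "?w \<bullet> f = 0" using selfadjoint_rel_symmetric[OF A w fg(1)] by simp
  then have "?w \<bullet> ?w = ?w \<bullet> (?w - f)" by (simp add: inner_diff_right)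
  also have "\<dots> \<le> norm ?w * norm (?w - f)" by (rule norm_cauchy_schwarz)
  also have "\<dots> < norm ?w * norm ?w" using fg ne by (intro mult_strict_left_mono) auto
  finally show False by (simp add: power2_norm_eq_inner[symmetric] power2_eq_square)
qed

lemma selfadjoint_rel_shift:
  assumes A: "selfadjoint_rel A" shows "selfadjoint_rel {(u, v - l *\<^sub>R u) | u v. (u, v) \<in> A}" (is "selfadjoint_rel ?G")
proof -
  have D: "Domain ?G = Domain A" by auto
  have "?G = adjoint_rel ?G"
  proof
    show "?G \<subseteq> adjoint_rel ?G"
      unfolding adjoint_rel_def using selfadjoint_rel_symmetric[OF A]
      by (auto simp: inner_diff_left inner_diff_right)
    show "adjoint_rel ?G \<subseteq> ?G"
    proof
      fix p assume p: "p \<in> adjoint_rel ?G"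
      obtain u v where uv: "p = (u, v)" by (cases p)
      have *: "(g - l *\<^sub>R f) \<bullet> u = f \<bullet> v" if "(f, g) \<in> A" for f g
        using p that unfolding uv adjoint_rel_def by blast
      have "(u, v + l *\<^sub>R u) \<in> A"
      proof (rule selfadjoint_relI[OF A])
        show "g \<bullet> u = f \<bullet> (v + l *\<^sub>R u)" if "(f, g) \<in> A" for f g
          using *[OF that] by (simp add: inner_diff_left inner_add_right algebra_simps)
      qed
      then show "p \<in> ?G" unfolding uv by force
    qed
  qed
  then show ?thesis using A D unfolding selfadjoint_rel_def by simp
qed

text \<open>The orthogonal projection onto the graph of \<open>A\<close> is the block matrix with entries
  \<open>B = (1 + A\<^sup>2)\<inverse>\<close>, \<open>T = A (1 + A\<^sup>2)\<inverse>\<close> (twice) and \<open>1 - B\<close>.\<close>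

lemma selfadjoint_rel_graph_projection:
  fixes A :: "('h::{real_inner,complete_space} \<times> 'h) set"
  assumes A: "selfadjoint_rel A"
  obtains B T where "contractive B" "symmetric_op B" "contractive T" "symmetric_op T"
    "\<And>w. (B w, T w) \<in> A" "\<And>w. (T w, w - B w) \<in> A"
    "\<And>b t w. (b, t) \<in> A \<Longrightarrow> (t, w - b) \<in> A \<Longrightarrow> B w = b \<and> T w = t"
proof -
  have sub: "subspace A"
    unfolding subspace_def using selfadjoint_rel_zero[OF A] selfadjoint_rel_add[OF A] selfadjoint_rel_scale[OF A]
    by (auto simp: zero_prod_def)
  have cl: "closed A"
    unfolding closed_sequential_limits
  proof safe
    fix X a b assume "\<forall>n. X n \<in> A" "X \<longlonglongrightarrow> (a, b)"
    then show "(a, b) \<in> A"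
      using selfadjoint_rel_limit[OF A, of "\<lambda>n. fst (X n)" "\<lambda>n. snd (X n)" a b]
        tendsto_fst[of X "(a, b)"] tendsto_snd[of X "(a, b)"] by simp
  qed
  obtain P where P: "projection_op P" and PA: "\<And>x. P x \<in> A"
    and Po: "\<And>x z. z \<in> A \<Longrightarrow> (x - P x) \<bullet> z = 0"
    using projection_onto_closed_subspace[OF sub cl] by metis
  have linP: "linear P" and Pn: "norm (P x) \<le> norm x" and Ps: "P x \<bullet> y = x \<bullet> P y" for x y
    using P projection_op_contractive[OF P] unfolding contractive_def projection_op_def symmetric_op_def by blast+
  define B where "B w = fst (P (w, 0))" for w
  define T where "T w = snd (P (w, 0))" for w
  have BT: "(B w, T w) \<in> A" for w using PA[of "(w, 0)"] by (simp add: B_def T_def)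
  have add: "P (v + w, 0) = P (v, 0) + P (w, 0)" for v w using linear_add[OF linP, of "(v, 0)" "(w, 0)"] by simp
  have sc: "P (c *\<^sub>R w, 0) = c *\<^sub>R P (w, 0)" for c w using linear_scale[OF linP, of c "(w, 0)"] by simp
  have "linear B" "linear T" unfolding B_def T_def by (auto intro!: linearI simp: add sc)
  moreover have "norm (B w) \<le> norm w" for w
    using Pn[of "(w, 0)"] norm_fst_le[of "fst (P (w, 0))" "snd (P (w, 0))"] by (simp add: B_def norm_Pair)
  moreover have "norm (T w) \<le> norm w" for w
    using Pn[of "(w, 0)"] norm_snd_le[of "snd (P (w, 0))" "fst (P (w, 0))"] by (simp add: T_def norm_Pair)
  ultimately have con: "contractive B" "contractive T" by (auto simp: contractive_def)
  \<comment> \<open>The residual \<open>(w - B w, - T w)\<close> is orthogonal to the graph, which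
    says that \<open>(T w, w - B w)\<close> lies in the adjoint.\<close>
  have TB: "(T w, w - B w) \<in> A" for w
  proof (rule selfadjoint_relI[OF A])
    fix f g assume fg: "(f, g) \<in> A"
    have "((w, 0) - P (w, 0)) \<bullet> (f, g) = 0" using Po[OF fg] .
    moreover have "P (w, 0) = (B w, T w)" by (simp add: B_def T_def)
    ultimately have "(w - B w) \<bullet> f - T w \<bullet> g = 0" by (simp add: inner_diff_left)
    then show "g \<bullet> T w = f \<bullet> (w - B w)" by (simp add: inner_commute)
  qed
  have Bs: "B v \<bullet> w = v \<bullet> B w" for v w
  proof -
    have "P (x, 0) \<bullet> (y, 0) = B x \<bullet> y" for x y by (cases "P (x, 0)") (simp add: B_def)
    then show ?thesis using Ps[of "(v, 0)" "(w, 0)"] by (metis inner_commute)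
  qed
  have Ts: "T v \<bullet> w = v \<bullet> T w" for v w
  proof -
    have 1: "T v \<bullet> B w = B v \<bullet> T w" by (rule selfadjoint_rel_symmetric[OF A BT BT])
    have 2: "(v - B v) \<bullet> T w = T v \<bullet> (w - B w)" by (rule selfadjoint_rel_symmetric[OF A TB TB])
    then show ?thesis using 1 by (simp add: inner_diff_left inner_diff_right)
  qed
  \<comment> \<open>The difference of two solutions is a vector that \<open>A\<^sup>2\<close> maps
    to its negative; symmetry then makes a sum of two squared norms vanish.\<close>
  have uniq: "B w = b \<and> T w = t" if bt: "(b, t) \<in> A" and tb: "(t, w - b) \<in> A" for b t w
  proof -
    have 1: "(B w - b, T w - t) \<in> A" by (rule selfadjoint_rel_diff[OF A BT bt])
    have 2: "(T w - t, - (B w - b)) \<in> A" using selfadjoint_rel_diff[OF A TB[of w] tb] by (simp add: algebra_simps)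
    have "(T w - t) \<bullet> (T w - t) = (B w - b) \<bullet> (- (B w - b))"
      by (rule selfadjoint_rel_symmetric[OF A 1 2])
    then have "(T w - t) \<bullet> (T w - t) + (B w - b) \<bullet> (B w - b) = 0" by (simp only: inner_minus_right)
    then have "(T w - t) \<bullet> (T w - t) = 0" "(B w - b) \<bullet> (B w - b) = 0"
      using add_nonneg_eq_0_iff[OF inner_ge_zero inner_ge_zero] by blast+
    then show ?thesis by simp
  qed
  have "symmetric_op B" "symmetric_op T"
    using con Bs Ts by (auto simp: symmetric_op_def contractive_def)
  then show ?thesis using that[OF con(1) _ con(2) _ BT TB uniq] by simp
qed

text \<open>\<open>T = A (1 + A\<^sup>2)\<inverse>\<close> is bounded and has the sign of
  \<open>A\<close>, so its negative projection serves for \<open>A\<close>. A symmetric contraction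
  that preserves the graph commutes with \<open>B\<close> and \<open>T\<close>, because these are
  determined by membership in the graph.\<close>

lemma selfadjoint_rel_negative_projection:
  fixes A :: "('h::{real_inner,complete_space} \<times> 'h) set"
  assumes A: "selfadjoint_rel A"
  obtains E where "projection_op E"
    "\<forall>S u. contractive S \<longrightarrow> symmetric_op S \<longrightarrow> (\<forall>(u, v)\<in>A. (S u, S v) \<in> A) \<longrightarrow> S (E u) = E (S u)"
    "\<And>u v. (u, v) \<in> A \<Longrightarrow> (E u, E v) \<in> A"
    "\<And>u v. (u, v) \<in> A \<Longrightarrow> E u = u \<Longrightarrow> v \<bullet> u \<le> 0"
    "\<And>u v. (u, v) \<in> A \<Longrightarrow> E u = 0 \<Longrightarrow> u \<noteq> 0 \<Longrightarrow> v \<bullet> u > 0"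
proof -
  obtain B T where B: "contractive B" "symmetric_op B" and T: "contractive T" "symmetric_op T"
    and BT: "\<And>w. (B w, T w) \<in> A" and TB: "\<And>w. (T w, w - B w) \<in> A"
    and uniq: "\<And>b t w. (b, t) \<in> A \<Longrightarrow> (t, w - b) \<in> A \<Longrightarrow> B w = b \<and> T w = t"
    by (rule selfadjoint_rel_graph_projection[OF A]) (rule that)
  obtain E where E: "projection_op E"
    and Ecom': "\<forall>S u. contractive S \<longrightarrow> symmetric_op S \<longrightarrow> (\<forall>u. S (T u) = T (S u)) \<longrightarrow> S (E u) = E (S u)"
    and Eneg: "\<And>u. E u = u \<Longrightarrow> T u \<bullet> u \<le> 0" and Epos: "\<And>u. E u = 0 \<Longrightarrow> u \<noteq> 0 \<Longrightarrow> T u \<bullet> u > 0"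
    by (rule contraction_negative_projection[OF T]) (rule that)
  have Ecom: "S (E u) = E (S u)" if "contractive S" "symmetric_op S" "\<And>u. S (T u) = T (S u)" for S u
    using Ecom' that by blast
  have commute: "S (B w) = B (S w) \<and> S (T w) = T (S w)"
    if S: "symmetric_op S" and com: "\<And>u v. (u, v) \<in> A \<Longrightarrow> (S u, S v) \<in> A" for S w
  proof -
    have "(S (T w), S w - S (B w)) \<in> A"
      using com[OF TB[of w]] S by (simp add: symmetric_op_def linear_diff)
    from uniq[OF com[OF BT] this] show ?thesis by simp
  qed
  have AB: "B v = T u \<and> T v = u - B u" if uv: "(u, v) \<in> A" for u v
  proof (rule uniq)
    show "(T u, u - B u) \<in> A" by (rule TB)
    show "(u - B u, v - T u) \<in> A" by (rule selfadjoint_rel_diff[OF A uv BT])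
  qed
  have EB: "B (E w) = E (B w)" for w
  proof (rule Ecom[OF B])
    have "(B u, B v) \<in> A" if uv: "(u, v) \<in> A" for u v using AB[OF uv] BT by simp
    then show "B (T u) = T (B u)" for u using commute[OF B(2)] by blast
  qed
  have ET: "T (E w) = E (T w)" for w by (rule Ecom[OF T]) simp
  have linE: "linear E" using E by (rule projection_op_linear)
  have EA: "(E u, E v) \<in> A" if uv: "(u, v) \<in> A" for u v
  proof -
    have "B (E v) = T (E u)" "T (E v) = E u - B (E u)"
      using AB[OF uv] EB ET by (simp_all add: linear_diff[OF linE])
    then show ?thesis
      using selfadjoint_rel_add[OF A BT[of "E u"] TB[of "E v"]] by (simp add: algebra_simps)
  qed
  \<comment> \<open>Pair \<open>v\<close> with \<open>u = B u + T v\<close>. As \<open>E\<close>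
    preserves the graph, \<open>u\<close> and \<open>v\<close> lie on the same side of
    \<open>E\<close>, and both terms have the sign dictated there.\<close>
  have form: "v \<bullet> u = T u \<bullet> u + T v \<bullet> v" if uv: "(u, v) \<in> A" for u v
  proof -
    have "u = B u + T v" "B v = T u" using AB[OF uv] by simp_all
    have "v \<bullet> u = v \<bullet> (B u + T v)" using \<open>u = B u + T v\<close> by simp
    also have "\<dots> = B v \<bullet> u + T v \<bullet> v"
      using B(2) by (simp add: inner_add_right symmetric_op_def inner_commute)
    finally show ?thesis using \<open>B v = T u\<close> by simp
  qed
  show ?thesis
  proof (rule that[OF E])
    show "\<forall>S u. contractive S \<longrightarrow> symmetric_op S \<longrightarrow> (\<forall>(u, v)\<in>A. (S u, S v) \<in> A) \<longrightarrow> S (E u) = E (S u)"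
      using Ecom commute by blast
    show "(E u, E v) \<in> A" if "(u, v) \<in> A" for u v by (rule EA[OF that])
    show "v \<bullet> u \<le> 0" if uv: "(u, v) \<in> A" and Eu: "E u = u" for u v
    proof -
      have "E v = v" using selfadjoint_rel_functional[OF A, of u] EA[OF uv] uv Eu by simp
      then show ?thesis using form[OF uv] Eneg[OF Eu] Eneg[of v] by simp
    qed
    show "v \<bullet> u > 0" if uv: "(u, v) \<in> A" and Eu: "E u = 0" and u: "u \<noteq> 0" for u v
    proof -
      have "E v = 0" using selfadjoint_rel_functional[OF A, of 0] EA[OF uv] selfadjoint_rel_zero[OF A] Eu by simp
      then have "T v \<bullet> v \<ge> 0" using Epos[of v] by (cases "v = 0") auto
      then show ?thesis using form[OF uv] Epos[OF Eu u] by simp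
    qed
  qed
qed

lemma projection_resolution_norm_diff:
  assumes "\<And>l. projection_op (E l)" "\<And>l m u. E l (E m u) = E (min l m) u" "l \<le> m"
  shows "(norm (E m u - E l u))\<^sup>2 = (norm (E m u))\<^sup>2 - (norm (E l u))\<^sup>2"
  using projection_op_pythagoras[OF assms(1)[of l], of "E m u"] assms(2)[of l m u] assms(3) by (simp add: min_def)

text \<open>Monotonicity reduces a limit along a filter to one along the sequence \<open>s\<close>,
  and contractivity reduces it to vectors of the dense domain.\<close>

lemma dense_tendsto_zero:
  assumes A: "selfadjoint_rel A" and con: "\<forall>\<^sub>F m in F. contractive (Q m)"
    and lim: "\<And>f g. (f, g) \<in> A \<Longrightarrow> (\<lambda>n. norm (Q (s n) f)) \<longlonglongrightarrow> (0::real)"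
    and mono: "\<And>f n. \<forall>\<^sub>F m in F. norm (Q m f) \<le> norm (Q (s n) f)"
  shows "((\<lambda>m. norm (Q m u)) \<longlongrightarrow> 0) F"
proof (rule tendstoI)
  fix e :: real assume e: "e > 0"
  obtain f g where fg: "(f, g) \<in> A" "norm (u - f) < e / 2"
    using selfadjoint_rel_dense[OF A, of "e / 2" u] e by auto
  have "\<forall>\<^sub>F n in sequentially. norm (Q (s n) f) < e / 2"
    using order_tendstoD(2)[OF lim[OF fg(1)], of "e / 2"] e by simp
  then obtain n where n: "norm (Q (s n) f) < e / 2" using eventually_happens'[OF sequentially_bot] by blast
  show "\<forall>\<^sub>F m in F. dist (norm (Q m u)) 0 < e"
    using con mono[of f n]
  proof eventually_elim
    case (elim m)
    have "Q m u = Q m (u - f) + Q m f" using elim(1) by (simp add: contractive_def linear_diff)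
    then have "norm (Q m u) \<le> norm (Q m (u - f)) + norm (Q m f)" by (metis norm_triangle_ineq)
    also have "norm (Q m (u - f)) \<le> norm (u - f)" using elim(1) by (simp add: contractive_def)
    finally show ?case using elim(2) fg(2) n by (simp add: dist_norm)
  qed
qed

text \<open>Repeated bisection.\<close>

lemma additive_interval_function_zero:
  fixes D :: "real \<Rightarrow> real \<Rightarrow> real"
  assumes ab: "a \<le> b"
    and add: "\<And>x z y. a \<le> x \<Longrightarrow> x \<le> z \<Longrightarrow> z \<le> y \<Longrightarrow> y \<le> b \<Longrightarrow> D x y = D x z + D z y"
    and small: "\<And>x y. a \<le> x \<Longrightarrow> x \<le> y \<Longrightarrow> y \<le> b \<Longrightarrow> \<bar>D x y\<bar> \<le> K * (y - x) * (F y - F x)"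
  shows "D a b = 0"
proof -
  have "\<bar>D x y\<bar> \<le> K * (y - x) * (F y - F x) / 2 ^ n" if "a \<le> x" "x \<le> y" "y \<le> b" for x y n
    using that
  proof (induction n arbitrary: x y)
    case 0
    then show ?case using small by simp
  next
    case (Suc n)
    define z where "z = (x + y) / 2"
    have z: "x \<le> z" "z \<le> y" "z - x = (y - x) / 2" "y - z = (y - x) / 2" using Suc by (auto simp: z_def field_simps)
    have "\<bar>D x y\<bar> \<le> \<bar>D x z\<bar> + \<bar>D z y\<bar>" using add[of x z y] Suc z by simp
    also have "\<dots> \<le> K * (z - x) * (F z - F x) / 2 ^ n + K * (y - z) * (F y - F z) / 2 ^ n"
      using Suc z by (intro add_mono Suc.IH) auto
    also have "\<dots> = K * (y - x) * (F y - F x) / 2 ^ Suc n" unfolding z by (simp add: field_simps)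
    finally show ?case .
  qed
  from this[OF order.refl ab order.refl]
  have "\<bar>D a b\<bar> \<le> K * (b - a) * (F b - F a) * (1/2) ^ n" for n by (simp add: power_one_over)
  moreover have "(\<lambda>n. K * (b - a) * (F b - F a) * (1/2) ^ n) \<longlonglongrightarrow> K * (b - a) * (F b - F a) * 0"
    by (intro tendsto_intros LIMSEQ_power_zero) simp
  ultimately have "\<bar>D a b\<bar> \<le> K * (b - a) * (F b - F a) * 0"
    by (intro LIMSEQ_le_const[where a="\<bar>D a b\<bar>"]) auto
  then show ?thesis by simp
qed

section \<open>The spectral measure attached to a resolution of the identity\<close>

lemma projection_resolution_inner:
  assumes "projection_resolution E" shows "E l u \<bullet> u = (norm (E l u))\<^sup>2"
  using assms projection_op_norm_sq by (metis projection_resolution_def)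

lemma projection_resolution_mono:
  assumes R: "projection_resolution E" and "l \<le> m" shows "E l u \<bullet> u \<le> E m u \<bullet> u"
proof -
  have "(norm (E m u - E l u))\<^sup>2 = (norm (E m u))\<^sup>2 - (norm (E l u))\<^sup>2"
    using R assms(2) by (intro projection_resolution_norm_diff) (auto simp: projection_resolution_def)
  then show ?thesis unfolding projection_resolution_inner[OF R] by (smt (verit) zero_le_power2)
qed

lemma projection_resolution_right_cont:
  assumes R: "projection_resolution E" shows "continuous (at_right a) (\<lambda>l. E l u \<bullet> u)"
proof -
  have "((\<lambda>m. norm (E m u - E a u)) \<longlongrightarrow> 0) (at_right a)" using R by (simp add: projection_resolution_def)
  then have "((\<lambda>m. E m u) \<longlongrightarrow> E a u) (at_right a)" by (rule LIM_zero_cancel[OF tendsto_norm_zero_cancel])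
  then show ?thesis unfolding continuous_within by (intro tendsto_intros)
qed

lemma projection_resolution_Ioc:
  assumes R: "projection_resolution E" and "x \<le> y"
  shows "emeasure (interval_measure (\<lambda>l. E l u \<bullet> u)) {x<..y} = ennreal (E y u \<bullet> u - E x u \<bullet> u)"
  using emeasure_interval_measure_Ioc[OF \<open>x \<le> y\<close> projection_resolution_mono[OF R] projection_resolution_right_cont[OF R]] .

lemma projection_resolution_Ioc_measure:
  assumes R: "projection_resolution E" and "x \<le> y"
  shows "measure (interval_measure (\<lambda>l. E l u \<bullet> u)) {x<..y} = E y u \<bullet> u - E x u \<bullet> u"
  using projection_resolution_Ioc[OF assms] projection_resolution_mono[OF assms] by (simp add: measure_def)

lemma UN_symmetric_Ioc: "(\<Union>n. {- real n<..real n}) = UNIV"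
proof -
  have "\<exists>n. - real n < x \<and> x \<le> real n" for x
    using reals_Archimedean2[of "\<bar>x\<bar>"] by (auto intro!: exI[of _ "nat \<lceil>\<bar>x\<bar> + 1\<rceil>"] simp: abs_le_iff) linarith+
  then show ?thesis by auto
qed

lemma projection_resolution_finite:
  assumes R: "projection_resolution E"
  shows "finite_measure (interval_measure (\<lambda>l. E l u \<bullet> u))" (is "finite_measure ?M")
proof (rule finite_measureI)
  have "emeasure ?M (\<Union>n. {- real n<..real n}) = (SUP n. emeasure ?M {- real n<..real n})"
    by (intro SUP_emeasure_incseq[symmetric]) (auto simp: incseq_def)
  also have "\<dots> \<le> ennreal ((norm u)\<^sup>2)"
  proof (intro SUP_least)
    fix n :: nat
    have "contractive (E n)" using R by (intro projection_op_contractive) (simp add: projection_resolution_def)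
    then have "(norm (E n u))\<^sup>2 \<le> (norm u)\<^sup>2" by (simp add: contractive_def)
    then show "emeasure ?M {- real n<..real n} \<le> ennreal ((norm u)\<^sup>2)"
      unfolding projection_resolution_Ioc[OF R, of "- real n" "real n", simplified]
      by (intro ennreal_leI) (smt (verit) projection_resolution_inner[OF R] zero_le_power2)
  qed
  finally show "emeasure ?M (space ?M) \<noteq> \<infinity>" unfolding UN_symmetric_Ioc by (auto simp: top_unique)
qed

text \<open>Both \<open>G\<close> and the integral are additive over adjacent intervals, and on a
  short interval both equal the mass times the left endpoint value of \<open>\<phi>\<close> up to
  the length times the mass. Their difference is then an additive interval function that bisection
  shows to vanish.\<close>

lemma interval_integral_eq:
  fixes M :: "real measure" and \<phi> :: "real \<Rightarrow> real"
  assumes fin: "finite_measure M" and sets: "sets M = sets borel"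
    and F: "\<And>x y. x \<le> y \<Longrightarrow> measure M {x<..y} = F y - F x"
    and ab: "a \<le> b" and \<phi>: "\<phi> \<in> borel_measurable borel"
    and lip: "\<And>x s. a \<le> x \<Longrightarrow> x \<le> s \<Longrightarrow> s \<le> b \<Longrightarrow> \<bar>\<phi> s - \<phi> x\<bar> \<le> L * (s - x)"
    and add: "\<And>x z y. a \<le> x \<Longrightarrow> x \<le> z \<Longrightarrow> z \<le> y \<Longrightarrow> y \<le> b \<Longrightarrow> G x y = G x z + G z y"
    and G: "\<And>x y. a \<le> x \<Longrightarrow> x \<le> y \<Longrightarrow> y \<le> b \<Longrightarrow> \<bar>G x y - \<phi> x * (F y - F x)\<bar> \<le> K * (y - x) * (F y - F x)"
    and L: "L \<ge> 0"
  shows "(\<integral>s. indicator {a<..b} s * \<phi> s \<partial>M) = G a b"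
proof -
  interpret finite_measure M by fact
  have [measurable]: "\<phi> \<in> borel_measurable M" using \<phi> sets by (simp cong: measurable_cong_sets)
  have [measurable]: "{x<..y} \<in> sets M" for x y using sets by simp
  have int: "integrable M (\<lambda>s. indicator {x<..y} s * \<phi> s)" if "a \<le> x" "y \<le> b" for x y
  proof (rule integrable_const_bound[where B="\<bar>\<phi> a\<bar> + L * (b - a)"])
    show "AE s in M. norm (indicator {x<..y} s * \<phi> s) \<le> \<bar>\<phi> a\<bar> + L * (b - a)"
    proof (rule AE_I2)
      fix s
      show "norm (indicator {x<..y} s * \<phi> s) \<le> \<bar>\<phi> a\<bar> + L * (b - a)"
      proof (cases "s \<in> {x<..y}")
        case True
        then have "\<bar>\<phi> s - \<phi> a\<bar> \<le> L * (s - a)" using that by (intro lip) auto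
        also have "\<dots> \<le> L * (b - a)" using L True that by (intro mult_left_mono) auto
        finally show ?thesis using True by simp
      qed (use L ab in simp)
    qed
  qed measurable
  define D where "D x y = G x y - (\<integral>s. indicator {x<..y} s * \<phi> s \<partial>M)" for x y
  have "D a b = 0"
  proof (rule additive_interval_function_zero[OF ab])
    fix x z y assume *: "a \<le> x" "x \<le> z" "z \<le> y" "y \<le> b"
    have "indicator {x<..y} s * \<phi> s = indicator {x<..z} s * \<phi> s + indicator {z<..y} s * \<phi> s" for s
      using * by (auto simp: indicator_def)
    then have "(\<integral>s. indicator {x<..y} s * \<phi> s \<partial>M) = (\<integral>s. indicator {x<..z} s * \<phi> s \<partial>M) + (\<integral>s. indicator {z<..y} s * \<phi> s \<partial>M)"
      using int * by (subst Bochner_Integration.integral_add[symmetric]) auto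
    then show "D x y = D x z + D z y" using add[OF *] by (simp add: D_def)
  next
    fix x y assume *: "a \<le> x" "x \<le> y" "y \<le> b"
    have ic: "integrable M (\<lambda>s. indicator {x<..y} s * c)" for c :: real by (simp add: less_top[symmetric])
    have "\<bar>(\<integral>s. indicator {x<..y} s * \<phi> s \<partial>M) - (\<integral>s. indicator {x<..y} s * \<phi> x \<partial>M)\<bar>
      = \<bar>\<integral>s. indicator {x<..y} s * \<phi> s - indicator {x<..y} s * \<phi> x \<partial>M\<bar>"
      by (subst Bochner_Integration.integral_diff) (use int * ic in auto)
    also have "\<dots> \<le> (\<integral>s. \<bar>indicator {x<..y} s * \<phi> s - indicator {x<..y} s * \<phi> x\<bar> \<partial>M)" by (rule integral_abs_bound)
    also have "\<dots> \<le> (\<integral>s. indicator {x<..y} s * (L * (y - x)) \<partial>M)"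
    proof (rule integral_mono)
      fix s
      show "\<bar>indicator {x<..y} s * \<phi> s - indicator {x<..y} s * \<phi> x\<bar> \<le> indicator {x<..y} s * (L * (y - x))"
      proof (cases "s \<in> {x<..y}")
        case True
        then have "\<bar>\<phi> s - \<phi> x\<bar> \<le> L * (s - x)" using * by (intro lip) auto
        also have "\<dots> \<le> L * (y - x)" using L True by (intro mult_left_mono) auto
        finally show ?thesis using True by simp
      qed simp
    qed (use int * ic in \<open>auto intro!: integrable_abs Bochner_Integration.integrable_diff\<close>)
    also have "\<dots> = L * (y - x) * (F y - F x)" using F[of x y] * by simp
    finally have "\<bar>(\<integral>s. indicator {x<..y} s * \<phi> s \<partial>M) - \<phi> x * (F y - F x)\<bar> \<le> L * (y - x) * (F y - F x)"
      using F[of x y] * by (simp add: mult.commute)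
    with G[OF *] show "\<bar>D x y\<bar> \<le> (K + L) * (y - x) * (F y - F x)"
      unfolding D_def by (simp add: distrib_right)
  qed
  then show ?thesis by (simp add: D_def)
qed

section \<open>From the negative projections of \<open>A - l\<close> to a spectral resolution of
  \<open>A\<close>\<close>

context
  fixes A :: "('h::{real_inner,complete_space} \<times> 'h) set" and E :: "real \<Rightarrow> 'h \<Rightarrow> 'h"
  assumes A: "selfadjoint_rel A" and P: "\<And>l. projection_op (E l)"
    and EA: "\<And>l u v. (u, v) \<in> A \<Longrightarrow> (E l u, E l v) \<in> A"
    and com: "\<And>l m u. E l (E m u) = E m (E l u)"
    and neg: "\<And>l u v. (u, v) \<in> A \<Longrightarrow> E l u = u \<Longrightarrow> v \<bullet> u \<le> l * (u \<bullet> u)"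
    and pos: "\<And>l u v. (u, v) \<in> A \<Longrightarrow> E l u = 0 \<Longrightarrow> u \<noteq> 0 \<Longrightarrow> v \<bullet> u > l * (u \<bullet> u)"
begin

lemma E_linear: "linear (E l)" using P by (rule projection_op_linear)
lemma E_contr: "contractive (E l)" using P by (rule projection_op_contractive)
lemma E_norm: "norm (E l u) \<le> norm u" using E_contr by (simp add: contractive_def)
lemma E_idem: "E l (E l u) = E l u" using P by (simp add: projection_op_def)
lemmas E_simps = linear_add[OF E_linear] linear_diff[OF E_linear] linear_scale[OF E_linear] linear_0[OF E_linear] E_idem

text \<open>A domain vector in the range of \<open>E l\<close> that \<open>E m\<close> annihilates
  has form at most \<open>l\<close> and, unless it is zero, above \<open>m\<close>. The operator
  \<open>Q\<close> maps into such vectors.\<close>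

lemma E_le: assumes "l \<le> m" shows "E m (E l u) = E l u"
proof (cases "l = m")
  case False
  define Q where "Q w = E l w - E m (E l w)" for w
  have "Q u = 0"
  proof (rule dense_operator_zero[OF A, of Q])
    have "linear Q" unfolding Q_def by (rule linearI) (simp_all add: E_simps algebra_simps)
    moreover have "norm (Q w) \<le> norm w" for w
    proof -
      have "(norm (Q w))\<^sup>2 \<le> (norm (E l w))\<^sup>2" unfolding Q_def projection_op_pythagoras[OF P] by simp
      then have "norm (Q w) \<le> norm (E l w)" by (rule power2_le_imp_le) simp
      then show ?thesis using E_norm[of l w] by simp
    qed
    ultimately show "contractive Q" by (simp add: contractive_def)
    fix f g assume fg: "(f, g) \<in> A"
    have QA: "(Q f, Q g) \<in> A" unfolding Q_def by (intro selfadjoint_rel_diff[OF A] EA fg)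
    have "E l (Q f) = Q f" unfolding Q_def by (simp add: E_simps com[of l m])
    moreover have "E m (Q f) = 0" unfolding Q_def by (simp add: E_simps)
    ultimately show "Q f = 0"
      using neg[OF QA, of l] pos[OF QA, of m] mult_right_mono[OF assms inner_ge_zero[of "Q f"]] by linarith
  qed
  then show ?thesis by (simp add: Q_def)
qed (simp add: E_idem)

lemma E_min: "E l (E m u) = E (min l m) u"
  using E_le[of l m u] E_le[of m l u] com[of l m u] by (cases "l \<le> m") (auto simp: min_def)

lemma E_norm_diff: "l \<le> m \<Longrightarrow> (norm (E m u - E l u))\<^sup>2 = (norm (E m u))\<^sup>2 - (norm (E l u))\<^sup>2"
  using projection_resolution_norm_diff[of E l m u] P E_min by blast

lemma E_norm_mono: "l \<le> m \<Longrightarrow> norm (E l u) \<le> norm (E m u)"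
  using E_norm[of l "E m u"] by (simp add: E_min min_def split: if_splits)

text \<open>The squared norms form a bounded monotone sequence, and Pythagoras identifies their
  differences with the squared distances of the vectors.\<close>

lemma E_seq_convergent: assumes s: "monoseq s" shows "convergent (\<lambda>n. E (s n) u)"
proof -
  define G where "G n = (norm (E (s n) u))\<^sup>2" for n
  have "monoseq G" using s unfolding monoseq_def G_def
    by (auto intro!: power_mono E_norm_mono)
  moreover have "Bseq G"
    by (rule BseqI'[where K="(norm u)\<^sup>2"]) (auto simp: G_def E_norm)
  ultimately have "Cauchy G" using Bseq_monoseq_convergent convergent_Cauchy by blast
  have eq: "(norm (E (s m) u - E (s n) u))\<^sup>2 = \<bar>G m - G n\<bar>" for m n
  proof (cases "s n \<le> s m")
    case True
    then show ?thesis
      using E_norm_diff[OF True, of u] zero_le_power2[of "norm (E (s m) u - E (s n) u)"] unfolding G_def by linarith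
  next
    case False
    then have "s m \<le> s n" by simp
    from E_norm_diff[OF this, of u] zero_le_power2[of "norm (E (s n) u - E (s m) u)"] show ?thesis
      unfolding G_def norm_minus_commute[of "E (s m) u" "E (s n) u"] by linarith
  qed
  have "Cauchy (\<lambda>n. E (s n) u)"
  proof (rule metric_CauchyI)
    fix e :: real assume e: "e > 0"
    then have "e\<^sup>2 > 0" by simp
    then obtain N where N: "\<And>m n. m \<ge> N \<Longrightarrow> n \<ge> N \<Longrightarrow> dist (G m) (G n) < e\<^sup>2"
      using \<open>Cauchy G\<close> unfolding Cauchy_def by metis
    show "\<exists>N. \<forall>m\<ge>N. \<forall>n\<ge>N. dist (E (s m) u) (E (s n) u) < e"
    proof (intro exI allI impI)
      fix m n assume "m \<ge> N" "n \<ge> N"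
      from N[OF this] have "(norm (E (s m) u - E (s n) u))\<^sup>2 < e\<^sup>2" by (simp add: eq dist_real_def)
      then show "dist (E (s m) u) (E (s n) u) < e" using e by (simp add: dist_norm power2_less_imp_less)
    qed
  qed
  then show ?thesis by (rule Cauchy_convergent)
qed

lemma E_seq_lim:
  assumes "(u, v) \<in> A" "monoseq s"
  obtains q q' where "(\<lambda>n. E (s n) u) \<longlonglongrightarrow> q" "(\<lambda>n. E (s n) v) \<longlonglongrightarrow> q'" "(q, q') \<in> A"
proof -
  obtain q q' where q: "(\<lambda>n. E (s n) u) \<longlonglongrightarrow> q" and q': "(\<lambda>n. E (s n) v) \<longlonglongrightarrow> q'"
    using E_seq_convergent[OF assms(2)] by (meson convergent_def)
  show ?thesis by (rule that[OF q q']) (rule selfadjoint_rel_limit[OF A EA[OF assms(1)] q q'])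
qed

lemma E_lim: assumes "f \<longlonglongrightarrow> q" shows "(\<lambda>n. E l (f n)) \<longlonglongrightarrow> E l q"
  by (rule bounded_linear.tendsto[OF contractive_bounded_linear[OF E_contr] assms])

text \<open>The defect \<open>r\<close> of the limit is fixed by every \<open>E m\<close> with
  \<open>m > l\<close> and annihilated by \<open>E l\<close>. Its form is at most
  \<open>l * (r \<bullet> r)\<close> in the limit, against the strict inequality \<open>pos\<close>.
  The strictness in \<open>pos\<close> is what selects right continuity.\<close>

lemma E_right_seq:
  assumes uv: "(u, v) \<in> A" shows "(\<lambda>n. norm (E (l + 1 / Suc n) u - E l u)) \<longlonglongrightarrow> 0"
proof -
  define s where "s n = l + 1 / Suc n" for n
  have "monoseq s" unfolding monoseq_def s_def by (auto intro!: divide_left_mono)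
  then obtain q q' where q: "(\<lambda>n. E (s n) u) \<longlonglongrightarrow> q" and "(q, q') \<in> A"
    using E_seq_lim[OF uv] by metis
  have s_l: "s \<longlonglongrightarrow> l + 0" unfolding s_def by (intro tendsto_intros LIMSEQ_Suc[OF lim_1_over_n])
  define r r' where "r = q - E l u" and "r' = q' - E l v"
  have rA: "(r, r') \<in> A" unfolding r_def r'_def by (intro selfadjoint_rel_diff[OF A] EA uv \<open>(q, q') \<in> A\<close>)
  have "(\<lambda>n. E l (E (s n) u)) \<longlonglongrightarrow> E l q" by (rule E_lim[OF q])
  moreover have "E l (E (s n) u) = E l u" for n by (simp add: E_min s_def min_def)
  ultimately have "E l q = E l u" by (simp add: LIMSEQ_const_iff)
  then have Elr: "E l r = 0" by (simp add: r_def E_simps)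
  have "E m r = r" if "l < m" for m
  proof -
    have "(\<lambda>n. E m (E (s n) u)) \<longlonglongrightarrow> E m q" by (rule E_lim[OF q])
    moreover have "\<forall>\<^sub>F n in sequentially. E m (E (s n) u) = E (s n) u"
      using order_tendstoD(2)[OF s_l, of m] that by (auto simp: E_min min_def elim!: eventually_mono)
    ultimately have "(\<lambda>n. E (s n) u) \<longlonglongrightarrow> E m q" using tendsto_cong by fast
    then have "E m q = q" using q LIMSEQ_unique by blast
    then show ?thesis using that by (simp add: r_def E_simps E_min min_def)
  qed
  then have "r' \<bullet> r \<le> s n * (r \<bullet> r)" for n by (intro neg[OF rA]) (simp add: s_def)
  moreover have "(\<lambda>n. s n * (r \<bullet> r)) \<longlonglongrightarrow> (l + 0) * (r \<bullet> r)" by (intro tendsto_intros s_l)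
  ultimately have "r' \<bullet> r \<le> (l + 0) * (r \<bullet> r)" by (intro LIMSEQ_le_const) auto
  then have "r = 0" using pos[OF rA Elr] by auto
  then have "q = E l u" by (simp add: r_def)
  then have "(\<lambda>n. norm (E (s n) u - E l u)) \<longlonglongrightarrow> norm (E l u - E l u)" using q by (intro tendsto_intros) auto
  then show ?thesis by (simp add: s_def)
qed

text \<open>A limit vector would be fixed by all \<open>E (- real m)\<close>, so its form would lie
  below every multiple of its squared norm; the same idea with the opposite sign gives the limit at
  the top.\<close>

lemma E_bot_seq:
  assumes uv: "(u, v) \<in> A" shows "(\<lambda>n. norm (E (- real n) u)) \<longlonglongrightarrow> 0"
proof -
  have "monoseq (\<lambda>n. - real n)" unfolding monoseq_def by auto
  then obtain q q' where q: "(\<lambda>n. E (- real n) u) \<longlonglongrightarrow> q" and qA: "(q, q') \<in> A"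
    using E_seq_lim[OF uv] by metis
  have "E (- real m) q = q" for m
  proof -
    have "(\<lambda>n. E (- real m) (E (- real n) u)) \<longlonglongrightarrow> E (- real m) q" by (rule E_lim[OF q])
    moreover have "\<forall>\<^sub>F n in sequentially. E (- real m) (E (- real n) u) = E (- real n) u"
      using eventually_ge_at_top[of m] by eventually_elim (auto simp: E_min min_def)
    ultimately have "(\<lambda>n. E (- real n) u) \<longlonglongrightarrow> E (- real m) q" using tendsto_cong by fast
    then show ?thesis using q LIMSEQ_unique by blast
  qed
  then have le: "q' \<bullet> q \<le> - real m * (q \<bullet> q)" for m by (rule neg[OF qA])
  have "q = 0"
  proof (rule ccontr)
    assume "q \<noteq> 0"
    then have qq: "q \<bullet> q > 0" by simp
    obtain m :: nat where "- (q' \<bullet> q) / (q \<bullet> q) < real m" using reals_Archimedean2 by blast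
    then have "- (q' \<bullet> q) < real m * (q \<bullet> q)" by (subst (asm) pos_divide_less_eq[OF qq])
    then show False using le[of m] by simp
  qed
  then show ?thesis using tendsto_norm[OF q] by simp
qed

lemma E_top_seq:
  assumes uv: "(u, v) \<in> A" shows "(\<lambda>n. norm (E (real n) u - u)) \<longlonglongrightarrow> 0"
proof -
  have "monoseq real" unfolding monoseq_def by auto
  then obtain q q' where q: "(\<lambda>n. E (real n) u) \<longlonglongrightarrow> q" and qA: "(q, q') \<in> A"
    using E_seq_lim[OF uv] by metis
  define r r' where "r = u - q" and "r' = v - q'"
  have rA: "(r, r') \<in> A" unfolding r_def r'_def by (intro selfadjoint_rel_diff[OF A] uv qA)
  have Er: "E (real m) r = 0" for m
  proof -
    have "(\<lambda>n. E (real m) (E (real n) u)) \<longlonglongrightarrow> E (real m) q" by (rule E_lim[OF q])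
    moreover have "\<forall>\<^sub>F n in sequentially. E (real m) (E (real n) u) = E (real m) u"
      using eventually_ge_at_top[of m] by eventually_elim (auto simp: E_min min_def)
    ultimately have "(\<lambda>n::nat. E (real m) u) \<longlonglongrightarrow> E (real m) q" using tendsto_cong by fast
    then show ?thesis by (simp add: r_def E_simps LIMSEQ_const_iff)
  qed
  have "r = 0"
  proof (rule ccontr)
    assume r0: "r \<noteq> 0"
    then have rr: "r \<bullet> r > 0" by simp
    obtain m :: nat where "(r' \<bullet> r) / (r \<bullet> r) < real m" using reals_Archimedean2 by blast
    then have "r' \<bullet> r < real m * (r \<bullet> r)" using rr by (simp add: pos_divide_less_eq)
    then show False using pos[OF rA Er[of m] r0] by simp
  qed
  then have "(\<lambda>n. norm (E (real n) u - u)) \<longlonglongrightarrow> norm (u - u)" using q by (intro tendsto_intros) (simp add: r_def)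
  then show ?thesis by simp
qed

lemma E_resolution: "projection_resolution E"
  unfolding projection_resolution_def
proof (intro conjI allI)
  fix l m u
  show "projection_op (E l)" by (rule P)
  show "E l (E m u) = E (min l m) u" by (rule E_min)
  show "((\<lambda>m. norm (E m u - E l u)) \<longlongrightarrow> 0) (at_right l)"
  proof (rule dense_tendsto_zero[OF A, where s="\<lambda>n. l + 1 / Suc n" and Q="\<lambda>m u. E m u - E l u"])
    have "contractive (\<lambda>u. E m u - E l u)" if "l < m" for m
    proof -
      have "linear (\<lambda>u. E m u - E l u)" by (rule linearI) (simp_all add: E_simps algebra_simps)
      moreover have "norm (E m w - E l w) \<le> norm w" for w
      proof -
        have "(norm (E m w - E l w))\<^sup>2 \<le> (norm (E m w))\<^sup>2" using E_norm_diff[of l m w] that by simp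
        then have "norm (E m w - E l w) \<le> norm (E m w)" by (rule power2_le_imp_le) simp
        then show ?thesis using E_norm[of m w] by simp
      qed
      ultimately show ?thesis by (simp add: contractive_def)
    qed
    then show "\<forall>\<^sub>F m in at_right l. contractive (\<lambda>u. E m u - E l u)"
      by (subst eventually_at_right[of l "l + 1"]) (auto intro: exI[of _ "l + 1"])
    show "(\<lambda>n. norm (E (l + 1 / Suc n) f - E l f)) \<longlonglongrightarrow> 0" if "(f, g) \<in> A" for f g
      by (rule E_right_seq[OF that])
    show "\<forall>\<^sub>F m in at_right l. norm (E m f - E l f) \<le> norm (E (l + 1 / Suc n) f - E l f)" for f n
    proof (subst eventually_at_right[of l "l + 1"], simp, intro exI[of _ "l + 1 / Suc n"] conjI allI impI)
      fix m assume m: "l < m" "m < l + 1 / Suc n"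
      have "(norm (E m f - E l f))\<^sup>2 \<le> (norm (E (l + 1 / Suc n) f - E l f))\<^sup>2"
        using m E_norm_mono[of m "l + 1 / Suc n" f] by (simp add: E_norm_diff)
      then show "norm (E m f - E l f) \<le> norm (E (l + 1 / Suc n) f - E l f)" by (rule power2_le_imp_le) simp
    qed simp
  qed
  show "((\<lambda>l. norm (E l u)) \<longlongrightarrow> 0) at_bot"
  proof (rule dense_tendsto_zero[OF A, where s="\<lambda>n. - real n" and Q=E])
    show "\<forall>\<^sub>F m in at_bot. norm (E m f) \<le> norm (E (- real n) f)" for f n
      using eventually_le_at_bot[of "- real n"] by eventually_elim (rule E_norm_mono)
  qed (auto intro: E_bot_seq simp: E_contr)
  have "((\<lambda>l. norm (u - E l u)) \<longlongrightarrow> 0) at_top"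
  proof (rule dense_tendsto_zero[OF A, where s="real" and Q="\<lambda>m u. u - E m u"])
    have lin: "linear (\<lambda>u. u - E m u)" for m by (rule linearI) (simp_all add: E_simps algebra_simps)
    have "norm (w - E m w) \<le> norm w" for m w
    proof -
      have "(norm (w - E m w))\<^sup>2 \<le> (norm w)\<^sup>2" unfolding projection_op_pythagoras[OF P] by simp
      then show ?thesis by (rule power2_le_imp_le) simp
    qed
    then show "\<forall>\<^sub>F m in at_top. contractive (\<lambda>u. u - E m u)" using lin by (simp add: contractive_def)
    show "\<forall>\<^sub>F m in at_top. norm (f - E m f) \<le> norm (f - E (real n) f)" for f n
      using eventually_ge_at_top[of "real n"]
    proof eventually_elim
      case (elim m)
      have "(norm (f - E m f))\<^sup>2 \<le> (norm (f - E (real n) f))\<^sup>2"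
        unfolding projection_op_pythagoras[OF P] using E_norm_mono[OF elim, of f] by simp
      then show ?case by (rule power2_le_imp_le) simp
    qed
    show "(\<lambda>n. norm (f - E (real n) f)) \<longlonglongrightarrow> 0" if "(f, g) \<in> A" for f g
      using E_top_seq[OF that] by (simp add: norm_minus_commute)
  qed
  then show "((\<lambda>l. norm (E l u - u)) \<longlongrightarrow> 0) at_top" by (simp add: norm_minus_commute)
qed

lemma band_range:
  assumes uv: "(u, v) \<in> A" and y: "E y u = u" and x: "E x u = 0"
  shows "E y v = v" "E x v = 0"
  using selfadjoint_rel_functional[OF A EA[OF uv, of y]] selfadjoint_rel_functional[OF A EA[OF uv, of x]]
    uv y x selfadjoint_rel_zero[OF A] by auto

lemma band_form:
  assumes uv: "(u, v) \<in> A" and y: "E y u = u" and x: "E x u = 0"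
  shows "0 \<le> (v - x *\<^sub>R u) \<bullet> u" "(v - x *\<^sub>R u) \<bullet> u \<le> (y - x) * (u \<bullet> u)"
  using neg[OF uv y] pos[OF uv x] by (cases "u = 0"; simp add: inner_diff_left algebra_simps)+

lemma band_dense:
  assumes w: "E y w = w" "E x w = 0" and xy: "x \<le> y"
  obtains f g where "\<And>n. (f n, g n) \<in> A" "\<And>n. E y (f n) = f n" "\<And>n. E x (f n) = 0" "f \<longlonglongrightarrow> w"
proof -
  have "\<exists>f g. (f, g) \<in> A \<and> norm (w - f) < 1 / Suc n" for n
    by (rule selfadjoint_rel_dense[OF A]) simp
  then obtain f g where fg: "\<And>n. (f n, g n) \<in> A" and lt: "\<And>n. norm (w - f n) < 1 / Suc n" by metis
  have "(\<lambda>n. f n - w) \<longlonglongrightarrow> 0"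
  proof (rule Lim_null_comparison[OF _ LIMSEQ_Suc[OF lim_1_over_n]])
    show "\<forall>\<^sub>F n in sequentially. norm (f n - w) \<le> 1 / real (Suc n)"
      using lt by (simp add: norm_minus_commute less_imp_le)
  qed
  then have "f \<longlonglongrightarrow> w" by (rule LIM_zero_cancel)
  then have "(\<lambda>n. E y (f n) - E x (f n)) \<longlonglongrightarrow> E y w - E x w" by (intro tendsto_diff E_lim)
  then have "(\<lambda>n. E y (f n) - E x (f n)) \<longlonglongrightarrow> w" using w by simp
  then show ?thesis
    using xy by (intro that[of "\<lambda>n. E y (f n) - E x (f n)" "\<lambda>n. E y (g n) - E x (g n)"])
      (auto intro!: selfadjoint_rel_diff[OF A] EA fg simp: E_simps E_min min_def)
qed

text \<open>On the band between \<open>x\<close> and \<open>y\<close> the form of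
  \<open>A - x\<close> lies between 0 and \<open>y - x\<close>, so a Cauchy-Schwarz argument bounds
  the operator itself. Since \<open>w = v - x u\<close> need not lie in the domain, it is first
  tested against domain vectors of the band, which then approximate it.\<close>

lemma band_norm:
  assumes uv: "(u, v) \<in> A" and y: "E y u = u" and x: "E x u = 0" and xy: "x \<le> y"
  shows "norm (v - x *\<^sub>R u) \<le> (y - x) * norm u"
proof -
  define w where "w = v - x *\<^sub>R u"
  have cs: "w \<bullet> f \<le> (y - x) * norm u * norm f" if fg: "(f, g) \<in> A" and fy: "E y f = f" and fx: "E x f = 0" for f g
  proof (cases "u = 0 \<or> f = 0")
    case True
    moreover have "v = 0" if "u = 0" using selfadjoint_rel_functional[OF A, of 0 v 0] uv selfadjoint_rel_zero[OF A] that by simp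
    ultimately show ?thesis by (auto simp: w_def)
  next
    case False
    then have nu: "norm u > 0" and nf: "norm f > 0" by auto
    \<comment> \<open>This scaling gives \<open>u\<close> and \<open>t *\<^sub>R f\<close> equal
      norms, so the two quadratic terms have the same bound.\<close>
    define t where "t = - norm u / norm f"
    define h where "h = g - x *\<^sub>R f"
    have sum: "(u + t *\<^sub>R f, v + t *\<^sub>R g) \<in> A" by (intro selfadjoint_rel_add[OF A] selfadjoint_rel_scale[OF A] uv fg)
    have "0 \<le> (v + t *\<^sub>R g - x *\<^sub>R (u + t *\<^sub>R f)) \<bullet> (u + t *\<^sub>R f)"
      by (rule band_form(1)[OF sum, of y]) (simp_all add: E_simps x y fx fy)
    also have "v + t *\<^sub>R g - x *\<^sub>R (u + t *\<^sub>R f) = w + t *\<^sub>R h" by (simp add: w_def h_def algebra_simps)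
    also have "(w + t *\<^sub>R h) \<bullet> (u + t *\<^sub>R f) = w \<bullet> u + t * (w \<bullet> f + h \<bullet> u) + t\<^sup>2 * (h \<bullet> f)"
      by (simp add: inner_add_left inner_add_right algebra_simps power2_eq_square)
    also have "h \<bullet> u = w \<bullet> f"
      using selfadjoint_rel_symmetric[OF A uv fg] by (simp add: h_def w_def inner_diff_left inner_diff_right inner_commute)
    also have "w \<bullet> u \<le> (y - x) * (norm u)\<^sup>2"
      using band_form(2)[OF uv y x] by (simp add: w_def power2_norm_eq_inner)
    also have "t\<^sup>2 * (h \<bullet> f) \<le> t\<^sup>2 * ((y - x) * (norm f)\<^sup>2)"
      using band_form(2)[OF fg fy fx] by (intro mult_left_mono) (auto simp: h_def power2_norm_eq_inner)
    also have "t\<^sup>2 * ((y - x) * (norm f)\<^sup>2) = (y - x) * (norm u)\<^sup>2" using nf by (simp add: t_def power_divide)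
    finally have "0 \<le> 2 * ((y - x) * (norm u)\<^sup>2) + 2 * t * (w \<bullet> f)" by simp
    then have "norm u * (w \<bullet> f) / norm f \<le> (y - x) * (norm u)\<^sup>2" by (simp add: t_def)
    then have "norm u * (w \<bullet> f) \<le> norm u * ((y - x) * norm u * norm f)" using nf
      by (simp add: pos_divide_le_eq power2_eq_square mult_ac)
    then show ?thesis using nu by simp
  qed
  have w: "E y w = w" "E x w = 0"
    using band_range[OF uv y x] x y by (simp_all add: w_def E_simps)
  obtain f g where fg: "\<And>n. (f n, g n) \<in> A" "\<And>n. E y (f n) = f n" "\<And>n. E x (f n) = 0" and lim: "f \<longlonglongrightarrow> w"
    using band_dense[OF w xy] by metis
  have "w \<bullet> w \<le> (y - x) * norm u * norm w"
  proof (rule LIMSEQ_le)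
    show "(\<lambda>n. w \<bullet> f n) \<longlonglongrightarrow> w \<bullet> w" "(\<lambda>n. (y - x) * norm u * norm (f n)) \<longlonglongrightarrow> (y - x) * norm u * norm w"
      by (intro tendsto_intros lim)+
    show "\<exists>N. \<forall>n\<ge>N. w \<bullet> f n \<le> (y - x) * norm u * norm (f n)" using cs[OF fg] by blast
  qed
  then have "norm w * norm w \<le> (y - x) * norm u * norm w" by (simp add: power2_norm_eq_inner[symmetric] power2_eq_square)
  then show ?thesis using xy unfolding w_def[symmetric] by (cases "norm w = 0") auto
qed

text \<open>\<open>A - x\<close> is bounded on domain vectors of the band, so the images of an
  approximating sequence converge, and the graph is closed.\<close>

lemma band_domain:
  assumes w: "E y w = w" "E x w = 0" and xy: "x \<le> y"
  shows "\<exists>v. (w, v) \<in> A"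
proof -
  obtain f g where fg: "\<And>n. (f n, g n) \<in> A" and fb: "\<And>n. E y (f n) = f n" "\<And>n. E x (f n) = 0" and lim: "f \<longlonglongrightarrow> w"
    using band_dense[OF w xy] by metis
  define h where "h n = g n - x *\<^sub>R f n" for n
  have le: "norm (h m - h n) \<le> (y - x) * norm (f m - f n)" for m n
  proof -
    have "(f m - f n, g m - g n) \<in> A" by (rule selfadjoint_rel_diff[OF A fg fg])
    from band_norm[OF this, of y x] have "norm (g m - g n - x *\<^sub>R (f m - f n)) \<le> (y - x) * norm (f m - f n)"
      using fb xy by (simp add: E_simps)
    moreover have "g m - g n - x *\<^sub>R (f m - f n) = h m - h n" by (simp add: h_def algebra_simps)
    ultimately show ?thesis by simp
  qed
  have "Cauchy f" using lim by (rule LIMSEQ_imp_Cauchy)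
  have "Cauchy h"
  proof (rule metric_CauchyI)
      fix e :: real assume e: "e > 0"
      have K: "y - x + 1 > 0" using xy by simp
      obtain N where N: "\<And>m n. m \<ge> N \<Longrightarrow> n \<ge> N \<Longrightarrow> dist (f m) (f n) < e / (y - x + 1)"
        using \<open>Cauchy f\<close> e K unfolding Cauchy_def by (metis divide_pos_pos)
      show "\<exists>N. \<forall>m\<ge>N. \<forall>n\<ge>N. dist (h m) (h n) < e"
      proof (intro exI allI impI)
        fix m n assume mn: "m \<ge> N" "n \<ge> N"
        have "norm (f m - f n) * (y - x + 1) < e"
          using N[OF mn] K by (simp add: dist_norm pos_less_divide_eq)
        moreover have "(y - x) * norm (f m - f n) \<le> norm (f m - f n) * (y - x + 1)" by (simp add: algebra_simps)
        ultimately show "dist (h m) (h n) < e" using le[of m n] by (simp add: dist_norm)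
      qed
  qed
  then obtain k where k: "h \<longlonglongrightarrow> k" using Cauchy_convergent convergent_def by blast
  have "(\<lambda>n. h n + x *\<^sub>R f n) \<longlonglongrightarrow> k + x *\<^sub>R w" by (intro tendsto_intros k lim)
  then have "g \<longlonglongrightarrow> k + x *\<^sub>R w" by (simp add: h_def)
  then show ?thesis using selfadjoint_rel_limit[OF A fg lim] by blast
qed

lemma band_projection:
  assumes "x \<le> y"
  shows "E y (E y u - E x u) = E y u - E x u" "E x (E y u - E x u) = 0"
  using assms by (simp_all add: E_simps E_min min_def)

lemma E_inner: "E l u \<bullet> v = u \<bullet> E l v"
  using P[of l] by (simp add: projection_op_def symmetric_op_def)

lemma E_sub_norm: "x \<le> y \<Longrightarrow> (norm (E y u - E x u))\<^sup>2 = E y u \<bullet> u - E x u \<bullet> u"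
  using E_norm_diff[of x y u] projection_op_norm_sq[OF P] by simp

text \<open>Let \<open>T x y\<close> be \<open>A\<close> applied to the band component of
  \<open>u\<close>. Its products with \<open>u\<close> and with itself are additive over adjacent
  bands, the latter by orthogonality. By \<open>band_norm\<close> they differ little from
  \<open>x\<close> and \<open>x\<^sup>2\<close> times the mass of the band, so the interval
  criterion applies.\<close>

lemma band_integrals:
  assumes ab: "a \<le> b" and v: "(E b u - E a u, v) \<in> A"
  shows "(\<integral>s. indicator {a<..b} s * s \<partial>interval_measure (\<lambda>l. E l u \<bullet> u)) = v \<bullet> u"
    and "(\<integral>s. indicator {a<..b} s * s\<^sup>2 \<partial>interval_measure (\<lambda>l. E l u \<bullet> u)) = v \<bullet> v"
proof -
  let ?M = "interval_measure (\<lambda>l. E l u \<bullet> u)"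
  have "\<exists>v. (E y u - E x u, v) \<in> A" if "x \<le> y" for x y
    using band_domain[of y "E y u - E x u" x] band_projection[OF that] that by simp
  then obtain T where T: "\<And>x y. x \<le> y \<Longrightarrow> (E y u - E x u, T x y) \<in> A" by metis
  have Tab: "T a b = v" using selfadjoint_rel_functional[OF A T[OF ab] v] .
  have Ty: "E y (T x y) = T x y" and Tx: "E x (T x y) = 0" if "x \<le> y" for x y
    using band_range[OF T[OF that], of y x] band_projection[OF that] by auto
  have Tadd: "T x y = T x z + T z y" if "x \<le> z" "z \<le> y" for x y z
  proof (rule selfadjoint_rel_functional[OF A])
    show "(E y u - E x u, T x y) \<in> A" using that by (intro T) simp
    show "(E y u - E x u, T x z + T z y) \<in> A"
      using selfadjoint_rel_add[OF A T[OF that(1)] T[OF that(2)]] by simp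
  qed
  have small: "norm (T x y - x *\<^sub>R (E y u - E x u)) \<le> (y - x) * norm (E y u - E x u)" if "x \<le> y" for x y
    using band_norm[OF T[OF that], of y x] band_projection[OF that] that by simp
  have Tu: "T x y \<bullet> u = T x y \<bullet> (E y u - E x u)" if "x \<le> y" for x y
    using Ty[OF that] Tx[OF that] by (metis E_inner diff_zero inner_diff_right inner_zero_left)
  note fin = projection_resolution_finite[OF E_resolution, of u]
  note meas = projection_resolution_Ioc_measure[OF E_resolution, of _ _ u]
  have pp: "(E y u - E x u) \<bullet> (E y u - E x u) = E y u \<bullet> u - E x u \<bullet> u" if "x \<le> y" for x y
    using E_sub_norm[OF that, of u] by (simp add: power2_norm_eq_inner)
  have "(\<integral>s. indicator {a<..b} s * s \<partial>?M) = T a b \<bullet> u"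
  proof (rule interval_integral_eq[OF fin sets_interval_measure meas ab, where L=1 and K=1 and G="\<lambda>x y. T x y \<bullet> u"])
    show "T x y \<bullet> u = T x z \<bullet> u + T z y \<bullet> u" if "x \<le> z" "z \<le> y" for x y z
      using Tadd[OF that] by (simp add: inner_add_left)
    show "\<bar>T x y \<bullet> u - x * (E y u \<bullet> u - E x u \<bullet> u)\<bar> \<le> 1 * (y - x) * (E y u \<bullet> u - E x u \<bullet> u)" if xy: "x \<le> y" for x y
    proof -
      let ?p = "E y u - E x u"
      have "\<bar>(T x y - x *\<^sub>R ?p) \<bullet> ?p\<bar> \<le> norm (T x y - x *\<^sub>R ?p) * norm ?p" by (rule Cauchy_Schwarz_ineq2)
      also have "\<dots> \<le> (y - x) * norm ?p * norm ?p" using small[OF xy] by (rule mult_right_mono) simp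
      also have "\<dots> = (y - x) * (E y u \<bullet> u - E x u \<bullet> u)"
        using E_sub_norm[OF xy, of u] by (simp add: power2_eq_square)
      also have "(T x y - x *\<^sub>R ?p) \<bullet> ?p = T x y \<bullet> u - x * (E y u \<bullet> u - E x u \<bullet> u)"
        unfolding inner_diff_left[of "T x y"] Tu[OF xy] inner_scaleR_left pp[OF xy] ..
      finally show ?thesis by simp
    qed
  qed auto
  then show "(\<integral>s. indicator {a<..b} s * s \<partial>?M) = v \<bullet> u" by (simp add: Tab)
  \<comment> \<open>\<open>2 * M\<close> is a Lipschitz constant of the square on
    \<open>{a..b}\<close>. The error of \<open>T x y \<bullet> T x y\<close> is a cross term plus a
    square, each at most \<open>2 * M * (y - x)\<close> times the mass, whence
    \<open>4 * M\<close>.\<close>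
  define M where "M = \<bar>a\<bar> + \<bar>b\<bar>"
  have "(\<integral>s. indicator {a<..b} s * s\<^sup>2 \<partial>?M) = T a b \<bullet> T a b"
  proof (rule interval_integral_eq[OF fin sets_interval_measure meas ab, where L="2 * M" and K="4 * M" and G="\<lambda>x y. T x y \<bullet> T x y"])
    show "T x y \<bullet> T x y = T x z \<bullet> T x z + T z y \<bullet> T z y" if "x \<le> z" "z \<le> y" for x y z
    proof -
      have "T x z \<bullet> T z y = T x z \<bullet> E z (T z y)" by (simp add: E_inner[symmetric] Ty[OF that(1)])
      also have "\<dots> = 0" by (simp add: Tx[OF that(2)])
      finally show ?thesis unfolding Tadd[OF that] by (simp add: inner_add_left inner_add_right inner_commute)
    qed
    show "\<bar>s\<^sup>2 - x\<^sup>2\<bar> \<le> 2 * M * (s - x)" if "a \<le> x" "x \<le> s" "s \<le> b" for x s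
    proof -
      have "\<bar>s\<^sup>2 - x\<^sup>2\<bar> = \<bar>s + x\<bar> * (s - x)" using that
        by (simp add: power2_eq_square square_diff_square_factored abs_mult)
      also have "\<dots> \<le> 2 * M * (s - x)" using that by (intro mult_right_mono) (auto simp: M_def)
      finally show ?thesis .
    qed
    show "\<bar>T x y \<bullet> T x y - x\<^sup>2 * (E y u \<bullet> u - E x u \<bullet> u)\<bar> \<le> 4 * M * (y - x) * (E y u \<bullet> u - E x u \<bullet> u)"
      if xy: "a \<le> x" "x \<le> y" "y \<le> b" for x y
    proof -
      let ?p = "E y u - E x u" and ?w = "T x y - x *\<^sub>R (E y u - E x u)"
      have "T x y \<bullet> T x y - x\<^sup>2 * (?p \<bullet> ?p) = 2 * x * (?w \<bullet> ?p) + ?w \<bullet> ?w"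
        by (simp add: inner_diff_left inner_diff_right inner_commute algebra_simps power2_eq_square)
      then have "\<bar>T x y \<bullet> T x y - x\<^sup>2 * (?p \<bullet> ?p)\<bar> \<le> 2 * \<bar>x\<bar> * \<bar>?w \<bullet> ?p\<bar> + \<bar>?w \<bullet> ?w\<bar>"
        by (metis abs_mult abs_numeral abs_triangle_ineq)
      also have "\<dots> \<le> 2 * M * ((y - x) * norm ?p * norm ?p) + 2 * M * ((y - x) * norm ?p * norm ?p)"
      proof (rule add_mono)
        have "\<bar>?w \<bullet> ?p\<bar> \<le> norm ?w * norm ?p" by (rule Cauchy_Schwarz_ineq2)
        also have "\<dots> \<le> (y - x) * norm ?p * norm ?p" using small[OF xy(2)] by (rule mult_right_mono) simp
        finally show "2 * \<bar>x\<bar> * \<bar>?w \<bullet> ?p\<bar> \<le> 2 * M * ((y - x) * norm ?p * norm ?p)"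
          using xy by (intro mult_mono) (auto simp: M_def)
        have "\<bar>?w \<bullet> ?w\<bar> = norm ?w * norm ?w" by (simp add: power2_norm_eq_inner[symmetric] power2_eq_square)
        also have "\<dots> \<le> ((y - x) * norm ?p) * ((y - x) * norm ?p)"
          using small[OF xy(2)] xy by (intro mult_mono) auto
        also have "\<dots> = (y - x) * ((y - x) * norm ?p * norm ?p)" by simp
        also have "\<dots> \<le> 2 * M * ((y - x) * norm ?p * norm ?p)"
          using xy by (intro mult_right_mono) (auto simp: M_def)
        finally show "\<bar>?w \<bullet> ?w\<bar> \<le> 2 * M * ((y - x) * norm ?p * norm ?p)" .
      qed
      also have "\<dots> = 4 * M * (y - x) * (E y u \<bullet> u - E x u \<bullet> u)"
        using E_sub_norm[OF xy(2), of u] by (simp add: power2_eq_square)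
      finally show ?thesis unfolding pp[OF xy(2)] .
    qed
  qed (auto simp: M_def)
  then show "(\<integral>s. indicator {a<..b} s * s\<^sup>2 \<partial>?M) = v \<bullet> v" by (simp add: Tab)
qed

lemma E_real_seq: "(\<lambda>n. E (real n) u - E (- real n) u) \<longlonglongrightarrow> u"
proof -
  have top: "((\<lambda>l. norm (E l u - u)) \<longlongrightarrow> 0) at_top" and bot: "((\<lambda>l. norm (E l u)) \<longlongrightarrow> 0) at_bot"
    using E_resolution by (auto simp: projection_resolution_def)
  have "((\<lambda>l. E l u) \<longlongrightarrow> u) at_top" by (rule LIM_zero_cancel[OF tendsto_norm_zero_cancel[OF top]])
  then have "(\<lambda>n. E (real n) u) \<longlonglongrightarrow> u" by (rule filterlim_compose[OF _ filterlim_real_sequentially])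
  moreover have "((\<lambda>l. E l u) \<longlongrightarrow> 0) at_bot" by (rule tendsto_norm_zero_cancel[OF bot])
  then have "(\<lambda>n. E (- real n) u) \<longlonglongrightarrow> 0"
    by (rule filterlim_compose) (rule filterlim_compose[OF filterlim_uminus_at_bot_at_top filterlim_real_sequentially])
  ultimately have "(\<lambda>n. E (real n) u - E (- real n) u) \<longlonglongrightarrow> u - 0" by (rule tendsto_diff)
  then show ?thesis by simp
qed

lemma indicator_symmetric_Ioc_tendsto: "(\<lambda>n. indicator {- real n<..real n} s * c) \<longlonglongrightarrow> (c::real)"
proof (rule tendsto_eventually)
  obtain N :: nat where "\<bar>s\<bar> < real N" using reals_Archimedean2 by blast
  then show "\<forall>\<^sub>F n in sequentially. indicator {- real n<..real n} s * c = c"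
    by (intro eventually_sequentiallyI[of N]) (auto simp: indicator_def)
qed

text \<open>The bands \<open>{- real n<..real n}\<close> exhaust the line. The truncated second
  moments tend to \<open>v \<bullet> v\<close>, so monotone convergence applies; the first moment
  follows by domination with \<open>1 + s\<^sup>2\<close>.\<close>

lemma E_domain_integral:
  assumes uv: "(u, v) \<in> A"
  shows "integrable (interval_measure (\<lambda>l. E l u \<bullet> u)) (\<lambda>s. s\<^sup>2)"
    and "(\<integral>s. s \<partial>interval_measure (\<lambda>l. E l u \<bullet> u)) = v \<bullet> u"
proof -
  let ?M = "interval_measure (\<lambda>l. E l u \<bullet> u)"
  interpret finite_measure ?M by (rule projection_resolution_finite[OF E_resolution])
  have uvn: "(E (real n) u - E (- real n) u, E (real n) v - E (- real n) v) \<in> A" for n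
    by (intro selfadjoint_rel_diff[OF A] EA uv)
  note I = band_integrals[OF _ uvn]
  have ind: "indicator {- real m<..real m} s * s\<^sup>2 \<le> indicator {- real n<..real n} s * s\<^sup>2" if "m \<le> n" for m n and s :: real
    using that by (auto simp: indicator_def)
  show int: "integrable ?M (\<lambda>s. s\<^sup>2)"
  proof (rule integrable_monotone_convergence)
    show "integrable ?M (\<lambda>s. indicator {- real n<..real n} s * s\<^sup>2)" for n
    proof (rule integrable_const_bound[where B="(real n)\<^sup>2"])
      show "AE s in ?M. norm (indicator {- real n<..real n} s * s\<^sup>2) \<le> (real n)\<^sup>2"
        by (rule AE_I2) (auto simp: indicator_def abs_le_square_iff[symmetric])
    qed simp
    show "AE s in ?M. mono (\<lambda>n. indicator {- real n<..real n} s * s\<^sup>2)"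
      by (rule AE_I2) (auto intro!: monoI ind)
    show "AE s in ?M. (\<lambda>n. indicator {- real n<..real n} s * s\<^sup>2) \<longlonglongrightarrow> s\<^sup>2"
      by (rule AE_I2) (rule indicator_symmetric_Ioc_tendsto)
    have "(\<lambda>n. (E (real n) v - E (- real n) v) \<bullet> (E (real n) v - E (- real n) v)) \<longlonglongrightarrow> v \<bullet> v"
      by (intro tendsto_inner E_real_seq)
    then show "(\<lambda>n. \<integral>s. indicator {- real n<..real n} s * s\<^sup>2 \<partial>?M) \<longlonglongrightarrow> v \<bullet> v" using I(2) by simp
  qed simp
  have "(\<lambda>n. \<integral>s. indicator {- real n<..real n} s * s \<partial>?M) \<longlonglongrightarrow> (\<integral>s. s \<partial>?M)"
  proof (rule integral_dominated_convergence[where w="\<lambda>s. 1 + s\<^sup>2"])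
    show "integrable ?M (\<lambda>s. 1 + s\<^sup>2)" using int by simp
    show "AE s in ?M. (\<lambda>n. indicator {- real n<..real n} s * s) \<longlonglongrightarrow> s"
      by (rule AE_I2) (rule indicator_symmetric_Ioc_tendsto)
    have "\<bar>s\<bar> \<le> 1 + s\<^sup>2" for s :: real using zero_le_power2[of "\<bar>s\<bar> - 1"] by (simp add: power2_eq_square algebra_simps)
    then show "AE s in ?M. norm (indicator {- real n<..real n} s * s) \<le> 1 + s\<^sup>2" for n
      by (intro AE_I2) (auto simp: indicator_def intro: order_trans)
  qed auto
  moreover have "(\<lambda>n. (E (real n) v - E (- real n) v) \<bullet> u) \<longlonglongrightarrow> v \<bullet> u"
    by (intro tendsto_inner E_real_seq tendsto_const)
  ultimately show "(\<integral>s. s \<partial>?M) = v \<bullet> u" using I(1) LIMSEQ_unique by simp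
qed

text \<open>\<open>A\<close> is defined on each truncation \<open>p n\<close>, and the squared norms
  of the images \<open>t n\<close> are truncated second moments. Finiteness of the full moment makes
  \<open>t\<close> Cauchy, and closedness of the graph puts \<open>u\<close> into the
  domain.\<close>

lemma E_integrable_domain:
  assumes int: "integrable (interval_measure (\<lambda>l. E l u \<bullet> u)) (\<lambda>s. s\<^sup>2)"
  shows "u \<in> Domain A"
proof -
  let ?M = "interval_measure (\<lambda>l. E l u \<bullet> u)"
  define p where "p n = E (real n) u - E (- real n) u" for n
  have "\<exists>v. (p n, v) \<in> A" for n
    unfolding p_def using band_domain[OF band_projection[of "- real n" "real n"]] by simp
  then obtain t where t: "\<And>n. (p n, t n) \<in> A" by metis
  have I: "(\<integral>s. indicator {- real n<..real n} s * s\<^sup>2 \<partial>?M) = t n \<bullet> t n" for n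
    by (rule band_integrals(2)) (use t[of n] in \<open>simp_all add: p_def\<close>)
  have "(\<lambda>n. \<integral>s. indicator {- real n<..real n} s * s\<^sup>2 \<partial>?M) \<longlonglongrightarrow> (\<integral>s. s\<^sup>2 \<partial>?M)"
  proof (rule integral_dominated_convergence[OF _ _ int])
    show "AE s in ?M. (\<lambda>n. indicator {- real n<..real n} s * s\<^sup>2) \<longlonglongrightarrow> s\<^sup>2"
      by (rule AE_I2) (rule indicator_symmetric_Ioc_tendsto)
    show "AE s in ?M. norm (indicator {- real n<..real n} s * s\<^sup>2) \<le> s\<^sup>2" for n
      by (intro AE_I2) (auto simp: indicator_def)
  qed auto
  then have "Cauchy (\<lambda>n. t n \<bullet> t n)" unfolding I by (rule LIMSEQ_imp_Cauchy)
  have diff: "(norm (t n - t m))\<^sup>2 = t n \<bullet> t n - t m \<bullet> t m" if "m \<le> n" for m n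
  proof -
    have "E (real m) (p n) - E (- real m) (p n) = p m"
      using that by (simp add: p_def E_simps E_min min_def)
    then have tm: "E (real m) (t n) - E (- real m) (t n) = t m"
      using selfadjoint_rel_functional[OF A _ t[of m]] selfadjoint_rel_diff[OF A EA[OF t[of n]] EA[OF t[of n]]] by metis
    have b: "E (real m) (t m) = t m" "E (- real m) (t m) = 0"
      unfolding tm[symmetric] using band_projection[of "- real m" "real m"] by auto
    have "t m \<bullet> t n = t m \<bullet> (E (real m) (t n) - E (- real m) (t n))"
      using b by (simp add: inner_diff_right E_inner[symmetric])
    then have "t m \<bullet> t n = t m \<bullet> t m" unfolding tm .
    then show ?thesis by (simp add: power2_norm_eq_inner inner_diff_left inner_diff_right inner_commute)
  qed
  have "Cauchy t"
  proof (rule metric_CauchyI)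
    fix e :: real assume e: "e > 0"
    then have "e\<^sup>2 > 0" by simp
    then obtain N where N: "\<And>m n. m \<ge> N \<Longrightarrow> n \<ge> N \<Longrightarrow> dist (t m \<bullet> t m) (t n \<bullet> t n) < e\<^sup>2"
      using \<open>Cauchy (\<lambda>n. t n \<bullet> t n)\<close> unfolding Cauchy_def by metis
    have lt: "dist (t m) (t n) < e" if "m \<ge> N" "n \<ge> N" "n \<le> m" for m n
    proof -
      have "(norm (t m - t n))\<^sup>2 < e\<^sup>2" using diff[OF that(3)] N[OF that(1,2)] by (simp add: dist_real_def)
      then show ?thesis using e by (simp add: dist_norm power2_less_imp_less)
    qed
    then have "dist (t m) (t n) < e" if "m \<ge> N" "n \<ge> N" for m n
      using that lt[of m n] lt[of n m] by (cases "n \<le> m") (auto simp: dist_commute)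
    then show "\<exists>N. \<forall>m\<ge>N. \<forall>n\<ge>N. dist (t m) (t n) < e" by blast
  qed
  then obtain v where "t \<longlonglongrightarrow> v" using Cauchy_convergent convergent_def by blast
  moreover have "p \<longlonglongrightarrow> u" unfolding p_def by (rule E_real_seq)
  ultimately have "(u, v) \<in> A" using selfadjoint_rel_limit[where u=p and v=t, OF A t] by blast
  then show ?thesis by blast
qed

lemma E_spectral_resolution: "spectral_resolution A E"
  unfolding spectral_resolution_def using E_resolution E_domain_integral E_integrable_domain by auto

end

text \<open>\<open>E l\<close> is the negative projection of \<open>A - l\<close>. These commute
  because each preserves the graph of \<open>A\<close>, hence that of every shift, and a negative
  projection commutes with all symmetric contractions preserving the graph.\<close>

theorem spectral_resolution_exists:
  fixes A :: "('h::{real_inner,complete_space} \<times> 'h) set"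
  assumes A: "selfadjoint_rel A"
  shows "\<exists>E. spectral_resolution A E"
proof -
  define G where "G l = {(u, v - l *\<^sub>R u) | u v. (u, v) \<in> A}" for l :: real
  have GA: "(u, v - l *\<^sub>R u) \<in> G l \<longleftrightarrow> (u, v) \<in> A" for u v l by (auto simp: G_def)
  have GE: "\<exists>v. p = (u, v - l *\<^sub>R u) \<and> (u, v) \<in> A" if "p \<in> G l" "u = fst p" for p u l
    using that by (auto simp: G_def)
  define R where "R l E \<longleftrightarrow> projection_op E \<and>
      (\<forall>S u. contractive S \<longrightarrow> symmetric_op S \<longrightarrow> (\<forall>(u, v)\<in>G l. (S u, S v) \<in> G l) \<longrightarrow> S (E u) = E (S u)) \<and>
      (\<forall>(u, v)\<in>G l. (E u, E v) \<in> G l) \<and> (\<forall>(u, v)\<in>G l. E u = u \<longrightarrow> v \<bullet> u \<le> 0) \<and>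
      (\<forall>(u, v)\<in>G l. E u = 0 \<longrightarrow> u \<noteq> 0 \<longrightarrow> v \<bullet> u > 0)" for l E
  have "\<exists>E. R l E" for l
  proof -
    obtain E where E: "projection_op E"
      "\<forall>S u. contractive S \<longrightarrow> symmetric_op S \<longrightarrow> (\<forall>(u, v)\<in>G l. (S u, S v) \<in> G l) \<longrightarrow> S (E u) = E (S u)"
      "\<And>u v. (u, v) \<in> G l \<Longrightarrow> (E u, E v) \<in> G l" "\<And>u v. (u, v) \<in> G l \<Longrightarrow> E u = u \<Longrightarrow> v \<bullet> u \<le> 0"
      "\<And>u v. (u, v) \<in> G l \<Longrightarrow> E u = 0 \<Longrightarrow> u \<noteq> 0 \<Longrightarrow> v \<bullet> u > 0"
      by (rule selfadjoint_rel_negative_projection[OF selfadjoint_rel_shift[OF A, of l], folded G_def]) (rule that)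
    show ?thesis unfolding R_def by (intro exI[of _ E] conjI E(1,2)) (use E(3-) in auto)
  qed
  then obtain E where R: "\<And>l. R l (E l)" by metis
  note R' = R[unfolded R_def]
  note P = R'[THEN conjunct1] and S = R'[THEN conjunct2, THEN conjunct1]
    and EG = R'[THEN conjunct2, THEN conjunct2, THEN conjunct1]
    and neg = R'[THEN conjunct2, THEN conjunct2, THEN conjunct2, THEN conjunct1]
    and pos = R'[THEN conjunct2, THEN conjunct2, THEN conjunct2, THEN conjunct2]
  have lin: "linear (E l)" for l using P by (rule projection_op_linear)
  have E_shift: "E l (v - m *\<^sub>R u) = E l v - m *\<^sub>R E l u" for l m u v
    by (simp add: linear_diff[OF lin] linear_scale[OF lin])
  have EA: "(E l u, E l v) \<in> A" if "(u, v) \<in> A" for l u v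
  proof -
    have "(E l u, E l (v - l *\<^sub>R u)) \<in> G l" using EG[of l] that GA[of u v l] by blast
    then show ?thesis unfolding E_shift GA .
  qed
  have com: "E l (E m u) = E m (E l u)" for l m u
  proof -
    have "\<forall>(u, v)\<in>G m. (E l u, E l v) \<in> G m"
    proof clarify
      fix a b assume "(a, b) \<in> G m"
      then obtain v where v: "b = v - m *\<^sub>R a" "(a, v) \<in> A" by (auto simp: G_def)
      then show "(E l a, E l b) \<in> G m" unfolding v(1) E_shift GA by (intro EA)
    qed
    moreover have "symmetric_op (E l)" using P by (simp add: projection_op_def)
    ultimately show ?thesis using S[of m] projection_op_contractive[OF P[of l]] by blast
  qed
  have "v \<bullet> u \<le> l * (u \<bullet> u)" if "(u, v) \<in> A" "E l u = u" for l u v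
    using neg[of l] that GA[of u v l] by (fastforce simp: inner_diff_left)
  moreover have "v \<bullet> u > l * (u \<bullet> u)" if "(u, v) \<in> A" "E l u = 0" "u \<noteq> 0" for l u v
    using pos[of l] that GA[of u v l] by (fastforce simp: inner_diff_left)
  ultimately show ?thesis using E_spectral_resolution[where A=A and E=E, OF A P EA com] by blast
qed

section \<open>Friedrichs extensions and variational bounds\<close>

lemma subspace_closure:
  fixes G :: "'a::real_normed_vector set"
  assumes G: "subspace G" shows "subspace (closure G)"
  unfolding subspace_def
proof (intro conjI ballI allI)
  show "0 \<in> closure G" using subspace_0[OF G] closure_subset by blast
next
  fix x y assume "x \<in> closure G" "y \<in> closure G"
  then obtain f g where "\<And>n. f n \<in> G" "f \<longlonglongrightarrow> x" "\<And>n. g n \<in> G" "g \<longlonglongrightarrow> y"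
    unfolding closure_sequential by blast
  then show "x + y \<in> closure G"
    unfolding closure_sequential using subspace_add[OF G] by (intro exI[of _ "\<lambda>n. f n + g n"]) (auto intro: tendsto_add)
next
  fix c x assume "x \<in> closure G"
  then obtain f where "\<And>n. f n \<in> G" "f \<longlonglongrightarrow> x" unfolding closure_sequential by blast
  then show "c *\<^sub>R x \<in> closure G"
    unfolding closure_sequential using subspace_mul[OF G]
    by (intro exI[of _ "\<lambda>n. c *\<^sub>R f n"]) (auto intro: tendsto_scaleR)
qed

text \<open>Friedrichs extension: the closure of the graph of \<open>D\<close> is a closed subspace of \<open>H \<times> K\<close>, and the
  resolvent of the extension is the compression of the projection onto it.\<close>

theorem friedrichs_extension:
  fixes S :: "('h::{real_inner,complete_space} \<times> 'h) set"
    and D :: "'h \<Rightarrow> 'k::{real_inner,complete_space}"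
  assumes dense: "\<And>u e. e > 0 \<Longrightarrow> \<exists>f\<in>Domain S. norm (u - f) < e"
    and sub: "subspace (Domain S)"
    and D_add: "\<And>u v. u \<in> Domain S \<Longrightarrow> v \<in> Domain S \<Longrightarrow> D (u + v) = D u + D v"
    and D_scale: "\<And>c u. u \<in> Domain S \<Longrightarrow> D (c *\<^sub>R u) = c *\<^sub>R D u"
    and form: "\<And>u v w. (u, v) \<in> S \<Longrightarrow> w \<in> Domain S \<Longrightarrow> v \<bullet> w = D u \<bullet> D w"
  shows "\<exists>A. S \<subseteq> A \<and> selfadjoint_rel A"
proof -
  define G where "G = (\<lambda>u. (u, D u)) ` Domain S"
  have G: "subspace G"
    unfolding subspace_def
  proof (intro conjI ballI allI)
    have "D (0 *\<^sub>R 0) = 0 *\<^sub>R D 0" by (rule D_scale) (rule subspace_0[OF sub])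
    then have "D 0 = 0" by simp
    then show "0 \<in> G" unfolding G_def using subspace_0[OF sub] by (force simp: zero_prod_def)
    show "x + y \<in> G" if "x \<in> G" "y \<in> G" for x y
      using that subspace_add[OF sub] D_add unfolding G_def by (force simp: image_iff)
    show "c *\<^sub>R x \<in> G" if "x \<in> G" for c x
      using that subspace_mul[OF sub] D_scale unfolding G_def by (force simp: image_iff)
  qed
  define M where "M = closure G"
  have M: "subspace M" "closed M" unfolding M_def using G by (simp_all add: subspace_closure)
  have GM: "(u, D u) \<in> M" if "u \<in> Domain S" for u
    using closure_subset[of G] that by (auto simp: M_def G_def)
  obtain P where P: "projection_op P" and PM: "\<And>x. P x \<in> M" and Po: "\<And>x z. z \<in> M \<Longrightarrow> (x - P x) \<bullet> z = 0"
    and Pu: "\<And>x y. y \<in> M \<Longrightarrow> (\<And>z. z \<in> M \<Longrightarrow> (x - y) \<bullet> z = 0) \<Longrightarrow> P x = y"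
    using projection_onto_closed_subspace[OF M] by metis
  have linP: "linear P" and Ps: "P x \<bullet> y = x \<bullet> P y" for x y
    using P unfolding projection_op_def symmetric_op_def by blast+
  have Morth: "x \<bullet> z = 0" if "z \<in> M" and x: "\<And>u. u \<in> Domain S \<Longrightarrow> x \<bullet> (u, D u) = 0" for x z
  proof -
    have "closed {z. x \<bullet> z = 0}" by (rule closed_hyperplane)
    moreover have "G \<subseteq> {z. x \<bullet> z = 0}" using x by (auto simp: G_def)
    ultimately have "M \<subseteq> {z. x \<bullet> z = 0}" unfolding M_def by (rule closure_minimal[rotated])
    then show ?thesis using that by auto
  qed
  define R where "R f = fst (P (f, 0))" for f
  have R_sym: "R f \<bullet> g = f \<bullet> R g" for f g
  proof -
    have "P (x, 0) \<bullet> (y, 0) = R x \<bullet> y" for x y by (cases "P (x, 0)") (simp add: R_def)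
    then show ?thesis using Ps[of "(f, 0)" "(g, 0)"] by (metis inner_commute)
  qed
  \<comment> \<open>The hypothesis \<open>form\<close> says that
    \<open>(u + v, 0) - (u, D u)\<close> is orthogonal to the graph of \<open>D\<close>.\<close>
  have R_S: "R (u + v) = u" if uv: "(u, v) \<in> S" for u v
  proof -
    have "P (u + v, 0) = (u, D u)"
    proof (rule Pu)
      show "(u, D u) \<in> M" using GM uv by blast
      show "((u + v, 0) - (u, D u)) \<bullet> z = 0" if z: "z \<in> M" for z
        by (rule Morth[OF z]) (simp add: form[OF uv])
    qed
    then show ?thesis by (simp add: R_def)
  qed
  \<comment> \<open>\<open>R\<close> plays the role of \<open>(1 + A)\<inverse>\<close>, so the
    graph is read off from it. Symmetry of \<open>R\<close> on the whole space makes this relation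
    equal to its adjoint.\<close>
  define A where "A = range (\<lambda>f. (R f, f - R f))"
  have SA: "S \<subseteq> A"
  proof clarify
    fix u v assume "(u, v) \<in> S"
    from R_S[OF this] show "(u, v) \<in> A" unfolding A_def by (intro image_eqI[of _ _ "u + v"]) auto
  qed
  have "A = adjoint_rel A"
  proof
    have "(g - R g) \<bullet> R f = R g \<bullet> (f - R f)" for f g
      unfolding inner_diff_left inner_diff_right using R_sym[of g f] by simp
    then show "A \<subseteq> adjoint_rel A"
      unfolding A_def adjoint_rel_def by auto
    show "adjoint_rel A \<subseteq> A"
    proof clarify
      fix p q assume pq: "(p, q) \<in> adjoint_rel A"
      have "f \<bullet> p = f \<bullet> R (p + q)" for f
      proof -
        have "(f - R f) \<bullet> p = R f \<bullet> q" using pq unfolding A_def adjoint_rel_def by blast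
        then have "f \<bullet> p = R f \<bullet> (p + q)" by (simp add: inner_diff_left inner_add_right)
        then show ?thesis by (simp add: R_sym)
      qed
      then have "p = R (p + q)" by (metis vector_eq_ldot)
      then show "(p, q) \<in> A" unfolding A_def by (intro image_eqI[of _ _ "p + q"]) auto
    qed
  qed
  moreover have "\<exists>f\<in>Domain A. norm (u - f) < e" if "e > 0" for u e
    using dense[OF that] SA by blast
  ultimately show ?thesis using SA unfolding selfadjoint_rel_def by blast
qed

section \<open>Variational consequences of a spectral resolution\<close>

lemma spectral_resolution_cdf:
  assumes R: "projection_resolution E"
  shows "measure (interval_measure (\<lambda>l. E l u \<bullet> u)) {..a} = E a u \<bullet> u"
proof -
  let ?M = "interval_measure (\<lambda>l. E l u \<bullet> u)"
  interpret finite_measure ?M by (rule projection_resolution_finite[OF R])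
  have "(\<lambda>n. measure ?M {a - real n<..a}) \<longlonglongrightarrow> measure ?M (\<Union>n. {a - real n<..a})"
    by (rule finite_Lim_measure_incseq) (auto simp: incseq_def)
  also have "(\<Union>n. {a - real n<..a}) = {..a}"
  proof -
    have "\<exists>n. a - real n < x" for x using reals_Archimedean2[of "a - x"] by (auto simp: algebra_simps)
    then show ?thesis by auto
  qed
  finally have 1: "(\<lambda>n. E a u \<bullet> u - E (a - real n) u \<bullet> u) \<longlonglongrightarrow> measure ?M {..a}"
    by (simp add: projection_resolution_Ioc_measure[OF R])
  have "((\<lambda>l. norm (E l u)) \<longlongrightarrow> 0) at_bot" using R by (auto simp: projection_resolution_def)
  then have "((\<lambda>l. E l u) \<longlongrightarrow> 0) at_bot" by (rule tendsto_norm_zero_cancel)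
  moreover have "LIM n sequentially. a - real n :> at_bot"
    unfolding filterlim_at_bot
  proof
    fix Z
    obtain N :: nat where N: "a - Z \<le> real N" using real_arch_simple by blast
    show "\<forall>\<^sub>F n in sequentially. a - real n \<le> Z" by (rule eventually_sequentiallyI[of N]) (use N in simp)
  qed
  ultimately have "(\<lambda>n. E (a - real n) u) \<longlonglongrightarrow> 0" by (rule filterlim_compose)
  then have "(\<lambda>n. E a u \<bullet> u - E (a - real n) u \<bullet> u) \<longlonglongrightarrow> E a u \<bullet> u - 0 \<bullet> u" by (intro tendsto_intros)
  with 1 show ?thesis using LIMSEQ_unique by fastforce
qed

lemma spectral_resolution_total:
  assumes R: "projection_resolution E"
  shows "measure (interval_measure (\<lambda>l. E l u \<bullet> u)) UNIV = u \<bullet> u"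
proof -
  let ?M = "interval_measure (\<lambda>l. E l u \<bullet> u)"
  interpret finite_measure ?M by (rule projection_resolution_finite[OF R])
  have "(\<lambda>n. measure ?M {..real n}) \<longlonglongrightarrow> measure ?M (\<Union>n. {..real n})"
    by (rule finite_Lim_measure_incseq) (auto simp: incseq_def)
  also have "(\<Union>n. {..real n}) = UNIV" using real_arch_simple by auto
  finally have 1: "(\<lambda>n. E (real n) u \<bullet> u) \<longlonglongrightarrow> measure ?M UNIV"
    by (simp add: spectral_resolution_cdf[OF R])
  have "((\<lambda>l. norm (E l u - u)) \<longlongrightarrow> 0) at_top" using R by (auto simp: projection_resolution_def)
  then have "((\<lambda>l. E l u) \<longlongrightarrow> u) at_top" by (rule LIM_zero_cancel[OF tendsto_norm_zero_cancel])
  then have "(\<lambda>n. E (real n) u) \<longlonglongrightarrow> u" by (rule filterlim_compose[OF _ filterlim_real_sequentially])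
  then have "(\<lambda>n. E (real n) u \<bullet> u) \<longlonglongrightarrow> u \<bullet> u" by (intro tendsto_intros)
  with 1 show ?thesis using LIMSEQ_unique by blast
qed

text \<open>The spectral measure of \<open>u\<close> lives on \<open>{a<..}\<close>, where
  \<open>s\<close> dominates the step function equal to \<open>a\<close> up to \<open>l\<close> and
  to \<open>l\<close> beyond. The resulting bound is continuous in \<open>u\<close>, so it survives
  limits of trial vectors.\<close>

lemma spectral_form_lower_bound:
  assumes S: "spectral_resolution A E" and uv: "(u, v) \<in> A" and a: "E a u = 0" and al: "a \<le> l"
  shows "l * (u \<bullet> u) + (a - l) * (E l u \<bullet> u) \<le> v \<bullet> u"
proof -
  let ?M = "interval_measure (\<lambda>l. E l u \<bullet> u)"
  have R: "projection_resolution E" and sq: "integrable ?M (\<lambda>s. s\<^sup>2)" and q: "v \<bullet> u = (\<integral>s. s \<partial>?M)"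
    using S uv unfolding spectral_resolution_def by auto
  interpret finite_measure ?M by (rule projection_resolution_finite[OF R])
  have int: "integrable ?M (\<lambda>s. s)"
  proof (rule Bochner_Integration.integrable_bound[of _ "\<lambda>s. 1 + s\<^sup>2"])
    show "integrable ?M (\<lambda>s. 1 + s\<^sup>2)" using sq by simp
    have "\<bar>s\<bar> \<le> 1 + s\<^sup>2" for s :: real using zero_le_power2[of "\<bar>s\<bar> - 1"] by (simp add: power2_eq_square algebra_simps)
    then show "AE s in ?M. norm s \<le> norm (1 + s\<^sup>2)" by (intro AE_I2) simp
  qed simp
  have "emeasure ?M {..a} = 0" using spectral_resolution_cdf[OF R, of u a] a by (simp add: emeasure_eq_measure)
  then have ae: "AE s in ?M. s \<notin> {..a}" by (intro AE_not_in) (auto simp: null_sets_def)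
  have "(\<integral>s. l + (a - l) * indicator {..l} s \<partial>?M) \<le> (\<integral>s. s \<partial>?M)"
  proof (rule integral_mono_AE)
    show "AE s in ?M. l + (a - l) * indicator {..l} s \<le> s"
      using ae by eventually_elim (use al in \<open>auto simp: indicator_def\<close>)
  qed (use int in \<open>auto simp: less_top[symmetric]\<close>)
  moreover have "(\<integral>s. l + (a - l) * indicator {..l} s \<partial>?M) = l * (u \<bullet> u) + (a - l) * (E l u \<bullet> u)"
    by (subst Bochner_Integration.integral_add) (auto simp: less_top[symmetric] spectral_resolution_cdf[OF R] spectral_resolution_total[OF R])
  ultimately show ?thesis using q by simp
qed

text \<open>Strong convergence of \<open>E a\<close> to 0 at \<open>- \<infinity>\<close> is uniform
  on a finite-dimensional range, and a projection of norm below 1 is zero. A finite-rank spectral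
  projection thus bounds the spectrum from below.\<close>

lemma finite_rank_projection_vanishes:
  assumes R: "projection_resolution E" and B: "finite B" and ran: "range (E l) \<subseteq> span B"
  shows "\<exists>a\<le>l. \<forall>u. E a u = 0"
proof -
  obtain C where C: "finite C" "span C = span B" "pairwise orthogonal C"
    using basis_orthogonal[OF B] by metis
  have P: "projection_op (E a)" and EE: "E a (E b u) = E (min a b) u" for a b u
    using R by (auto simp: projection_resolution_def)
  \<comment> \<open>Dividing by \<open>norm c\<close> matches the bound
    \<open>norm v / norm c\<close> on the coefficient of \<open>c\<close> in an orthogonal expansion
    of \<open>v\<close>. A zero vector in \<open>C\<close> contributes 0.\<close>
  have bot: "((\<lambda>a. \<Sum>c\<in>C. norm (E a c) / norm c) \<longlongrightarrow> (\<Sum>c\<in>C. 0 / norm c)) at_bot"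
    unfolding divide_inverse using R by (intro tendsto_intros) (auto simp: projection_resolution_def)
  then have "\<forall>\<^sub>F a in at_bot. (\<Sum>c\<in>C. norm (E a c) / norm c) < 1"
    by (rule order_tendstoD) simp
  then have "\<forall>\<^sub>F a in at_bot. (\<Sum>c\<in>C. norm (E a c) / norm c) < 1 \<and> a \<le> l"
    using eventually_le_at_bot by (rule eventually_conj)
  then obtain a where a: "(\<Sum>c\<in>C. norm (E a c) / norm c) < 1" "a \<le> l"
    using eventually_happens'[OF trivial_limit_at_bot_linorder] by blast
  have "E a u = 0" for u
  proof (rule ccontr)
    let ?v = "E a u"
    assume v0: "?v \<noteq> 0"
    have lin: "linear (E a)" using P by (rule projection_op_linear)
    have "?v = E l ?v" using a(2) by (simp add: EE min_def)
    then have "?v \<in> span C" using ran C(2) by auto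
    then obtain r where r: "?v = (\<Sum>c\<in>C. r c *\<^sub>R c)" using span_finite[OF C(1)] by auto
    have le: "\<bar>r c\<bar> * norm (E a c) \<le> norm ?v * (norm (E a c) / norm c)" if c: "c \<in> C" for c
    proof (cases "c = 0")
      case True
      then show ?thesis by (simp add: linear_0[OF lin])
    next
      case False
      have "?v \<bullet> c = (\<Sum>d\<in>C. r d * (d \<bullet> c))" unfolding r inner_sum_left by simp
      also have "\<dots> = (\<Sum>d\<in>{c}. r d * (d \<bullet> c))"
        using C(1,3) c by (intro sum.mono_neutral_right) (auto simp: pairwise_def orthogonal_def)
      finally have "r c * (norm c)\<^sup>2 = ?v \<bullet> c" by (simp add: power2_norm_eq_inner)
      then have "\<bar>r c\<bar> * (norm c)\<^sup>2 = \<bar>?v \<bullet> c\<bar>" by (metis abs_mult abs_power2)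
      also have "\<dots> \<le> norm ?v * norm c" by (rule Cauchy_Schwarz_ineq2)
      finally have "\<bar>r c\<bar> * norm c \<le> norm ?v" using False by (simp add: power2_eq_square)
      then have "\<bar>r c\<bar> \<le> norm ?v / norm c" using False by (simp add: pos_le_divide_eq)
      then have "\<bar>r c\<bar> * norm (E a c) \<le> norm ?v / norm c * norm (E a c)" by (rule mult_right_mono) simp
      then show ?thesis by simp
    qed
    have "?v = E a ?v" by (simp add: EE)
    also have "\<dots> = (\<Sum>c\<in>C. r c *\<^sub>R E a c)"
      using arg_cong[OF r, of "E a"] by (simp add: linear_sum[OF lin] linear_scale[OF lin])
    finally have "norm ?v \<le> (\<Sum>c\<in>C. \<bar>r c\<bar> * norm (E a c))" by (metis (no_types, lifting) norm_scaleR norm_sum sum.cong)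
    also have "\<dots> \<le> (\<Sum>c\<in>C. norm ?v * (norm (E a c) / norm c))" using le by (rule sum_mono)
    also have "\<dots> = norm ?v * (\<Sum>c\<in>C. norm (E a c) / norm c)" by (simp add: sum_distrib_left)
    also have "\<dots> < norm ?v * 1" using a(1) v0 by (intro mult_strict_left_mono) auto
    finally show False by simp
  qed
  then show ?thesis using a(2) by blast
qed

text \<open>Upper half of the min-max principle, for trial vectors in the closure of the form domain.\<close>

lemma rayleigh_upper_bound:
  assumes S: "spectral_resolution A E" and B: "finite B" and ran: "range (E l) \<subseteq> span B"
    and f: "E l f = 0" "f \<noteq> 0" and uv: "\<And>n. (u n, v n) \<in> A" and lim: "u \<longlonglongrightarrow> f"
    and q: "(\<lambda>n. v n \<bullet> u n) \<longlonglongrightarrow> c" and c: "c \<le> L * (f \<bullet> f)"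
  shows "l \<le> L"
proof -
  have R: "projection_resolution E" using S by (simp add: spectral_resolution_def)
  obtain a where a: "a \<le> l" "\<And>u. E a u = 0" using finite_rank_projection_vanishes[OF R B ran] by blast
  \<comment> \<open>The component \<open>E l (u n)\<close> need not vanish, only tend to 0; the
    lower cutoff \<open>a\<close> controls what it contributes to the form.\<close>
  have "(\<lambda>n. E l (u n)) \<longlonglongrightarrow> E l f"
    using R by (intro bounded_linear.tendsto[OF contractive_bounded_linear lim] projection_op_contractive)
      (simp add: projection_resolution_def)
  then have "(\<lambda>n. l * (u n \<bullet> u n) + (a - l) * (E l (u n) \<bullet> u n)) \<longlonglongrightarrow> l * (f \<bullet> f) + (a - l) * (E l f \<bullet> f)"
    by (intro tendsto_intros lim)
  then have "l * (f \<bullet> f) + (a - l) * (E l f \<bullet> f) \<le> c"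
    by (rule LIMSEQ_le[OF _ q]) (use spectral_form_lower_bound[OF S uv a(2) a(1)] in blast)
  then have "l * (f \<bullet> f) \<le> L * (f \<bullet> f)" using c f(1) by simp
  then show ?thesis using f(2) by simp
qed

text \<open>A spectral resolution is specified by domains and quadratic forms only, so commutation
  with \<open>A\<close> has to be replaced. Split \<open>h\<close> into \<open>u = E m h\<close> and
  the rest \<open>w\<close>, with \<open>(u, v)\<close> in \<open>A\<close>. Additivity of the form
  over the split together with symmetry yields \<open>v \<bullet> w = 0\<close>, so the form of
  \<open>u\<close> is \<open>lam * (u \<bullet> u)\<close>. It is also at most
  \<open>m * (u \<bullet> u)\<close>, because the measure of \<open>u\<close> sits on
  \<open>{..m}\<close>.\<close>

lemma eigenvector_spectral_projection_zero:
  assumes A: "selfadjoint_rel A" and S: "spectral_resolution A E"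
    and h: "(h, lam *\<^sub>R h) \<in> A" and m: "m < lam"
  shows "E m h = 0"
proof -
  have R: "projection_resolution E" using S by (simp add: spectral_resolution_def)
  have P: "projection_op (E a)" and EE: "E a (E b u) = E (min a b) u" for a b u
    using R by (auto simp: projection_resolution_def)
  have lin: "linear (E a)" for a using P by (rule projection_op_linear)
  have Es: "E a u \<bullet> v = u \<bullet> E a v" for a u v using P by (simp add: projection_op_def symmetric_op_def)
  let ?M = "\<lambda>u. interval_measure (\<lambda>l. E l u \<bullet> u)"
  define u w where "u = E m h" and "w = h - E m h"
  have hD: "integrable (?M h) (\<lambda>s. s\<^sup>2)" and hq: "(\<integral>s. s \<partial>?M h) = lam * (h \<bullet> h)"
    using S h unfolding spectral_resolution_def by auto
  have Fu: "E s u \<bullet> u = E (min s m) h \<bullet> h" for s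
  proof -
    have "E s u \<bullet> u = E (min s m) h \<bullet> E m h" by (simp add: u_def EE)
    also have "\<dots> = E m (E (min s m) h) \<bullet> h" by (simp add: Es)
    finally show ?thesis by (simp add: EE min.commute min.left_commute)
  qed
  have Fw: "E s w \<bullet> w = E s h \<bullet> h - E (min s m) h \<bullet> h" for s
  proof -
    have "E s w = E s h - E (min s m) h" by (simp add: w_def linear_diff[OF lin] EE)
    moreover have "E s h \<bullet> E m h = E m (E s h) \<bullet> h" "E (min s m) h \<bullet> E m h = E m (E (min s m) h) \<bullet> h"
      by (simp_all only: Es)
    then have "E s h \<bullet> E m h = E (min s m) h \<bullet> h" "E (min s m) h \<bullet> E m h = E (min s m) h \<bullet> h"
      by (simp_all add: EE min.commute min.left_commute)
    ultimately show ?thesis by (simp add: w_def inner_diff_left inner_diff_right)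
  qed
  interpret h: finite_measure "?M h" by (rule projection_resolution_finite[OF R])
  \<comment> \<open>The spectral measures of \<open>u\<close> and \<open>w\<close> turn out to be
    restrictions of that of \<open>h\<close>; agreement on half-open intervals suffices.\<close>
  have density: "interval_measure G = density (?M h) (indicator T)"
    if T: "T \<in> sets borel" and G: "\<And>x y. x \<le> y \<Longrightarrow> emeasure (interval_measure G) {x<..y} = emeasure (?M h) ({x<..y} \<inter> T)" for G T
  proof (rule measure_eqI_generator_eq[where E="range (\<lambda>(a, b). {a<..b::real})" and \<Omega>=UNIV and A="\<lambda>n. {- real n<..real n}"])
    have "{a<..b} \<inter> {c<..d} \<in> range (\<lambda>(a, b). {a<..b::real})" for a b c d
      by (rule image_eqI[of _ _ "(max a c, min b d)"]) auto
    then show "Int_stable (range (\<lambda>(a, b). {a<..b::real}))" by (intro Int_stableI) auto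
    show "sets (interval_measure G) = sigma_sets UNIV (range (\<lambda>(a, b). {a<..b::real}))"
      by (simp add: borel_sigma_sets_Ioc)
    show "sets (density (?M h) (indicator T)) = sigma_sets UNIV (range (\<lambda>(a, b). {a<..b::real}))"
      by (simp add: borel_sigma_sets_Ioc)
    have eq: "emeasure (density (?M h) (indicator T)) X = emeasure (?M h) (X \<inter> T)" if "X \<in> sets borel" for X
      using that T by (simp add: emeasure_density Int_commute flip: indicator_inter_arith)
    fix X assume "X \<in> range (\<lambda>(a, b). {a<..b::real})"
    then obtain a b where X: "X = {a<..b}" by auto
    show "emeasure (interval_measure G) X = emeasure (density (?M h) (indicator T)) X"
      by (cases "a \<le> b") (simp_all add: X eq G)
  next
    show "emeasure (interval_measure G) {- real n<..real n} \<noteq> \<infinity>" for n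
      by (subst G) auto
  qed (auto simp: UN_symmetric_Ioc)
  have du: "?M u = density (?M h) (indicator {..m})"
  proof (rule density)
    fix x y :: real assume xy: "x \<le> y"
    have "{x<..y} \<inter> {..m} = {min x m<..min y m}" by auto
    then show "emeasure (?M u) {x<..y} = emeasure (?M h) ({x<..y} \<inter> {..m})"
      using projection_resolution_Ioc[OF R xy, of u] projection_resolution_Ioc[OF R, of "min x m" "min y m" h] xy
      by (simp add: Fu min.coboundedI1)
  qed simp
  have dw: "?M w = density (?M h) (indicator {m<..})"
  proof (rule density)
    fix x y :: real assume xy: "x \<le> y"
    have "{x<..y} \<inter> {m<..} = {max x m<..max y m}" by auto
    moreover have "E (max a m) h \<bullet> h = E a w \<bullet> w + E m h \<bullet> h" for a
      by (simp add: Fw max_def min_def)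
    moreover have "max x m \<le> max y m" using xy by simp
    ultimately show "emeasure (?M w) {x<..y} = emeasure (?M h) ({x<..y} \<inter> {m<..})"
      using projection_resolution_Ioc[OF R xy, of w] projection_resolution_Ioc[OF R, of "max x m" "max y m" h]
      by simp
  qed simp
  have bd: "\<bar>s\<bar> \<le> 1 + s\<^sup>2" for s :: real using zero_le_power2[of "\<bar>s\<bar> - 1"] by (simp add: power2_eq_square algebra_simps)
  have h1: "integrable (?M h) (\<lambda>s. s)"
    by (rule Bochner_Integration.integrable_bound[of _ "\<lambda>s. 1 + s\<^sup>2"]) (use hD bd in auto)
  have ind: "(indicator T s :: ennreal) = ennreal (indicator T s)" for T and s :: real by (simp add: indicator_def)
  have int_u: "integrable (?M u) g \<longleftrightarrow> integrable (?M h) (\<lambda>s. indicator {..m} s * g s)"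
    and eq_u: "(\<integral>s. g s \<partial>?M u) = (\<integral>s. indicator {..m} s * g s \<partial>?M h)"
    and eq_w: "(\<integral>s. g s \<partial>?M w) = (\<integral>s. indicator {m<..} s * g s \<partial>?M h)"
    if "g \<in> borel_measurable borel" for g :: "real \<Rightarrow> real"
    unfolding du dw ind using that
    by (subst integrable_density integral_density; simp)+
  have restr: "integrable (?M h) (\<lambda>s. indicator T s * g s)" if "integrable (?M h) g" "T \<in> sets borel" for g :: "real \<Rightarrow> real" and T
    using that by (intro integrable_real_mult_indicator[of T "?M h" g, unfolded mult.commute[of "g _"]]) auto
  have "u \<in> Domain A"
    using S restr[OF hD, of "{..m}"] unfolding spectral_resolution_def by (simp add: int_u)
  then obtain v where uv: "(u, v) \<in> A" by blast
  have wv: "(w, lam *\<^sub>R h - v) \<in> A"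
    unfolding w_def u_def[symmetric] by (rule selfadjoint_rel_diff[OF A h uv])
  have qu: "v \<bullet> u = (\<integral>s. indicator {..m} s * s \<partial>?M h)"
    using S uv unfolding spectral_resolution_def by (auto simp: eq_u)
  have qw: "(lam *\<^sub>R h - v) \<bullet> w = (\<integral>s. indicator {m<..} s * s \<partial>?M h)"
    using S wv unfolding spectral_resolution_def by (auto simp: eq_w)
  have "(\<integral>s. s \<partial>?M h) = (\<integral>s. indicator {..m} s * s + indicator {m<..} s * s \<partial>?M h)"
    by (intro Bochner_Integration.integral_cong) (auto simp: indicator_def)
  also have "\<dots> = v \<bullet> u + (lam *\<^sub>R h - v) \<bullet> w"
    unfolding qu qw by (intro Bochner_Integration.integral_add restr h1) auto
  finally have sum: "lam * (h \<bullet> h) = v \<bullet> u + (lam *\<^sub>R h - v) \<bullet> w" using hq by simp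
  have h_uw: "h = u + w" by (simp add: u_def w_def)
  have sym: "v \<bullet> h = lam * (u \<bullet> h)" using selfadjoint_rel_symmetric[OF A uv h] by simp
  have uw: "u \<bullet> w = 0"
  proof -
    have "u \<bullet> w = h \<bullet> E m w" by (simp add: u_def Es)
    then show ?thesis by (simp add: w_def linear_diff[OF lin] EE)
  qed
  have "v \<bullet> w = 0"
  proof -
    have "v \<bullet> u + (lam *\<^sub>R h - v) \<bullet> w = v \<bullet> u + lam * (w \<bullet> w) - v \<bullet> w"
      using uw by (subst h_uw) (simp add: inner_diff_left inner_add_left)
    moreover have "lam * (h \<bullet> h) = lam * (u \<bullet> u) + lam * (w \<bullet> w)"
      using uw by (subst (1 2) h_uw) (simp add: inner_add_left inner_add_right inner_commute algebra_simps)
    moreover have "v \<bullet> u + v \<bullet> w = lam * (u \<bullet> u)"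
      using sym uw by (simp add: h_uw inner_add_right)
    ultimately show ?thesis using sum by simp
  qed
  then have vu: "v \<bullet> u = lam * (u \<bullet> u)" using sym uw by (simp add: h_uw inner_add_right)
  have "v \<bullet> u \<le> (\<integral>s. indicator {..m} s * m \<partial>?M h)"
    unfolding qu by (intro integral_mono restr h1) (auto simp: indicator_def less_top[symmetric])
  also have "\<dots> = m * (u \<bullet> u)"
  proof -
    have "E m u \<bullet> u = u \<bullet> u" by (simp add: u_def EE)
    then have "E m h \<bullet> h = u \<bullet> u" using Fu[of m] by simp
    then show ?thesis using spectral_resolution_cdf[OF R, of h m] by simp
  qed
  finally have "lam * (u \<bullet> u) \<le> m * (u \<bullet> u)" unfolding vu .
  then have "(lam - m) * (u \<bullet> u) \<le> 0" by (simp add: algebra_simps)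
  then have "u \<bullet> u \<le> 0" using m by (simp add: mult_le_0_iff)
  then have "u \<bullet> u = 0" using inner_ge_zero[of u] by (rule order.antisym)
  then have "u = 0" by simp
  then show ?thesis by (simp add: u_def)
qed

section \<open>The Hilbert space of square-integrable functions\<close>

lemma rep_aefun_measurable [measurable, simp]: "rep_aefun u \<in> borel_measurable borel"
  using Quotient3_rep_reflp[OF Quotient3_aefun, of u] by simp

lemma rep_abs_aefun: "f \<in> borel_measurable borel \<Longrightarrow> AE x in lborel. rep_aefun (abs_aefun f) x = f x"
  using Quotient3_rel[OF Quotient3_aefun, of "rep_aefun (abs_aefun f)" f]
    Quotient3_abs_rep[OF Quotient3_aefun, of "abs_aefun f"] by simp

lemma abs_rep_aefun: "abs_aefun (rep_aefun u) = u"
  by (rule Quotient3_abs_rep[OF Quotient3_aefun])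

lemma abs_aefun_eq_iff:
  "f \<in> borel_measurable borel \<Longrightarrow> g \<in> borel_measurable borel \<Longrightarrow>
    abs_aefun f = abs_aefun g \<longleftrightarrow> (AE x in lborel. f x = g x)"
  using Quotient3_rel[OF Quotient3_aefun, of f g] by simp

lemma aefun_eq_iff: "u = v \<longleftrightarrow> (AE x in lborel. rep_aefun u x = rep_aefun v x)"
  using abs_aefun_eq_iff[of "rep_aefun u" "rep_aefun v"] by (simp add: abs_rep_aefun)

lemma rep_aefun_add: "AE x in lborel. rep_aefun (u + v) x = rep_aefun u x + rep_aefun v x"
  unfolding plus_aefun_def map_fun_apply by (rule rep_abs_aefun) measurable

lemma rep_aefun_scale: "AE x in lborel. rep_aefun (c *\<^sub>R u) x = c * rep_aefun u x"
  unfolding scaleR_aefun_def map_fun_apply id_apply by (rule rep_abs_aefun) measurable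

lemma rep_aefun_zero: "AE x in lborel. rep_aefun (0::'a::euclidean_space aefun) x = 0"
  unfolding zero_aefun_def by (rule rep_abs_aefun) measurable

lemma abs_aefun_add:
  "f \<in> borel_measurable borel \<Longrightarrow> g \<in> borel_measurable borel \<Longrightarrow>
    abs_aefun (\<lambda>x. f x + g x) = abs_aefun f + abs_aefun g"
  using plus_aefun.abs_eq[where xa=f and x=g] by simp

lemma abs_aefun_scale: "f \<in> borel_measurable borel \<Longrightarrow> abs_aefun (\<lambda>x. c * f x) = c *\<^sub>R abs_aefun f"
  using scaleR_aefun.abs_eq[where xa=c and x=f] by simp

lemma integrable_square_add:
  fixes f g :: "'a \<Rightarrow> real"
  assumes [measurable]: "f \<in> borel_measurable M" "g \<in> borel_measurable M"
    and "integrable M (\<lambda>x. (f x)\<^sup>2)" "integrable M (\<lambda>x. (g x)\<^sup>2)"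
  shows "integrable M (\<lambda>x. (f x + g x)\<^sup>2)"
proof (rule Bochner_Integration.integrable_bound[of _ "\<lambda>x. 2 * (f x)\<^sup>2 + 2 * (g x)\<^sup>2"])
  show "integrable M (\<lambda>x. 2 * (f x)\<^sup>2 + 2 * (g x)\<^sup>2)" using assms by simp
  have "(f x + g x)\<^sup>2 \<le> 2 * (f x)\<^sup>2 + 2 * (g x)\<^sup>2" for x
    using zero_le_power2[of "f x - g x"] by (simp add: power2_sum power2_diff)
  then show "AE x in M. norm ((f x + g x)\<^sup>2) \<le> norm (2 * (f x)\<^sup>2 + 2 * (g x)\<^sup>2)" by simp
qed simp

lemma integrable_square_mult:
  fixes f g :: "'a \<Rightarrow> real"
  assumes [measurable]: "f \<in> borel_measurable M" "g \<in> borel_measurable M"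
    and "integrable M (\<lambda>x. (f x)\<^sup>2)" "integrable M (\<lambda>x. (g x)\<^sup>2)"
  shows "integrable M (\<lambda>x. f x * g x)"
proof (rule Bochner_Integration.integrable_bound[of _ "\<lambda>x. (f x)\<^sup>2 + (g x)\<^sup>2"])
  show "integrable M (\<lambda>x. (f x)\<^sup>2 + (g x)\<^sup>2)" using assms by simp
  have "\<bar>f x * g x\<bar> \<le> (f x)\<^sup>2 + (g x)\<^sup>2" for x
  proof -
    have "2 * (\<bar>f x\<bar> * \<bar>g x\<bar>) \<le> (f x)\<^sup>2 + (g x)\<^sup>2"
      using zero_le_power2[of "\<bar>f x\<bar> - \<bar>g x\<bar>"] by (simp add: power2_diff)
    moreover have "0 \<le> \<bar>f x\<bar> * \<bar>g x\<bar>" by simp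
    ultimately show ?thesis unfolding abs_mult by linarith
  qed
  then show "AE x in M. norm (f x * g x) \<le> norm ((f x)\<^sup>2 + (g x)\<^sup>2)" by simp
qed simp

section \<open>The unweighted space of square-integrable functions as a Hilbert space type\<close>

typedef (overloaded) 'a l2 = "{u :: 'a::euclidean_space aefun. integrable lborel (\<lambda>x. (rep_aefun u x)\<^sup>2)}"
proof
  have "integrable lborel (\<lambda>x. (rep_aefun (0::'a aefun) x)\<^sup>2) \<longleftrightarrow> integrable (lborel::'a measure) (\<lambda>x. 0::real)"
    by (rule integrable_cong_AE) (use rep_aefun_zero[where 'a='a] in auto)
  then show "0 \<in> {u :: 'a aefun. integrable lborel (\<lambda>x. (rep_aefun u x)\<^sup>2)}" by simp
qed

lemma integrable_rep_l2: "integrable lborel (\<lambda>x. (rep_aefun (Rep_l2 u) x)\<^sup>2)"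
  using Rep_l2[of u] by simp

definition l2_of :: "('a::euclidean_space \<Rightarrow> real) \<Rightarrow> 'a l2" where
  "l2_of f = Abs_l2 (abs_aefun f)"

definition l2_fun :: "'a::euclidean_space l2 \<Rightarrow> 'a \<Rightarrow> real" where
  "l2_fun u = rep_aefun (Rep_l2 u)"

definition square_integrable :: "('a::euclidean_space \<Rightarrow> real) \<Rightarrow> bool" where
  "square_integrable f \<longleftrightarrow> f \<in> borel_measurable borel \<and> integrable lborel (\<lambda>x. (f x)\<^sup>2)"

lemma l2_fun_measurable [measurable, simp]: "l2_fun u \<in> borel_measurable borel"
  by (simp add: l2_fun_def)

lemma square_integrable_l2_fun [simp]: "square_integrable (l2_fun u)"
  using integrable_rep_l2[of u] by (simp add: square_integrable_def l2_fun_def)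

lemma square_integrable_measurable: "square_integrable f \<Longrightarrow> f \<in> borel_measurable borel"
  by (simp add: square_integrable_def)

lemma integrable_square_cong:
  fixes f g :: "'a::euclidean_space \<Rightarrow> real"
  assumes [measurable]: "f \<in> borel_measurable borel" "g \<in> borel_measurable borel"
    and "AE x in lborel. f x = g x"
  shows "integrable lborel (\<lambda>x. (f x)\<^sup>2) \<longleftrightarrow> integrable lborel (\<lambda>x. (g x)\<^sup>2)"
  by (rule integrable_cong_AE) (use assms(3) in auto)

lemma Rep_l2_of: "square_integrable f \<Longrightarrow> Rep_l2 (l2_of f) = abs_aefun f"
  unfolding l2_of_def square_integrable_def
  using integrable_square_cong[OF rep_aefun_measurable _ rep_abs_aefun, of f]
  by (intro Abs_l2_inverse) auto

lemma l2_fun_of: "square_integrable f \<Longrightarrow> AE x in lborel. l2_fun (l2_of f) x = f x"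
  unfolding l2_fun_def by (simp add: Rep_l2_of) (simp add: rep_abs_aefun square_integrable_def)

lemma l2_of_fun: "l2_of (l2_fun u) = u"
  by (simp add: l2_of_def l2_fun_def abs_rep_aefun Rep_l2_inverse)

lemma l2_of_eq_iff:
  "square_integrable f \<Longrightarrow> square_integrable g \<Longrightarrow> l2_of f = l2_of g \<longleftrightarrow> (AE x in lborel. f x = g x)"
  using abs_aefun_eq_iff[of f g] Rep_l2_inject[of "l2_of f" "l2_of g"]
  by (simp add: Rep_l2_of square_integrable_measurable)

lemma square_integrable_add:
  "square_integrable f \<Longrightarrow> square_integrable g \<Longrightarrow> square_integrable (\<lambda>x. f x + g x)"
  unfolding square_integrable_def by (auto intro!: integrable_square_add)

lemma square_integrable_scale: "square_integrable f \<Longrightarrow> square_integrable (\<lambda>x. c * f x)"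
  unfolding square_integrable_def by (auto simp: power_mult_distrib)

lemma square_integrable_zero: "square_integrable (\<lambda>x. 0)"
  unfolding square_integrable_def by simp

lemma square_integrable_mult:
  "square_integrable f \<Longrightarrow> square_integrable g \<Longrightarrow> integrable lborel (\<lambda>x. f x * g x)"
  unfolding square_integrable_def by (auto intro!: integrable_square_mult)

instantiation l2 :: (euclidean_space) real_vector
begin

definition zero_l2 :: "'a l2" where "zero_l2 = l2_of (\<lambda>x. 0)"
definition plus_l2 :: "'a l2 \<Rightarrow> 'a l2 \<Rightarrow> 'a l2" where "u + v = l2_of (\<lambda>x. l2_fun u x + l2_fun v x)"
definition scaleR_l2 :: "real \<Rightarrow> 'a l2 \<Rightarrow> 'a l2" where "c *\<^sub>R u = l2_of (\<lambda>x. c * l2_fun u x)"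
definition uminus_l2 :: "'a l2 \<Rightarrow> 'a l2" where "- u = (-1) *\<^sub>R (u :: 'a l2)"
definition minus_l2 :: "'a l2 \<Rightarrow> 'a l2 \<Rightarrow> 'a l2" where "u - v = u + - (v :: 'a l2)"

lemma Rep_l2_add: "Rep_l2 (u + v) = Rep_l2 u + Rep_l2 v"
  unfolding plus_l2_def
  by (subst Rep_l2_of) (simp_all add: square_integrable_add abs_aefun_add, simp add: l2_fun_def abs_rep_aefun)

lemma Rep_l2_scale: "Rep_l2 (c *\<^sub>R u) = c *\<^sub>R Rep_l2 u"
  unfolding scaleR_l2_def
  by (subst Rep_l2_of) (simp_all add: square_integrable_scale abs_aefun_scale, simp add: l2_fun_def abs_rep_aefun)

lemma Rep_l2_zero: "Rep_l2 0 = 0"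
  unfolding zero_l2_def by (subst Rep_l2_of) (simp_all add: square_integrable_zero zero_aefun_def)

instance
proof
  fix a b c :: "'a l2" and r s :: real
  note simps = Rep_l2_add Rep_l2_scale Rep_l2_zero Rep_l2_inject[symmetric]
  show "a + b + c = a + (b + c)" "a + b = b + a" "0 + a = a" "- a + a = 0" "a - b = a + - b"
    "r *\<^sub>R (a + b) = r *\<^sub>R a + r *\<^sub>R b" "(r + s) *\<^sub>R a = r *\<^sub>R a + s *\<^sub>R a" "r *\<^sub>R s *\<^sub>R a = (r * s) *\<^sub>R a" "1 *\<^sub>R a = a"
    by (simp_all add: simps uminus_l2_def minus_l2_def algebra_simps)
qed

end

lemma l2_of_add: "square_integrable f \<Longrightarrow> square_integrable g \<Longrightarrow> l2_of (\<lambda>x. f x + g x) = l2_of f + l2_of g"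
  by (simp add: Rep_l2_inject[symmetric] Rep_l2_add Rep_l2_of square_integrable_add abs_aefun_add square_integrable_measurable)

lemma l2_of_scale: "square_integrable f \<Longrightarrow> l2_of (\<lambda>x. c * f x) = c *\<^sub>R l2_of f"
  by (simp add: Rep_l2_inject[symmetric] Rep_l2_scale Rep_l2_of square_integrable_scale abs_aefun_scale square_integrable_measurable)

lemma l2_of_diff: "square_integrable f \<Longrightarrow> square_integrable g \<Longrightarrow> l2_of (\<lambda>x. f x - g x) = l2_of f - l2_of g"
  using l2_of_add[of f "\<lambda>x. -1 * g x"] l2_of_scale[of g "-1"] square_integrable_scale[of g "-1"] by simp

lemma square_integrable_diff:
  "square_integrable f \<Longrightarrow> square_integrable g \<Longrightarrow> square_integrable (\<lambda>x. f x - g x)"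
  using square_integrable_add[of f "\<lambda>x. -1 * g x"] square_integrable_scale[of g "-1"] by simp

lemma l2_fun_add: "AE x in lborel. l2_fun (u + v) x = l2_fun u x + l2_fun v x"
  unfolding l2_fun_def Rep_l2_add by (rule rep_aefun_add)

lemma l2_fun_scale: "AE x in lborel. l2_fun (c *\<^sub>R u) x = c * l2_fun u x"
  unfolding l2_fun_def Rep_l2_scale by (rule rep_aefun_scale)

lemma l2_eq_iff: "u = v \<longleftrightarrow> (AE x in lborel. l2_fun u x = l2_fun v x)"
  unfolding l2_fun_def by (simp add: Rep_l2_inject[symmetric] aefun_eq_iff)

instantiation l2 :: (euclidean_space) real_inner
begin

definition inner_l2 :: "'a l2 \<Rightarrow> 'a l2 \<Rightarrow> real" where
  "inner_l2 u v = (\<integral>x. l2_fun u x * l2_fun v x \<partial>lborel)"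
definition norm_l2 :: "'a l2 \<Rightarrow> real" where "norm_l2 u = sqrt (inner u u)"
definition dist_l2 :: "'a l2 \<Rightarrow> 'a l2 \<Rightarrow> real" where "dist_l2 u v = norm (u - v)"
definition sgn_l2 :: "'a l2 \<Rightarrow> 'a l2" where "sgn_l2 u = u /\<^sub>R norm u"
definition uniformity_l2 :: "('a l2 \<times> 'a l2) filter" where
  "uniformity_l2 = (INF e\<in>{0<..}. principal {(u, v). dist u v < e})"
definition open_l2 :: "'a l2 set \<Rightarrow> bool" where
  "open_l2 U \<longleftrightarrow> (\<forall>u\<in>U. eventually (\<lambda>(u', v). u' = u \<longrightarrow> v \<in> U) uniformity)"

instance
proof
  fix u v w :: "'a l2" and c :: real
  have int: "integrable lborel (\<lambda>x. l2_fun u x * l2_fun v x)" for u v :: "'a l2"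
    by (rule square_integrable_mult) simp_all
  show "inner u v = inner v u" by (simp add: inner_l2_def mult.commute)
  have "inner (u + v) w = (\<integral>x. l2_fun u x * l2_fun w x + l2_fun v x * l2_fun w x \<partial>lborel)"
    unfolding inner_l2_def
    by (rule integral_cong_AE) (use l2_fun_add[of u v] in \<open>auto simp: distrib_right\<close>)
  then show "inner (u + v) w = inner u w + inner v w" by (simp add: inner_l2_def int)
  have "inner (c *\<^sub>R u) v = (\<integral>x. c * (l2_fun u x * l2_fun v x) \<partial>lborel)"
    unfolding inner_l2_def
    by (rule integral_cong_AE) (use l2_fun_scale[of c u] in auto)
  then show "inner (c *\<^sub>R u) v = c * inner u v" by (simp add: inner_l2_def)
  show "0 \<le> inner u u" by (simp add: inner_l2_def)
  show "inner u u = 0 \<longleftrightarrow> u = 0"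
  proof -
    have "inner u u = 0 \<longleftrightarrow> (AE x in lborel. l2_fun u x * l2_fun u x = 0)"
      unfolding inner_l2_def by (rule integral_nonneg_eq_0_iff_AE[OF int]) simp
    also have "\<dots> \<longleftrightarrow> (AE x in lborel. l2_fun u x = 0)" by simp
    also have "\<dots> \<longleftrightarrow> (AE x in lborel. l2_fun u x = l2_fun 0 x)"
    proof -
      have z: "AE x in lborel. l2_fun (0::'a l2) x = 0" unfolding l2_fun_def Rep_l2_zero by (rule rep_aefun_zero)
      show ?thesis
      proof
        assume "AE x in lborel. l2_fun u x = 0"
        with z show "AE x in lborel. l2_fun u x = l2_fun 0 x" by eventually_elim simp
      next
        assume "AE x in lborel. l2_fun u x = l2_fun 0 x"
        with z show "AE x in lborel. l2_fun u x = 0" by eventually_elim simp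
      qed
    qed
    finally show ?thesis by (simp add: l2_eq_iff)
  qed
qed (simp_all add: norm_l2_def dist_l2_def sgn_l2_def uniformity_l2_def open_l2_def)

end

lemma inner_l2_of:
  assumes "square_integrable f" "square_integrable g"
  shows "l2_of f \<bullet> l2_of g = (\<integral>x. f x * g x \<partial>lborel)"
  unfolding inner_l2_def
  by (rule integral_cong_AE) (use l2_fun_of[OF assms(1)] l2_fun_of[OF assms(2)] assms in \<open>auto simp: square_integrable_def\<close>)

lemma norm_l2_sq: "(norm u)\<^sup>2 = (\<integral>x. (l2_fun u x)\<^sup>2 \<partial>lborel)"
  by (simp only: power2_norm_eq_inner inner_l2_def) (simp add: power2_eq_square)

lemma norm_l2_nn: "(\<integral>\<^sup>+x. ennreal ((l2_fun u x)\<^sup>2) \<partial>lborel) = ennreal ((norm u)\<^sup>2)"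
  unfolding norm_l2_sq using square_integrable_l2_fun[of u]
  by (intro nn_integral_eq_integral) (auto simp: square_integrable_def)

lemma l2_fun_diff: "AE x in lborel. l2_fun (u - v) x = l2_fun u x - l2_fun v x"
proof -
  have "u - v = l2_of (\<lambda>x. l2_fun u x - l2_fun v x)" by (simp add: l2_of_diff l2_of_fun)
  then show ?thesis by (simp add: l2_fun_of square_integrable_diff)
qed

lemma ennreal_le_suminf: "g n \<le> (\<Sum>n. g n :: ennreal)"
  using sum_le_suminf[of g "{n}"] by simp

text \<open>Riesz--Fischer: a sufficiently fast subsequence converges almost everywhere, and its limit is the
  \<open>L\<^sup>2\<close> limit by Fatou's lemma.\<close>

lemma fast_subsequence_converges_AE:
  fixes X :: "nat \<Rightarrow> 'a::euclidean_space l2"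
  assumes X: "\<And>n. norm (X (Suc n) - X n) < (1/8) ^ n"
  shows "AE x in lborel. convergent (\<lambda>n. l2_fun (X n) x)"
proof -
  define d where "d n x = l2_fun (X (Suc n) - X n) x" for n x
  have [measurable]: "d n \<in> borel_measurable borel" for n unfolding d_def by measurable
  \<comment> \<open>The rate \<open>(1/8) ^ n\<close> leaves room for the weight
    \<open>4 ^ n\<close>: the weighted squares still have a summable integral, so almost everywhere
    the increments decay like \<open>(1/2) ^ n\<close>.\<close>
  have "(\<integral>\<^sup>+x. (\<Sum>n. ennreal (4 ^ n * (d n x)\<^sup>2)) \<partial>lborel) = (\<Sum>n. \<integral>\<^sup>+x. ennreal (4 ^ n * (d n x)\<^sup>2) \<partial>lborel)"
    by (rule nn_integral_suminf) measurable
  also have "\<dots> = (\<Sum>n. ennreal (4 ^ n * (norm (X (Suc n) - X n))\<^sup>2))"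
  proof -
    have "(\<integral>\<^sup>+x. ennreal (4 ^ n * (d n x)\<^sup>2) \<partial>lborel) = ennreal (4 ^ n * (norm (X (Suc n) - X n))\<^sup>2)" for n
      by (simp add: ennreal_mult nn_integral_cmult d_def norm_l2_nn)
    then show ?thesis by simp
  qed
  also have "\<dots> \<le> (\<Sum>n. ennreal ((1/2) ^ n))"
  proof (intro suminf_le allI ennreal_leI)
    fix n
    have "4 ^ n * (norm (X (Suc n) - X n))\<^sup>2 \<le> 4 ^ n * ((1/8) ^ n)\<^sup>2"
      using X[of n] by (intro mult_left_mono power_mono) auto
    also have "\<dots> = (1/16) ^ n" by (simp add: power2_eq_square power_mult_distrib[symmetric])
    also have "\<dots> \<le> (1/2) ^ n" by (intro power_mono) auto
    finally show "4 ^ n * (norm (X (Suc n) - X n))\<^sup>2 \<le> (1/2) ^ n" .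
  qed auto
  also have "\<dots> < \<infinity>"
    by (subst suminf_ennreal2) (auto simp: summable_geometric)
  finally have "(\<integral>\<^sup>+x. (\<Sum>n. ennreal (4 ^ n * (d n x)\<^sup>2)) \<partial>lborel) \<noteq> \<infinity>" by simp
  then have "AE x in lborel. (\<Sum>n. ennreal (4 ^ n * (d n x)\<^sup>2)) \<noteq> \<infinity>"
    by (intro nn_integral_noteq_infinite) auto
  moreover have "AE x in lborel. \<forall>n. d n x = l2_fun (X (Suc n)) x - l2_fun (X n) x"
    unfolding AE_all_countable d_def by (intro allI l2_fun_diff)
  ultimately show ?thesis
  proof eventually_elim
    case (elim x)
    define C where "C = (\<Sum>n. ennreal (4 ^ n * (d n x)\<^sup>2))"
    obtain c where c: "c \<ge> 0" "C = ennreal c" using elim(1) unfolding C_def[symmetric] by (cases C) auto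
    have "\<bar>d n x\<bar> \<le> sqrt c * (1/2) ^ n" for n
    proof -
      have "ennreal (4 ^ n * (d n x)\<^sup>2) \<le> C"
        unfolding C_def by (rule ennreal_le_suminf)
      then have "4 ^ n * (d n x)\<^sup>2 \<le> c" using c by simp
      moreover have "(2 ^ n * \<bar>d n x\<bar>)\<^sup>2 = 4 ^ n * (d n x)\<^sup>2"
      proof -
        have "((2::real) ^ n)\<^sup>2 = 4 ^ n" unfolding power2_eq_square by (simp flip: power_mult_distrib)
        then show ?thesis unfolding power_mult_distrib by simp
      qed
      ultimately have "(2 ^ n * \<bar>d n x\<bar>)\<^sup>2 \<le> c" by simp
      then have "2 ^ n * \<bar>d n x\<bar> \<le> sqrt c" by (rule real_le_rsqrt)
      then have "\<bar>d n x\<bar> \<le> sqrt c / 2 ^ n" by (simp add: pos_le_divide_eq mult.commute)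
      then show ?thesis by (simp add: power_one_over)
    qed
    then have le: "norm (d n x) \<le> sqrt c * (1/2) ^ n" for n by simp
    have "summable (\<lambda>n. sqrt c * (1/2) ^ n)" by (intro summable_mult summable_geometric) simp
    then have "summable (\<lambda>n. d n x)" using le by (rule summable_comparison_test')
    then have "summable (\<lambda>n. l2_fun (X (Suc n)) x - l2_fun (X n) x)" using elim(2) by simp
    then have "convergent (\<lambda>n. l2_fun (X n) x - l2_fun (X 0) x)"
      unfolding summable_iff_convergent sum_lessThan_telescope[of "\<lambda>n. l2_fun (X n) x"] .
    then have "convergent (\<lambda>n. (l2_fun (X n) x - l2_fun (X 0) x) + l2_fun (X 0) x)"
      by (intro convergent_add convergent_const)
    then show ?case by simp
  qed
qed

instance l2 :: (euclidean_space) complete_space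
proof
  fix X :: "nat \<Rightarrow> 'a l2"
  assume "Cauchy X"
  then have "\<forall>n. \<exists>N. \<forall>i\<ge>N. \<forall>j\<ge>N. dist (X i) (X j) < (1/8) ^ n" unfolding Cauchy_def by simp
  then obtain N where N: "\<And>n i j. i \<ge> N n \<Longrightarrow> j \<ge> N n \<Longrightarrow> dist (X i) (X j) < (1/8) ^ n" by metis
  \<comment> \<open>The sum makes \<open>r\<close> monotone and at least \<open>N n\<close>; the
    summand \<open>n\<close> makes \<open>Y\<close> run through arbitrarily late terms of
    \<open>X\<close>.\<close>
  define r where "r n = (\<Sum>i\<le>n. N i) + n" for n
  have rN: "N n \<le> r n" for n unfolding r_def by (simp add: member_le_sum trans_le_add1)
  have r_Suc: "r n \<le> r (Suc n)" for n by (simp add: r_def)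
  have r_n: "n \<le> r n" for n by (simp add: r_def)
  define Y where "Y n = X (r n)" for n
  have Y: "norm (Y (Suc n) - Y n) < (1/8) ^ n" for n
    using N[of n "r (Suc n)" "r n"] rN[of n] r_Suc[of n] by (simp add: Y_def dist_norm)
  define f where "f x = lim (\<lambda>n. l2_fun (Y n) x)" for x
  have [measurable]: "f \<in> borel_measurable borel" unfolding f_def by measurable
  have lim: "AE x in lborel. (\<lambda>n. l2_fun (Y n) x) \<longlonglongrightarrow> f x"
    using fast_subsequence_converges_AE[of Y] Y unfolding f_def by (auto simp: convergent_LIMSEQ_iff)
  \<comment> \<open>Used twice: with the tolerance 1 to see that \<open>f\<close> is
    square-integrable, and with \<open>e / 2\<close> for convergence of the whole sequence.\<close>
  have bound: "(\<integral>\<^sup>+x. ennreal ((l2_fun (X i) x - f x)\<^sup>2) \<partial>lborel) \<le> ennreal (e\<^sup>2)"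
    if e: "e > 0" and M: "\<And>j. j \<ge> M \<Longrightarrow> dist (X i) (X j) < e" for i M e
  proof -
    have "AE x in lborel. \<forall>n. l2_fun (X i - Y n) x = l2_fun (X i) x - l2_fun (Y n) x"
      unfolding AE_all_countable by (intro allI l2_fun_diff)
    with lim have "AE x in lborel. ennreal ((l2_fun (X i) x - f x)\<^sup>2) = liminf (\<lambda>n. ennreal ((l2_fun (X i - Y n) x)\<^sup>2))"
    proof eventually_elim
      case (elim x)
      have "(\<lambda>n. ennreal ((l2_fun (X i - Y n) x)\<^sup>2)) \<longlonglongrightarrow> ennreal ((l2_fun (X i) x - f x)\<^sup>2)"
        unfolding elim(2)[rule_format] by (intro tendsto_intros elim(1))
      then show ?case by (rule lim_imp_Liminf[OF sequentially_bot, symmetric])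
    qed
    then have "(\<integral>\<^sup>+x. ennreal ((l2_fun (X i) x - f x)\<^sup>2) \<partial>lborel) = (\<integral>\<^sup>+x. liminf (\<lambda>n. ennreal ((l2_fun (X i - Y n) x)\<^sup>2)) \<partial>lborel)"
      by (rule nn_integral_cong_AE)
    also have "\<dots> \<le> liminf (\<lambda>n. \<integral>\<^sup>+x. ennreal ((l2_fun (X i - Y n) x)\<^sup>2) \<partial>lborel)"
      by (rule nn_integral_liminf) measurable
    also have "\<dots> = liminf (\<lambda>n. ennreal ((norm (X i - Y n))\<^sup>2))" by (simp add: norm_l2_nn)
    also have "\<dots> \<le> liminf (\<lambda>n. ennreal (e\<^sup>2))"
    proof (rule Liminf_mono, rule eventually_sequentiallyI[of M])
      fix n assume "n \<ge> M"
      then have "dist (X i) (Y n) < e" unfolding Y_def using r_n[of n] by (intro M) simp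
      then show "ennreal ((norm (X i - Y n))\<^sup>2) \<le> ennreal (e\<^sup>2)"
        by (intro ennreal_leI power_mono) (auto simp: dist_norm)
    qed
    finally show ?thesis by (simp add: Liminf_const)
  qed
  have int: "square_integrable (\<lambda>x. l2_fun (X i) x - f x)"
    if "e > 0" "\<And>j. j \<ge> M \<Longrightarrow> dist (X i) (X j) < e" for i M e
    unfolding square_integrable_def
  proof
    show "integrable lborel (\<lambda>x. (l2_fun (X i) x - f x)\<^sup>2)"
    proof (rule integrableI_bounded)
      show "(\<integral>\<^sup>+ x. ennreal (norm ((l2_fun (X i) x - f x)\<^sup>2)) \<partial>lborel) < \<infinity>"
      proof -
        have "(\<integral>\<^sup>+x. ennreal ((l2_fun (X i) x - f x)\<^sup>2) \<partial>lborel) \<le> ennreal (e\<^sup>2)" using that by (rule bound)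
        then have "(\<integral>\<^sup>+x. ennreal ((l2_fun (X i) x - f x)\<^sup>2) \<partial>lborel) < top"
          using ennreal_less_top by (rule order_le_less_trans)
        then show ?thesis by simp
      qed
    qed measurable
  qed measurable
  define i0 where "i0 = N 0"
  have "square_integrable (\<lambda>x. l2_fun (X i0) x - f x)"
    by (rule int[of 1 "N 0"]) (use N[of 0] in \<open>auto simp: i0_def\<close>)
  then have "square_integrable (\<lambda>x. l2_fun (X i0) x - (l2_fun (X i0) x - f x))"
    by (rule square_integrable_diff[OF square_integrable_l2_fun])
  then have f: "square_integrable f" by simp
  have "X \<longlonglongrightarrow> l2_of f"
  proof (rule metric_LIMSEQ_I)
    fix e :: real assume e: "e > 0"
    then obtain M where M: "\<And>i j. i \<ge> M \<Longrightarrow> j \<ge> M \<Longrightarrow> dist (X i) (X j) < e / 2"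
      using \<open>Cauchy X\<close> unfolding Cauchy_def by (metis half_gt_zero)
    have "dist (X i) (l2_of f) < e" if i: "i \<ge> M" for i
    proof -
      have b: "(\<integral>\<^sup>+x. ennreal ((l2_fun (X i) x - f x)\<^sup>2) \<partial>lborel) \<le> ennreal ((e/2)\<^sup>2)"
      proof (rule bound)
        show "e / 2 > 0" using e by simp
        show "dist (X i) (X j) < e / 2" if "j \<ge> M" for j by (rule M[OF i that])
      qed
      have s: "square_integrable (\<lambda>x. l2_fun (X i) x - f x)" using f by (intro square_integrable_diff) simp_all
      have "X i - l2_of f = l2_of (\<lambda>x. l2_fun (X i) x - f x)" by (simp add: l2_of_diff f l2_of_fun)
      then have "(norm (X i - l2_of f))\<^sup>2 = (\<integral>x. (l2_fun (X i) x - f x)\<^sup>2 \<partial>lborel)"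
        by (simp add: power2_norm_eq_inner inner_l2_of s) (simp add: power2_eq_square)
      then have "ennreal ((norm (X i - l2_of f))\<^sup>2) \<le> ennreal ((e/2)\<^sup>2)"
        using b s by (subst (asm) nn_integral_eq_integral) (auto simp: square_integrable_def)
      then have "(norm (X i - l2_of f))\<^sup>2 \<le> (e/2)\<^sup>2" by simp
      then have "norm (X i - l2_of f) \<le> e / 2" by (rule power2_le_imp_le) (use e in simp)
      then show ?thesis using e by (simp add: dist_norm)
    qed
    then show "\<exists>no. \<forall>n\<ge>no. dist (X n) (l2_of f) < e" by blast
  qed
  then show "convergent X" by (rule convergentI)
qed

text \<open>Multiplication by \<open>exp (V / 2)\<close> identifies the unweighted \<open>L\<^sup>2\<close> space with \<open>L2 V\<close>; all operators are
  moved to the unweighted space, which is a type.\<close>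

definition l2_class :: "('a::euclidean_space \<Rightarrow> real) \<Rightarrow> ('a \<Rightarrow> real) \<Rightarrow> 'a l2" where
  "l2_class V f = l2_of (\<lambda>x. exp (- V x / 2) * f x)"

definition l2_unweight :: "('a::euclidean_space \<Rightarrow> real) \<Rightarrow> 'a l2 \<Rightarrow> 'a aefun" where
  "l2_unweight V u = abs_aefun (\<lambda>x. exp (V x / 2) * l2_fun u x)"

definition weighted_square_integrable :: "('a::euclidean_space \<Rightarrow> real) \<Rightarrow> ('a \<Rightarrow> real) \<Rightarrow> bool" where
  "weighted_square_integrable V f \<longleftrightarrow> f \<in> borel_measurable borel \<and> integrable lborel (\<lambda>x. exp (- V x) * (f x)\<^sup>2)"

lemma integrable_weighted_measure:
  assumes [measurable]: "V \<in> borel_measurable borel" "f \<in> borel_measurable borel"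
  shows "integrable (weighted_measure V) f \<longleftrightarrow> integrable lborel (\<lambda>x. exp (- V x) * f x)"
  unfolding weighted_measure_def by (subst integrable_density) (auto simp: mult.commute)

lemma integral_weighted_measure:
  assumes [measurable]: "V \<in> borel_measurable borel" "f \<in> borel_measurable borel"
  shows "(\<integral>x. f x \<partial>weighted_measure V) = (\<integral>x. exp (- V x) * f x \<partial>lborel)"
  unfolding weighted_measure_def by (subst integral_density) (auto simp: mult.commute)

lemma exp_half_cancel:
  fixes v c :: real
  shows "exp (- (v / 2)) * (exp (v / 2) * c) = c" "exp (v / 2) * (exp (- (v / 2)) * c) = c"
    "exp (v / 2) * exp (- (v / 2)) = 1"
proof -
  have 1: "exp (- (v / 2)) * exp (v / 2) = 1" "exp (v / 2) * exp (- (v / 2)) = 1" unfolding exp_add[symmetric] by simp_all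
  then show "exp (- (v / 2)) * (exp (v / 2) * c) = c" "exp (v / 2) * (exp (- (v / 2)) * c) = c"
    unfolding mult.assoc[symmetric] by simp_all
  show "exp (v / 2) * exp (- (v / 2)) = 1" by (rule 1(2))
qed

lemma exp_half_square: "(exp (- v / 2))\<^sup>2 = exp (- v :: real)"
  by (simp add: power2_eq_square flip: exp_add)

section \<open>Weighted classes and the transport of operators and resolutions\<close>

context
  fixes V :: "'a::euclidean_space \<Rightarrow> real"
  assumes V [measurable]: "V \<in> borel_measurable borel"
begin

lemma square_integrable_weight:
  "weighted_square_integrable V f \<longleftrightarrow> f \<in> borel_measurable borel \<and> square_integrable (\<lambda>x. exp (- V x / 2) * f x)"
  unfolding weighted_square_integrable_def square_integrable_def power_mult_distrib exp_half_square by auto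

lemma weighted_square_integrable_add:
  "weighted_square_integrable V f \<Longrightarrow> weighted_square_integrable V g \<Longrightarrow> weighted_square_integrable V (\<lambda>x. f x + g x)"
  unfolding square_integrable_weight using square_integrable_add by (fastforce simp: distrib_left)

lemma weighted_square_integrable_scale:
  "weighted_square_integrable V f \<Longrightarrow> weighted_square_integrable V (\<lambda>x. c * f x)"
  unfolding square_integrable_weight using square_integrable_scale[of "\<lambda>x. exp (- V x / 2) * f x" c] by (auto simp: mult.left_commute)

lemma l2_class_add:
  "weighted_square_integrable V f \<Longrightarrow> weighted_square_integrable V g \<Longrightarrow>
    l2_class V (\<lambda>x. f x + g x) = l2_class V f + l2_class V g"
  unfolding square_integrable_weight l2_class_def by (simp add: distrib_left l2_of_add)

lemma l2_class_scale: "weighted_square_integrable V f \<Longrightarrow> l2_class V (\<lambda>x. c * f x) = c *\<^sub>R l2_class V f"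
  unfolding square_integrable_weight l2_class_def using l2_of_scale[of "\<lambda>x. exp (- V x / 2) * f x" c]
  by (simp add: mult.left_commute)

lemma l2_class_diff:
  assumes "weighted_square_integrable V f" "weighted_square_integrable V g"
  shows "l2_class V (\<lambda>x. f x - g x) = l2_class V f - l2_class V g"
  using l2_class_add[OF assms(1) weighted_square_integrable_scale[OF assms(2)], of "-1"] l2_class_scale[OF assms(2), of "-1"]
  by simp

lemma inner_l2_class:
  assumes f: "weighted_square_integrable V f" and g: "weighted_square_integrable V g"
  shows "l2_class V f \<bullet> l2_class V g = (\<integral>x. exp (- V x) * (f x * g x) \<partial>lborel)"
proof -
  have "l2_class V f \<bullet> l2_class V g = (\<integral>x. (exp (- V x / 2) * f x) * (exp (- V x / 2) * g x) \<partial>lborel)"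
    unfolding l2_class_def using f g by (intro inner_l2_of) (auto simp: square_integrable_weight)
  also have "(\<lambda>x. (exp (- V x / 2) * f x) * (exp (- V x / 2) * g x)) = (\<lambda>x. exp (- V x) * (f x * g x))"
  proof
    fix x
    have "(exp (- V x / 2) * f x) * (exp (- V x / 2) * g x) = (exp (- V x / 2))\<^sup>2 * (f x * g x)"
      unfolding power2_eq_square by (simp only: mult_ac)
    then show "(exp (- V x / 2) * f x) * (exp (- V x / 2) * g x) = exp (- V x) * (f x * g x)"
      unfolding exp_half_square .
  qed
  finally show ?thesis .
qed

lemma l2_class_eq_iff:
  assumes f: "weighted_square_integrable V f" and g: "weighted_square_integrable V g"
  shows "l2_class V f = l2_class V g \<longleftrightarrow> (AE x in lborel. f x = g x)"
  using f g unfolding l2_class_def square_integrable_weight by (simp add: l2_of_eq_iff)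

lemma weighted_square_integrable_unweight:
  "weighted_square_integrable V (\<lambda>x. exp (V x / 2) * l2_fun u x)"
  unfolding square_integrable_weight by (simp add: exp_half_cancel)

lemma l2_class_surj: "l2_class V (\<lambda>x. exp (V x / 2) * l2_fun u x) = u"
  unfolding l2_class_def by (simp add: exp_half_cancel l2_of_fun)

lemma l2_class_cases:
  obtains f where "weighted_square_integrable V f" "u = l2_class V f"
  using that[OF weighted_square_integrable_unweight l2_class_surj[symmetric]] .

lemma l2_unweight_class:
  assumes "weighted_square_integrable V f" shows "l2_unweight V (l2_class V f) = abs_aefun f"
proof -
  have "square_integrable (\<lambda>x. exp (- V x / 2) * f x)" and [measurable]: "f \<in> borel_measurable borel"
    using assms by (auto simp: square_integrable_weight)
  have "AE x in lborel. exp (V x / 2) * l2_fun (l2_class V f) x = f x"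
    using l2_fun_of[OF \<open>square_integrable _\<close>] unfolding l2_class_def
    by eventually_elim (simp add: exp_half_cancel)
  then show ?thesis unfolding l2_unweight_def by (subst abs_aefun_eq_iff) auto
qed

lemma l2_unweight_linear: "linear (l2_unweight V)"
proof (rule linearI)
  fix u v :: "'a l2" and c :: real
  obtain f g where "weighted_square_integrable V f" "u = l2_class V f" "weighted_square_integrable V g" "v = l2_class V g"
    by (metis l2_class_cases)
  then show "l2_unweight V (u + v) = l2_unweight V u + l2_unweight V v"
    "l2_unweight V (c *\<^sub>R u) = c *\<^sub>R l2_unweight V u"
    by (simp_all add: l2_unweight_class weighted_square_integrable_add weighted_square_integrable_scale abs_aefun_add abs_aefun_scale
      flip: l2_class_add l2_class_scale) (simp_all add: weighted_square_integrable_def abs_aefun_add abs_aefun_scale)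
qed

lemma l2_unweight_inj: "l2_unweight V u = l2_unweight V v \<Longrightarrow> u = v"
proof -
  assume eq: "l2_unweight V u = l2_unweight V v"
  obtain f g where fg: "weighted_square_integrable V f" "u = l2_class V f" "weighted_square_integrable V g" "v = l2_class V g"
    by (metis l2_class_cases)
  then have "AE x in lborel. f x = g x"
    using eq abs_aefun_eq_iff[of f g] by (simp add: l2_unweight_class weighted_square_integrable_def)
  then show ?thesis using fg by (simp add: l2_class_eq_iff)
qed

lemma L2_iff: "abs_aefun f \<in> L2 V \<longleftrightarrow> weighted_square_integrable V f" if [measurable]: "f \<in> borel_measurable borel"
proof -
  have "abs_aefun f \<in> L2 V \<longleftrightarrow> integrable lborel (\<lambda>x. exp (- V x) * (rep_aefun (abs_aefun f) x)\<^sup>2)"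
    by (simp add: L2_def integrable_weighted_measure)
  also have "\<dots> \<longleftrightarrow> integrable lborel (\<lambda>x. exp (- V x) * (f x)\<^sup>2)"
    by (rule integrable_cong_AE) (use rep_abs_aefun[OF that] in auto)
  finally show ?thesis by (simp add: weighted_square_integrable_def)
qed

lemma range_l2_unweight: "range (l2_unweight V) = L2 V"
proof
  show "range (l2_unweight V) \<subseteq> L2 V"
    unfolding l2_unweight_def using weighted_square_integrable_unweight by (auto simp: L2_iff)
  show "L2 V \<subseteq> range (l2_unweight V)"
  proof
    fix w assume w: "w \<in> L2 V"
    then have "weighted_square_integrable V (rep_aefun w)"
      using L2_iff[of "rep_aefun w"] by (simp add: abs_rep_aefun)
    then have "w = l2_unweight V (l2_class V (rep_aefun w))" by (simp add: l2_unweight_class abs_rep_aefun)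
    then show "w \<in> range (l2_unweight V)" by blast
  qed
qed

lemma l2_unweight_mem: "l2_unweight V u \<in> L2 V"
  using range_l2_unweight by blast

lemma L2_inner_unweight: "L2_inner V (l2_unweight V u) (l2_unweight V v) = u \<bullet> v"
proof -
  obtain f g where fg: "weighted_square_integrable V f" "u = l2_class V f" "weighted_square_integrable V g" "v = l2_class V g"
    by (metis l2_class_cases)
  have [measurable]: "f \<in> borel_measurable borel" "g \<in> borel_measurable borel"
    using fg by (auto simp: weighted_square_integrable_def)
  have "L2_inner V (l2_unweight V u) (l2_unweight V v)
      = (\<integral>x. exp (- V x) * (rep_aefun (abs_aefun f) x * rep_aefun (abs_aefun g) x) \<partial>lborel)"
    using fg by (simp add: L2_inner_def l2_unweight_class integral_weighted_measure)
  also have "\<dots> = (\<integral>x. exp (- V x) * (f x * g x) \<partial>lborel)"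
    by (rule integral_cong_AE) (use rep_abs_aefun[of f] rep_abs_aefun[of g] in auto)
  finally show ?thesis using fg by (simp add: inner_l2_class)
qed

lemma L2_norm_unweight: "L2_norm V (l2_unweight V u) = norm u"
  by (simp add: L2_norm_def L2_inner_unweight norm_eq_sqrt_inner)

lemma L2_cases: assumes "w \<in> L2 V" obtains u where "w = l2_unweight V u"
  using assms range_l2_unweight by blast

definition pull_rel :: "'a operator \<Rightarrow> ('a l2 \<times> 'a l2) set" where
  "pull_rel A = {(u, v). (l2_unweight V u, l2_unweight V v) \<in> A}"

definition push_rel :: "('a l2 \<times> 'a l2) set \<Rightarrow> 'a operator" where
  "push_rel A = {(l2_unweight V u, l2_unweight V v) | u v. (u, v) \<in> A}"

lemma push_rel_iff: "(l2_unweight V u, l2_unweight V v) \<in> push_rel A \<longleftrightarrow> (u, v) \<in> A"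
  unfolding push_rel_def using l2_unweight_inj by blast

lemma push_rel_cases:
  assumes "(f, g) \<in> push_rel A" obtains u v where "f = l2_unweight V u" "g = l2_unweight V v" "(u, v) \<in> A"
  using assms unfolding push_rel_def by blast

lemma adjoint_push_rel: "adjoint_graph V (push_rel A) = push_rel (adjoint_rel A)"
proof (intro set_eqI iffI)
  fix p assume p: "p \<in> adjoint_graph V (push_rel A)"
  then have "fst p \<in> L2 V" "snd p \<in> L2 V" by (auto simp: adjoint_graph_def)
  then obtain u v where uv: "p = (l2_unweight V u, l2_unweight V v)" by (metis L2_cases prod.collapse)
  have "g \<bullet> u = f \<bullet> v" if "(f, g) \<in> A" for f g
    using p that unfolding uv adjoint_graph_def by (auto simp: push_rel_iff L2_inner_unweight dest!: bspec[of _ _ "(l2_unweight V f, l2_unweight V g)"])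
  then show "p \<in> push_rel (adjoint_rel A)" unfolding uv push_rel_iff adjoint_rel_def by auto
next
  fix p assume "p \<in> push_rel (adjoint_rel A)"
  then obtain u v where uv: "p = (l2_unweight V u, l2_unweight V v)" "(u, v) \<in> adjoint_rel A"
    by (metis push_rel_cases prod.collapse)
  then show "p \<in> adjoint_graph V (push_rel A)"
    unfolding adjoint_graph_def adjoint_rel_def
    by (auto simp: l2_unweight_mem L2_inner_unweight elim!: push_rel_cases)
qed

lemma Domain_push_rel: "Domain (push_rel A) = l2_unweight V ` Domain A"
  unfolding push_rel_def by auto

lemma l2_unweight_diff: "l2_unweight V u - l2_unweight V v = l2_unweight V (u - v)"
  by (simp add: linear_diff[OF l2_unweight_linear])

lemma self_adjoint_push_rel: "self_adjoint V (push_rel A) \<longleftrightarrow> selfadjoint_rel A"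
proof -
  have "push_rel A = push_rel (adjoint_rel A) \<longleftrightarrow> A = adjoint_rel A"
    by (auto simp: push_rel_iff[symmetric])
  moreover have "densely_defined V (push_rel A) \<longleftrightarrow> (\<forall>u. \<forall>e>0. \<exists>f\<in>Domain A. norm (u - f) < e)"
    unfolding densely_defined_def Domain_push_rel range_l2_unweight[symmetric]
    by (auto simp: l2_unweight_diff L2_norm_unweight)
  ultimately show ?thesis unfolding self_adjoint_def selfadjoint_rel_def adjoint_push_rel by simp
qed

lemma self_adjoint_push_pull:
  assumes "self_adjoint V A" shows "push_rel (pull_rel A) = A"
proof -
  have "u \<in> L2 V \<and> v \<in> L2 V" if "(u, v) \<in> A" for u v
    using assms that unfolding self_adjoint_def adjoint_graph_def by auto
  then show ?thesis
    unfolding push_rel_def pull_rel_def using L2_cases by (auto, metis)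
qed

lemma orthogonal_projection_transfer:
  assumes PQ: "\<And>u. P (l2_unweight V u) = l2_unweight V (Q u)"
  shows "orthogonal_projection V P \<longleftrightarrow> projection_op Q"
proof -
  have lin: "l2_unweight V u + l2_unweight V v = l2_unweight V (u + v)"
    "c *\<^sub>R l2_unweight V u = l2_unweight V (c *\<^sub>R u)" for u v c
    by (simp_all add: linear_add[OF l2_unweight_linear] linear_scale[OF l2_unweight_linear])
  have inj: "l2_unweight V u = l2_unweight V v \<longleftrightarrow> u = v" for u v using l2_unweight_inj by blast
  show ?thesis
    unfolding orthogonal_projection_def projection_op_def symmetric_op_def linear_iff range_l2_unweight[symmetric]
    by (auto simp: lin PQ inj L2_inner_unweight)
qed

lemma resolution_transfer:
  assumes EF: "\<And>l u. E l (l2_unweight V u) = l2_unweight V (F l u)"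
  shows "resolution_of_identity V E \<longleftrightarrow> projection_resolution F"
proof -
  have inj: "l2_unweight V u = l2_unweight V v \<longleftrightarrow> u = v" for u v using l2_unweight_inj by blast
  have "orthogonal_projection V (E l) \<longleftrightarrow> projection_op (F l)" for l
    by (rule orthogonal_projection_transfer) (rule EF)
  then show ?thesis
    unfolding resolution_of_identity_def projection_resolution_def range_l2_unweight[symmetric]
    by (simp add: EF inj l2_unweight_diff L2_norm_unweight)
qed

lemma spectral_transfer:
  assumes EF: "\<And>l u. E l (l2_unweight V u) = l2_unweight V (F l u)"
  shows "spectral_decomposition V (push_rel A) E \<longleftrightarrow> spectral_resolution A F"
proof -
  have mu: "spectral_measure V E (l2_unweight V u) = interval_measure (\<lambda>l. F l u \<bullet> u)" for u
    by (simp add: spectral_measure_def EF L2_inner_unweight)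
  have inj: "inj (l2_unweight V)" using l2_unweight_inj by (rule injI)
  have "{u \<in> L2 V. integrable (spectral_measure V E u) (\<lambda>l. l\<^sup>2)}
      = l2_unweight V ` {u. integrable (interval_measure (\<lambda>l. F l u \<bullet> u)) (\<lambda>l. l\<^sup>2)}"
    unfolding range_l2_unweight[symmetric] by (auto simp: mu)
  then have "Domain (push_rel A) = {u \<in> L2 V. integrable (spectral_measure V E u) (\<lambda>l. l\<^sup>2)}
      \<longleftrightarrow> Domain A = {u. integrable (interval_measure (\<lambda>l. F l u \<bullet> u)) (\<lambda>l. l\<^sup>2)}"
    unfolding Domain_push_rel by (simp add: inj_image_eq_iff[OF inj])
  moreover have "(\<forall>(u, v)\<in>push_rel A. L2_inner V v u = (\<integral>l. l \<partial>spectral_measure V E u))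
      \<longleftrightarrow> (\<forall>(u, v)\<in>A. v \<bullet> u = (\<integral>l. l \<partial>interval_measure (\<lambda>l. F l u \<bullet> u)))"
    unfolding push_rel_def by (fastforce simp: mu L2_inner_unweight)
  ultimately show ?thesis
    unfolding spectral_decomposition_def spectral_resolution_def resolution_transfer[of E F, OF EF] by argo
qed

text \<open>Existence of an extension and of its spectral decomposition is what turns the two
  choices by \<open>SOME\<close> into usable facts. The conclusion records the range of each
  spectral projection, since the spectral values depend on its dimension alone.\<close>

lemma spectral_projection_model:
  assumes ext: "\<exists>A. pull_rel (neg_weighted_laplacian_graph V) \<subseteq> A \<and> selfadjoint_rel A"
    and L2: "neg_weighted_laplacian_graph V \<subseteq> L2 V \<times> L2 V"
  obtains A E where "selfadjoint_rel A" "pull_rel (neg_weighted_laplacian_graph V) \<subseteq> A" "spectral_resolution A E"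
    "\<And>l. spectral_projection V l ` L2 V = l2_unweight V ` range (E l)"
proof -
  let ?G = "neg_weighted_laplacian_graph V" and ?A = "neg_weighted_laplacian V"
  have G: "?G \<subseteq> push_rel A \<longleftrightarrow> pull_rel ?G \<subseteq> A" for A
  proof
    assume *: "?G \<subseteq> push_rel A"
    show "pull_rel ?G \<subseteq> A"
    proof (rule subrelI)
      fix u v assume "(u, v) \<in> pull_rel ?G"
      then have "(l2_unweight V u, l2_unweight V v) \<in> ?G" unfolding pull_rel_def mem_Collect_eq prod.case .
      then have "(l2_unweight V u, l2_unweight V v) \<in> push_rel A" by (rule subsetD[OF *])
      then show "(u, v) \<in> A" by (simp only: push_rel_iff)
    qed
  next
    assume *: "pull_rel ?G \<subseteq> A"
    show "?G \<subseteq> push_rel A"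
    proof (rule subrelI)
      fix f g assume fg: "(f, g) \<in> ?G"
      then have "f \<in> L2 V" "g \<in> L2 V" using subsetD[OF L2, of "(f, g)"] by (simp_all only: mem_Sigma_iff)
      then obtain u where u: "f = l2_unweight V u" using range_l2_unweight by blast
      obtain v where v: "g = l2_unweight V v" using \<open>g \<in> L2 V\<close> range_l2_unweight by blast
      note uv = u v
      have "(u, v) \<in> pull_rel ?G" using fg unfolding uv pull_rel_def mem_Collect_eq prod.case .
      then show "(f, g) \<in> push_rel A" unfolding uv push_rel_iff by (rule subsetD[OF *])
    qed
  qed
  obtain A0 where "pull_rel ?G \<subseteq> A0" "selfadjoint_rel A0" using ext by blast
  then have "self_adjoint_extension V ?G (push_rel A0)"
    unfolding self_adjoint_extension_def using G self_adjoint_push_rel by blast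
  then have sae: "self_adjoint_extension V ?G ?A" unfolding neg_weighted_laplacian_def by (rule someI)
  define A where "A = pull_rel ?A"
  have AA: "push_rel A = ?A" unfolding A_def
    using sae by (intro self_adjoint_push_pull) (simp add: self_adjoint_extension_def)
  have sa: "selfadjoint_rel A" and GA: "pull_rel ?G \<subseteq> A"
    using sae G[of A] self_adjoint_push_rel[of A] unfolding AA self_adjoint_extension_def by auto
  obtain F0 where F0: "spectral_resolution A F0" using spectral_resolution_exists[OF sa] by blast
  \<comment> \<open>Witness for existence on the weighted side: the abstract resolution conjugated
    by the isometry.\<close>
  define E0 where "E0 l w = l2_unweight V (F0 l (inv (l2_unweight V) w))" for l w
  have inj: "inj (l2_unweight V)" using l2_unweight_inj by (rule injI)
  have "E0 l (l2_unweight V u) = l2_unweight V (F0 l u)" for l u by (simp add: E0_def inv_f_f[OF inj])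
  then have "spectral_decomposition V ?A E0" using F0 spectral_transfer[of E0 F0 A] unfolding AA by blast
  then have E: "spectral_decomposition V ?A (spectral_projection V)" unfolding spectral_projection_def by (rule someI[where P="spectral_decomposition V ?A"])
  \<comment> \<open>Now in the opposite direction: the chosen weighted projections are pulled back,
    and may differ from \<open>F0\<close>.\<close>
  define F where "F l u = inv (l2_unweight V) (spectral_projection V l (l2_unweight V u))" for l u
  have EF: "spectral_projection V l (l2_unweight V u) = l2_unweight V (F l u)" for l u
  proof -
    have "spectral_projection V l (l2_unweight V u) \<in> L2 V"
      using E l2_unweight_mem[of u]
      unfolding spectral_decomposition_def resolution_of_identity_def orthogonal_projection_def by blast
    then show ?thesis unfolding F_def range_l2_unweight[symmetric] by (simp add: f_inv_into_f)
  qed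
  have F: "spectral_resolution A F" using E spectral_transfer[of "spectral_projection V" F A] EF unfolding AA by blast
  have "spectral_projection V l ` L2 V = l2_unweight V ` range (F l)" for l
    unfolding range_l2_unweight[symmetric] by (auto simp: EF image_image)
  then show ?thesis using that[OF sa GA F] by blast
qed

end

section \<open>Smooth functions and integration by parts\<close>

lemma partial_deriv_eq: "(f has_derivative D) (at x) \<Longrightarrow> partial_deriv b f x = D b"
  unfolding partial_deriv_def using frechet_derivative_at[of f D x] by simp

lemma C_k_pred: "C_k (Suc k) f \<Longrightarrow> C_k k f"
proof (induction k arbitrary: f)
  case 0
  then show ?case by (simp add: differentiable_imp_continuous_on)
next
  case (Suc k)
  then show ?case using C_k.simps(2) by blast
qed

lemma smooth_differentiable: "smooth f \<Longrightarrow> f differentiable (at x)"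
  unfolding smooth_def using C_k.simps(2)[of 0 f] by (auto simp: differentiable_on_def)

lemma smooth_has_derivative: "smooth f \<Longrightarrow> (f has_derivative frechet_derivative f (at x)) (at x)"
  using smooth_differentiable frechet_derivative_works by blast

lemma smooth_partial: "smooth f \<Longrightarrow> b \<in> Basis \<Longrightarrow> smooth (partial_deriv b f)"
  unfolding smooth_def using C_k.simps(2) by blast

lemma smooth_continuous: "smooth f \<Longrightarrow> continuous_on A f"
  unfolding smooth_def using C_k.simps(1)[of f] continuous_on_subset by blast

lemma smooth_isCont: "smooth f \<Longrightarrow> isCont f x"
  using smooth_continuous[of f UNIV] by (simp add: continuous_on_eq_continuous_at)

lemma smooth_measurable: "smooth f \<Longrightarrow> f \<in> borel_measurable borel"
  by (rule borel_measurable_continuous_onI[OF smooth_continuous])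

text \<open>Smoothness from closure: a family of differentiable functions stable under partial
  derivatives replaces any formula for higher derivatives.\<close>

lemma smooth_coinduct:
  assumes f: "f \<in> S" and S: "\<And>g. g \<in> S \<Longrightarrow> g differentiable_on UNIV" "\<And>g b. g \<in> S \<Longrightarrow> b \<in> Basis \<Longrightarrow> partial_deriv b g \<in> S"
  shows "smooth f"
proof -
  have "\<forall>g\<in>S. C_k k g" for k
    by (induction k) (use S in \<open>auto simp: differentiable_imp_continuous_on\<close>)
  then show ?thesis using f by (simp add: smooth_def)
qed

lemma partial_add: "f differentiable (at x) \<Longrightarrow> g differentiable (at x) \<Longrightarrow>
    partial_deriv b (\<lambda>x. f x + g x) x = partial_deriv b f x + partial_deriv b g x"
  unfolding frechet_derivative_works
  by (subst partial_deriv_eq[OF has_derivative_add]) (simp_all add: partial_deriv_def)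

lemma partial_mult: "f differentiable (at x) \<Longrightarrow> g differentiable (at x) \<Longrightarrow>
    partial_deriv b (\<lambda>x. f x * g x) x = f x * partial_deriv b g x + partial_deriv b f x * g x"
  unfolding frechet_derivative_works
  by (subst partial_deriv_eq[OF has_derivative_mult]) (simp_all add: partial_deriv_def)

lemma partial_const: "partial_deriv b (\<lambda>x. c) = (\<lambda>x. 0)"
  using partial_deriv_eq[OF has_derivative_const] by blast

lemma partial_cmult: "f differentiable (at x) \<Longrightarrow> partial_deriv b (\<lambda>x. c * f x) x = c * partial_deriv b f x"
  by (subst partial_mult) (simp_all add: partial_const)

lemma partial_inner: "partial_deriv b (\<lambda>x. x \<bullet> c) = (\<lambda>x. b \<bullet> c)"
  using partial_deriv_eq[OF has_derivative_inner_left[OF has_derivative_ident]] by blast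

lemma partial_compose:
  assumes "f differentiable (at x)" "(\<phi> has_real_derivative d) (at (f x))"
  shows "partial_deriv b (\<lambda>x. \<phi> (f x)) x = d * partial_deriv b f x"
proof -
  have "((\<lambda>x. \<phi> (f x)) has_derivative (\<lambda>h. frechet_derivative f (at x) h * d)) (at x)"
    using has_derivative_compose[OF assms(1)[unfolded frechet_derivative_works] assms(2)[unfolded has_field_derivative_def]]
    by (simp add: mult.commute)
  then show ?thesis by (subst partial_deriv_eq) (simp_all add: partial_deriv_def mult.commute)
qed

lemma frechet_derivative_partial:
  assumes "f differentiable (at x)"
  shows "frechet_derivative f (at x) v = (\<Sum>b\<in>Basis. (v \<bullet> b) * partial_deriv b f x)"
proof -
  have lin: "linear (frechet_derivative f (at x))" using assms by (rule linear_frechet_derivative)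
  have "frechet_derivative f (at x) v = frechet_derivative f (at x) (\<Sum>b\<in>Basis. (v \<bullet> b) *\<^sub>R b)"
    by (simp add: euclidean_representation)
  then show ?thesis by (simp add: linear_sum[OF lin] linear_scale[OF lin] partial_deriv_def)
qed

lemma C_k_const: "C_k k (\<lambda>x. c)"
  by (induction k arbitrary: c) (simp_all add: partial_const)

lemma C_k_add: "C_k k f \<Longrightarrow> C_k k g \<Longrightarrow> C_k k (\<lambda>x. f x + g x)"
proof (induction k arbitrary: f g)
  case (Suc k)
  have d: "f differentiable (at x)" "g differentiable (at x)" for x
    using Suc.prems by (auto simp: differentiable_on_def)
  have "partial_deriv b (\<lambda>x. f x + g x) = (\<lambda>x. partial_deriv b f x + partial_deriv b g x)" for b
    using partial_add[OF d] by blast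
  then show ?case using Suc by (auto simp: differentiable_on_add)
qed (simp add: continuous_on_add)

lemma C_k_mult: "C_k k f \<Longrightarrow> C_k k g \<Longrightarrow> C_k k (\<lambda>x. f x * g x)"
proof (induction k arbitrary: f g)
  case (Suc k)
  have d: "f differentiable (at x)" "g differentiable (at x)" for x
    using Suc.prems by (auto simp: differentiable_on_def)
  have e: "partial_deriv b (\<lambda>x. f x * g x) = (\<lambda>x. f x * partial_deriv b g x + partial_deriv b f x * g x)" for b
    using partial_mult[OF d] by blast
  have "C_k k (partial_deriv b (\<lambda>x. f x * g x))" if "b \<in> Basis" for b
    unfolding e using Suc.prems that C_k_pred[OF Suc.prems(1)] C_k_pred[OF Suc.prems(2)]
    by (intro C_k_add Suc.IH) auto
  then show ?case using Suc.prems by (auto simp: differentiable_on_mult)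
qed (simp add: continuous_on_mult)

lemma smooth_const: "smooth (\<lambda>x. c)"
  by (simp add: smooth_def C_k_const)

lemma smooth_add: "smooth f \<Longrightarrow> smooth g \<Longrightarrow> smooth (\<lambda>x. f x + g x)"
  by (simp add: smooth_def C_k_add)

lemma smooth_mult: "smooth f \<Longrightarrow> smooth g \<Longrightarrow> smooth (\<lambda>x. f x * g x)"
  by (simp add: smooth_def C_k_mult)

lemma smooth_cmult: "smooth f \<Longrightarrow> smooth (\<lambda>x. c * f x)"
  using smooth_mult[OF smooth_const] by blast

lemma smooth_minus: "smooth f \<Longrightarrow> smooth (\<lambda>x. - f x)"
  using smooth_cmult[of f "-1"] by simp

lemma smooth_diff: "smooth f \<Longrightarrow> smooth g \<Longrightarrow> smooth (\<lambda>x. f x - g x)"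
  using smooth_add[of f "\<lambda>x. - g x"] smooth_minus[of g] by simp

lemma smooth_sum: "(\<And>i. i \<in> I \<Longrightarrow> smooth (f i)) \<Longrightarrow> smooth (\<lambda>x. \<Sum>i\<in>I. f i x)"
  by (induction I rule: infinite_finite_induct) (auto intro: smooth_add smooth_const)

lemma smooth_prod: "(\<And>i. i \<in> I \<Longrightarrow> smooth (f i)) \<Longrightarrow> smooth (\<lambda>x. \<Prod>i\<in>I. f i x)"
  by (induction I rule: infinite_finite_induct) (auto intro: smooth_mult smooth_const)

lemma smooth_inner: "smooth (\<lambda>x. x \<bullet> c)"
proof -
  have "(\<lambda>x. x \<bullet> c) differentiable (at x)" for x
    using has_derivative_inner_left[OF has_derivative_ident] differentiableI by blast
  then have "C_k k (\<lambda>x. x \<bullet> c)" for k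
    by (cases k) (auto simp: partial_inner C_k_const differentiable_on_def intro!: continuous_intros)
  then show ?thesis by (simp add: smooth_def)
qed

lemma smooth_norm_sq: "smooth (\<lambda>x. (norm x)\<^sup>2)"
proof -
  have "(\<lambda>x. (norm x)\<^sup>2) = (\<lambda>x::'a. \<Sum>b\<in>Basis. (x \<bullet> b) * (x \<bullet> b))"
    by (simp add: power2_norm_eq_inner fun_eq_iff) (metis euclidean_inner)
  then show ?thesis by (auto intro!: smooth_sum smooth_mult smooth_inner)
qed

text \<open>The outer functions form a family closed under differentiation, such as
  \<open>{exp}\<close> or all \<open>bump_fun p\<close>, so the chain rule leads back into the
  family.\<close>

lemma smooth_compose:
  assumes \<Phi>: "\<And>\<phi>. \<phi> \<in> \<Phi> \<Longrightarrow> \<exists>\<phi>'\<in>\<Phi>. \<forall>t. (\<phi> has_real_derivative \<phi>' t) (at t)"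
    and f: "smooth f" and \<phi>: "\<phi> \<in> \<Phi>"
  shows "smooth (\<lambda>x. \<phi> (f x))"
proof -
  have "\<forall>\<phi>\<in>\<Phi>. C_k k (\<lambda>x. \<phi> (f x))" for k
  proof (induction k)
    case 0
    have "continuous_on UNIV \<phi>" if "\<phi> \<in> \<Phi>" for \<phi>
      using \<Phi>[OF that] by (auto intro!: continuous_at_imp_continuous_on DERIV_isCont)
    then show ?case using smooth_continuous[OF f, of UNIV]
      by (auto intro: continuous_on_compose2)
  next
    case (Suc k)
    show ?case
    proof
      fix \<phi> assume "\<phi> \<in> \<Phi>"
      then obtain \<phi>' where \<phi>': "\<phi>' \<in> \<Phi>" "\<And>t. (\<phi> has_real_derivative \<phi>' t) (at t)" using \<Phi> by blast
      have "(\<lambda>x. \<phi> (f x)) differentiable (at x)" for x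
        using differentiable_compose[of \<phi> f x UNIV] smooth_differentiable[OF f, of x] \<phi>'(2)[of "f x"]
        by (auto simp: real_differentiable_def intro: differentiable_compose)
      moreover have "partial_deriv b (\<lambda>x. \<phi> (f x)) = (\<lambda>x. \<phi>' (f x) * partial_deriv b f x)" for b
        using partial_compose[OF smooth_differentiable[OF f] \<phi>'(2)] by blast
      moreover have "C_k k (\<lambda>x. \<phi>' (f x) * partial_deriv b f x)" if "b \<in> Basis" for b
        using Suc \<phi>'(1) smooth_partial[OF f that] by (intro C_k_mult) (auto simp: smooth_def)
      ultimately show "C_k (Suc k) (\<lambda>x. \<phi> (f x))" by (simp add: differentiable_on_def)
    qed
  qed
  then show ?thesis using \<phi> by (simp add: smooth_def)
qed

lemma smooth_exp: "smooth f \<Longrightarrow> smooth (\<lambda>x. exp (f x))"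
  by (rule smooth_compose[of "{exp}"]) (auto intro: DERIV_exp)

lemma smooth_scale_arg:
  fixes f :: "'a::euclidean_space \<Rightarrow> real"
  assumes "smooth f" shows "smooth (\<lambda>x. f (c *\<^sub>R x))"
    and "partial_deriv b (\<lambda>x. f (c *\<^sub>R x)) x = c * partial_deriv b f (c *\<^sub>R x)"
proof -
  have der: "((\<lambda>x. f (c *\<^sub>R x)) has_derivative (\<lambda>h. frechet_derivative f (at (c *\<^sub>R x)) (c *\<^sub>R h))) (at x)"
    if "smooth f" for f :: "'a \<Rightarrow> real" and x :: 'a
    using has_derivative_compose[OF has_derivative_scaleR_right[OF has_derivative_ident] smooth_has_derivative[OF that]] by simp
  have part: "partial_deriv b (\<lambda>x. f (c *\<^sub>R x)) x = c * partial_deriv b f (c *\<^sub>R x)" if "smooth f" for f :: "'a \<Rightarrow> real" and b and x :: 'a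
  proof -
    have "linear (frechet_derivative f (at (c *\<^sub>R x)))" using smooth_differentiable[OF that] by (rule linear_frechet_derivative)
    then show ?thesis using partial_deriv_eq[OF der[OF that]] by (simp add: partial_deriv_def linear_scale)
  qed
  show "partial_deriv b (\<lambda>x. f (c *\<^sub>R x)) x = c * partial_deriv b f (c *\<^sub>R x)" by (rule part[OF assms])
  let ?S = "{\<lambda>x. a * g (c *\<^sub>R x) | a (g :: 'a \<Rightarrow> real). smooth g}"
  show "smooth (\<lambda>x. f (c *\<^sub>R x))"
  proof (rule smooth_coinduct[of _ ?S])
    show "(\<lambda>x. f (c *\<^sub>R x)) \<in> ?S" using assms by (auto intro!: exI[of _ 1] exI[of _ f])
    have diff: "(\<lambda>x. g (c *\<^sub>R x)) differentiable (at x)" if "smooth g" for g :: "'a \<Rightarrow> real" and x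
      using der[OF that] by (auto simp: differentiable_def)
    fix k assume "k \<in> ?S"
    then obtain a g where k: "k = (\<lambda>x. a * g (c *\<^sub>R x))" and g: "smooth g" by blast
    show "k differentiable_on UNIV" unfolding k differentiable_on_def
      using diff[OF g] by (auto intro!: differentiable_mult)
    fix b :: 'a assume b: "b \<in> Basis"
    have "partial_deriv b k = (\<lambda>x. (a * c) * partial_deriv b g (c *\<^sub>R x))"
      unfolding k using partial_cmult[OF diff[OF g]] part[OF g] by (auto simp: fun_eq_iff)
    then show "partial_deriv b k \<in> ?S" using smooth_partial[OF g b] by blast
  qed
qed

lemma line_derivative:
  assumes "smooth f"
  shows "((\<lambda>s. f (y + s *\<^sub>R b)) has_real_derivative partial_deriv b f (y + s *\<^sub>R b)) (at s)"
proof -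
  have "((\<lambda>s. y + s *\<^sub>R b) has_derivative (\<lambda>h. h *\<^sub>R b)) (at s)" by (auto intro!: derivative_eq_intros)
  from has_derivative_compose[OF this smooth_has_derivative[OF assms]]
  have "((\<lambda>s. f (y + s *\<^sub>R b)) has_derivative (\<lambda>h. frechet_derivative f (at (y + s *\<^sub>R b)) (h *\<^sub>R b))) (at s)" .
  moreover have "linear (frechet_derivative f (at (y + s *\<^sub>R b)))"
    using smooth_differentiable[OF assms] by (rule linear_frechet_derivative)
  ultimately show ?thesis by (simp add: has_field_derivative_def linear_scale partial_deriv_def mult.commute[of _ "frechet_derivative _ _ _"])
qed

lemma line_mean_value:
  assumes "smooth f" "h > 0"
  obtains \<xi> where "0 < \<xi>" "\<xi> < h" "f (y + h *\<^sub>R b) - f y = h * partial_deriv b f (y + \<xi> *\<^sub>R b)"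
  using MVT2[of 0 h "\<lambda>s. f (y + s *\<^sub>R b)" "\<lambda>s. partial_deriv b f (y + s *\<^sub>R b)"] assms line_derivative[OF assms(1)] by auto

text \<open>Two applications of the mean value theorem. The second difference is symmetric in
  \<open>b\<close> and \<open>c\<close>, whence the symmetry of second derivatives.\<close>

lemma second_difference_limit:
  fixes f :: "'a::euclidean_space \<Rightarrow> real"
  assumes f: "smooth f" and b: "b \<in> Basis" and c: "c \<in> Basis"
  shows "(\<lambda>n. (f (x + (1 / Suc n) *\<^sub>R b + (1 / Suc n) *\<^sub>R c) - f (x + (1 / Suc n) *\<^sub>R b) - f (x + (1 / Suc n) *\<^sub>R c) + f x) * (real (Suc n))\<^sup>2)
    \<longlonglongrightarrow> partial_deriv c (partial_deriv b f) x"
proof -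
  define h where "h n = 1 / real (Suc n)" for n
  have h0: "h n > 0" for n by (simp add: h_def)
  have h_lim: "h \<longlonglongrightarrow> 0" unfolding h_def by (rule LIMSEQ_Suc[OF lim_1_over_n])
  have "\<exists>\<xi> \<eta>. 0 < \<xi> \<and> \<xi> < h n \<and> 0 < \<eta> \<and> \<eta> < h n \<and>
    f (x + h n *\<^sub>R b + h n *\<^sub>R c) - f (x + h n *\<^sub>R b) - f (x + h n *\<^sub>R c) + f x
      = h n * h n * partial_deriv c (partial_deriv b f) (x + \<xi> *\<^sub>R b + \<eta> *\<^sub>R c)" for n
  proof -
    have "\<exists>\<xi>. 0 < \<xi> \<and> \<xi> < h n \<and> (f (x + h n *\<^sub>R c + h n *\<^sub>R b) - f (x + h n *\<^sub>R b)) - (f (x + h n *\<^sub>R c + 0 *\<^sub>R b) - f (x + 0 *\<^sub>R b))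
        = (h n - 0) * (partial_deriv b f (x + h n *\<^sub>R c + \<xi> *\<^sub>R b) - partial_deriv b f (x + \<xi> *\<^sub>R b))"
      by (rule MVT2[OF h0]) (intro DERIV_diff line_derivative[OF f])
    then obtain \<xi> where \<xi>: "0 < \<xi>" "\<xi> < h n" and e: "f (x + h n *\<^sub>R c + h n *\<^sub>R b) - f (x + h n *\<^sub>R b) - (f (x + h n *\<^sub>R c) - f x)
        = h n * (partial_deriv b f (x + h n *\<^sub>R c + \<xi> *\<^sub>R b) - partial_deriv b f (x + \<xi> *\<^sub>R b))" by auto
    obtain \<eta> where \<eta>: "0 < \<eta>" "\<eta> < h n" and e': "partial_deriv b f ((x + \<xi> *\<^sub>R b) + h n *\<^sub>R c) - partial_deriv b f (x + \<xi> *\<^sub>R b)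
        = h n * partial_deriv c (partial_deriv b f) (x + \<xi> *\<^sub>R b + \<eta> *\<^sub>R c)"
      using line_mean_value[OF smooth_partial[OF f b] h0] by blast
    have "x + h n *\<^sub>R c + \<xi> *\<^sub>R b = (x + \<xi> *\<^sub>R b) + h n *\<^sub>R c" "x + h n *\<^sub>R c + h n *\<^sub>R b = x + h n *\<^sub>R b + h n *\<^sub>R c" by simp_all
    then show ?thesis using \<xi> \<eta> e e' by (intro exI[of _ \<xi>] exI[of _ \<eta>]) (simp add: algebra_simps)
  qed
  then obtain \<xi> \<eta> where xe: "\<And>n. 0 < \<xi> n" "\<And>n. \<xi> n < h n" "\<And>n. 0 < \<eta> n" "\<And>n. \<eta> n < h n"
    and eq: "\<And>n. f (x + h n *\<^sub>R b + h n *\<^sub>R c) - f (x + h n *\<^sub>R b) - f (x + h n *\<^sub>R c) + f x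
      = h n * h n * partial_deriv c (partial_deriv b f) (x + \<xi> n *\<^sub>R b + \<eta> n *\<^sub>R c)" by metis
  have "\<xi> \<longlonglongrightarrow> 0" by (rule tendsto_sandwich[OF _ _ tendsto_const h_lim]) (auto intro!: always_eventually less_imp_le xe)
  moreover have "\<eta> \<longlonglongrightarrow> 0" by (rule tendsto_sandwich[OF _ _ tendsto_const h_lim]) (auto intro!: always_eventually less_imp_le xe)
  ultimately have "(\<lambda>n. x + \<xi> n *\<^sub>R b + \<eta> n *\<^sub>R c) \<longlonglongrightarrow> x + 0 *\<^sub>R b + 0 *\<^sub>R c" by (intro tendsto_intros)
  then have "(\<lambda>n. x + \<xi> n *\<^sub>R b + \<eta> n *\<^sub>R c) \<longlonglongrightarrow> x" by simp
  then have "(\<lambda>n. partial_deriv c (partial_deriv b f) (x + \<xi> n *\<^sub>R b + \<eta> n *\<^sub>R c)) \<longlonglongrightarrow> partial_deriv c (partial_deriv b f) x"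
    by (rule isCont_tendsto_compose[OF smooth_isCont[OF smooth_partial[OF smooth_partial[OF f b] c]]])
  moreover have "(f (x + h n *\<^sub>R b + h n *\<^sub>R c) - f (x + h n *\<^sub>R b) - f (x + h n *\<^sub>R c) + f x) * (real (Suc n))\<^sup>2
      = partial_deriv c (partial_deriv b f) (x + \<xi> n *\<^sub>R b + \<eta> n *\<^sub>R c)" for n
  proof -
    have "h n * h n * (real (Suc n))\<^sup>2 = 1" unfolding h_def by (simp add: power2_eq_square)
    then have "h n * h n * y * (real (Suc n))\<^sup>2 = y" for y
      using arg_cong[of _ _ "\<lambda>a. a * y"] by (simp only: mult_ac mult_1_right)
    then show ?thesis unfolding eq .
  qed
  ultimately show ?thesis unfolding h_def by simp
qed

lemma partial_commute:
  fixes f :: "'a::euclidean_space \<Rightarrow> real"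
  assumes "smooth f" "b \<in> Basis" "c \<in> Basis"
  shows "partial_deriv b (partial_deriv c f) x = partial_deriv c (partial_deriv b f) x"
proof (rule LIMSEQ_unique)
  let ?D = "\<lambda>n. (f (x + (1 / Suc n) *\<^sub>R b + (1 / Suc n) *\<^sub>R c) - f (x + (1 / Suc n) *\<^sub>R b) - f (x + (1 / Suc n) *\<^sub>R c) + f x) * (real (Suc n))\<^sup>2"
  show "?D \<longlonglongrightarrow> partial_deriv c (partial_deriv b f) x" by (rule second_difference_limit[OF assms])
  have "x + (1 / Suc n) *\<^sub>R c + (1 / Suc n) *\<^sub>R b = x + (1 / Suc n) *\<^sub>R b + (1 / Suc n) *\<^sub>R c" for n by simp
  then show "?D \<longlonglongrightarrow> partial_deriv b (partial_deriv c f) x"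
    using second_difference_limit[OF assms(1,3,2), of x] by (simp add: algebra_simps)
qed

section \<open>Flat functions and test functions\<close>

lemma tendsto_poly_exp_zero: "((\<lambda>y. poly p y / exp y) \<longlongrightarrow> (0::real)) at_top"
proof -
  have "((\<lambda>y. \<Sum>i\<le>degree p. coeff p i * (y ^ i / exp y)) \<longlongrightarrow> (\<Sum>i\<le>degree p. coeff p i * 0)) at_top"
    by (intro tendsto_sum tendsto_mult tendsto_const tendsto_power_div_exp_0)
  then show ?thesis by (simp add: poly_altdef sum_divide_distrib)
qed

text \<open>The factor \<open>poly p (1 / t)\<close> makes the family closed under differentiation,
  so one argument at \<open>t = 0\<close> covers all derivatives of
  \<open>exp (- 1 / t)\<close>.\<close>

definition bump_fun :: "real poly \<Rightarrow> real \<Rightarrow> real" where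
  "bump_fun p t = (if t \<le> 0 then 0 else poly p (1 / t) * exp (- 1 / t))"

lemma bump_fun_at_right: "(bump_fun p \<longlongrightarrow> 0) (at_right 0)"
proof -
  have "((\<lambda>t. poly p (inverse t) / exp (inverse t)) \<longlongrightarrow> 0) (at_right 0)"
    using filterlim_compose[OF tendsto_poly_exp_zero filterlim_inverse_at_top_right] .
  then show ?thesis
  proof (rule Lim_transform_eventually)
    show "\<forall>\<^sub>F t in at_right 0. poly p (inverse t) / exp (inverse t) = bump_fun p t"
      using eventually_at_right_less[of "0::real"]
      by eventually_elim (simp add: bump_fun_def exp_minus divide_inverse)
  qed
qed

text \<open>With \<open>X = 1 / t\<close> one has \<open>dX/dt = - X\<^sup>2\<close>, and
  \<open>exp (- X)\<close> has derivative \<open>X\<^sup>2 * exp (- X)\<close>; hence the polynomial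
  \<open>X\<^sup>2 * (p - p')\<close>.\<close>

lemma bump_fun_derivative:
  "(bump_fun p has_real_derivative bump_fun ([:0, 0, 1:] * (p - pderiv p)) t) (at t)"
proof -
  consider "t < 0" | "t = 0" | "t > 0" by linarith
  then show ?thesis
  proof cases
    case 1
    then have "((\<lambda>t. 0) has_real_derivative 0) (at t)" by simp
    then have "(bump_fun p has_real_derivative 0) (at t)"
      by (rule has_field_derivative_transform_within_open[of _ _ _ "{..<0}"]) (use 1 in \<open>auto simp: bump_fun_def\<close>)
    then show ?thesis using 1 by (simp add: bump_fun_def)
  next
    case 3
    have "((\<lambda>t. poly p (1 / t) * exp (- 1 / t)) has_real_derivative
        (poly (pderiv p) (1 / t) * (- 1 / t\<^sup>2)) * exp (- 1 / t) + (exp (- 1 / t) * (1 / t\<^sup>2)) * poly p (1 / t)) (at t)"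
      using 3 by (auto intro!: derivative_eq_intros DERIV_chain'[where g="poly p" and f="\<lambda>t. 1 / t"] poly_DERIV simp: power2_eq_square)
    then have "(bump_fun p has_real_derivative
        (poly (pderiv p) (1 / t) * (- 1 / t\<^sup>2)) * exp (- 1 / t) + (exp (- 1 / t) * (1 / t\<^sup>2)) * poly p (1 / t)) (at t)"
      by (rule has_field_derivative_transform_within_open[of _ _ _ "{0<..}"]) (use 3 in \<open>auto simp: bump_fun_def\<close>)
    then show ?thesis using 3 by (simp add: bump_fun_def power2_eq_square algebra_simps)
  next
    case 2
    \<comment> \<open>For positive \<open>s\<close> the difference quotient at 0 is again a member
      of the family, for the polynomial \<open>[:0, 1:] * p\<close>, and all members tend to 0 from
      the right.\<close>
    have "((\<lambda>s. (bump_fun p s - bump_fun p 0) / (s - 0)) \<longlongrightarrow> 0) (at_right 0)"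
      by (rule Lim_transform_eventually[OF bump_fun_at_right[of "[:0, 1:] * p"]])
        (use eventually_at_right_less[of "0::real"] in \<open>eventually_elim, simp add: bump_fun_def\<close>)
    moreover have "((\<lambda>s. (bump_fun p s - bump_fun p 0) / (s - 0)) \<longlongrightarrow> 0) (at_left 0)"
    proof (rule Lim_transform_eventually[OF tendsto_const])
      show "\<forall>\<^sub>F s in at_left 0. 0 = (bump_fun p s - bump_fun p 0) / (s - 0)"
        by (subst eventually_at_left[of "-1"]) (auto simp: bump_fun_def intro!: exI[of _ "-1"])
    qed
    ultimately have "((\<lambda>s. (bump_fun p s - bump_fun p 0) / (s - 0)) \<longlongrightarrow> 0) (at 0)"
      by (simp add: filterlim_at_split)
    then show ?thesis unfolding 2 has_field_derivative_iff by (simp add: bump_fun_def)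
  qed
qed

lemma smooth_bump: "smooth f \<Longrightarrow> smooth (\<lambda>x. bump_fun p (f x))"
  by (rule smooth_compose[of "range bump_fun"]) (use bump_fun_derivative in blast)+

lemma test_function_iff: "test_function f \<longleftrightarrow> smooth f \<and> (\<exists>R. \<forall>x. R < norm x \<longrightarrow> f x = 0)"
proof -
  have "compact (closure {x. f x \<noteq> 0}) \<longleftrightarrow> bounded {x. f x \<noteq> 0}"
    using bounded_closure bounded_subset[OF _ closure_subset] by (auto simp: compact_eq_bounded_closed)
  also have "\<dots> \<longleftrightarrow> (\<exists>R. \<forall>x. R < norm x \<longrightarrow> f x = 0)"
    unfolding bounded_iff by (auto simp: not_less[symmetric])
  finally show ?thesis by (simp add: test_function_def)
qed

lemma test_function_smooth: "test_function f \<Longrightarrow> smooth f"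
  by (simp add: test_function_def)

lemma test_function_zero: "test_function (\<lambda>x. 0)"
  by (simp add: test_function_iff smooth_const)

lemma test_function_add: "test_function f \<Longrightarrow> test_function g \<Longrightarrow> test_function (\<lambda>x. f x + g x)"
  unfolding test_function_iff
proof (elim conjE exE, intro conjI smooth_add)
  fix R Q assume "\<forall>x. R < norm x \<longrightarrow> f x = 0" "\<forall>x. Q < norm x \<longrightarrow> g x = 0"
  then show "\<exists>R. \<forall>x. R < norm x \<longrightarrow> f x + g x = 0" by (intro exI[of _ "max R Q"]) auto
qed

lemma test_function_mult: "test_function f \<Longrightarrow> smooth g \<Longrightarrow> test_function (\<lambda>x. f x * g x)"
  unfolding test_function_iff using smooth_mult by fastforce

lemma test_function_cmult: "test_function f \<Longrightarrow> test_function (\<lambda>x. c * f x)"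
  using test_function_mult[OF _ smooth_const, of f c] by (simp add: mult.commute)

lemma partial_vanish:
  fixes f :: "'a::euclidean_space \<Rightarrow> real"
  assumes "\<forall>x. R < norm x \<longrightarrow> f x = 0" "R < norm x" shows "partial_deriv b f x = 0"
proof -
  have "open {x::'a. R < norm x}" by (intro open_Collect_less continuous_intros)
  then have "(f has_derivative (\<lambda>h. 0)) (at x)"
    by (rule has_derivative_transform_within_open[OF has_derivative_const[of 0]]) (use assms in auto)
  then show ?thesis by (simp add: partial_deriv_eq)
qed

lemma test_function_partial: "test_function f \<Longrightarrow> b \<in> Basis \<Longrightarrow> test_function (partial_deriv b f)"
  unfolding test_function_iff using smooth_partial partial_vanish by metis

lemma test_function_bounded:
  assumes "test_function f" obtains B where "B \<ge> 0" "\<And>x. \<bar>f x\<bar> \<le> B"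
proof -
  obtain R where f: "smooth f" and R: "\<And>x. R < norm x \<Longrightarrow> f x = 0" using assms unfolding test_function_iff by blast
  have "bounded (f ` cball 0 R)"
    by (intro compact_imp_bounded compact_continuous_image smooth_continuous f) simp
  then obtain B where "\<forall>y\<in>f ` cball 0 R. norm y \<le> B" unfolding bounded_iff by blast
  then have B: "\<bar>f x\<bar> \<le> B" if "x \<in> cball 0 R" for x using that by simp
  have "\<bar>f x\<bar> \<le> max B 0" for x
    using B[of x] R[of x] by (cases "R < norm x") auto
  then show ?thesis using that[of "max B 0"] by simp
qed

lemma compact_support_integrable:
  fixes f :: "'a::euclidean_space \<Rightarrow> real"
  assumes "continuous_on UNIV f" "\<forall>x. R < norm x \<longrightarrow> f x = 0"
  shows "integrable lborel f"
proof -
  have "integrable lborel (\<lambda>x. indicator (cball 0 R) x *\<^sub>R f x)"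
    by (rule borel_integrable_compact) (use continuous_on_subset[OF assms(1)] in auto)
  also have "(\<lambda>x. indicator (cball 0 R) x *\<^sub>R f x) = f"
    using assms(2) by (auto simp: indicator_def fun_eq_iff not_le)
  finally show ?thesis .
qed

lemma test_function_integrable: "test_function f \<Longrightarrow> integrable lborel f"
  unfolding test_function_iff using compact_support_integrable smooth_continuous by blast

text \<open>Difference quotients have integral 0 by translation invariance, and they converge to the
  derivative under a common integrable bound.\<close>

lemma integral_partial_zero:
  assumes F: "test_function F" and b: "b \<in> Basis"
  shows "(\<integral>x. partial_deriv b F x \<partial>lborel) = 0"
proof -
  obtain R where sm: "smooth F" and R: "\<And>x. R < norm x \<Longrightarrow> F x = 0" using F unfolding test_function_iff by blast
  define h where "h n = 1 / real (Suc n)" for n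
  have h0: "h n > 0" "h n \<le> 1" for n by (auto simp: h_def)
  have h_lim: "h \<longlonglongrightarrow> 0" unfolding h_def by (rule LIMSEQ_Suc[OF lim_1_over_n])
  obtain B where B: "B \<ge> 0" "\<And>x. \<bar>partial_deriv b F x\<bar> \<le> B"
    using test_function_bounded[OF test_function_partial[OF F b]] by metis
  have [measurable]: "F \<in> borel_measurable borel" "partial_deriv b F \<in> borel_measurable borel"
    using sm b by (auto intro: smooth_measurable smooth_partial)
  define D where "D n x = (F (x + h n *\<^sub>R b) - F x) / h n" for n x
  have "\<exists>\<xi>. 0 < \<xi> \<and> \<xi> < h n \<and> D n x = partial_deriv b F (x + \<xi> *\<^sub>R b)" for n x
  proof -
    obtain \<xi> where "0 < \<xi>" "\<xi> < h n" "F (x + h n *\<^sub>R b) - F x = h n * partial_deriv b F (x + \<xi> *\<^sub>R b)"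
      using line_mean_value[OF sm h0(1)] by blast
    then show ?thesis using h0[of n] by (auto simp: D_def)
  qed
  then obtain \<xi> where \<xi>: "\<And>n x. 0 < \<xi> n x" "\<And>n x. \<xi> n x < h n" "\<And>n x. D n x = partial_deriv b F (x + \<xi> n x *\<^sub>R b)"
    by metis
  have "(\<lambda>n. \<integral>x. D n x \<partial>lborel) \<longlonglongrightarrow> (\<integral>x. partial_deriv b F x \<partial>lborel)"
  \<comment> \<open>The steps are at most 1, so all difference quotients vanish outside the ball of
    radius \<open>R + 1\<close>.\<close>
  proof (rule integral_dominated_convergence[where w="\<lambda>x. B * indicator (cball 0 (R + 1)) x"])
    show "integrable lborel (\<lambda>x. B * indicator (cball 0 (R + 1)) x)"
      using emeasure_lborel_cball_finite[of 0 "R + 1"] by (intro integrable_mult_right integrable_real_indicator) auto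
    show "AE x in lborel. (\<lambda>n. D n x) \<longlonglongrightarrow> partial_deriv b F x"
    proof (rule AE_I2)
      fix x
      have "(\<lambda>n. \<xi> n x) \<longlonglongrightarrow> 0"
        by (rule tendsto_sandwich[OF _ _ tendsto_const h_lim]) (auto intro!: always_eventually less_imp_le \<xi>)
      then have "(\<lambda>n. x + \<xi> n x *\<^sub>R b) \<longlonglongrightarrow> x + 0 *\<^sub>R b" by (intro tendsto_intros)
      then have "(\<lambda>n. x + \<xi> n x *\<^sub>R b) \<longlonglongrightarrow> x" by simp
      then show "(\<lambda>n. D n x) \<longlonglongrightarrow> partial_deriv b F x"
        unfolding \<xi>(3) by (rule isCont_tendsto_compose[OF smooth_isCont[OF smooth_partial[OF sm b]]])
    qed
    show "AE x in lborel. norm (D n x) \<le> B * indicator (cball 0 (R + 1)) x" for n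
    proof (rule AE_I2)
      fix x
      show "norm (D n x) \<le> B * indicator (cball 0 (R + 1)) x"
      proof (cases "norm x \<le> R + 1")
        case True
        then show ?thesis using B(2) by (simp add: \<xi>(3))
      next
        case False
        have "norm x \<le> norm (x + \<xi> n x *\<^sub>R b) + norm (\<xi> n x *\<^sub>R b)"
          using norm_triangle_ineq4[of "x + \<xi> n x *\<^sub>R b" "\<xi> n x *\<^sub>R b"] by simp
        also have "norm (\<xi> n x *\<^sub>R b) \<le> 1" using \<xi>(1,2)[of n x] h0(2)[of n] b by (auto simp: abs_of_pos)
        finally have "R < norm (x + \<xi> n x *\<^sub>R b)" using False by simp
        then show ?thesis using False partial_vanish[of R F] R by (simp add: \<xi>(3))
      qed
    qed
  qed (simp_all add: D_def)
  moreover have "(\<integral>x. D n x \<partial>lborel) = 0" for n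
  proof -
    have int: "integrable lborel F" by (rule test_function_integrable[OF F])
    have int': "integrable lborel (\<lambda>x. F (h n *\<^sub>R b + x))"
      using int integrable_distr_eq[of "(+) (h n *\<^sub>R b)" lborel borel F] by (simp add: lborel_distr_plus)
    have "(\<integral>x. F (h n *\<^sub>R b + x) \<partial>lborel) = (\<integral>x. F x \<partial>lborel)"
      using integral_distr[of "(+) (h n *\<^sub>R b)" lborel borel F] by (simp add: lborel_distr_plus)
    then have "(\<integral>x. F (x + h n *\<^sub>R b) - F x \<partial>lborel) = 0"
      using int int' by (simp add: add.commute)
    then show ?thesis by (simp add: D_def)
  qed
  ultimately show ?thesis by (simp add: LIMSEQ_const_iff)
qed

lemma grad_inner: "grad f x \<bullet> grad g x = (\<Sum>b\<in>Basis. partial_deriv b f x * partial_deriv b g x)"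
proof -
  have "b \<bullet> grad g x = partial_deriv b g x" if "b \<in> Basis" for b
    using that unfolding grad_def by (simp add: inner_sum_right inner_Basis if_distrib cong: if_cong)
  then show ?thesis unfolding grad_def[of f] by (simp add: inner_sum_left)
qed

lemma grad_Basis: "b \<in> Basis \<Longrightarrow> grad f x \<bullet> b = partial_deriv b f x"
  unfolding grad_def by (simp add: inner_sum_left inner_Basis if_distrib cong: if_cong)

lemma weighted_laplacian_eq:
  "weighted_laplacian V f x = (\<Sum>b\<in>Basis. partial_deriv b (partial_deriv b f) x - partial_deriv b V x * partial_deriv b f x)"
  by (simp add: weighted_laplacian_def laplacian_def grad_inner sum_subtractf)

lemma hessian_inner:
  assumes V: "smooth V"
  shows "hessian V x v \<bullet> v = (\<Sum>b\<in>Basis. \<Sum>c\<in>Basis. (v \<bullet> c) * partial_deriv c (partial_deriv b V) x * (v \<bullet> b))"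
proof -
  have "((\<lambda>x. \<Sum>b\<in>Basis. partial_deriv b V x *\<^sub>R b) has_derivative
      (\<lambda>h. \<Sum>b\<in>Basis. frechet_derivative (partial_deriv b V) (at x) h *\<^sub>R b)) (at x)"
    using smooth_has_derivative[OF smooth_partial[OF V]]
    by (intro has_derivative_sum has_derivative_scaleR_left) blast
  moreover have "(\<lambda>x. \<Sum>b\<in>Basis. partial_deriv b V x *\<^sub>R b) = grad V" by (simp add: grad_def fun_eq_iff)
  ultimately have "(grad V has_derivative (\<lambda>h. \<Sum>b\<in>Basis. frechet_derivative (partial_deriv b V) (at x) h *\<^sub>R b)) (at x)"
    by simp
  then have "hessian V x = (\<lambda>h. \<Sum>b\<in>Basis. frechet_derivative (partial_deriv b V) (at x) h *\<^sub>R b)"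
    unfolding hessian_def by (rule frechet_derivative_at[symmetric])
  then have "hessian V x v \<bullet> v = (\<Sum>b\<in>Basis. frechet_derivative (partial_deriv b V) (at x) v * (v \<bullet> b))"
    by (simp add: inner_sum_left) (simp add: inner_commute)
  then show ?thesis
    using smooth_differentiable[OF smooth_partial[OF V]]
    by (simp add: frechet_derivative_partial sum_distrib_right)
qed

context
  fixes V :: "'a::euclidean_space \<Rightarrow> real"
  assumes V: "smooth V"
begin

lemma V_measurable [measurable]: "V \<in> borel_measurable borel"
  using V by (rule smooth_measurable)

lemma smooth_weight: "smooth (\<lambda>x. exp (- V x))"
  by (intro smooth_exp smooth_minus V)

lemma smooth_weighted_laplacian: "smooth f \<Longrightarrow> smooth (weighted_laplacian V f)"
  unfolding weighted_laplacian_eq[abs_def] by (intro smooth_sum smooth_diff smooth_mult smooth_partial V)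

lemma test_function_weighted_laplacian: "test_function f \<Longrightarrow> test_function (weighted_laplacian V f)"
proof -
  assume f: "test_function f"
  then obtain R where R: "\<forall>x. R < norm x \<longrightarrow> f x = 0" unfolding test_function_iff by blast
  have "weighted_laplacian V f x = 0" if "R < norm x" for x
    using partial_vanish[OF R] partial_vanish[of R "partial_deriv _ f"] that by (simp add: weighted_laplacian_eq)
  then show ?thesis using f smooth_weighted_laplacian unfolding test_function_iff by blast
qed

lemma test_function_weight_integrable: "test_function g \<Longrightarrow> integrable lborel (\<lambda>x. exp (- V x) * g x)"
  using test_function_integrable[OF test_function_mult[OF _ smooth_weight], of g] by (simp add: mult.commute)

lemma test_function_square_integrable: "test_function f \<Longrightarrow> weighted_square_integrable V f"
proof -
  assume f: "test_function f"
  have "test_function (\<lambda>x. f x * (exp (- V x) * f x))"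
    by (intro test_function_mult f smooth_mult smooth_weight test_function_smooth)
  moreover have "(\<lambda>x. f x * (exp (- V x) * f x)) = (\<lambda>x. exp (- V x) * (f x)\<^sup>2)"
    by (simp add: fun_eq_iff power2_eq_square)
  ultimately show ?thesis
    unfolding weighted_square_integrable_def using f test_function_integrable
    by (auto intro: smooth_measurable test_function_smooth)
qed

text \<open>The \<open>F b\<close> are the components of the compactly supported field
  \<open>exp (- V) * g * grad f\<close>, whose divergence is the sum of the two integrands. Compact
  support of one factor is enough, so \<open>g\<close> may later be taken as a smooth expression in
  \<open>f\<close>.\<close>

lemma weighted_integration_by_parts:
  assumes f: "smooth f" and g: "smooth g" and fg: "test_function f \<or> test_function g"
  shows "(\<integral>x. exp (- V x) * (weighted_laplacian V f x * g x) \<partial>lborel)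
    = - (\<integral>x. exp (- V x) * (\<Sum>b\<in>Basis. partial_deriv b f x * partial_deriv b g x) \<partial>lborel)"
proof -
  let ?W = "\<lambda>x. exp (- V x)"
  define F where "F b x = ?W x * (partial_deriv b f x * g x)" for b x
  have F_test: "test_function (F b)" if "b \<in> Basis" for b
    using fg
  proof
    assume "test_function f"
    then have "test_function (\<lambda>x. partial_deriv b f x * (?W x * g x))"
      by (intro test_function_mult test_function_partial that smooth_mult smooth_weight g)
    then show ?thesis unfolding F_def by (simp add: mult_ac)
  next
    assume "test_function g"
    then have "test_function (\<lambda>x. g x * (?W x * partial_deriv b f x))"
      by (intro test_function_mult that smooth_mult smooth_weight smooth_partial f)
    then show ?thesis unfolding F_def by (simp add: mult_ac)
  qed
  have dW: "partial_deriv b ?W x = - partial_deriv b V x * ?W x" if "b \<in> Basis" for b x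
  proof -
    have "partial_deriv b ?W x = exp (- V x) * partial_deriv b (\<lambda>x. - V x) x"
      by (rule partial_compose) (auto intro: smooth_differentiable smooth_minus V DERIV_exp)
    also have "partial_deriv b (\<lambda>x. - V x) x = - partial_deriv b V x"
      using partial_cmult[OF smooth_differentiable[OF V], of b "-1"] by simp
    finally show ?thesis by simp
  qed
  have dF: "partial_deriv b (F b) x
      = ?W x * ((partial_deriv b (partial_deriv b f) x - partial_deriv b V x * partial_deriv b f x) * g x)
      + ?W x * (partial_deriv b f x * partial_deriv b g x)" if b: "b \<in> Basis" for b x
  proof -
    have "partial_deriv b (F b) x = ?W x * partial_deriv b (\<lambda>x. partial_deriv b f x * g x) x
        + partial_deriv b ?W x * (partial_deriv b f x * g x)"
      unfolding F_def[abs_def]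
      by (rule partial_mult) (intro smooth_differentiable smooth_weight smooth_mult smooth_partial f g b)+
    also have "partial_deriv b (\<lambda>x. partial_deriv b f x * g x) x
        = partial_deriv b f x * partial_deriv b g x + partial_deriv b (partial_deriv b f) x * g x"
      by (rule partial_mult) (intro smooth_differentiable smooth_partial f g b)+
    finally show ?thesis unfolding dW[OF b] by (simp add: algebra_simps)
  qed
  have "test_function (\<lambda>x. (weighted_laplacian V f x * g x))"
    using fg test_function_mult[OF test_function_weighted_laplacian g, of f]
      test_function_mult[of g "weighted_laplacian V f"] smooth_weighted_laplacian[OF f] by (auto simp: mult.commute)
  then have i1: "integrable lborel (\<lambda>x. ?W x * (weighted_laplacian V f x * g x))"
    by (rule test_function_weight_integrable)
  have t: "test_function (\<lambda>x. partial_deriv b f x * partial_deriv b g x)" if "b \<in> Basis" for b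
    using fg test_function_mult[OF test_function_partial[OF _ that] smooth_partial[OF g that], of f]
      test_function_mult[OF test_function_partial[OF _ that] smooth_partial[OF f that], of g] by (auto simp: mult.commute)
  have i2': "integrable lborel (\<lambda>x. ?W x * (partial_deriv b f x * partial_deriv b g x))" if "b \<in> Basis" for b
    by (rule test_function_weight_integrable[OF t[OF that]])
  have i2: "integrable lborel (\<lambda>x. ?W x * (\<Sum>b\<in>Basis. partial_deriv b f x * partial_deriv b g x))"
    unfolding sum_distrib_left using i2' by (rule Bochner_Integration.integrable_sum)
  have "(\<integral>x. (\<Sum>b\<in>Basis. partial_deriv b (F b) x) \<partial>lborel) = (\<Sum>b\<in>Basis. \<integral>x. partial_deriv b (F b) x \<partial>lborel)"
    by (rule Bochner_Integration.integral_sum) (intro test_function_integrable test_function_partial F_test)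
  also have "\<dots> = 0" using integral_partial_zero[OF F_test] by simp
  also have "(\<lambda>x. \<Sum>b\<in>Basis. partial_deriv b (F b) x)
      = (\<lambda>x. ?W x * (weighted_laplacian V f x * g x) + ?W x * (\<Sum>b\<in>Basis. partial_deriv b f x * partial_deriv b g x))"
    by (simp add: fun_eq_iff dF weighted_laplacian_eq sum.distrib sum_distrib_left sum_distrib_right)
  finally show ?thesis using i1 i2 by simp
qed

lemma inner_weighted_laplacian:
  assumes f: "test_function f" and g: "test_function g"
  shows "l2_class V (\<lambda>x. - weighted_laplacian V f x) \<bullet> l2_class V g
    = (\<Sum>b\<in>Basis. l2_class V (partial_deriv b f) \<bullet> l2_class V (partial_deriv b g))"
proof -
  have sq: "weighted_square_integrable V (partial_deriv b f)" "weighted_square_integrable V (partial_deriv b g)" if "b \<in> Basis" for b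
    using that f g by (auto intro: test_function_square_integrable test_function_partial)
  have sL: "weighted_square_integrable V (\<lambda>x. - weighted_laplacian V f x)"
    using test_function_square_integrable[OF test_function_cmult[OF test_function_weighted_laplacian[OF f], of "-1"]] by simp
  have t: "integrable lborel (\<lambda>x. exp (- V x) * (partial_deriv b f x * partial_deriv b g x))" if "b \<in> Basis" for b
  proof -
    have "test_function (\<lambda>x. partial_deriv b f x * (exp (- V x) * partial_deriv b g x))"
      by (intro test_function_mult test_function_partial f that smooth_mult smooth_weight smooth_partial test_function_smooth g)
    from test_function_integrable[OF this] show ?thesis by (simp add: mult.left_commute)
  qed
  have "l2_class V (\<lambda>x. - weighted_laplacian V f x) \<bullet> l2_class V g
      = - (\<integral>x. exp (- V x) * (weighted_laplacian V f x * g x) \<partial>lborel)"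
    by (simp add: inner_l2_class[OF V_measurable sL test_function_square_integrable[OF g]])
  also have "\<dots> = (\<integral>x. (\<Sum>b\<in>Basis. exp (- V x) * (partial_deriv b f x * partial_deriv b g x)) \<partial>lborel)"
    using f g by (subst weighted_integration_by_parts) (auto intro: test_function_smooth simp: sum_distrib_left)
  also have "\<dots> = (\<Sum>b\<in>Basis. \<integral>x. exp (- V x) * (partial_deriv b f x * partial_deriv b g x) \<partial>lborel)"
    using t by (rule Bochner_Integration.integral_sum)
  finally show ?thesis by (simp add: inner_l2_class[OF V_measurable sq])
qed

text \<open>The commutator of a partial derivative with the weighted Laplacian is the Hessian of
  \<open>V\<close> applied to the gradient of \<open>f\<close>; this is where the curvature bound
  will enter.\<close>

lemma partial_weighted_laplacian:
  assumes f: "smooth f" and b: "b \<in> Basis"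
  shows "partial_deriv b (weighted_laplacian V f) x
    = weighted_laplacian V (partial_deriv b f) x - (\<Sum>c\<in>Basis. partial_deriv b (partial_deriv c V) x * partial_deriv c f x)"
proof -
  have sum: "partial_deriv b (\<lambda>x. \<Sum>c\<in>I. h c x) x = (\<Sum>c\<in>I. partial_deriv b (h c) x)"
    if "\<And>c. c \<in> I \<Longrightarrow> smooth (h c)" "finite I" for I :: "'a set" and h :: "'a \<Rightarrow> 'a \<Rightarrow> real"
    using that(2,1)
  proof (induction I)
    case (insert c I)
    then have "partial_deriv b (\<lambda>x. h c x + (\<Sum>c\<in>I. h c x)) x = partial_deriv b (h c) x + partial_deriv b (\<lambda>x. \<Sum>c\<in>I. h c x) x"
      by (intro partial_add smooth_differentiable smooth_sum) auto
    then show ?case using insert by simp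
  qed (simp add: partial_const)
  have c: "partial_deriv b (\<lambda>x. partial_deriv c (partial_deriv c f) x - partial_deriv c V x * partial_deriv c f x) x
    = partial_deriv c (partial_deriv c (partial_deriv b f)) x - partial_deriv c V x * partial_deriv c (partial_deriv b f) x
      - partial_deriv b (partial_deriv c V) x * partial_deriv c f x" if c: "c \<in> Basis" for c
  proof -
    have m: "partial_deriv b (\<lambda>x. (-1) * (partial_deriv c V x * partial_deriv c f x)) x
      = - (partial_deriv c V x * partial_deriv b (partial_deriv c f) x + partial_deriv b (partial_deriv c V) x * partial_deriv c f x)"
    proof -
      have "partial_deriv b (\<lambda>x. (-1) * (partial_deriv c V x * partial_deriv c f x)) x
        = (-1) * partial_deriv b (\<lambda>x. partial_deriv c V x * partial_deriv c f x) x"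
        by (rule partial_cmult) (intro smooth_differentiable smooth_mult smooth_partial V f c)
      also have "partial_deriv b (\<lambda>x. partial_deriv c V x * partial_deriv c f x) x
        = partial_deriv c V x * partial_deriv b (partial_deriv c f) x + partial_deriv b (partial_deriv c V) x * partial_deriv c f x"
        by (rule partial_mult) (intro smooth_differentiable smooth_partial V f c)+
      finally show ?thesis by simp
    qed
    have "partial_deriv b (\<lambda>x. partial_deriv c (partial_deriv c f) x + (-1) * (partial_deriv c V x * partial_deriv c f x)) x
      = partial_deriv b (partial_deriv c (partial_deriv c f)) x + partial_deriv b (\<lambda>x. (-1) * (partial_deriv c V x * partial_deriv c f x)) x"
      by (rule partial_add) (intro smooth_differentiable smooth_cmult smooth_mult smooth_partial V f c)+
    moreover have "partial_deriv b (partial_deriv c f) = partial_deriv c (partial_deriv b f)"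
      using partial_commute[OF f b c] by blast
    moreover have "partial_deriv b (partial_deriv c (partial_deriv c f)) x = partial_deriv c (partial_deriv c (partial_deriv b f)) x"
      using partial_commute[OF smooth_partial[OF f c] b c] \<open>partial_deriv b (partial_deriv c f) = partial_deriv c (partial_deriv b f)\<close> by simp
    ultimately show ?thesis unfolding m by simp
  qed
  have "partial_deriv b (weighted_laplacian V f) x
    = (\<Sum>c\<in>Basis. partial_deriv b (\<lambda>x. partial_deriv c (partial_deriv c f) x - partial_deriv c V x * partial_deriv c f x) x)"
    unfolding weighted_laplacian_eq[abs_def]
    by (rule sum) (auto intro!: smooth_diff smooth_mult smooth_partial V f)
  then show ?thesis by (simp add: c weighted_laplacian_eq sum_subtractf)
qed

text \<open>Integrated Bochner inequality.\<close>

lemma norm_weighted_laplacian_le: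
  assumes f: "test_function f" and hess: "\<And>x v. hessian V x v \<bullet> v \<le> \<rho> * (v \<bullet> v)"
  shows "(norm (l2_class V (\<lambda>x. - weighted_laplacian V f x)))\<^sup>2
    \<le> (\<Sum>b\<in>Basis. \<Sum>c\<in>Basis. (norm (l2_class V (partial_deriv c (partial_deriv b f))))\<^sup>2)
      + \<rho> * (\<Sum>b\<in>Basis. (norm (l2_class V (partial_deriv b f)))\<^sup>2)"
proof -
  let ?W = "\<lambda>x. exp (- V x)" and ?L = "weighted_laplacian V f"
  have fs: "smooth f" using f by (rule test_function_smooth)
  have tb: "test_function (partial_deriv b f)" if "b \<in> Basis" for b by (rule test_function_partial[OF f that])
  have norm_eq: "(norm (l2_class V g))\<^sup>2 = (\<integral>x. ?W x * (g x)\<^sup>2 \<partial>lborel)" if "test_function g" for g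
    using inner_l2_class[OF V_measurable test_function_square_integrable[OF that] test_function_square_integrable[OF that]]
    by (simp only: power2_norm_eq_inner) (simp add: power2_eq_square)
  note int = test_function_weight_integrable
  have tL: "test_function ?L" by (rule test_function_weighted_laplacian[OF f])
  have mult: "test_function (\<lambda>x. g x * h x)" if "test_function g" "test_function h" for g h :: "'a \<Rightarrow> real"
    using that by (intro test_function_mult) (auto intro: test_function_smooth)
  have tsum: "test_function (\<lambda>x. \<Sum>i\<in>I. g i x)" if "\<And>i. i \<in> I \<Longrightarrow> test_function (g i)" for I and g :: "'a \<Rightarrow> 'a \<Rightarrow> real"
    using that by (induction I rule: infinite_finite_induct) (auto intro: test_function_add test_function_zero)
  have tV: "test_function (\<lambda>x. partial_deriv b (partial_deriv c V) x * partial_deriv c f x * partial_deriv b f x)"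
    if "b \<in> Basis" "c \<in> Basis" for b c
  proof -
    have "test_function (\<lambda>x. partial_deriv b f x * (partial_deriv b (partial_deriv c V) x * partial_deriv c f x))"
      by (intro test_function_mult tb that smooth_mult smooth_partial V fs)
    then show ?thesis by (simp add: mult.commute)
  qed
  have iV: "integrable lborel (\<lambda>x. ?W x * (\<Sum>b\<in>Basis. \<Sum>c\<in>Basis. partial_deriv b (partial_deriv c V) x * partial_deriv c f x * partial_deriv b f x))"
    by (intro int tsum tV)
  have pos: "(\<integral>x. ?W x * (\<Sum>b\<in>Basis. \<Sum>c\<in>Basis. partial_deriv b (partial_deriv c V) x * partial_deriv c f x * partial_deriv b f x) \<partial>lborel)
      \<le> \<rho> * (\<Sum>b\<in>Basis. \<integral>x. ?W x * (partial_deriv b f x)\<^sup>2 \<partial>lborel)"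
  proof -
    have "\<rho> * (\<Sum>b\<in>Basis. \<integral>x. ?W x * (partial_deriv b f x)\<^sup>2 \<partial>lborel)
        = (\<integral>x. ?W x * (\<rho> * (\<Sum>b\<in>Basis. (partial_deriv b f x)\<^sup>2)) \<partial>lborel)"
      using int[OF mult[OF tb tb]]
      by (simp add: sum_distrib_left mult.left_commute[of _ \<rho>] Bochner_Integration.integral_sum power2_eq_square)
    moreover have "(\<integral>x. ?W x * (\<Sum>b\<in>Basis. \<Sum>c\<in>Basis. partial_deriv b (partial_deriv c V) x * partial_deriv c f x * partial_deriv b f x) \<partial>lborel)
        \<le> (\<integral>x. ?W x * (\<rho> * (\<Sum>b\<in>Basis. (partial_deriv b f x)\<^sup>2)) \<partial>lborel)"
    proof (rule integral_mono)
      show "integrable lborel (\<lambda>x. ?W x * (\<Sum>b\<in>Basis. \<Sum>c\<in>Basis. partial_deriv b (partial_deriv c V) x * partial_deriv c f x * partial_deriv b f x))"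
        by (rule iV)
      show "integrable lborel (\<lambda>x. ?W x * (\<rho> * (\<Sum>b\<in>Basis. (partial_deriv b f x)\<^sup>2)))"
        unfolding power2_eq_square by (intro int test_function_cmult tsum mult tb)
      fix x
      have "(\<Sum>b\<in>Basis. \<Sum>c\<in>Basis. partial_deriv b (partial_deriv c V) x * partial_deriv c f x * partial_deriv b f x)
          = (\<Sum>b\<in>Basis. \<Sum>c\<in>Basis. (grad f x \<bullet> c) * partial_deriv c (partial_deriv b V) x * (grad f x \<bullet> b))"
        by (intro sum.cong refl) (simp add: grad_Basis partial_commute[OF V])
      also have "\<dots> = hessian V x (grad f x) \<bullet> grad f x" by (rule hessian_inner[OF V, symmetric])
      also have "\<dots> \<le> \<rho> * (grad f x \<bullet> grad f x)" by (rule hess)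
      also have "grad f x \<bullet> grad f x = (\<Sum>b\<in>Basis. (partial_deriv b f x)\<^sup>2)" by (simp add: grad_inner power2_eq_square)
      finally show "?W x * (\<Sum>b\<in>Basis. \<Sum>c\<in>Basis. partial_deriv b (partial_deriv c V) x * partial_deriv c f x * partial_deriv b f x)
          \<le> ?W x * (\<rho> * (\<Sum>b\<in>Basis. (partial_deriv b f x)\<^sup>2))" by (intro mult_left_mono) simp_all
    qed
    ultimately show ?thesis by simp
  qed
  \<comment> \<open>Integrating by parts moves one \<open>L\<close> to a gradient pairing. Commuting
    \<open>L\<close> with the derivative leaves the Hessian of \<open>V\<close> on
    \<open>grad f\<close>, and a second integration by parts turns each
    \<open>L (partial_deriv b f)\<close> term into squared second derivatives.\<close>
  have "(norm (l2_class V (\<lambda>x. - ?L x)))\<^sup>2 = (\<integral>x. ?W x * (?L x * ?L x) \<partial>lborel)"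
    using norm_eq[OF test_function_cmult[OF tL, of "-1"]] by (simp add: power2_eq_square)
  also have "\<dots> = - (\<integral>x. ?W x * (\<Sum>b\<in>Basis. partial_deriv b f x * partial_deriv b ?L x) \<partial>lborel)"
    by (rule weighted_integration_by_parts) (use f fs smooth_weighted_laplacian in auto)
  also have "\<dots> = - (\<integral>x. (\<Sum>b\<in>Basis. ?W x * (weighted_laplacian V (partial_deriv b f) x * partial_deriv b f x))
      - ?W x * (\<Sum>b\<in>Basis. \<Sum>c\<in>Basis. partial_deriv b (partial_deriv c V) x * partial_deriv c f x * partial_deriv b f x) \<partial>lborel)"
    by (intro arg_cong[where f=uminus] Bochner_Integration.integral_cong refl)
      (simp add: partial_weighted_laplacian[OF fs] algebra_simps sum_subtractf sum_distrib_left sum_distrib_right)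
  also have "\<dots> = - (\<Sum>b\<in>Basis. \<integral>x. ?W x * (weighted_laplacian V (partial_deriv b f) x * partial_deriv b f x) \<partial>lborel)
      + (\<integral>x. ?W x * (\<Sum>b\<in>Basis. \<Sum>c\<in>Basis. partial_deriv b (partial_deriv c V) x * partial_deriv c f x * partial_deriv b f x) \<partial>lborel)"
  proof -
    have a: "integrable lborel (\<lambda>x. ?W x * (weighted_laplacian V (partial_deriv b f) x * partial_deriv b f x))" if "b \<in> Basis" for b
      using that by (intro int mult tb test_function_weighted_laplacian)
    then show ?thesis using iV
      by (subst Bochner_Integration.integral_diff) (auto intro: Bochner_Integration.integrable_sum simp: Bochner_Integration.integral_sum)
  qed
  also have "\<dots> \<le> (\<Sum>b\<in>Basis. \<Sum>c\<in>Basis. (norm (l2_class V (partial_deriv c (partial_deriv b f))))\<^sup>2)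
      + \<rho> * (\<Sum>b\<in>Basis. \<integral>x. ?W x * (partial_deriv b f x)\<^sup>2 \<partial>lborel)"
  proof (rule add_mono[OF eq_refl pos])
    have "- (\<integral>x. ?W x * (weighted_laplacian V (partial_deriv b f) x * partial_deriv b f x) \<partial>lborel)
      = (\<Sum>c\<in>Basis. (norm (l2_class V (partial_deriv c (partial_deriv b f))))\<^sup>2)" if b: "b \<in> Basis" for b
    proof -
      have "weighted_square_integrable V (\<lambda>x. - weighted_laplacian V (partial_deriv b f) x)"
        using test_function_square_integrable[OF test_function_cmult[OF test_function_weighted_laplacian[OF tb[OF b]], of "-1"]] by simp
      then show ?thesis
        using inner_weighted_laplacian[OF tb[OF b] tb[OF b]]
        by (simp add: inner_l2_class[OF V_measurable _ test_function_square_integrable[OF tb[OF b]]] power2_norm_eq_inner)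
    qed
    then show "- (\<Sum>b\<in>Basis. \<integral>x. ?W x * (weighted_laplacian V (partial_deriv b f) x * partial_deriv b f x) \<partial>lborel)
      = (\<Sum>b\<in>Basis. \<Sum>c\<in>Basis. (norm (l2_class V (partial_deriv c (partial_deriv b f))))\<^sup>2)"
      by (simp add: sum_negf[symmetric])
  qed
  finally show ?thesis using norm_eq[OF tb] by simp
qed

text \<open>The gradient energy is the pairing of \<open>- L f\<close> with \<open>f\<close>, so
  Cauchy-Schwarz applies and the bound on the norm of \<open>L f\<close> finishes.\<close>

lemma gradient_interpolation_test:
  assumes f: "test_function f" and hess: "\<And>x v. hessian V x v \<bullet> v \<le> \<rho> * (v \<bullet> v)"
  shows "(\<Sum>b\<in>Basis. (norm (l2_class V (partial_deriv b f)))\<^sup>2)\<^sup>2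
    \<le> (norm (l2_class V f))\<^sup>2 * ((\<Sum>b\<in>Basis. \<Sum>c\<in>Basis. (norm (l2_class V (partial_deriv c (partial_deriv b f))))\<^sup>2)
      + \<rho> * (\<Sum>b\<in>Basis. (norm (l2_class V (partial_deriv b f)))\<^sup>2))"
proof -
  let ?L = "l2_class V (\<lambda>x. - weighted_laplacian V f x)"
  have "(\<Sum>b\<in>Basis. (norm (l2_class V (partial_deriv b f)))\<^sup>2) = ?L \<bullet> l2_class V f"
    by (simp add: inner_weighted_laplacian[OF f f] power2_norm_eq_inner)
  then have "(\<Sum>b\<in>Basis. (norm (l2_class V (partial_deriv b f)))\<^sup>2)\<^sup>2 \<le> (?L \<bullet> ?L) * (l2_class V f \<bullet> l2_class V f)"
    using Cauchy_Schwarz_ineq[of ?L "l2_class V f"] by simp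
  also have "\<dots> = (norm (l2_class V f))\<^sup>2 * (norm ?L)\<^sup>2" by (simp add: power2_norm_eq_inner)
  also have "\<dots> \<le> (norm (l2_class V f))\<^sup>2 * ((\<Sum>b\<in>Basis. \<Sum>c\<in>Basis. (norm (l2_class V (partial_deriv c (partial_deriv b f))))\<^sup>2)
      + \<rho> * (\<Sum>b\<in>Basis. (norm (l2_class V (partial_deriv b f)))\<^sup>2))"
    by (intro mult_left_mono norm_weighted_laplacian_le f hess) simp
  finally show ?thesis .
qed

end

section \<open>Approximation by test functions\<close>

text \<open>A smooth substitute for the indicator of \<open>box a b\<close>: each factor is flat at
  a face, and \<open>j\<close> measures the steepness.\<close>

definition box_bump :: "real \<Rightarrow> 'a::euclidean_space \<Rightarrow> 'a \<Rightarrow> 'a \<Rightarrow> real" where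
  "box_bump j a b x = (\<Prod>i\<in>Basis. bump_fun 1 (j * (x \<bullet> i - a \<bullet> i)) * bump_fun 1 (j * (b \<bullet> i - x \<bullet> i)))"

lemma bump_fun_1_range: "0 \<le> bump_fun 1 t" "bump_fun 1 t \<le> 1"
  by (auto simp: bump_fun_def)

lemma box_bump_range: "0 \<le> box_bump j a b x" "box_bump j a b x \<le> 1"
  unfolding box_bump_def using bump_fun_1_range
  by (auto intro!: prod_nonneg prod_le_1 mult_le_one)

lemma box_bump_outside: "j \<ge> 0 \<Longrightarrow> x \<notin> box a b \<Longrightarrow> box_bump j a b x = 0"
proof -
  assume j: "j \<ge> 0" and "x \<notin> box a b"
  then obtain i where i: "i \<in> Basis" "x \<bullet> i \<le> a \<bullet> i \<or> b \<bullet> i \<le> x \<bullet> i"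
    by (auto simp: mem_box not_less)
  then have "j * (x \<bullet> i - a \<bullet> i) \<le> 0 \<or> j * (b \<bullet> i - x \<bullet> i) \<le> 0"
    using j by (auto intro: mult_nonneg_nonpos)
  then have "bump_fun 1 (j * (x \<bullet> i - a \<bullet> i)) * bump_fun 1 (j * (b \<bullet> i - x \<bullet> i)) = 0"
    by (auto simp: bump_fun_def)
  then show ?thesis unfolding box_bump_def using i(1) by (intro prod_zero) auto
qed

lemma test_function_box_bump: "j \<ge> 0 \<Longrightarrow> test_function (box_bump j a b)"
  unfolding test_function_iff
proof
  assume j: "j \<ge> 0"
  show "smooth (box_bump j a b)"
    unfolding box_bump_def by (intro smooth_prod smooth_mult smooth_bump smooth_cmult smooth_diff smooth_inner smooth_const)
  obtain R where "\<forall>x\<in>box a b. norm x \<le> R" using bounded_box[of a b] unfolding bounded_iff by blast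
  then show "\<exists>R. \<forall>x. R < norm x \<longrightarrow> box_bump j a b x = 0"
  proof (intro exI[of _ R] allI impI)
    fix x :: 'a assume "\<forall>x\<in>box a b. norm x \<le> R" "R < norm x"
    then have "x \<notin> box a b" by force
    then show "box_bump j a b x = 0" by (rule box_bump_outside[OF j])
  qed
qed

lemma bump_fun_1_limit: "c > 0 \<Longrightarrow> (\<lambda>n. bump_fun 1 (real (Suc n) * c)) \<longlonglongrightarrow> 1"
proof -
  assume c: "c > 0"
  have "(\<lambda>n. exp (- (1 / c) * (1 / real (Suc n)))) \<longlonglongrightarrow> exp (- (1 / c) * 0)"
    by (intro tendsto_intros LIMSEQ_Suc[OF lim_1_over_n])
  moreover have "bump_fun 1 (real (Suc n) * c) = exp (- (1 / c) * (1 / real (Suc n)))" for n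
    using c by (simp add: bump_fun_def mult_le_0_iff)
  ultimately show ?thesis by simp
qed

lemma box_bump_limit: "(\<lambda>n. box_bump (real (Suc n)) a b x) \<longlonglongrightarrow> indicator (box a b) x"
proof (cases "x \<in> box a b")
  case True
  have "(\<lambda>n. box_bump (real (Suc n)) a b x) \<longlonglongrightarrow> (\<Prod>i\<in>(Basis::'a set). 1 * 1)"
    unfolding box_bump_def using True
    by (intro tendsto_prod tendsto_mult bump_fun_1_limit) (auto simp: mem_box)
  then show ?thesis using True by simp
next
  case False
  then show ?thesis by (simp add: box_bump_outside)
qed

lemma square_integrable_indicator_box: "square_integrable (indicator (box a b) :: 'a::euclidean_space \<Rightarrow> real)"
proof -
  have "(\<lambda>x. (indicator (box a b) x)\<^sup>2) = (indicator (box a b) :: 'a \<Rightarrow> real)"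
    by (auto simp: indicator_def fun_eq_iff)
  then show ?thesis
    unfolding square_integrable_def using emeasure_bounded_finite[OF bounded_box, of a b]
    by (auto intro!: integrable_real_indicator)
qed

text \<open>The positive and negative parts of \<open>h\<close> define measures that agree on all
  boxes, which generate the Borel sets; uniqueness of densities then gives equality almost
  everywhere.\<close>

lemma box_integrals_zero:
  fixes h :: "'a::euclidean_space \<Rightarrow> real"
  assumes h: "square_integrable h" and box: "\<And>a b. (\<integral>x. h x * indicator (box a b) x \<partial>lborel) = 0"
  shows "AE x in lborel. h x = 0"
proof -
  have [measurable]: "h \<in> borel_measurable borel" using h by (rule square_integrable_measurable)
  define P N where "P x = max 0 (h x)" and "N x = max 0 (- h x)" for x
  have [measurable]: "P \<in> borel_measurable borel" "N \<in> borel_measurable borel" unfolding P_def N_def by measurable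
  have int: "integrable lborel (\<lambda>x. h x * indicator (box a b) x)" for a b
    using h square_integrable_indicator_box by (rule square_integrable_mult)
  have iP: "integrable lborel (\<lambda>x. P x * indicator (box a b) x)" and iN: "integrable lborel (\<lambda>x. N x * indicator (box a b) x)" for a b
    by (rule Bochner_Integration.integrable_bound[OF int[of a b]]; auto simp: P_def N_def indicator_def)+
  have "(\<integral>x. P x * indicator (box a b) x \<partial>lborel) - (\<integral>x. N x * indicator (box a b) x \<partial>lborel) = (\<integral>x. h x * indicator (box a b) x \<partial>lborel)" for a b
    by (subst Bochner_Integration.integral_diff[symmetric, OF iP iN]) (auto intro!: Bochner_Integration.integral_cong simp: P_def N_def indicator_def)
  then have eq: "(\<integral>x. P x * indicator (box a b) x \<partial>lborel) = (\<integral>x. N x * indicator (box a b) x \<partial>lborel)" for a b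
    by (simp add: box)
  have em: "emeasure (density lborel (\<lambda>x. ennreal (G x))) (box a b) = ennreal (\<integral>x. G x * indicator (box a b) x \<partial>lborel)"
    if [measurable]: "G \<in> borel_measurable borel" and "\<And>x. G x \<ge> 0" "integrable lborel (\<lambda>x. G x * indicator (box a b) x)" for G :: "'a \<Rightarrow> real" and a b
  proof -
    have "emeasure (density lborel (\<lambda>x. ennreal (G x))) (box a b) = (\<integral>\<^sup>+x. ennreal (G x) * indicator (box a b) x \<partial>lborel)"
      by (rule emeasure_density) auto
    also have "\<dots> = (\<integral>\<^sup>+x. ennreal (G x * indicator (box a b) x) \<partial>lborel)"
      by (intro nn_integral_cong) (auto simp: indicator_def)
    also have "\<dots> = ennreal (\<integral>x. G x * indicator (box a b) x \<partial>lborel)"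
      using that by (intro nn_integral_eq_integral) auto
    finally show ?thesis .
  qed
  have PN0: "P x \<ge> 0" "N x \<ge> 0" for x by (auto simp: P_def N_def)
  have "density lborel (\<lambda>x. ennreal (P x)) = density lborel (\<lambda>x. ennreal (N x))"
  proof (rule measure_eqI_generator_eq)
    let ?E = "range (\<lambda>(a, b). box a b::'a set)"
    show "Int_stable ?E" by (auto simp: Int_stable_def box_Int_box)
    show "?E \<subseteq> Pow UNIV" "sets (density lborel (\<lambda>x. ennreal (P x))) = sigma_sets UNIV ?E"
      "sets (density lborel (\<lambda>x. ennreal (N x))) = sigma_sets UNIV ?E"
      by (simp_all add: borel_eq_box)
    let ?A = "\<lambda>n::nat. box (- (real n *\<^sub>R One)) (real n *\<^sub>R One) :: 'a set"
    show "range ?A \<subseteq> ?E" "(\<Union>i. ?A i) = UNIV" unfolding UN_box_eq_UNIV by auto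
    show "emeasure (density lborel (\<lambda>x. ennreal (P x))) (?A i) \<noteq> \<infinity>" for i
      by (subst em[OF _ PN0(1) iP]) auto
    fix X assume "X \<in> ?E"
    then obtain a b where X: "X = box a b" by auto
    show "emeasure (density lborel (\<lambda>x. ennreal (P x))) X = emeasure (density lborel (\<lambda>x. ennreal (N x))) X"
      unfolding X by (simp add: em[OF _ PN0(1) iP] em[OF _ PN0(2) iN] eq)
  qed
  then have "AE x in lborel. ennreal (P x) = ennreal (N x)"
    by (subst (asm) sigma_finite_measure.density_unique_iff[OF sigma_finite_lborel]) auto
  then show ?thesis by eventually_elim (auto simp: P_def N_def max_def split: if_splits)
qed

lemma orthogonal_to_test_functions:
  fixes h :: "'a::euclidean_space \<Rightarrow> real"
  assumes h: "square_integrable h" and orth: "\<And>\<phi>. test_function \<phi> \<Longrightarrow> (\<integral>x. h x * \<phi> x \<partial>lborel) = 0"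
  shows "AE x in lborel. h x = 0"
proof (rule box_integrals_zero[OF h])
  fix a b :: 'a
  have [measurable]: "h \<in> borel_measurable borel" using h by (rule square_integrable_measurable)
  have [measurable]: "box_bump (real (Suc n)) a b \<in> borel_measurable borel" for n
    by (intro smooth_measurable test_function_smooth test_function_box_bump) simp
  have int: "integrable lborel (\<lambda>x. h x * indicator (box a b) x)"
    using h square_integrable_indicator_box by (rule square_integrable_mult)
  have "(\<lambda>n. \<integral>x. h x * box_bump (real (Suc n)) a b x \<partial>lborel) \<longlonglongrightarrow> (\<integral>x. h x * indicator (box a b) x \<partial>lborel)"
  proof (rule integral_dominated_convergence[OF _ _ integrable_norm[OF int]])
    show "AE x in lborel. (\<lambda>n. h x * box_bump (real (Suc n)) a b x) \<longlonglongrightarrow> h x * indicator (box a b) x"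
      by (intro AE_I2 tendsto_mult tendsto_const box_bump_limit)
    show "AE x in lborel. norm (h x * box_bump (real (Suc n)) a b x) \<le> norm (h x * indicator (box a b) x)" for n
    proof (rule AE_I2)
      fix x
      show "norm (h x * box_bump (real (Suc n)) a b x) \<le> norm (h x * indicator (box a b) x)"
        using box_bump_range[of "real (Suc n)" a b x] box_bump_outside[of "real (Suc n)" x a b]
        by (cases "x \<in> box a b") (auto simp: abs_mult mult_left_le)
    qed
  qed (auto simp del: of_nat_Suc)
  moreover have "(\<integral>x. h x * box_bump (real (Suc n)) a b x \<partial>lborel) = 0" for n
    by (rule orth[OF test_function_box_bump]) simp
  ultimately show "(\<integral>x. h x * indicator (box a b) x \<partial>lborel) = 0" by (simp add: LIMSEQ_const_iff)
qed

lemma finite_test_functions_bounded: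
  assumes "finite S" "\<And>g. g \<in> S \<Longrightarrow> test_function g"
  shows "\<exists>B\<ge>0. \<forall>g\<in>S. \<forall>x. \<bar>g x\<bar> \<le> B"
  using assms
proof (induction S)
  case (insert g S)
  then obtain B where B: "B \<ge> 0" "\<forall>g\<in>S. \<forall>x. \<bar>g x\<bar> \<le> B" by auto
  obtain C where "C \<ge> 0" "\<And>x. \<bar>g x\<bar> \<le> C" using test_function_bounded insert.prems by blast
  then show ?case using B by (intro exI[of _ "max B C"]) (auto simp: le_max_iff_disj)
qed auto

text \<open>One fixed bump is stretched by the factor \<open>Suc n\<close>, so each derivative gains
  a factor \<open>s n\<close>. Dividing by its value \<open>c0\<close> at the origin makes the limit
  1 everywhere.\<close>

lemma cutoff_functions:
  obtains \<eta> :: "nat \<Rightarrow> 'a::euclidean_space \<Rightarrow> real" and B where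
    "\<And>n. test_function (\<eta> n)" "\<And>n x. \<bar>\<eta> n x\<bar> \<le> B" "\<And>x. (\<lambda>n. \<eta> n x) \<longlonglongrightarrow> 1"
    "\<And>b n x. b \<in> Basis \<Longrightarrow> \<bar>partial_deriv b (\<eta> n) x\<bar> \<le> B" "\<And>b x. b \<in> Basis \<Longrightarrow> (\<lambda>n. partial_deriv b (\<eta> n) x) \<longlonglongrightarrow> 0"
    "\<And>b c n x. b \<in> Basis \<Longrightarrow> c \<in> Basis \<Longrightarrow> \<bar>partial_deriv c (partial_deriv b (\<eta> n)) x\<bar> \<le> B"
    "\<And>b c x. b \<in> Basis \<Longrightarrow> c \<in> Basis \<Longrightarrow> (\<lambda>n. partial_deriv c (partial_deriv b (\<eta> n)) x) \<longlonglongrightarrow> 0"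
proof -
  define f :: "'a \<Rightarrow> real" where "f = box_bump 1 (- One) One"
  have f: "test_function f" unfolding f_def by (rule test_function_box_bump) simp
  have fs: "smooth f" using f by (rule test_function_smooth)
  define c0 where "c0 = f 0"
  have "c0 > 0" unfolding c0_def f_def box_bump_def by (intro prod_pos) (auto simp: bump_fun_def)
  define s where "s n = 1 / real (Suc n)" for n
  have s: "0 < s n" "s n \<le> 1" for n by (auto simp: s_def)
  have s_lim: "s \<longlonglongrightarrow> 0" unfolding s_def by (rule LIMSEQ_Suc[OF lim_1_over_n])
  define \<eta> where "\<eta> n x = (1 / c0) * f (s n *\<^sub>R x)" for n x
  let ?S = "{f} \<union> (\<lambda>b. partial_deriv b f) ` Basis \<union> (\<lambda>(b, c). partial_deriv c (partial_deriv b f)) ` (Basis \<times> Basis)"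
  obtain B where B: "B \<ge> 0" "\<And>g x. g \<in> ?S \<Longrightarrow> \<bar>g x\<bar> \<le> B"
    using finite_test_functions_bounded[of ?S] f test_function_partial by fastforce
  have p1: "partial_deriv b (\<eta> n) = (\<lambda>x. (s n / c0) * partial_deriv b f (s n *\<^sub>R x))" for b n
  proof
    fix x
    have "partial_deriv b (\<lambda>x. (1 / c0) * f (s n *\<^sub>R x)) x = (1 / c0) * partial_deriv b (\<lambda>x. f (s n *\<^sub>R x)) x"
      by (intro partial_cmult smooth_differentiable smooth_scale_arg fs)
    then show "partial_deriv b (\<eta> n) x = (s n / c0) * partial_deriv b f (s n *\<^sub>R x)"
      by (simp add: \<eta>_def[abs_def] smooth_scale_arg(2)[OF fs])
  qed
  have p2: "partial_deriv c (partial_deriv b (\<eta> n)) x = (s n * s n / c0) * partial_deriv c (partial_deriv b f) (s n *\<^sub>R x)"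
    if "b \<in> Basis" for b c n x
  proof -
    have "partial_deriv c (\<lambda>x. (s n / c0) * partial_deriv b f (s n *\<^sub>R x)) x = (s n / c0) * partial_deriv c (\<lambda>x. partial_deriv b f (s n *\<^sub>R x)) x"
      by (intro partial_cmult smooth_differentiable smooth_scale_arg smooth_partial fs that)
    then show ?thesis unfolding p1 by (simp add: smooth_scale_arg(2)[OF smooth_partial[OF fs that]])
  qed
  have bound: "\<bar>t / c0 * g y\<bar> \<le> B / c0" if "0 \<le> t" "t \<le> 1" "g \<in> ?S" for t y and g :: "'a \<Rightarrow> real"
  proof -
    have "\<bar>t / c0 * g y\<bar> = t * \<bar>g y\<bar> / c0" using that \<open>c0 > 0\<close> by (simp add: abs_mult)
    also have "\<dots> \<le> 1 * B / c0" using that B \<open>c0 > 0\<close> by (intro divide_right_mono mult_mono) auto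
    finally show ?thesis by simp
  qed
  have zero: "(\<lambda>n. t n / c0 * g (s n *\<^sub>R x)) \<longlonglongrightarrow> 0" if t: "t \<longlonglongrightarrow> 0" and g: "g \<in> ?S" for t x and g :: "'a \<Rightarrow> real"
  proof (rule Lim_null_comparison)
    show "\<forall>\<^sub>F n in sequentially. norm (t n / c0 * g (s n *\<^sub>R x)) \<le> \<bar>t n\<bar> * (B / c0)"
    proof (rule always_eventually, rule allI)
      fix n
      have "norm (t n / c0 * g (s n *\<^sub>R x)) = \<bar>t n\<bar> * \<bar>1 / c0 * g (s n *\<^sub>R x)\<bar>" by (simp add: abs_mult)
      also have "\<dots> \<le> \<bar>t n\<bar> * (B / c0)" using bound[of 1 g "s n *\<^sub>R x"] g by (intro mult_left_mono) auto
      finally show "norm (t n / c0 * g (s n *\<^sub>R x)) \<le> \<bar>t n\<bar> * (B / c0)" .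
    qed
    have "(\<lambda>n. \<bar>t n\<bar> * (B / c0)) \<longlonglongrightarrow> \<bar>0\<bar> * (B / c0)" by (intro tendsto_intros t)
    then show "(\<lambda>n. \<bar>t n\<bar> * (B / c0)) \<longlonglongrightarrow> 0" by simp
  qed
  have ss: "0 \<le> s n * s n" "s n * s n \<le> 1" for n using s[of n] by (auto intro: mult_le_one)
  have ss_lim: "(\<lambda>n. s n * s n) \<longlonglongrightarrow> 0" using tendsto_mult[OF s_lim s_lim] by simp
  show ?thesis
  proof (rule that[of \<eta> "B / c0"])
    show "test_function (\<eta> n)" for n
    proof -
      obtain R where R: "\<And>x. R < norm x \<Longrightarrow> f x = 0" using f unfolding test_function_iff by blast
      have "\<eta> n x = 0" if "R * real (Suc n) < norm x" for x
        using R[of "s n *\<^sub>R x"] that by (simp add: \<eta>_def s_def pos_less_divide_eq)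
      moreover have "smooth (\<eta> n)" unfolding \<eta>_def[abs_def] by (intro smooth_cmult smooth_scale_arg fs)
      ultimately show ?thesis unfolding test_function_iff by blast
    qed
    show "\<bar>\<eta> n x\<bar> \<le> B / c0" for n x unfolding \<eta>_def by (rule bound) auto
    show "(\<lambda>n. \<eta> n x) \<longlonglongrightarrow> 1" for x
    proof -
      have "(\<lambda>n. s n *\<^sub>R x) \<longlonglongrightarrow> 0 *\<^sub>R x" by (intro tendsto_intros s_lim)
      then have "(\<lambda>n. s n *\<^sub>R x) \<longlonglongrightarrow> 0" by simp
      then have "(\<lambda>n. f (s n *\<^sub>R x)) \<longlonglongrightarrow> f 0" by (rule isCont_tendsto_compose[OF smooth_isCont[OF fs]])
      then have "(\<lambda>n. \<eta> n x) \<longlonglongrightarrow> (1 / c0) * c0" unfolding \<eta>_def c0_def by (intro tendsto_intros)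
      then show ?thesis using \<open>c0 > 0\<close> by simp
    qed
    show "\<bar>partial_deriv b (\<eta> n) x\<bar> \<le> B / c0" if "b \<in> Basis" for b n x
      unfolding p1 using s[of n] that by (intro bound) auto
    show "(\<lambda>n. partial_deriv b (\<eta> n) x) \<longlonglongrightarrow> 0" if "b \<in> Basis" for b x
      unfolding p1 using that by (intro zero s_lim) auto
    show "\<bar>partial_deriv c (partial_deriv b (\<eta> n)) x\<bar> \<le> B / c0" if "b \<in> Basis" "c \<in> Basis" for b c n x
      unfolding p2[OF that(1)] using ss[of n] that by (intro bound) auto
    show "(\<lambda>n. partial_deriv c (partial_deriv b (\<eta> n)) x) \<longlonglongrightarrow> 0" if "b \<in> Basis" "c \<in> Basis" for b c x
      unfolding p2[OF that(1)] using that by (intro zero ss_lim) auto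
  qed
qed

context
  fixes V :: "'a::euclidean_space \<Rightarrow> real"
  assumes V: "smooth V"
begin

lemma bounded_mult_square_integrable:
  assumes k: "weighted_square_integrable V k" and [measurable]: "g \<in> borel_measurable borel" and B: "\<And>x. \<bar>g x\<bar> \<le> B"
  shows "weighted_square_integrable V (\<lambda>x. g x * k x)"
  unfolding weighted_square_integrable_def
proof
  note [measurable] = V_measurable[OF V]
  have [measurable]: "k \<in> borel_measurable borel" using k by (simp add: weighted_square_integrable_def)
  show "(\<lambda>x. g x * k x) \<in> borel_measurable borel" by measurable
  show "integrable lborel (\<lambda>x. exp (- V x) * (g x * k x)\<^sup>2)"
  proof (rule Bochner_Integration.integrable_bound)
    show "integrable lborel (\<lambda>x. B\<^sup>2 * (exp (- V x) * (k x)\<^sup>2))"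
      using k by (simp add: weighted_square_integrable_def)
    have "(g x)\<^sup>2 \<le> B\<^sup>2" for x using B[of x] by (metis abs_ge_zero power2_abs power_mono)
    then show "AE x in lborel. norm (exp (- V x) * (g x * k x)\<^sup>2) \<le> norm (B\<^sup>2 * (exp (- V x) * (k x)\<^sup>2))"
      by (intro AE_I2) (auto simp: power_mult_distrib abs_mult mult.left_commute intro!: mult_mono)
  qed measurable
qed

text \<open>Dominated convergence for multipliers; it is applied to cutoffs with
  \<open>c = 1\<close> and to their derivatives with \<open>c = 0\<close>.\<close>

lemma bounded_mult_tendsto:
  assumes k: "weighted_square_integrable V k" and [measurable]: "\<And>n. g n \<in> borel_measurable borel"
    and B: "\<And>n x. \<bar>g n x\<bar> \<le> B" and lim: "\<And>x. (\<lambda>n. g n x) \<longlonglongrightarrow> c"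
  shows "(\<lambda>n. l2_class V (\<lambda>x. g n x * k x)) \<longlonglongrightarrow> c *\<^sub>R l2_class V k"
proof -
  note [measurable] = V_measurable[OF V]
  have [measurable]: "k \<in> borel_measurable borel" using k by (simp add: weighted_square_integrable_def)
  have cB: "\<bar>c\<bar> \<le> B" by (rule LIMSEQ_le_const2[OF tendsto_rabs[OF lim[of 0]]]) (use B in blast)
  have gk: "weighted_square_integrable V (\<lambda>x. g n x * k x)" for n
    by (rule bounded_mult_square_integrable[OF k _ B]) measurable
  have dk: "weighted_square_integrable V (\<lambda>x. (g n x - c) * k x)" for n
  proof (rule bounded_mult_square_integrable[OF k])
    show "\<bar>g n x - c\<bar> \<le> B + B" for x using B[of n x] cB by linarith
  qed measurable
  have eq: "(norm (l2_class V (\<lambda>x. g n x * k x) - c *\<^sub>R l2_class V k))\<^sup>2 = (\<integral>x. exp (- V x) * ((g n x - c) * k x)\<^sup>2 \<partial>lborel)" for n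
  proof -
    have "l2_class V (\<lambda>x. g n x * k x) - c *\<^sub>R l2_class V k = l2_class V (\<lambda>x. (g n x - c) * k x)"
      using l2_class_diff[OF V_measurable[OF V] gk weighted_square_integrable_scale[OF V_measurable[OF V] k], of n c]
      by (simp add: l2_class_scale[OF V_measurable[OF V] k] left_diff_distrib)
    then show ?thesis
      using inner_l2_class[OF V_measurable[OF V] dk dk, of n n] by (simp add: power2_norm_eq_inner) (simp add: power2_eq_square)
  qed
  have "(\<lambda>n. \<integral>x. exp (- V x) * ((g n x - c) * k x)\<^sup>2 \<partial>lborel) \<longlonglongrightarrow> (\<integral>x. 0 \<partial>(lborel :: 'a measure))"
  proof (rule integral_dominated_convergence[where w="\<lambda>x. (2 * B)\<^sup>2 * (exp (- V x) * (k x)\<^sup>2)" and f="\<lambda>x. 0"])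
    show "integrable lborel (\<lambda>x. (2 * B)\<^sup>2 * (exp (- V x) * (k x)\<^sup>2))"
      using k by (simp add: weighted_square_integrable_def)
    show "AE x in lborel. (\<lambda>n. exp (- V x) * ((g n x - c) * k x)\<^sup>2) \<longlonglongrightarrow> 0"
    proof (rule AE_I2)
      fix x
      have "(\<lambda>n. exp (- V x) * ((g n x - c) * k x)\<^sup>2) \<longlonglongrightarrow> exp (- V x) * ((c - c) * k x)\<^sup>2"
        by (intro tendsto_intros lim)
      then show "(\<lambda>n. exp (- V x) * ((g n x - c) * k x)\<^sup>2) \<longlonglongrightarrow> 0" by simp
    qed
    show "AE x in lborel. norm (exp (- V x) * ((g n x - c) * k x)\<^sup>2) \<le> (2 * B)\<^sup>2 * (exp (- V x) * (k x)\<^sup>2)" for n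
    proof (rule AE_I2)
      fix x
      have "\<bar>g n x - c\<bar> \<le> 2 * B" using B[of n x] cB by linarith
      then have "(g n x - c)\<^sup>2 \<le> (2 * B)\<^sup>2" by (metis abs_ge_zero power2_abs power_mono)
      then have "(g n x - c)\<^sup>2 * (exp (- V x) * (k x)\<^sup>2) \<le> (2 * B)\<^sup>2 * (exp (- V x) * (k x)\<^sup>2)"
        by (rule mult_right_mono) simp
      then show "norm (exp (- V x) * ((g n x - c) * k x)\<^sup>2) \<le> (2 * B)\<^sup>2 * (exp (- V x) * (k x)\<^sup>2)"
        by (simp add: power_mult_distrib mult_ac)
    qed
  qed measurable
  then have "(\<lambda>n. (norm (l2_class V (\<lambda>x. g n x * k x) - c *\<^sub>R l2_class V k))\<^sup>2) \<longlonglongrightarrow> 0" unfolding eq by simp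
  then have "(\<lambda>n. sqrt ((norm (l2_class V (\<lambda>x. g n x * k x) - c *\<^sub>R l2_class V k))\<^sup>2)) \<longlonglongrightarrow> sqrt 0"
    by (rule tendsto_real_sqrt)
  then have "(\<lambda>n. norm (l2_class V (\<lambda>x. g n x * k x) - c *\<^sub>R l2_class V k)) \<longlonglongrightarrow> 0" by simp
  then show ?thesis by (rule LIM_zero_cancel[OF tendsto_norm_zero_cancel])
qed

lemma orthogonal_to_test_classes:
  assumes "\<And>\<phi>. test_function \<phi> \<Longrightarrow> u \<bullet> l2_class V \<phi> = 0" shows "u = 0"
proof -
  have "(\<integral>x. l2_fun u x * \<psi> x \<partial>lborel) = 0" if \<psi>: "test_function \<psi>" for \<psi>
  proof -
    \<comment> \<open>This factor undoes the weight, so \<open>l2_of \<psi>\<close> is the weighted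
      class of a test function.\<close>
    have "smooth (\<lambda>x. exp ((1/2) * V x))" by (intro smooth_exp smooth_cmult V)
    then have "test_function (\<lambda>x. \<psi> x * exp ((1/2) * V x))" by (rule test_function_mult[OF \<psi>])
    then have t: "test_function (\<lambda>x. exp (V x / 2) * \<psi> x)" by (simp add: mult.commute)
    have "square_integrable \<psi>"
    proof -
      have "test_function (\<lambda>x. \<psi> x * \<psi> x)" using \<psi> by (intro test_function_mult test_function_smooth)
      then show ?thesis unfolding square_integrable_def
        using smooth_measurable[OF test_function_smooth[OF \<psi>]] test_function_integrable by (simp add: power2_eq_square)
    qed
    then have "l2_of (l2_fun u) \<bullet> l2_of \<psi> = (\<integral>x. l2_fun u x * \<psi> x \<partial>lborel)"
      by (intro inner_l2_of) simp_all
    moreover have "l2_class V (\<lambda>x. exp (V x / 2) * \<psi> x) = l2_of \<psi>"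
      by (simp add: l2_class_def exp_half_cancel)
    ultimately show ?thesis using assms[OF t] by (simp add: l2_of_fun)
  qed
  then have "AE x in lborel. l2_fun u x = 0" by (intro orthogonal_to_test_functions) simp_all
  then have "l2_of (l2_fun u) = l2_of (\<lambda>x. 0)" by (subst l2_of_eq_iff) (simp_all add: square_integrable_zero)
  then show ?thesis by (simp add: l2_of_fun zero_l2_def)
qed

lemma test_classes_subspace: "subspace (l2_class V ` Collect test_function)"
  unfolding subspace_def
proof (intro conjI ballI allI)
  note sq = test_function_square_integrable[OF V]
  show "0 \<in> l2_class V ` Collect test_function"
    using test_function_zero by (intro image_eqI[of _ _ "\<lambda>x. 0"]) (auto simp: l2_class_def zero_l2_def)
  show "x + y \<in> l2_class V ` Collect test_function" if xy: "x \<in> l2_class V ` Collect test_function" "y \<in> l2_class V ` Collect test_function" for x y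
  proof -
    obtain f g where fg: "test_function f" "test_function g" "x = l2_class V f" "y = l2_class V g" using xy by auto
    then have "x + y = l2_class V (\<lambda>x. f x + g x)" by (simp add: l2_class_add[OF V_measurable[OF V]] sq)
    then show ?thesis using test_function_add[OF fg(1,2)] by blast
  qed
  show "c *\<^sub>R x \<in> l2_class V ` Collect test_function" if x: "x \<in> l2_class V ` Collect test_function" for c x
  proof -
    obtain f where f: "test_function f" "x = l2_class V f" using x by auto
    then have "c *\<^sub>R x = l2_class V (\<lambda>x. c * f x)" by (simp add: l2_class_scale[OF V_measurable[OF V]] sq)
    then show ?thesis using test_function_cmult[OF f(1)] by blast
  qed
qed

text \<open>A vector minus its projection onto the closure of the test classes is orthogonal to all
  of them, hence zero.\<close>

lemma test_classes_dense:
  assumes e: "e > 0" shows "\<exists>f. test_function f \<and> norm (u - l2_class V f) < e"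
proof -
  let ?M = "closure (l2_class V ` Collect test_function)"
  obtain P where PM: "\<And>x. P x \<in> ?M" and Po: "\<And>x z. z \<in> ?M \<Longrightarrow> (x - P x) \<bullet> z = 0"
    using projection_onto_closed_subspace[OF subspace_closure[OF test_classes_subspace] closed_closure] by metis
  have "u - P u = 0"
    using Po closure_subset[of "l2_class V ` Collect test_function"] by (intro orthogonal_to_test_classes) blast
  then have "u \<in> ?M" using PM[of u] by simp
  then show ?thesis using e unfolding closure_approachable by (auto simp: dist_norm norm_minus_commute)
qed

lemma pull_rel_graph:
  "pull_rel V (neg_weighted_laplacian_graph V) = {(l2_class V f, l2_class V (\<lambda>x. - weighted_laplacian V f x)) | f. test_function f}"
proof -
  note sq = test_function_square_integrable[OF V]
  note M = V_measurable[OF V]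
  have sL: "weighted_square_integrable V (\<lambda>x. - weighted_laplacian V f x)" if "test_function f" for f
    using sq[OF test_function_cmult[OF test_function_weighted_laplacian[OF V that], of "-1"]] by simp
  show ?thesis
  proof (intro set_eqI iffI)
    fix p assume "p \<in> pull_rel V (neg_weighted_laplacian_graph V)"
    then obtain u v f where p: "p = (u, v)" and f: "test_function f"
      and "l2_unweight V u = abs_aefun f" "l2_unweight V v = abs_aefun (\<lambda>x. - weighted_laplacian V f x)"
      unfolding pull_rel_def[OF M] neg_weighted_laplacian_graph_def by auto
    then have "u = l2_class V f" "v = l2_class V (\<lambda>x. - weighted_laplacian V f x)"
      using l2_unweight_class[OF M] sq sL l2_unweight_inj[OF M] by metis+
    then show "p \<in> {(l2_class V f, l2_class V (\<lambda>x. - weighted_laplacian V f x)) | f. test_function f}" using p f by blast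
  next
    fix p assume "p \<in> {(l2_class V f, l2_class V (\<lambda>x. - weighted_laplacian V f x)) | f. test_function f}"
    then obtain f where p: "p = (l2_class V f, l2_class V (\<lambda>x. - weighted_laplacian V f x))" and f: "test_function f" by blast
    show "p \<in> pull_rel V (neg_weighted_laplacian_graph V)"
      unfolding p pull_rel_def[OF M] neg_weighted_laplacian_graph_def
      using l2_unweight_class[OF M sq[OF f]] l2_unweight_class[OF M sL[OF f]] f by auto
  qed
qed

lemma graph_L2: "neg_weighted_laplacian_graph V \<subseteq> L2 V \<times> L2 V"
proof (rule subrelI)
  fix f g assume "(f, g) \<in> neg_weighted_laplacian_graph V"
  then obtain h where h: "test_function h" and f: "f = abs_aefun h" and g: "g = abs_aefun (\<lambda>x. - weighted_laplacian V h x)"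
    unfolding neg_weighted_laplacian_graph_def by blast
  have "weighted_square_integrable V (\<lambda>x. - weighted_laplacian V h x)"
    using test_function_square_integrable[OF V test_function_cmult[OF test_function_weighted_laplacian[OF V h], of "-1"]] by simp
  moreover have "weighted_square_integrable V h" by (rule test_function_square_integrable[OF V h])
  ultimately show "(f, g) \<in> L2 V \<times> L2 V"
    unfolding f g using L2_iff[OF V_measurable[OF V]] by (auto simp: weighted_square_integrable_def)
qed

end

lemma AE_eq_continuous_imp_eq:
  fixes f g :: "'a::euclidean_space \<Rightarrow> real"
  assumes f: "continuous_on UNIV f" and g: "continuous_on UNIV g" and ae: "AE x in lborel. f x = g x"
  shows "f = g"
proof (rule ccontr)
  assume "f \<noteq> g"
  then obtain x where x: "f x \<noteq> g x" by auto
  let ?S = "{x. f x \<noteq> g x}"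
  have "open ?S" by (intro open_Collect_neq f g)
  then obtain e where e: "e > 0" "ball x e \<subseteq> ?S" using x open_contains_ball by blast
  obtain a b where ab: "x \<in> box a b" "box a b \<subseteq> ball x e" using rational_boxes[OF e(1), of x] by blast
  have "AE y in lborel. y \<notin> box a b"
    using ae by eventually_elim (use ab e in blast)
  then have "box a b \<in> null_sets lborel"
    by (subst AE_iff_null_sets) auto
  then have "emeasure lborel (box a b) = 0" by auto
  moreover have lt: "a \<bullet> i < b \<bullet> i" if "i \<in> Basis" for i
    using ab(1) that by (auto simp: mem_box intro: less_trans)
  then have "emeasure lborel (box a b) = ennreal (\<Prod>i\<in>Basis. (b - a) \<bullet> i)"
    by (intro emeasure_lborel_box) (auto intro: less_imp_le)
  moreover have "(\<Prod>i\<in>Basis. (b - a) \<bullet> i) > 0"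
    using lt by (intro prod_pos) (simp add: inner_diff_left)
  ultimately show False by (metis ennreal_eq_0_iff not_le)
qed

section \<open>Cutoff approximation and the interpolation inequality without compact support\<close>

context
  fixes V :: "'a::euclidean_space \<Rightarrow> real"
  assumes V: "smooth V"
begin

lemma weighted_square_integrable_sum:
  "(\<And>i. i \<in> I \<Longrightarrow> weighted_square_integrable V (h i)) \<Longrightarrow> weighted_square_integrable V (\<lambda>x. \<Sum>i\<in>I. h i x)"
proof (induction I rule: infinite_finite_induct)
  case (insert i I)
  then show ?case by (simp add: weighted_square_integrable_add[OF V_measurable[OF V]])
qed (simp_all add: weighted_square_integrable_def)

lemma l2_class_zero: "l2_class V (\<lambda>x. 0) = 0"
  by (simp add: l2_class_def zero_l2_def)

lemma l2_class_sum:
  "(\<And>i. i \<in> I \<Longrightarrow> weighted_square_integrable V (h i)) \<Longrightarrow> l2_class V (\<lambda>x. \<Sum>i\<in>I. h i x) = (\<Sum>i\<in>I. l2_class V (h i))"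
proof (induction I rule: infinite_finite_induct)
  case (insert i I)
  then show ?case
    by (simp add: l2_class_add[OF V_measurable[OF V]] weighted_square_integrable_sum)
qed (simp_all add: l2_class_zero)

text \<open>Multiply by cutoffs: Leibniz terms containing a derivative of the cutoff tend to 0. The
  last two conclusions carry their own integrability premises because they serve different purposes:
  second derivatives for the Bochner inequality, the weighted Laplacian for polynomials under the
  Gaussian.\<close>

lemma cutoff_approximation:
  assumes f: "smooth f" and f0: "weighted_square_integrable V f"
    and f1: "\<And>b. b \<in> Basis \<Longrightarrow> weighted_square_integrable V (partial_deriv b f)"
  obtains g :: "nat \<Rightarrow> 'a \<Rightarrow> real" where
    "\<And>n. test_function (g n)" "(\<lambda>n. l2_class V (g n)) \<longlonglongrightarrow> l2_class V f"
    "\<And>b. b \<in> Basis \<Longrightarrow> (\<lambda>n. l2_class V (partial_deriv b (g n))) \<longlonglongrightarrow> l2_class V (partial_deriv b f)"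
    "\<And>b c. b \<in> Basis \<Longrightarrow> c \<in> Basis \<Longrightarrow> weighted_square_integrable V (partial_deriv c (partial_deriv b f)) \<Longrightarrow>
      (\<lambda>n. l2_class V (partial_deriv c (partial_deriv b (g n)))) \<longlonglongrightarrow> l2_class V (partial_deriv c (partial_deriv b f))"
    "(\<And>b. b \<in> Basis \<Longrightarrow> weighted_square_integrable V (\<lambda>x. partial_deriv b V x * f x)) \<Longrightarrow>
      weighted_square_integrable V (weighted_laplacian V f) \<Longrightarrow>
      (\<lambda>n. l2_class V (weighted_laplacian V (g n))) \<longlonglongrightarrow> l2_class V (weighted_laplacian V f)"
proof -
  note M = V_measurable[OF V]
  note add = l2_class_add[OF M] and wadd = weighted_square_integrable_add[OF M]
  obtain \<eta> :: "nat \<Rightarrow> 'a \<Rightarrow> real" and B where \<eta>: "\<And>n. test_function (\<eta> n)" "\<And>n x. \<bar>\<eta> n x\<bar> \<le> B" "\<And>x. (\<lambda>n. \<eta> n x) \<longlonglongrightarrow> 1"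
    and \<eta>1: "\<And>b n x. b \<in> Basis \<Longrightarrow> \<bar>partial_deriv b (\<eta> n) x\<bar> \<le> B" "\<And>b x. b \<in> Basis \<Longrightarrow> (\<lambda>n. partial_deriv b (\<eta> n) x) \<longlonglongrightarrow> 0"
    and \<eta>2: "\<And>b c n x. b \<in> Basis \<Longrightarrow> c \<in> Basis \<Longrightarrow> \<bar>partial_deriv c (partial_deriv b (\<eta> n)) x\<bar> \<le> B"
      "\<And>b c x. b \<in> Basis \<Longrightarrow> c \<in> Basis \<Longrightarrow> (\<lambda>n. partial_deriv c (partial_deriv b (\<eta> n)) x) \<longlonglongrightarrow> 0"
    by (rule cutoff_functions) (rule that)
  have \<eta>s: "smooth (\<eta> n)" for n by (rule test_function_smooth[OF \<eta>(1)])
  have t0: "(\<lambda>n. l2_class V (\<lambda>x. \<eta> n x * k x)) \<longlonglongrightarrow> l2_class V k" and w0: "weighted_square_integrable V (\<lambda>x. \<eta> n x * k x)"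
    if "weighted_square_integrable V k" for k n
    using bounded_mult_tendsto[OF V that smooth_measurable[OF \<eta>s] \<eta>(2,3)]
      bounded_mult_square_integrable[OF V that smooth_measurable[OF \<eta>s] \<eta>(2)] by simp_all
  have t1: "(\<lambda>n. l2_class V (\<lambda>x. partial_deriv b (\<eta> n) x * k x)) \<longlonglongrightarrow> 0"
    and w1: "weighted_square_integrable V (\<lambda>x. partial_deriv b (\<eta> n) x * k x)"
    if "weighted_square_integrable V k" "b \<in> Basis" for k b n
    using bounded_mult_tendsto[OF V that(1) smooth_measurable[OF smooth_partial[OF \<eta>s that(2)]] \<eta>1[OF that(2)]]
      bounded_mult_square_integrable[OF V that(1) smooth_measurable[OF smooth_partial[OF \<eta>s that(2)]] \<eta>1(1)[OF that(2)]] by simp_all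
  have t2: "(\<lambda>n. l2_class V (\<lambda>x. partial_deriv c (partial_deriv b (\<eta> n)) x * k x)) \<longlonglongrightarrow> 0"
    and w2: "weighted_square_integrable V (\<lambda>x. partial_deriv c (partial_deriv b (\<eta> n)) x * k x)"
    if "weighted_square_integrable V k" "b \<in> Basis" "c \<in> Basis" for k b c n
    using bounded_mult_tendsto[OF V that(1) smooth_measurable[OF smooth_partial[OF smooth_partial[OF \<eta>s that(2)] that(3)]] \<eta>2[OF that(2,3)]]
      bounded_mult_square_integrable[OF V that(1) smooth_measurable[OF smooth_partial[OF smooth_partial[OF \<eta>s that(2)] that(3)]] \<eta>2(1)[OF that(2,3)]] by simp_all
  define g where "g n x = \<eta> n x * f x" for n x
  have p1: "partial_deriv b (g n) = (\<lambda>x. \<eta> n x * partial_deriv b f x + partial_deriv b (\<eta> n) x * f x)" for b n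
    unfolding g_def[abs_def] using partial_mult[OF smooth_differentiable[OF \<eta>s] smooth_differentiable[OF f]] by blast
  have p2: "partial_deriv c (partial_deriv b (g n)) = (\<lambda>x. (\<eta> n x * partial_deriv c (partial_deriv b f) x + partial_deriv c (\<eta> n) x * partial_deriv b f x)
      + (partial_deriv b (\<eta> n) x * partial_deriv c f x + partial_deriv c (partial_deriv b (\<eta> n)) x * f x))"
    if b: "b \<in> Basis" for b c n
  proof
    fix x
    have "partial_deriv c (\<lambda>x. \<eta> n x * partial_deriv b f x + partial_deriv b (\<eta> n) x * f x) x
      = partial_deriv c (\<lambda>x. \<eta> n x * partial_deriv b f x) x + partial_deriv c (\<lambda>x. partial_deriv b (\<eta> n) x * f x) x"
      by (rule partial_add) (intro smooth_differentiable smooth_mult smooth_partial \<eta>s f b)+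
    also have "partial_deriv c (\<lambda>x. \<eta> n x * partial_deriv b f x) x = \<eta> n x * partial_deriv c (partial_deriv b f) x + partial_deriv c (\<eta> n) x * partial_deriv b f x"
      by (rule partial_mult) (intro smooth_differentiable smooth_partial \<eta>s f b)+
    also have "partial_deriv c (\<lambda>x. partial_deriv b (\<eta> n) x * f x) x = partial_deriv b (\<eta> n) x * partial_deriv c f x + partial_deriv c (partial_deriv b (\<eta> n)) x * f x"
      by (rule partial_mult) (intro smooth_differentiable smooth_partial \<eta>s f b)+
    finally show "partial_deriv c (partial_deriv b (g n)) x = (\<eta> n x * partial_deriv c (partial_deriv b f) x + partial_deriv c (\<eta> n) x * partial_deriv b f x)
      + (partial_deriv b (\<eta> n) x * partial_deriv c f x + partial_deriv c (partial_deriv b (\<eta> n)) x * f x)" unfolding p1 .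
  qed
  \<comment> \<open>All terms but the first contain a derivative of the cutoff. The drift produces
    \<open>partial_deriv b V x * f x\<close>, which explains the integrability premise on that
    product.\<close>
  have pL: "weighted_laplacian V (g n) = (\<lambda>x. \<eta> n x * weighted_laplacian V f x
      + (\<Sum>b\<in>Basis. ((2 * (partial_deriv b (\<eta> n) x * partial_deriv b f x) + partial_deriv b (partial_deriv b (\<eta> n)) x * f x)
        + (-1) * (partial_deriv b (\<eta> n) x * (partial_deriv b V x * f x)))))" for n
  proof
    fix x
    have "weighted_laplacian V (g n) x = (\<Sum>b\<in>Basis. \<eta> n x * (partial_deriv b (partial_deriv b f) x - partial_deriv b V x * partial_deriv b f x)
      + ((2 * (partial_deriv b (\<eta> n) x * partial_deriv b f x) + partial_deriv b (partial_deriv b (\<eta> n)) x * f x)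
        + (-1) * (partial_deriv b (\<eta> n) x * (partial_deriv b V x * f x))))"
      unfolding weighted_laplacian_eq
    proof (rule sum.cong[OF refl])
      fix b :: 'a assume b: "b \<in> Basis"
      show "partial_deriv b (partial_deriv b (g n)) x - partial_deriv b V x * partial_deriv b (g n) x
        = \<eta> n x * (partial_deriv b (partial_deriv b f) x - partial_deriv b V x * partial_deriv b f x)
      + ((2 * (partial_deriv b (\<eta> n) x * partial_deriv b f x) + partial_deriv b (partial_deriv b (\<eta> n)) x * f x)
        + (-1) * (partial_deriv b (\<eta> n) x * (partial_deriv b V x * f x)))"
        unfolding p2[OF b] unfolding p1 by (simp add: algebra_simps)
    qed
    then show "weighted_laplacian V (g n) x = \<eta> n x * weighted_laplacian V f x
      + (\<Sum>b\<in>Basis. ((2 * (partial_deriv b (\<eta> n) x * partial_deriv b f x) + partial_deriv b (partial_deriv b (\<eta> n)) x * f x)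
        + (-1) * (partial_deriv b (\<eta> n) x * (partial_deriv b V x * f x))))"
      unfolding weighted_laplacian_eq[of V f] sum_distrib_left sum.distrib[symmetric] .
  qed
  show ?thesis
  proof (rule that[of g])
    show "test_function (g n)" for n unfolding g_def[abs_def] by (rule test_function_mult[OF \<eta>(1) f])
    show "(\<lambda>n. l2_class V (g n)) \<longlonglongrightarrow> l2_class V f" unfolding g_def[abs_def] by (rule t0[OF f0])
    fix b :: 'a assume b: "b \<in> Basis"
    have "(\<lambda>n. l2_class V (\<lambda>x. \<eta> n x * partial_deriv b f x) + l2_class V (\<lambda>x. partial_deriv b (\<eta> n) x * f x)) \<longlonglongrightarrow> l2_class V (partial_deriv b f) + 0"
      by (intro tendsto_add t0 t1 f1 f0 b)
    then show "(\<lambda>n. l2_class V (partial_deriv b (g n))) \<longlonglongrightarrow> l2_class V (partial_deriv b f)"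
      unfolding p1 by (simp add: add[OF w0[OF f1[OF b]] w1[OF f0 b]])
    fix c :: 'a assume c: "c \<in> Basis" and f2: "weighted_square_integrable V (partial_deriv c (partial_deriv b f))"
    have "(\<lambda>n. (l2_class V (\<lambda>x. \<eta> n x * partial_deriv c (partial_deriv b f) x) + l2_class V (\<lambda>x. partial_deriv c (\<eta> n) x * partial_deriv b f x))
      + (l2_class V (\<lambda>x. partial_deriv b (\<eta> n) x * partial_deriv c f x) + l2_class V (\<lambda>x. partial_deriv c (partial_deriv b (\<eta> n)) x * f x)))
      \<longlonglongrightarrow> (l2_class V (partial_deriv c (partial_deriv b f)) + 0) + (0 + 0)"
      by (intro tendsto_add t0 t1 t2 f1 f0 f2 b c)
    then show "(\<lambda>n. l2_class V (partial_deriv c (partial_deriv b (g n)))) \<longlonglongrightarrow> l2_class V (partial_deriv c (partial_deriv b f))"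
      unfolding p2[OF b]
      by (simp add: add[OF wadd[OF w0[OF f2] w1[OF f1[OF b] c]] wadd[OF w1[OF f1[OF c] b] w2[OF f0 b c]]]
          add[OF w0[OF f2] w1[OF f1[OF b] c]] add[OF w1[OF f1[OF c] b] w2[OF f0 b c]])
  next
    assume fV: "\<And>b. b \<in> Basis \<Longrightarrow> weighted_square_integrable V (\<lambda>x. partial_deriv b V x * f x)"
      and fL: "weighted_square_integrable V (weighted_laplacian V f)"
    note sc = weighted_square_integrable_scale[OF M] and lsc = l2_class_scale[OF M]
    have wb: "weighted_square_integrable V (\<lambda>x. (2 * (partial_deriv b (\<eta> n) x * partial_deriv b f x) + partial_deriv b (partial_deriv b (\<eta> n)) x * f x)
        + (-1) * (partial_deriv b (\<eta> n) x * (partial_deriv b V x * f x)))" if "b \<in> Basis" for b n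
      by (intro wadd sc w1 w2 f0 f1 fV that)
    have lb: "l2_class V (\<lambda>x. (2 * (partial_deriv b (\<eta> n) x * partial_deriv b f x) + partial_deriv b (partial_deriv b (\<eta> n)) x * f x)
        + (-1) * (partial_deriv b (\<eta> n) x * (partial_deriv b V x * f x)))
      = (2 *\<^sub>R l2_class V (\<lambda>x. partial_deriv b (\<eta> n) x * partial_deriv b f x) + l2_class V (\<lambda>x. partial_deriv b (partial_deriv b (\<eta> n)) x * f x))
        + (-1) *\<^sub>R l2_class V (\<lambda>x. partial_deriv b (\<eta> n) x * (partial_deriv b V x * f x))" if b: "b \<in> Basis" for b n
    proof -
      note wa = w1[OF f1[OF b] b, of n] and wb = w2[OF f0 b b, of n] and wc = w1[OF fV[OF b] b, of n]
      show ?thesis by (simp only: add[OF wadd[OF sc[OF wa] wb] sc[OF wc]] add[OF sc[OF wa] wb] lsc[OF wa] lsc[OF wc])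
    qed
    have "(\<lambda>n. l2_class V (\<lambda>x. \<eta> n x * weighted_laplacian V f x) + (\<Sum>b\<in>Basis.
      (2 *\<^sub>R l2_class V (\<lambda>x. partial_deriv b (\<eta> n) x * partial_deriv b f x) + l2_class V (\<lambda>x. partial_deriv b (partial_deriv b (\<eta> n)) x * f x))
        + (-1) *\<^sub>R l2_class V (\<lambda>x. partial_deriv b (\<eta> n) x * (partial_deriv b V x * f x))))
      \<longlonglongrightarrow> l2_class V (weighted_laplacian V f) + (\<Sum>b\<in>(Basis::'a set). (2 *\<^sub>R 0 + 0) + (-1) *\<^sub>R 0)"
      by (intro tendsto_add tendsto_sum tendsto_scaleR tendsto_const t0 t1 t2 fL f1 f0 fV)
    moreover have "l2_class V (weighted_laplacian V (g n)) = l2_class V (\<lambda>x. \<eta> n x * weighted_laplacian V f x) + (\<Sum>b\<in>Basis.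
      (2 *\<^sub>R l2_class V (\<lambda>x. partial_deriv b (\<eta> n) x * partial_deriv b f x) + l2_class V (\<lambda>x. partial_deriv b (partial_deriv b (\<eta> n)) x * f x))
        + (-1) *\<^sub>R l2_class V (\<lambda>x. partial_deriv b (\<eta> n) x * (partial_deriv b V x * f x)))" for n
    proof -
      have "l2_class V (weighted_laplacian V (g n)) = l2_class V (\<lambda>x. \<eta> n x * weighted_laplacian V f x)
        + l2_class V (\<lambda>x. \<Sum>b\<in>Basis. ((2 * (partial_deriv b (\<eta> n) x * partial_deriv b f x) + partial_deriv b (partial_deriv b (\<eta> n)) x * f x)
        + (-1) * (partial_deriv b (\<eta> n) x * (partial_deriv b V x * f x))))"
        unfolding pL by (rule add[OF w0[OF fL] weighted_square_integrable_sum[OF wb]])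
      then show ?thesis by (simp only: l2_class_sum[OF wb] lb cong: sum.cong)
    qed
    ultimately show "(\<lambda>n. l2_class V (weighted_laplacian V (g n))) \<longlonglongrightarrow> l2_class V (weighted_laplacian V f)"
      by simp
  qed
qed

text \<open>Damped polynomials lack compact support, so the inequality is passed to the limit of
  their cutoffs.\<close>

lemma gradient_interpolation:
  assumes f: "smooth f" and f0: "weighted_square_integrable V f"
    and f1: "\<And>b. b \<in> Basis \<Longrightarrow> weighted_square_integrable V (partial_deriv b f)"
    and f2: "\<And>b c. b \<in> Basis \<Longrightarrow> c \<in> Basis \<Longrightarrow> weighted_square_integrable V (partial_deriv c (partial_deriv b f))"
    and hess: "\<And>x v. hessian V x v \<bullet> v \<le> \<rho> * (v \<bullet> v)"
  shows "(\<Sum>b\<in>Basis. (norm (l2_class V (partial_deriv b f)))\<^sup>2)\<^sup>2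
    \<le> (norm (l2_class V f))\<^sup>2 * ((\<Sum>b\<in>Basis. \<Sum>c\<in>Basis. (norm (l2_class V (partial_deriv c (partial_deriv b f))))\<^sup>2)
      + \<rho> * (\<Sum>b\<in>Basis. (norm (l2_class V (partial_deriv b f)))\<^sup>2))"
proof -
  obtain g where g: "\<And>n. test_function (g n)" and l0: "(\<lambda>n. l2_class V (g n)) \<longlonglongrightarrow> l2_class V f"
    and l1: "\<And>b. b \<in> Basis \<Longrightarrow> (\<lambda>n. l2_class V (partial_deriv b (g n))) \<longlonglongrightarrow> l2_class V (partial_deriv b f)"
    and l2: "\<And>b c. b \<in> Basis \<Longrightarrow> c \<in> Basis \<Longrightarrow> weighted_square_integrable V (partial_deriv c (partial_deriv b f)) \<Longrightarrow>
      (\<lambda>n. l2_class V (partial_deriv c (partial_deriv b (g n)))) \<longlonglongrightarrow> l2_class V (partial_deriv c (partial_deriv b f))"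
    by (rule cutoff_approximation[OF f f0 f1]) (assumption, rule that)
  show ?thesis
  proof (rule LIMSEQ_le)
    show "(\<lambda>n. (\<Sum>b\<in>Basis. (norm (l2_class V (partial_deriv b (g n))))\<^sup>2)\<^sup>2) \<longlonglongrightarrow> (\<Sum>b\<in>Basis. (norm (l2_class V (partial_deriv b f)))\<^sup>2)\<^sup>2"
      by (intro tendsto_power tendsto_sum tendsto_norm l1)
    show "(\<lambda>n. (norm (l2_class V (g n)))\<^sup>2 * ((\<Sum>b\<in>Basis. \<Sum>c\<in>Basis. (norm (l2_class V (partial_deriv c (partial_deriv b (g n)))))\<^sup>2)
      + \<rho> * (\<Sum>b\<in>Basis. (norm (l2_class V (partial_deriv b (g n))))\<^sup>2)))
      \<longlonglongrightarrow> (norm (l2_class V f))\<^sup>2 * ((\<Sum>b\<in>Basis. \<Sum>c\<in>Basis. (norm (l2_class V (partial_deriv c (partial_deriv b f))))\<^sup>2)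
      + \<rho> * (\<Sum>b\<in>Basis. (norm (l2_class V (partial_deriv b f)))\<^sup>2))"
      by (intro tendsto_mult tendsto_add tendsto_power tendsto_sum tendsto_norm tendsto_const l0 l1 l2 f2)
    show "\<exists>N. \<forall>n\<ge>N. (\<Sum>b\<in>Basis. (norm (l2_class V (partial_deriv b (g n))))\<^sup>2)\<^sup>2
      \<le> (norm (l2_class V (g n)))\<^sup>2 * ((\<Sum>b\<in>Basis. \<Sum>c\<in>Basis. (norm (l2_class V (partial_deriv c (partial_deriv b (g n)))))\<^sup>2)
      + \<rho> * (\<Sum>b\<in>Basis. (norm (l2_class V (partial_deriv b (g n))))\<^sup>2))"
      using gradient_interpolation_test[OF V g hess] by blast
  qed
qed

lemma test_class_inj:
  assumes f: "test_function f" and g: "test_function g" and eq: "l2_class V f = l2_class V g" shows "f = g"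
proof (rule AE_eq_continuous_imp_eq)
  show "continuous_on UNIV f" "continuous_on UNIV g"
    using f g by (auto intro: smooth_continuous test_function_smooth)
  show "AE x in lborel. f x = g x"
    using eq l2_class_eq_iff[OF V_measurable[OF V]] test_function_square_integrable[OF V] f g by blast
qed

end

lemma sum_Basis_vec:
  fixes h :: "real ^ 'n \<Rightarrow> 'b::comm_monoid_add"
  shows "(\<Sum>b\<in>Basis. h b) = (\<Sum>i\<in>UNIV. h (axis i 1 :: real ^ 'n))"
proof -
  have "(Basis :: (real ^ 'n) set) = range (\<lambda>i. axis i 1)" by (auto simp: Basis_vec_def)
  then have "(\<Sum>b\<in>Basis. h b) = sum h (range (\<lambda>i. axis i 1))" by (rule arg_cong)
  moreover have "inj (\<lambda>i. axis i 1 :: real ^ 'n)" by (auto simp: inj_on_def axis_eq_axis)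
  ultimately show ?thesis by (simp only: sum.reindex comp_def)
qed

text \<open>Friedrichs extension with the gradient as \<open>D\<close>. Its components are collected
  in a vector indexed by \<open>'n\<close>, so the target is again a complete inner product
  type.\<close>

lemma self_adjoint_extension_exists:
  fixes V :: "real ^ 'n \<Rightarrow> real"
  assumes V: "smooth V"
  shows "\<exists>A. pull_rel V (neg_weighted_laplacian_graph V) \<subseteq> A \<and> selfadjoint_rel A"
proof -
  let ?S = "pull_rel V (neg_weighted_laplacian_graph V)"
  note S = pull_rel_graph[OF V] and M = V_measurable[OF V] and sq = test_function_square_integrable[OF V]
  have D: "Domain ?S = l2_class V ` Collect test_function" unfolding S by auto
  \<comment> \<open>Recovers the test function from its class; it is unique because continuous
    functions that agree almost everywhere are equal.\<close>
  define F where "F u = (SOME f. test_function f \<and> u = l2_class V f)" for u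
  have F: "F (l2_class V f) = f" if "test_function f" for f
  proof -
    have "test_function (F (l2_class V f)) \<and> l2_class V f = l2_class V (F (l2_class V f))"
      unfolding F_def by (rule someI[of _ f]) (use that in simp)
    then show ?thesis using test_class_inj[OF V] that by metis
  qed
  define G :: "(real ^ 'n) l2 \<Rightarrow> (real ^ 'n) l2 ^ 'n" where "G u = (\<chi> i. l2_class V (partial_deriv (axis i 1) (F u)))" for u
  have ax: "axis i 1 \<in> (Basis :: (real ^ 'n) set)" for i by (simp add: axis_in_Basis_iff)
  have Gf: "G (l2_class V f) $ i = l2_class V (partial_deriv (axis i 1) f)" if "test_function f" for f i
    by (simp add: G_def F that)
  show ?thesis
  proof (rule friedrichs_extension[where D=G])
    show "\<exists>f\<in>Domain ?S. norm (u - f) < e" if "e > 0" for u e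
      using test_classes_dense[OF V that, of u] unfolding D by blast
    show "subspace (Domain ?S)" unfolding D by (rule test_classes_subspace[OF V])
    show "G (u + v) = G u + G v" if uv: "u \<in> Domain ?S" "v \<in> Domain ?S" for u v
    proof -
      obtain f g where fg: "test_function f" "test_function g" "u = l2_class V f" "v = l2_class V g"
        using uv unfolding D by auto
      have "u + v = l2_class V (\<lambda>x. f x + g x)" unfolding fg by (simp add: l2_class_add[OF M] sq fg)
      moreover have "partial_deriv b (\<lambda>x. f x + g x) = (\<lambda>x. partial_deriv b f x + partial_deriv b g x)" for b
        using partial_add smooth_differentiable test_function_smooth fg by blast
      ultimately show ?thesis
        using fg Gf[OF test_function_add[OF fg(1,2)]]
        by (simp add: vec_eq_iff Gf l2_class_add[OF M] sq test_function_partial ax)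
    qed
    show "G (c *\<^sub>R u) = c *\<^sub>R G u" if u: "u \<in> Domain ?S" for c u
    proof -
      obtain f where f: "test_function f" "u = l2_class V f" using u unfolding D by auto
      have "c *\<^sub>R u = l2_class V (\<lambda>x. c * f x)" unfolding f by (simp add: l2_class_scale[OF M] sq f)
      moreover have "partial_deriv b (\<lambda>x. c * f x) = (\<lambda>x. c * partial_deriv b f x)" for b
        using partial_cmult smooth_differentiable test_function_smooth f by blast
      ultimately show ?thesis
        using f Gf[OF test_function_cmult[OF f(1)]]
        by (simp add: vec_eq_iff Gf l2_class_scale[OF M] sq test_function_partial ax)
    qed
    show "v \<bullet> w = G u \<bullet> G w" if uv: "(u, v) \<in> ?S" and w: "w \<in> Domain ?S" for u v w
    proof -
      obtain f where f: "test_function f" "u = l2_class V f" "v = l2_class V (\<lambda>x. - weighted_laplacian V f x)"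
        using uv unfolding S by auto
      obtain g where g: "test_function g" "w = l2_class V g" using w unfolding D by auto
      have "v \<bullet> w = (\<Sum>b\<in>Basis. l2_class V (partial_deriv b f) \<bullet> l2_class V (partial_deriv b g))"
        unfolding f g by (rule inner_weighted_laplacian[OF V f(1) g(1)])
      also have "\<dots> = G u \<bullet> G w" unfolding sum_Basis_vec inner_vec_def by (simp add: f g Gf)
      finally show ?thesis .
    qed
  qed
qed

section \<open>Polynomials\<close>

text \<open>Total degree at most \<open>d\<close>, in Horner form. The \<open>g b\<close> are not
  unique, but the recursion on \<open>d\<close> fits the induction on degree for derivatives and the
  Euler operator.\<close>

primrec poly_le :: "nat \<Rightarrow> ('a::euclidean_space \<Rightarrow> real) \<Rightarrow> bool" where
  "poly_le 0 f \<longleftrightarrow> (\<exists>c. f = (\<lambda>x. c))"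
| "poly_le (Suc d) f \<longleftrightarrow> (\<exists>c g. (\<forall>b\<in>Basis. poly_le d (g b)) \<and> f = (\<lambda>x. c + (\<Sum>b\<in>Basis. (x \<bullet> b) * g b x)))"

lemma poly_le_const: "poly_le d (\<lambda>x. c)"
proof (induction d arbitrary: c)
  case (Suc d)
  show ?case unfolding poly_le.simps
    by (intro exI[of _ c] exI[of _ "\<lambda>b x. 0"]) (simp add: Suc)
qed auto

lemma poly_le_Suc: "poly_le d f \<Longrightarrow> poly_le (Suc d) f"
proof (induction d arbitrary: f)
  case 0
  then obtain c where f: "f = (\<lambda>x. c)" by auto
  show ?case unfolding f by (rule poly_le_const)
next
  case (Suc d)
  then obtain c g where g: "\<forall>b\<in>Basis. poly_le d (g b)" and f: "f = (\<lambda>x. c + (\<Sum>b\<in>Basis. (x \<bullet> b) * g b x))" by auto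
  show ?case unfolding poly_le.simps(2)[of "Suc d"] f
    by (intro exI[of _ c] exI[of _ g]) (use g Suc.IH in blast)
qed

lemma poly_le_mono: "poly_le d f \<Longrightarrow> d \<le> e \<Longrightarrow> poly_le e f"
  by (induction e) (auto simp: le_Suc_eq intro: poly_le_Suc simp del: poly_le.simps(2))

lemma poly_le_add: "poly_le d f \<Longrightarrow> poly_le d g \<Longrightarrow> poly_le d (\<lambda>x. f x + g x)"
proof (induction d arbitrary: f g)
  case 0
  then show ?case by auto
next
  case (Suc d)
  obtain c h where h: "\<forall>b\<in>Basis. poly_le d (h b)" and f: "f = (\<lambda>x. c + (\<Sum>b\<in>Basis. (x \<bullet> b) * h b x))" using Suc.prems by auto
  obtain c' h' where h': "\<forall>b\<in>Basis. poly_le d (h' b)" and g: "g = (\<lambda>x. c' + (\<Sum>b\<in>Basis. (x \<bullet> b) * h' b x))" using Suc.prems by auto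
  show ?case unfolding poly_le.simps f g
  proof (intro exI[of _ "c + c'"] exI[of _ "\<lambda>b x. h b x + h' b x"] conjI)
    show "\<forall>b\<in>Basis. poly_le d (\<lambda>x. h b x + h' b x)" using h h' Suc.IH by blast
    show "(\<lambda>x. c + (\<Sum>b\<in>Basis. x \<bullet> b * h b x) + (c' + (\<Sum>b\<in>Basis. x \<bullet> b * h' b x)))
      = (\<lambda>x. c + c' + (\<Sum>b\<in>Basis. x \<bullet> b * (h b x + h' b x)))"
      by (simp add: distrib_left sum.distrib fun_eq_iff)
  qed
qed

lemma poly_le_cmult: "poly_le d f \<Longrightarrow> poly_le d (\<lambda>x. a * f x)"
proof (induction d arbitrary: f)
  case 0
  then show ?case by auto
next
  case (Suc d)
  obtain c h where h: "\<forall>b\<in>Basis. poly_le d (h b)" and f: "f = (\<lambda>x. c + (\<Sum>b\<in>Basis. (x \<bullet> b) * h b x))" using Suc.prems by auto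
  show ?case unfolding poly_le.simps f
  proof (intro exI[of _ "a * c"] exI[of _ "\<lambda>b x. a * h b x"] conjI)
    show "\<forall>b\<in>Basis. poly_le d (\<lambda>x. a * h b x)" using h Suc.IH by blast
    show "(\<lambda>x. a * (c + (\<Sum>b\<in>Basis. x \<bullet> b * h b x))) = (\<lambda>x. a * c + (\<Sum>b\<in>Basis. x \<bullet> b * (a * h b x)))"
      by (simp add: distrib_left sum_distrib_left mult.left_commute fun_eq_iff)
  qed
qed

lemma poly_le_sum: "(\<And>i. i \<in> I \<Longrightarrow> poly_le d (f i)) \<Longrightarrow> poly_le d (\<lambda>x. \<Sum>i\<in>I. f i x)"
  by (induction I rule: infinite_finite_induct) (auto intro: poly_le_add poly_le_const)

lemma poly_le_coord: assumes f: "poly_le d f" and b: "b \<in> Basis" shows "poly_le (Suc d) (\<lambda>x. (x \<bullet> b) * f x)"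
  unfolding poly_le.simps
proof (intro exI[of _ 0] exI[of _ "\<lambda>b' x. if b' = b then f x else 0"] conjI)
  show "\<forall>b'\<in>Basis. poly_le d (\<lambda>x. if b' = b then f x else 0)"
  proof
    fix b'
    show "poly_le d (\<lambda>x. if b' = b then f x else 0)"
      using f poly_le_const[of d 0] by (cases "b' = b") simp_all
  qed
  show "(\<lambda>x. x \<bullet> b * f x) = (\<lambda>x. 0 + (\<Sum>b'\<in>Basis. x \<bullet> b' * (if b' = b then f x else 0)))"
    using b by (simp add: if_distrib fun_eq_iff cong: if_cong)
qed

lemma poly_le_norm_sq: assumes f: "poly_le d f" shows "poly_le (Suc (Suc d)) (\<lambda>x. (norm x)\<^sup>2 * f x)"
proof -
  have "(\<lambda>x. (norm x)\<^sup>2 * f x) = (\<lambda>x. \<Sum>b\<in>Basis. (x \<bullet> b) * ((x \<bullet> b) * f x))"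
    unfolding power2_norm_eq_inner by (subst euclidean_inner) (simp add: sum_distrib_right mult.assoc)
  then show ?thesis using f by (simp only:) (intro poly_le_sum poly_le_coord)
qed

lemma poly_le_smooth: "poly_le d f \<Longrightarrow> smooth f"
proof (induction d arbitrary: f)
  case 0
  then show ?case by (auto intro: smooth_const)
next
  case (Suc d)
  then obtain c g where g: "\<forall>b\<in>Basis. poly_le d (g b)" and f: "f = (\<lambda>x. c + (\<Sum>b\<in>Basis. (x \<bullet> b) * g b x))" by auto
  show ?case unfolding f using g Suc.IH by (intro smooth_add smooth_const smooth_sum smooth_mult smooth_inner) auto
qed

lemma partial_sum:
  assumes "\<And>i. i \<in> I \<Longrightarrow> smooth (h i)"
  shows "partial_deriv b (\<lambda>x. \<Sum>i\<in>I. h i x) x = (\<Sum>i\<in>I. partial_deriv b (h i) x)"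
  using assms
proof (induction I rule: infinite_finite_induct)
  case (insert i I)
  then have "partial_deriv b (\<lambda>x. h i x + (\<Sum>i\<in>I. h i x)) x = partial_deriv b (h i) x + partial_deriv b (\<lambda>x. \<Sum>i\<in>I. h i x) x"
    by (intro partial_add smooth_differentiable smooth_sum) auto
  then show ?case using insert by simp
qed (simp_all add: partial_const)

lemma poly_partial_eq:
  assumes g: "\<And>b. b \<in> Basis \<Longrightarrow> smooth (g b)"
  shows "partial_deriv v (\<lambda>x. c + (\<Sum>b\<in>Basis. (x \<bullet> b) * g b x)) = (\<lambda>x. \<Sum>b\<in>Basis. (x \<bullet> b) * partial_deriv v (g b) x + (v \<bullet> b) * g b x)"
proof
  fix x
  have sm: "smooth (\<lambda>x. (x \<bullet> b) * g b x)" if "b \<in> Basis" for b by (intro smooth_mult smooth_inner g that)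
  have "partial_deriv v (\<lambda>x. c + (\<Sum>b\<in>Basis. (x \<bullet> b) * g b x)) x = partial_deriv v (\<lambda>x. c) x + partial_deriv v (\<lambda>x. \<Sum>b\<in>Basis. (x \<bullet> b) * g b x) x"
    by (intro partial_add smooth_differentiable smooth_sum smooth_const sm)
  also have "\<dots> = (\<Sum>b\<in>Basis. partial_deriv v (\<lambda>x. (x \<bullet> b) * g b x) x)" by (simp add: partial_const partial_sum sm)
  also have "\<dots> = (\<Sum>b\<in>Basis. (x \<bullet> b) * partial_deriv v (g b) x + (v \<bullet> b) * g b x)"
    by (intro sum.cong refl, subst partial_mult) (auto intro!: smooth_differentiable smooth_inner g simp: partial_inner)
  finally show "partial_deriv v (\<lambda>x. c + (\<Sum>b\<in>Basis. (x \<bullet> b) * g b x)) x = (\<Sum>b\<in>Basis. (x \<bullet> b) * partial_deriv v (g b) x + (v \<bullet> b) * g b x)" .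
qed

lemma poly_le_partial: "poly_le (Suc d) f \<Longrightarrow> poly_le d (partial_deriv v f)"
proof (induction d arbitrary: f)
  case 0
  then obtain c g where g: "\<forall>b\<in>Basis. poly_le 0 (g b)" and f: "f = (\<lambda>x. c + (\<Sum>b\<in>Basis. (x \<bullet> b) * g b x))" by auto
  obtain k where k: "\<And>b. b \<in> Basis \<Longrightarrow> g b = (\<lambda>x. k b)" using bchoice[of Basis "\<lambda>b c. g b = (\<lambda>x. c)"] g by auto
  have "partial_deriv v f = (\<lambda>x. \<Sum>b\<in>Basis. (v \<bullet> b) * k b)"
    unfolding f by (subst poly_partial_eq) (simp_all add: k smooth_const partial_const)
  then show ?case by auto
next
  case (Suc d)
  then obtain c g where g: "\<And>b. b \<in> Basis \<Longrightarrow> poly_le (Suc d) (g b)" and f: "f = (\<lambda>x. c + (\<Sum>b\<in>Basis. (x \<bullet> b) * g b x))"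
    using poly_le.simps(2)[of "Suc d" f] by blast
  show ?case unfolding f
    by (subst poly_partial_eq) (auto intro!: poly_le_sum poly_le_add poly_le_cmult poly_le_coord Suc.IH g intro: poly_le_smooth[OF g] simp del: poly_le.simps)
qed

lemma poly_le_partial': "poly_le d f \<Longrightarrow> poly_le d (partial_deriv v f)"
  by (rule poly_le_partial[OF poly_le_Suc])

lemma poly_le_bound: "poly_le d f \<Longrightarrow> \<exists>C\<ge>0. \<forall>x. \<bar>f x\<bar> \<le> C * (1 + norm x) ^ d"
proof (induction d arbitrary: f)
  case 0
  then obtain c where "f = (\<lambda>x. c)" by auto
  then show ?case by (intro exI[of _ "\<bar>c\<bar>"]) auto
next
  case (Suc d)
  then obtain c g where g': "\<forall>b\<in>Basis. poly_le d (g b)" and f: "f = (\<lambda>x. c + (\<Sum>b\<in>Basis. (x \<bullet> b) * g b x))" by auto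
  have g: "poly_le d (g b)" if "b \<in> Basis" for b using g' that by blast
  obtain C where C: "\<And>b. b \<in> Basis \<Longrightarrow> C b \<ge> 0" "\<And>b x. b \<in> Basis \<Longrightarrow> \<bar>g b x\<bar> \<le> C b * (1 + norm x) ^ d"
    using Suc.IH[OF g] by metis
  show ?case
  proof (intro exI[of _ "\<bar>c\<bar> + (\<Sum>b\<in>Basis. C b)"] conjI allI)
    show "0 \<le> \<bar>c\<bar> + (\<Sum>b\<in>Basis. C b)" using C(1) by (simp add: sum_nonneg)
    fix x
    have "\<bar>f x\<bar> \<le> \<bar>c\<bar> + (\<Sum>b\<in>Basis. \<bar>(x \<bullet> b) * g b x\<bar>)"
      unfolding f by (rule order_trans[OF abs_triangle_ineq]) (simp add: sum_abs)
    also have "\<dots> \<le> \<bar>c\<bar> * (1 + norm x) ^ Suc d + (\<Sum>b\<in>Basis. C b * (1 + norm x) ^ Suc d)"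
    proof (rule add_mono[OF _ sum_mono])
      show "\<bar>c\<bar> \<le> \<bar>c\<bar> * (1 + norm x) ^ Suc d" using mult_left_mono[OF one_le_power[of "1 + norm x" "Suc d"], of "\<bar>c\<bar>"] by simp
      fix b :: 'a assume b: "b \<in> Basis"
      have "\<bar>(x \<bullet> b) * g b x\<bar> \<le> (1 + norm x) * (C b * (1 + norm x) ^ d)"
        unfolding abs_mult using C[OF b] Basis_le_norm[OF b, of x] by (intro mult_mono) (auto intro: order_trans)
      then show "\<bar>(x \<bullet> b) * g b x\<bar> \<le> C b * (1 + norm x) ^ Suc d" by (simp add: mult.left_commute)
    qed
    finally show "\<bar>f x\<bar> \<le> (\<bar>c\<bar> + (\<Sum>b\<in>Basis. C b)) * (1 + norm x) ^ Suc d" by (simp add: distrib_right sum_distrib_right)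
  qed
qed

section \<open>Damped polynomials\<close>

text \<open>The logarithmic derivative of a power of \<open>damp\<close> is of order
  \<open>s\<close> uniformly in space, so damping perturbs gradients by a small multiple of the
  function itself. Since \<open>damp\<close> never vanishes, multiplication by it preserves linear
  independence.\<close>

definition damp :: "real \<Rightarrow> 'a::euclidean_space \<Rightarrow> real" where
  "damp s x = 1 / (1 + s\<^sup>2 * (norm x)\<^sup>2)"

lemma damp_range: "0 < damp s x" "damp s x \<le> 1"
  unfolding damp_def by (auto simp: add_pos_nonneg)

lemma damp_inverse: "(1 + s\<^sup>2 * (norm x)\<^sup>2) * damp s x = 1"
  unfolding damp_def using add_pos_nonneg[of 1 "s\<^sup>2 * (norm x)\<^sup>2"] by simp

lemma damp_power_derivative:
  "((\<lambda>x. damp s x ^ k) has_derivative (\<lambda>h. - 2 * real k * s\<^sup>2 * (x \<bullet> h) * damp s x ^ Suc k)) (at x)"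
proof -
  let ?q = "\<lambda>x::'a. 1 + s\<^sup>2 * (x \<bullet> x)"
  have q0: "?q x > 0" by (simp add: add_pos_nonneg)
  have q: "(?q has_derivative (\<lambda>h. s\<^sup>2 * (x \<bullet> h + h \<bullet> x))) (at x)"
    by (auto intro!: derivative_eq_intros)
  have "((\<lambda>t. inverse t ^ k) has_real_derivative - real k * inverse (?q x) ^ Suc k) (at (?q x))"
  proof (cases k)
    case (Suc j)
    have "((\<lambda>t. inverse t ^ Suc j) has_real_derivative (1 + of_nat j) * (- (inverse (?q x) ^ Suc (Suc 0)) * inverse (?q x) ^ j)) (at (?q x))"
      by (rule DERIV_power_Suc[OF DERIV_inverse]) (use q0 in simp)
    then show ?thesis using Suc by (simp add: algebra_simps)
  qed simp
  then have "((\<lambda>x. inverse (?q x) ^ k) has_derivative (\<lambda>h. - real k * inverse (?q x) ^ Suc k * (s\<^sup>2 * (x \<bullet> h + h \<bullet> x)))) (at x)"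
    unfolding has_field_derivative_def by (rule has_derivative_compose[OF q])
  moreover have "damp s = (\<lambda>x. inverse (?q x))" by (simp add: damp_def fun_eq_iff power2_norm_eq_inner divide_inverse)
  ultimately show ?thesis by (simp add: inner_commute algebra_simps)
qed

lemma damp_power_differentiable: "(\<lambda>x. damp s x ^ k) differentiable (at x)"
  using damp_power_derivative differentiableI by blast

lemma damp_power_partial: "partial_deriv b (\<lambda>x. damp s x ^ k) x = - 2 * real k * s\<^sup>2 * (x \<bullet> b) * damp s x ^ Suc k"
  by (rule partial_deriv_eq[OF damp_power_derivative])

lemma damped_partial:
  assumes P: "smooth P"
  shows "partial_deriv b (\<lambda>x. P x * damp s x ^ k) x
    = (partial_deriv b P x + s\<^sup>2 * ((norm x)\<^sup>2 * partial_deriv b P x) + (- 2 * real k * s\<^sup>2) * ((x \<bullet> b) * P x)) * damp s x ^ Suc k"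
proof -
  have "partial_deriv b (\<lambda>x. P x * damp s x ^ k) x
    = P x * (- 2 * real k * s\<^sup>2 * (x \<bullet> b) * damp s x ^ Suc k) + partial_deriv b P x * damp s x ^ k"
    using partial_mult[OF smooth_differentiable[OF P] damp_power_differentiable] by (simp add: damp_power_partial)
  \<comment> \<open>The factor 1 is written as \<open>damp\<close> times its reciprocal, to bring
    both terms to the power \<open>Suc k\<close>.\<close>
  also have "damp s x ^ k = (1 + s\<^sup>2 * (norm x)\<^sup>2) * damp s x * damp s x ^ k" unfolding damp_inverse by simp
  finally show ?thesis by (simp add: algebra_simps)
qed

lemma damped_partial_poly:
  assumes P: "poly_le (2 * k) P" and b: "b \<in> Basis"
  obtains Q where "poly_le (2 * Suc k) Q" "partial_deriv b (\<lambda>x. P x * damp s x ^ k) = (\<lambda>x. Q x * damp s x ^ Suc k)"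
proof -
  let ?Q = "\<lambda>x. partial_deriv b P x + s\<^sup>2 * ((norm x)\<^sup>2 * partial_deriv b P x) + (- 2 * real k * s\<^sup>2) * ((x \<bullet> b) * P x)"
  have "poly_le (Suc (Suc (2 * k))) ?Q"
  proof (intro poly_le_add poly_le_cmult)
    show "poly_le (Suc (Suc (2 * k))) (partial_deriv b P)" by (rule poly_le_mono[OF poly_le_partial'[OF P]]) simp
    show "poly_le (Suc (Suc (2 * k))) (\<lambda>x. (norm x)\<^sup>2 * partial_deriv b P x)" by (rule poly_le_norm_sq[OF poly_le_partial'[OF P]])
    show "poly_le (Suc (Suc (2 * k))) (\<lambda>x. (x \<bullet> b) * P x)" by (rule poly_le_mono[OF poly_le_coord[OF P b]]) simp
  qed
  moreover have "partial_deriv b (\<lambda>x. P x * damp s x ^ k) = (\<lambda>x. ?Q x * damp s x ^ Suc k)"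
    using damped_partial[OF poly_le_smooth[OF P]] by blast
  ultimately show ?thesis using that[of ?Q] by simp
qed

text \<open>Differentiation raises the power of \<open>damp\<close> by one and the permitted degree
  by two, so the condition that the degree is at most \<open>2 * k\<close> is stable.\<close>

lemma damped_smooth:
  fixes P :: "'a::euclidean_space \<Rightarrow> real"
  shows "poly_le (2 * k) P \<Longrightarrow> smooth (\<lambda>x. P x * damp s x ^ k)"
proof (rule smooth_coinduct[of _ "{\<lambda>x. P x * damp s x ^ k | (P :: 'a \<Rightarrow> real) k. poly_le (2 * k) P}"])
  assume "poly_le (2 * k) P"
  then show "(\<lambda>x. P x * damp s x ^ k) \<in> {\<lambda>x. P x * damp s x ^ k | P k. poly_le (2 * k) P}" by blast
next
  fix g :: "'a \<Rightarrow> real" assume "g \<in> {\<lambda>x. P x * damp s x ^ k | P k. poly_le (2 * k) P}"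
  then obtain P k where g: "g = (\<lambda>x. P x * damp s x ^ k)" and P: "poly_le (2 * k) P" by blast
  show "g differentiable_on UNIV"
    unfolding g differentiable_on_def
    using differentiableI[OF has_derivative_mult[OF smooth_has_derivative[OF poly_le_smooth[OF P]] damp_power_derivative]] by simp
  fix b :: 'a assume "b \<in> Basis"
  then obtain Q where "poly_le (2 * Suc k) Q" "partial_deriv b g = (\<lambda>x. Q x * damp s x ^ Suc k)"
    unfolding g by (rule damped_partial_poly[OF P])
  then show "partial_deriv b g \<in> {\<lambda>x. P x * damp s x ^ k | P k. poly_le (2 * k) P}" by blast
qed

lemma damped_bounded:
  assumes P: "poly_le (2 * k) P" and s: "0 < s" "s \<le> 1"
  obtains B where "B \<ge> 0" "\<And>x. \<bar>P x * damp s x ^ k\<bar> \<le> B"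
proof -
  obtain C where C: "C \<ge> 0" "\<And>x. \<bar>P x\<bar> \<le> C * (1 + norm x) ^ (2 * k)" using poly_le_bound[OF P] by blast
  have q: "(1 + norm x)\<^sup>2 * damp s x \<le> 2 / s\<^sup>2" for x :: 'a
  proof -
    have "(1 + norm x)\<^sup>2 \<le> 2 * (1 + (norm x)\<^sup>2)"
      using zero_le_power2[of "1 - norm x"] by (simp add: power2_eq_square algebra_simps)
    also have "\<dots> = 2 / s\<^sup>2 * (s\<^sup>2 + s\<^sup>2 * (norm x)\<^sup>2)" using s by (simp add: field_simps)
    also have "\<dots> \<le> 2 / s\<^sup>2 * (1 + s\<^sup>2 * (norm x)\<^sup>2)" using s by (intro mult_left_mono add_mono power_le_one) auto
    finally have "(1 + norm x)\<^sup>2 * damp s x \<le> 2 / s\<^sup>2 * (1 + s\<^sup>2 * (norm x)\<^sup>2) * damp s x"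
      using damp_range(1)[of s x] by (intro mult_right_mono) auto
    then show ?thesis by (simp only: mult.assoc damp_inverse mult_1_right)
  qed
  have "\<bar>P x * damp s x ^ k\<bar> \<le> C * (2 / s\<^sup>2) ^ k" for x
  proof -
    have "\<bar>P x * damp s x ^ k\<bar> = \<bar>P x\<bar> * damp s x ^ k" using damp_range(1)[of s x] by (simp add: abs_mult)
    also have "\<dots> \<le> C * (1 + norm x) ^ (2 * k) * damp s x ^ k"
      using C(2)[of x] damp_range(1)[of s x] by (intro mult_right_mono) auto
    also have "\<dots> = C * ((1 + norm x)\<^sup>2 * damp s x) ^ k" by (simp add: power_mult power_mult_distrib)
    also have "\<dots> \<le> C * (2 / s\<^sup>2) ^ k"
      using q[of x] C(1) damp_range(1)[of s x] by (intro mult_left_mono power_mono) auto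
    finally show ?thesis .
  qed
  then show ?thesis using that[of "C * (2 / s\<^sup>2) ^ k"] C(1) by simp
qed

text \<open>Minus the logarithmic derivative of \<open>damp s x ^ m\<close> in direction
  \<open>b\<close>. The exponent 1 is kept so that the results on damped polynomials apply to
  it.\<close>

definition damp_log :: "nat \<Rightarrow> real \<Rightarrow> 'a::euclidean_space \<Rightarrow> 'a \<Rightarrow> real" where
  "damp_log m s b x = (2 * real m * s\<^sup>2) * (x \<bullet> b) * damp s x ^ 1"

lemma damped_partial_log:
  assumes P: "smooth P"
  shows "partial_deriv b (\<lambda>x. P x * damp s x ^ m) x = partial_deriv b P x * damp s x ^ m + (-1) * (damp_log m s b x * (P x * damp s x ^ m))"
proof -
  have "partial_deriv b (\<lambda>x. P x * damp s x ^ m) x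
    = P x * (- 2 * real m * s\<^sup>2 * (x \<bullet> b) * damp s x ^ Suc m) + partial_deriv b P x * damp s x ^ m"
    using partial_mult[OF smooth_differentiable[OF P] damp_power_differentiable] by (simp add: damp_power_partial)
  then show ?thesis by (simp add: damp_log_def algebra_simps)
qed

lemma damp_coord_le: assumes s: "0 < s" and b: "norm b \<le> 1" shows "s * \<bar>x \<bullet> b\<bar> * damp s x \<le> 1"
proof -
  have "\<bar>x \<bullet> b\<bar> \<le> norm x * norm b" by (rule Cauchy_Schwarz_ineq2)
  also have "\<dots> \<le> norm x" using mult_left_mono[OF b, of "norm x"] by simp
  finally have "s * \<bar>x \<bullet> b\<bar> \<le> s * norm x" using s by simp
  also have "\<dots> \<le> 1 + s\<^sup>2 * (norm x)\<^sup>2"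
    using zero_le_power2[of "s * norm x - 1"] zero_le_power2[of "s * norm x"] by (simp add: power2_eq_square algebra_simps)
  finally have "s * \<bar>x \<bullet> b\<bar> * damp s x \<le> (1 + s\<^sup>2 * (norm x)\<^sup>2) * damp s x"
    using damp_range(1)[of s x] by (intro mult_right_mono) auto
  then show ?thesis by (simp add: damp_inverse)
qed

text \<open>The function is bounded by \<open>2 * m * s\<close>, its derivative by
  \<open>2 * m * s\<close> times 3 since \<open>s\<close> is at most 1; one constant is used for
  both.\<close>

lemma damp_log_bounds:
  assumes s: "0 < s" "s \<le> 1" and b: "b \<in> Basis" and c: "c \<in> Basis"
  shows "\<bar>damp_log m s b x\<bar> \<le> 6 * real m * s" "\<bar>partial_deriv c (damp_log m s b) x\<bar> \<le> 6 * real m * s" "smooth (damp_log m s b)"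
proof -
  have b1: "s * \<bar>x \<bullet> b\<bar> * damp s x \<le> 1" and c1: "s * \<bar>x \<bullet> c\<bar> * damp s x \<le> 1"
    using damp_coord_le[OF s(1), of b x] damp_coord_le[OF s(1), of c x] b c by simp_all
  have "\<bar>damp_log m s b x\<bar> = (2 * real m * s) * (s * \<bar>x \<bullet> b\<bar> * damp s x)"
    using s damp_range(1)[of s x] by (simp add: damp_log_def abs_mult power2_eq_square)
  also have "\<dots> \<le> (2 * real m * s) * 1" using b1 s by (intro mult_left_mono) auto
  also have "\<dots> \<le> 6 * real m * s" using s by simp
  finally show "\<bar>damp_log m s b x\<bar> \<le> 6 * real m * s" .
  let ?P = "\<lambda>x. (2 * real m * s\<^sup>2) * (x \<bullet> b)"
  have P: "poly_le (2 * 1) ?P"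
    using poly_le_cmult[OF poly_le_mono[OF poly_le_coord[OF poly_le_const[of 0 1] b]], of 2] by simp
  show "smooth (damp_log m s b)" unfolding damp_log_def[abs_def] using damped_smooth[OF P] .
  have "partial_deriv c ?P x = (2 * real m * s\<^sup>2) * (c \<bullet> b)"
    by (subst partial_cmult) (auto intro: smooth_differentiable smooth_inner simp: partial_inner)
  moreover have "partial_deriv c (damp_log m s b) x = ?P x * partial_deriv c (\<lambda>x. damp s x ^ 1) x + partial_deriv c ?P x * damp s x ^ 1"
    unfolding damp_log_def[abs_def]
    by (rule partial_mult[OF smooth_differentiable[OF poly_le_smooth[OF P]] damp_power_differentiable])
  ultimately have "partial_deriv c (damp_log m s b) x
      = ?P x * (- 2 * real 1 * s\<^sup>2 * (x \<bullet> c) * damp s x ^ Suc 1) + (2 * real m * s\<^sup>2) * (c \<bullet> b) * damp s x ^ 1"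
    by (simp only: damp_power_partial)
  also have "\<dots> = (2 * real m * s) * (s * ((c \<bullet> b) * damp s x - 2 * ((s * (x \<bullet> b) * damp s x) * (s * (x \<bullet> c) * damp s x))))"
    by (simp add: algebra_simps power2_eq_square)
  finally have "\<bar>partial_deriv c (damp_log m s b) x\<bar> = (2 * real m * s) * (s * \<bar>(c \<bullet> b) * damp s x - 2 * ((s * (x \<bullet> b) * damp s x) * (s * (x \<bullet> c) * damp s x))\<bar>)"
    using s by (simp add: abs_mult)
  also have "\<dots> \<le> (2 * real m * s) * (1 * 3)"
  proof (intro mult_left_mono mult_mono)
    have "\<bar>(c \<bullet> b) * damp s x\<bar> \<le> 1 * 1"
      unfolding abs_mult using damp_range[of s x] b c by (intro mult_mono) (auto simp: inner_Basis)
    moreover have "\<bar>(s * (x \<bullet> b) * damp s x) * (s * (x \<bullet> c) * damp s x)\<bar> \<le> 1 * 1"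
      unfolding abs_mult[of "s * (x \<bullet> b) * damp s x"] using b1 c1 s damp_range(1)[of s x]
      by (intro mult_mono) (auto simp: abs_mult)
    ultimately show "\<bar>(c \<bullet> b) * damp s x - 2 * ((s * (x \<bullet> b) * damp s x) * (s * (x \<bullet> c) * damp s x))\<bar> \<le> 3" by linarith
  qed (use s in auto)
  finally show "\<bar>partial_deriv c (damp_log m s b) x\<bar> \<le> 6 * real m * s" by simp
qed

text \<open>Young's inequality with weight \<open>s\<close>: the cross term is at most
  \<open>s * (norm x)\<^sup>2 + (norm y)\<^sup>2 / s\<close>, and since \<open>norm y\<close> is of
  order \<open>s\<close>, every correction is of order \<open>s\<close>.\<close>

lemma norm_sq_perturb:
  fixes x y :: "'h::real_inner"
  assumes s: "0 < s" "s \<le> 1" and y: "norm y \<le> K * s * r"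
  shows "(norm (x + y))\<^sup>2 \<le> (1 + s) * (norm x)\<^sup>2 + 2 * K\<^sup>2 * s * r\<^sup>2"
proof -
  have "2 * (norm x * norm y) \<le> s * (norm x)\<^sup>2 + (norm y)\<^sup>2 / s"
  proof -
    have "0 \<le> (s * norm x - norm y)\<^sup>2 / s" using s by simp
    also have "\<dots> = s * (norm x)\<^sup>2 + (norm y)\<^sup>2 / s - 2 * (norm x * norm y)"
      using s by (simp add: power2_diff power_mult_distrib field_simps power2_eq_square)
    finally show ?thesis by simp
  qed
  moreover have "(norm (x + y))\<^sup>2 \<le> (norm x + norm y)\<^sup>2" by (intro power_mono norm_triangle_ineq) simp
  ultimately have 1: "(norm (x + y))\<^sup>2 \<le> (1 + s) * (norm x)\<^sup>2 + ((norm y)\<^sup>2 + (norm y)\<^sup>2 / s)"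
    by (simp add: power2_sum algebra_simps)
  have y2: "(norm y)\<^sup>2 \<le> (K * s * r)\<^sup>2" using y by (intro power_mono) auto
  then have "(norm y)\<^sup>2 / s \<le> (K * s * r)\<^sup>2 / s" using s by (intro divide_right_mono) auto
  also have "\<dots> = K\<^sup>2 * s * r\<^sup>2" using s by (simp add: power_mult_distrib power2_eq_square)
  finally have 2: "(norm y)\<^sup>2 / s \<le> K\<^sup>2 * s * r\<^sup>2" .
  have "(K * s * r)\<^sup>2 = (K\<^sup>2 * s * r\<^sup>2) * s" by (simp add: power_mult_distrib power2_eq_square)
  also have "\<dots> \<le> (K\<^sup>2 * s * r\<^sup>2) * 1" using s by (intro mult_left_mono) auto
  finally show ?thesis using 1 2 y2 by simp
qed

text \<open>If \<open>t2\<close> exceeded \<open>\<Lambda> * a2\<close>, then \<open>a2\<close>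
  would be at most \<open>t2 / \<Lambda>\<close>, the bracket would be at most
  \<open>\<Lambda> * t2\<close>, and \<open>t2\<^sup>2 < t2\<^sup>2\<close> would follow.\<close>

lemma interpolation_conclusion:
  fixes a2 t2 :: real
  assumes a2: "a2 \<ge> 0" and t2: "t2\<^sup>2 \<le> a2 * (\<alpha> * t2 + q * (a2 + t2) + \<rho> * t2)" and q: "q \<ge> 0"
    and \<Lambda>: "\<Lambda> > 0" "\<alpha> + \<rho> + q * (1 + 1 / \<Lambda>) \<le> \<Lambda>"
  shows "t2 \<le> \<Lambda> * a2"
proof (rule ccontr)
  assume "\<not> t2 \<le> \<Lambda> * a2"
  then have lt: "\<Lambda> * a2 < t2" by simp
  moreover have "\<Lambda> * a2 \<ge> 0" using a2 \<Lambda> by simp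
  ultimately have t0: "t2 > 0" by linarith
  have "a2 \<le> t2 / \<Lambda>" using lt \<Lambda> by (simp add: pos_le_divide_eq mult.commute)
  then have "q * (a2 + t2) \<le> q * (t2 * (1 + 1 / \<Lambda>))" using q by (intro mult_left_mono) (simp_all add: algebra_simps)
  then have "\<alpha> * t2 + q * (a2 + t2) + \<rho> * t2 \<le> t2 * (\<alpha> + \<rho> + q * (1 + 1 / \<Lambda>))" by (simp add: algebra_simps)
  also have "\<dots> \<le> t2 * \<Lambda>" using \<Lambda> t0 by (intro mult_left_mono) auto
  finally have "t2\<^sup>2 \<le> a2 * (t2 * \<Lambda>)" using t2 mult_left_mono[OF _ a2] by (meson order_trans)
  also have "\<dots> < t2 * t2" using mult_strict_right_mono[OF lt t0] by (simp add: mult_ac)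
  finally show False by (simp add: power2_eq_square)
qed

context
  fixes V :: "'a::euclidean_space \<Rightarrow> real"
  assumes V: "smooth V" and V_int: "integrable lborel (\<lambda>x. exp (- V x))"
begin

lemma bounded_square_integrable:
  assumes "f \<in> borel_measurable borel" "\<And>x. \<bar>f x\<bar> \<le> B" shows "weighted_square_integrable V f"
proof -
  have "weighted_square_integrable V (\<lambda>x. 1)" unfolding weighted_square_integrable_def using V_int by simp
  from bounded_mult_square_integrable[OF V this assms] show ?thesis by simp
qed

lemma norm_bounded_mult:
  assumes k: "weighted_square_integrable V k" and g: "g \<in> borel_measurable borel" and B: "\<And>x. \<bar>g x\<bar> \<le> B"
  shows "norm (l2_class V (\<lambda>x. g x * k x)) \<le> B * norm (l2_class V k)"
proof -
  note M = V_measurable[OF V]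
  have B0: "B \<ge> 0" using B[of 0] by (meson abs_ge_zero order_trans)
  have gk: "weighted_square_integrable V (\<lambda>x. g x * k x)" by (rule bounded_mult_square_integrable[OF V k g B])
  have nrm: "(norm (l2_class V h))\<^sup>2 = (\<integral>x. exp (- V x) * (h x)\<^sup>2 \<partial>lborel)" if "weighted_square_integrable V h" for h
    using inner_l2_class[OF M that that] by (simp only: power2_norm_eq_inner) (simp add: power2_eq_square)
  have "(norm (l2_class V (\<lambda>x. g x * k x)))\<^sup>2 \<le> (\<integral>x. B\<^sup>2 * (exp (- V x) * (k x)\<^sup>2) \<partial>lborel)"
    unfolding nrm[OF gk]
  proof (rule integral_mono)
    show "integrable lborel (\<lambda>x. exp (- V x) * (g x * k x)\<^sup>2)" "integrable lborel (\<lambda>x. B\<^sup>2 * (exp (- V x) * (k x)\<^sup>2))"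
      using gk k by (simp_all add: weighted_square_integrable_def)
    fix x
    have "(g x)\<^sup>2 \<le> B\<^sup>2" using B[of x] by (metis abs_ge_zero power2_abs power_mono)
    then have "(g x)\<^sup>2 * (exp (- V x) * (k x)\<^sup>2) \<le> B\<^sup>2 * (exp (- V x) * (k x)\<^sup>2)" by (rule mult_right_mono) simp
    then show "exp (- V x) * (g x * k x)\<^sup>2 \<le> B\<^sup>2 * (exp (- V x) * (k x)\<^sup>2)" by (simp add: power_mult_distrib mult_ac)
  qed
  also have "\<dots> = (B * norm (l2_class V k))\<^sup>2" by (simp add: nrm[OF k] power_mult_distrib)
  finally show ?thesis by (rule power2_le_imp_le) (use B0 in simp)
qed

lemma damped_square_integrable:
  assumes P: "poly_le (2 * k) P" and s: "0 < s" "s \<le> 1"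
  shows "weighted_square_integrable V (\<lambda>x. P x * damp s x ^ k)"
    "b \<in> Basis \<Longrightarrow> weighted_square_integrable V (partial_deriv b (\<lambda>x. P x * damp s x ^ k))"
    "b \<in> Basis \<Longrightarrow> c \<in> Basis \<Longrightarrow> weighted_square_integrable V (partial_deriv c (partial_deriv b (\<lambda>x. P x * damp s x ^ k)))"
proof -
  have w: "weighted_square_integrable V (\<lambda>x. P x * damp s x ^ k)" if P: "poly_le (2 * k) P" for P k
  proof -
    obtain B where "\<And>x. \<bar>P x * damp s x ^ k\<bar> \<le> B" by (rule damped_bounded[OF P s]) (rule that)
    then show ?thesis by (rule bounded_square_integrable[OF smooth_measurable[OF damped_smooth[OF P]]])
  qed
  show "weighted_square_integrable V (\<lambda>x. P x * damp s x ^ k)" by (rule w[OF P])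
  have d: "\<exists>Q. poly_le (2 * Suc k) Q \<and> partial_deriv b (\<lambda>x. P x * damp s x ^ k) = (\<lambda>x. Q x * damp s x ^ Suc k)"
    if "poly_le (2 * k) P" "b \<in> Basis" for P k b
    by (rule damped_partial_poly[OF that]) blast
  show "weighted_square_integrable V (partial_deriv b (\<lambda>x. P x * damp s x ^ k))" if b: "b \<in> Basis"
  proof -
    obtain Q where "poly_le (2 * Suc k) Q" "partial_deriv b (\<lambda>x. P x * damp s x ^ k) = (\<lambda>x. Q x * damp s x ^ Suc k)"
      using d[OF P b] by blast
    then show ?thesis using w[of "Suc k" Q] by (simp only:)
  qed
  show "weighted_square_integrable V (partial_deriv c (partial_deriv b (\<lambda>x. P x * damp s x ^ k)))" if b: "b \<in> Basis" and c: "c \<in> Basis"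
  proof -
    obtain Q where Q: "poly_le (2 * Suc k) Q" "partial_deriv b (\<lambda>x. P x * damp s x ^ k) = (\<lambda>x. Q x * damp s x ^ Suc k)"
      using d[OF P b] by blast
    obtain R where R: "poly_le (2 * Suc (Suc k)) R" "partial_deriv c (\<lambda>x. Q x * damp s x ^ Suc k) = (\<lambda>x. R x * damp s x ^ Suc (Suc k))"
      using d[OF Q(1) c] by blast
    show ?thesis unfolding Q(2) R(2) by (rule w[OF R(1)])
  qed
qed

text \<open>Differentiating a damped polynomial gives \<open>partial_deriv b P\<close> with the same
  damping power, up to multiplication by \<open>damp_log\<close>. Keeping the power \<open>m\<close>
  fixed is what lets the hypothesis for degree \<open>j\<close> apply to
  \<open>partial_deriv b P\<close>.\<close>

lemma damped_gradient_step:
  fixes P :: "'a \<Rightarrow> real"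
  assumes hess: "\<And>x v. hessian V x v \<bullet> v \<le> \<rho> * (v \<bullet> v)"
    and P: "poly_le (Suc j) P" and j: "Suc j \<le> 2 * m" and s: "0 < s" "s \<le> 1" and \<alpha>: "\<alpha> \<ge> 0"
    and IH: "\<And>Q. poly_le j Q \<Longrightarrow> (\<Sum>b\<in>Basis. (norm (l2_class V (partial_deriv b (\<lambda>x. Q x * damp s x ^ m))))\<^sup>2)
      \<le> \<alpha> * (norm (l2_class V (\<lambda>x. Q x * damp s x ^ m)))\<^sup>2"
    and C: "C = 3 * \<alpha> + 4 * \<alpha> * real DIM('a) * (6 * real m)\<^sup>2 + 4 * (6 * real m)\<^sup>2 * (real DIM('a))\<^sup>2 + 4 * (6 * real m)\<^sup>2 * real DIM('a)"
    and \<Lambda>: "\<Lambda> > 0" "\<alpha> + \<rho> + s * C * (1 + 1 / \<Lambda>) \<le> \<Lambda>"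
  shows "(\<Sum>b\<in>Basis. (norm (l2_class V (partial_deriv b (\<lambda>x. P x * damp s x ^ m))))\<^sup>2)
      \<le> \<Lambda> * (norm (l2_class V (\<lambda>x. P x * damp s x ^ m)))\<^sup>2"
proof -
  note M = V_measurable[OF V]
  note add = l2_class_add[OF M] and scale = l2_class_scale[OF M] and wscale = weighted_square_integrable_scale[OF M]
  define K where "K = 6 * real m"
  define n where "n = real DIM('a)"
  have K0: "K \<ge> 0" and n0: "n \<ge> 0" by (auto simp: K_def n_def)
  define f where "f x = P x * damp s x ^ m" for x
  define g where "g b x = partial_deriv b P x * damp s x ^ m" for b x
  let ?\<theta> = "damp_log m s"
  have P2: "poly_le (2 * m) P" by (rule poly_le_mono[OF P j])
  have Ps: "smooth P" by (rule poly_le_smooth[OF P])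
  have dP: "poly_le j (partial_deriv b P)" for b by (rule poly_le_partial[OF P])
  have dP2: "poly_le (2 * m) (partial_deriv b P)" for b using j by (intro poly_le_mono[OF dP]) simp
  have fs: "smooth f" unfolding f_def[abs_def] by (rule damped_smooth[OF P2])
  have gs: "smooth (g b)" for b unfolding g_def[abs_def] by (rule damped_smooth[OF dP2])
  have wf: "weighted_square_integrable V f" and wf1: "\<And>b. b \<in> Basis \<Longrightarrow> weighted_square_integrable V (partial_deriv b f)"
    and wf2: "\<And>b c. b \<in> Basis \<Longrightarrow> c \<in> Basis \<Longrightarrow> weighted_square_integrable V (partial_deriv c (partial_deriv b f))"
    unfolding f_def[abs_def] using damped_square_integrable[OF P2 s] by blast+
  have wg: "weighted_square_integrable V (g b)" and wg1: "c \<in> Basis \<Longrightarrow> weighted_square_integrable V (partial_deriv c (g b))" for b c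
    unfolding g_def[abs_def] using damped_square_integrable[OF dP2 s] by blast+
  note \<theta> = damp_log_bounds[OF s, where m=m, folded K_def]
  have wth: "weighted_square_integrable V (\<lambda>x. ?\<theta> b x * k x)" "norm (l2_class V (\<lambda>x. ?\<theta> b x * k x)) \<le> K * s * norm (l2_class V k)"
    if "b \<in> Basis" "weighted_square_integrable V k" for b k
    using bounded_mult_square_integrable[OF V that(2) smooth_measurable[OF \<theta>(3)[OF that(1) that(1)]] \<theta>(1)[OF that(1) that(1)]]
      norm_bounded_mult[OF that(2) smooth_measurable[OF \<theta>(3)[OF that(1) that(1)]] \<theta>(1)[OF that(1) that(1)]] by auto
  have wdth: "weighted_square_integrable V (\<lambda>x. partial_deriv c (?\<theta> b) x * k x)" "norm (l2_class V (\<lambda>x. partial_deriv c (?\<theta> b) x * k x)) \<le> K * s * norm (l2_class V k)"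
    if "b \<in> Basis" "c \<in> Basis" "weighted_square_integrable V k" for b c k
    using bounded_mult_square_integrable[OF V that(3) smooth_measurable[OF smooth_partial[OF \<theta>(3)[OF that(1,2)] that(2)]] \<theta>(2)[OF that(1,2)]]
      norm_bounded_mult[OF that(3) smooth_measurable[OF smooth_partial[OF \<theta>(3)[OF that(1,2)] that(2)]] \<theta>(2)[OF that(1,2)]] by auto
  have f1: "partial_deriv b f = (\<lambda>x. g b x + (-1) * (?\<theta> b x * f x))" for b
    unfolding f_def[abs_def] g_def using damped_partial_log[OF Ps] by blast
  define a2 where "a2 = (norm (l2_class V f))\<^sup>2"
  define t2 where "t2 = (\<Sum>b\<in>Basis. (norm (l2_class V (partial_deriv b f)))\<^sup>2)"
  define A2 where "A2 = (\<Sum>b\<in>Basis. \<Sum>c\<in>Basis. (norm (l2_class V (partial_deriv c (partial_deriv b f))))\<^sup>2)"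
  have pos: "a2 \<ge> 0" "t2 \<ge> 0" by (auto simp: a2_def t2_def sum_nonneg)
  \<comment> \<open>\<open>H\<close> bounds second derivatives of \<open>f\<close> by gradients of
    the \<open>g b\<close>, the hypothesis \<open>IH\<close> bounds these by the \<open>g b\<close>,
    and \<open>G\<close> returns to the gradient of \<open>f\<close>. The passages cost factors
    \<open>1 + s\<close> and errors of order \<open>s\<close>.\<close>
  have G: "(norm (l2_class V (g b)))\<^sup>2 \<le> (1 + s) * (norm (l2_class V (partial_deriv b f)))\<^sup>2 + 2 * K\<^sup>2 * s * a2" if b: "b \<in> Basis" for b
  proof -
    have "g b = (\<lambda>x. partial_deriv b f x + ?\<theta> b x * f x)" by (simp add: f1 fun_eq_iff)
    then have "l2_class V (g b) = l2_class V (partial_deriv b f) + l2_class V (\<lambda>x. ?\<theta> b x * f x)"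
      using add[OF wf1[OF b] wth(1)[OF b wf]] by simp
    then show ?thesis unfolding a2_def using norm_sq_perturb[OF s wth(2)[OF b wf]] by simp
  qed
  have H: "(norm (l2_class V (partial_deriv c (partial_deriv b f))))\<^sup>2
      \<le> (1 + s) * (norm (l2_class V (partial_deriv c (g b))))\<^sup>2 + 4 * K\<^sup>2 * s * ((norm (l2_class V (partial_deriv c f)))\<^sup>2 + a2)"
    if b: "b \<in> Basis" and c: "c \<in> Basis" for b c
  proof -
    let ?y = "l2_class V (\<lambda>x. ?\<theta> b x * partial_deriv c f x) + l2_class V (\<lambda>x. partial_deriv c (?\<theta> b) x * f x)"
    have "partial_deriv c (partial_deriv b f) = (\<lambda>x. partial_deriv c (g b) x + (-1) * (?\<theta> b x * partial_deriv c f x + partial_deriv c (?\<theta> b) x * f x))"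
    proof
      fix x
      have "partial_deriv c (\<lambda>x. g b x + (-1) * (?\<theta> b x * f x)) x = partial_deriv c (g b) x + partial_deriv c (\<lambda>x. (-1) * (?\<theta> b x * f x)) x"
        by (rule partial_add) (intro smooth_differentiable smooth_cmult smooth_mult gs fs \<theta>(3)[OF b c])+
      also have "partial_deriv c (\<lambda>x. (-1) * (?\<theta> b x * f x)) x = (-1) * partial_deriv c (\<lambda>x. ?\<theta> b x * f x) x"
        by (rule partial_cmult) (intro smooth_differentiable smooth_mult fs \<theta>(3)[OF b c])
      also have "partial_deriv c (\<lambda>x. ?\<theta> b x * f x) x = ?\<theta> b x * partial_deriv c f x + partial_deriv c (?\<theta> b) x * f x"
        by (rule partial_mult) (intro smooth_differentiable fs \<theta>(3)[OF b c])+
      finally show "partial_deriv c (partial_deriv b f) x = partial_deriv c (g b) x + (-1) * (?\<theta> b x * partial_deriv c f x + partial_deriv c (?\<theta> b) x * f x)"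
        unfolding f1[of b] .
    qed
    moreover have w: "weighted_square_integrable V (\<lambda>x. ?\<theta> b x * partial_deriv c f x + partial_deriv c (?\<theta> b) x * f x)"
      by (rule weighted_square_integrable_add[OF M wth(1)[OF b wf1[OF c]] wdth(1)[OF b c wf]])
    ultimately have eq: "l2_class V (partial_deriv c (partial_deriv b f)) = l2_class V (partial_deriv c (g b)) + (-1) *\<^sub>R ?y"
      by (simp only: add[OF wg1[OF c] wscale[OF w]] scale[OF w] add[OF wth(1)[OF b wf1[OF c]] wdth(1)[OF b c wf]])
    let ?r = "norm (l2_class V (partial_deriv c f)) + norm (l2_class V f)"
    have "norm ?y \<le> K * s * norm (l2_class V (partial_deriv c f)) + K * s * norm (l2_class V f)"
      by (rule norm_triangle_le[OF add_mono[OF wth(2)[OF b wf1[OF c]] wdth(2)[OF b c wf]]])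
    then have "norm ((-1) *\<^sub>R ?y) \<le> K * s * ?r" by (simp only: norm_scaleR distrib_left abs_minus_cancel abs_one mult_1)
    from norm_sq_perturb[OF s this] have "(norm (l2_class V (partial_deriv c (partial_deriv b f))))\<^sup>2
      \<le> (1 + s) * (norm (l2_class V (partial_deriv c (g b))))\<^sup>2 + 2 * K\<^sup>2 * s * ?r\<^sup>2" unfolding eq .
    also have "?r\<^sup>2 \<le> 2 * ((norm (l2_class V (partial_deriv c f)))\<^sup>2 + a2)"
      unfolding a2_def using zero_le_power2[of "norm (l2_class V (partial_deriv c f)) - norm (l2_class V f)"]
      by (simp add: power2_sum power2_diff)
    then have "2 * K\<^sup>2 * s * ?r\<^sup>2 \<le> 2 * K\<^sup>2 * s * (2 * ((norm (l2_class V (partial_deriv c f)))\<^sup>2 + a2))"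
      using s by (intro mult_left_mono) auto
    finally show ?thesis by (simp add: algebra_simps)
  qed
  have "A2 \<le> (\<Sum>b\<in>Basis. (1 + s) * (\<alpha> * ((1 + s) * (norm (l2_class V (partial_deriv b f)))\<^sup>2 + 2 * K\<^sup>2 * s * a2)) + 4 * K\<^sup>2 * s * (t2 + n * a2))"
    unfolding A2_def
  proof (rule sum_mono)
    fix b :: 'a assume b: "b \<in> Basis"
    have "(\<Sum>c\<in>Basis. (norm (l2_class V (partial_deriv c (partial_deriv b f))))\<^sup>2)
      \<le> (\<Sum>c\<in>Basis. (1 + s) * (norm (l2_class V (partial_deriv c (g b))))\<^sup>2 + 4 * K\<^sup>2 * s * ((norm (l2_class V (partial_deriv c f)))\<^sup>2 + a2))"
      using H[OF b] by (rule sum_mono)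
    also have "\<dots> = (1 + s) * (\<Sum>c\<in>Basis. (norm (l2_class V (partial_deriv c (g b))))\<^sup>2) + 4 * K\<^sup>2 * s * (t2 + n * a2)"
      by (simp add: sum.distrib sum_distrib_left[symmetric] t2_def n_def)
    also have "(\<Sum>c\<in>Basis. (norm (l2_class V (partial_deriv c (g b))))\<^sup>2) \<le> \<alpha> * (norm (l2_class V (g b)))\<^sup>2"
      unfolding g_def[abs_def] by (rule IH[OF dP])
    also have "\<dots> \<le> \<alpha> * ((1 + s) * (norm (l2_class V (partial_deriv b f)))\<^sup>2 + 2 * K\<^sup>2 * s * a2)"
      using G[OF b] \<alpha> by (rule mult_left_mono)
    finally show "(\<Sum>c\<in>Basis. (norm (l2_class V (partial_deriv c (partial_deriv b f))))\<^sup>2)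
      \<le> (1 + s) * (\<alpha> * ((1 + s) * (norm (l2_class V (partial_deriv b f)))\<^sup>2 + 2 * K\<^sup>2 * s * a2)) + 4 * K\<^sup>2 * s * (t2 + n * a2)"
      using s by (simp add: mult_left_mono)
  qed
  also have "\<dots> = (1 + s) * (\<alpha> * ((1 + s) * t2 + n * (2 * K\<^sup>2 * s * a2))) + n * (4 * K\<^sup>2 * s * (t2 + n * a2))"
    by (simp add: sum.distrib sum_distrib_left[symmetric] t2_def n_def)
  \<comment> \<open>\<open>C\<close> collects the error terms: \<open>3 * \<alpha>\<close> from
    \<open>(1 + s) * (1 + s) \<le> 1 + 3 * s\<close>, the \<open>\<alpha> * n * K\<^sup>2\<close>
    term from \<open>G\<close> with \<open>1 + s \<le> 2\<close>, and the last two from summing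
    \<open>H\<close> over both indices.\<close>
  also have "\<dots> \<le> \<alpha> * t2 + s * C * (a2 + t2)"
  proof -
    have "(1 + s) * (1 + s) \<le> 1 + 3 * s" using s mult_left_mono[of s 1 s] by (simp add: algebra_simps)
    then have 1: "(1 + s) * (1 + s) * (\<alpha> * t2) \<le> (1 + 3 * s) * (\<alpha> * t2)" using \<alpha> pos by (intro mult_right_mono) auto
    have 2: "(1 + s) * (\<alpha> * n * (2 * K\<^sup>2 * s * a2)) \<le> 2 * (\<alpha> * n * (2 * K\<^sup>2 * s * a2))"
      using s \<alpha> n0 pos by (intro mult_right_mono) auto
    have Ceq: "C = 3 * \<alpha> + 4 * \<alpha> * n * K\<^sup>2 + 4 * K\<^sup>2 * n\<^sup>2 + 4 * K\<^sup>2 * n" unfolding C K_def n_def ..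
    have "(1 + s) * (\<alpha> * ((1 + s) * t2 + n * (2 * K\<^sup>2 * s * a2))) + n * (4 * K\<^sup>2 * s * (t2 + n * a2))
      = (1 + s) * (1 + s) * (\<alpha> * t2) + (1 + s) * (\<alpha> * n * (2 * K\<^sup>2 * s * a2)) + (4 * K\<^sup>2 * s * n * t2 + 4 * K\<^sup>2 * s * n\<^sup>2 * a2)"
      by (simp add: algebra_simps power2_eq_square)
    also have "\<dots> \<le> (1 + 3 * s) * (\<alpha> * t2) + 2 * (\<alpha> * n * (2 * K\<^sup>2 * s * a2)) + (4 * K\<^sup>2 * s * n * t2 + 4 * K\<^sup>2 * s * n\<^sup>2 * a2)"
      by (intro add_right_mono add_mono 1 2)
    also have "\<dots> = \<alpha> * t2 + s * (3 * \<alpha> * t2 + 4 * \<alpha> * n * K\<^sup>2 * a2 + 4 * K\<^sup>2 * n * t2 + 4 * K\<^sup>2 * n\<^sup>2 * a2)"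
      by (simp add: algebra_simps)
    also have "\<dots> \<le> \<alpha> * t2 + s * (C * (a2 + t2))"
    proof (intro add_left_mono mult_left_mono)
      have "0 \<le> 3 * \<alpha> * a2" "0 \<le> 4 * \<alpha> * n * K\<^sup>2 * t2" "0 \<le> 4 * K\<^sup>2 * n * a2" "0 \<le> 4 * K\<^sup>2 * n\<^sup>2 * t2"
        using \<alpha> n0 pos by auto
      then show "3 * \<alpha> * t2 + 4 * \<alpha> * n * K\<^sup>2 * a2 + 4 * K\<^sup>2 * n * t2 + 4 * K\<^sup>2 * n\<^sup>2 * a2 \<le> C * (a2 + t2)"
        unfolding Ceq by (simp add: distrib_left distrib_right)
    qed (use s in simp)
    finally show ?thesis by (simp add: mult.assoc)
  qed
  finally have A2: "A2 \<le> \<alpha> * t2 + s * C * (a2 + t2)" .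
  have "t2\<^sup>2 \<le> a2 * (A2 + \<rho> * t2)"
    unfolding t2_def a2_def A2_def by (rule gradient_interpolation[OF V fs wf wf1 wf2 hess])
  also have "\<dots> \<le> a2 * (\<alpha> * t2 + s * C * (a2 + t2) + \<rho> * t2)" using A2 pos by (intro mult_left_mono) auto
  finally have "t2 \<le> \<Lambda> * a2"
  proof (rule interpolation_conclusion[OF pos(1) _ _ \<Lambda>])
    show "0 \<le> s * C" unfolding C using s \<alpha> by simp
  qed
  then show ?thesis unfolding t2_def a2_def f_def[abs_def] .
qed

text \<open>Differentiation lowers the degree, and the Bochner inequality loses \<open>\<rho>\<close> each time.\<close>

lemma damped_rayleigh:
  assumes hess: "\<And>x v. hessian V x v \<bullet> v \<le> \<rho> * (v \<bullet> v)" and \<rho>: "\<rho> > 0"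
    and j: "j \<le> 2 * m" and \<epsilon>: "\<epsilon> > 0"
  shows "\<exists>s0>0. s0 \<le> 1 \<and> (\<forall>s. 0 < s \<longrightarrow> s \<le> s0 \<longrightarrow> (\<forall>P. poly_le j P \<longrightarrow>
    (\<Sum>b\<in>Basis. (norm (l2_class V (partial_deriv b (\<lambda>x. P x * damp s x ^ m))))\<^sup>2)
      \<le> (real j * \<rho> + \<epsilon>) * (norm (l2_class V (\<lambda>x. P x * damp s x ^ m)))\<^sup>2))"
  using j \<epsilon>
proof (induction j arbitrary: \<epsilon>)
  case 0
  define n K where "n = real DIM('a)" and "K = 6 * real m"
  have n0: "n \<ge> 0" by (simp add: n_def)
  \<comment> \<open>For constant \<open>P\<close> the gradient consists of \<open>damp_log\<close>
    terms, of squared norm at most \<open>n * K\<^sup>2 * s\<^sup>2\<close> times that of the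
    function. The added 1 keeps the denominator positive when \<open>m = 0\<close>.\<close>
  define s0 where "s0 = min 1 (\<epsilon> / (n * K\<^sup>2 + 1))"
  have d: "n * K\<^sup>2 + 1 > 0" using n0 by (simp add: add_nonneg_pos)
  have "s0 > 0" "s0 \<le> 1" using 0 d by (auto simp: s0_def)
  moreover have "(\<Sum>b\<in>Basis. (norm (l2_class V (partial_deriv b (\<lambda>x. P x * damp s x ^ m))))\<^sup>2)
      \<le> (real 0 * \<rho> + \<epsilon>) * (norm (l2_class V (\<lambda>x. P x * damp s x ^ m)))\<^sup>2" if s: "0 < s" "s \<le> s0" and P: "poly_le 0 P" for s P
  proof -
    have s1: "s \<le> 1" using s \<open>s0 \<le> 1\<close> by simp
    let ?f = "\<lambda>x. P x * damp s x ^ m" and ?\<theta> = "damp_log m s"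
    have P2: "poly_le (2 * m) P" by (rule poly_le_mono[OF P]) simp
    have wf: "weighted_square_integrable V ?f" by (rule damped_square_integrable(1)[OF P2 s(1) s1])
    have dP: "partial_deriv b P = (\<lambda>x. 0)" for b using P by (auto simp: partial_const)
    have b: "(norm (l2_class V (partial_deriv b ?f)))\<^sup>2 \<le> (K * s * norm (l2_class V ?f))\<^sup>2" if b: "b \<in> Basis" for b
    proof -
      note \<theta> = damp_log_bounds[OF s(1) s1 b b, where m=m, folded K_def]
      have w: "weighted_square_integrable V (\<lambda>x. ?\<theta> b x * ?f x)" by (rule bounded_mult_square_integrable[OF V wf smooth_measurable[OF \<theta>(3)] \<theta>(1)])
      have "partial_deriv b ?f = (\<lambda>x. (-1) * (?\<theta> b x * ?f x))"
        using damped_partial_log[OF poly_le_smooth[OF P]] by (auto simp: dP fun_eq_iff)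
      then have "norm (l2_class V (partial_deriv b ?f)) = norm (l2_class V (\<lambda>x. ?\<theta> b x * ?f x))"
        using l2_class_scale[OF V_measurable[OF V] w, of "-1"] by simp
      also have "\<dots> \<le> K * s * norm (l2_class V ?f)" by (rule norm_bounded_mult[OF wf smooth_measurable[OF \<theta>(3)] \<theta>(1)])
      finally show ?thesis by (rule power_mono) simp
    qed
    have "(\<Sum>b\<in>Basis. (norm (l2_class V (partial_deriv b ?f)))\<^sup>2) \<le> (\<Sum>b\<in>(Basis::'a set). (K * s * norm (l2_class V ?f))\<^sup>2)"
      using b by (rule sum_mono)
    also have "\<dots> = (n * K\<^sup>2 * s * s) * (norm (l2_class V ?f))\<^sup>2" by (simp add: n_def power_mult_distrib power2_eq_square)
    also have "\<dots> \<le> \<epsilon> * (norm (l2_class V ?f))\<^sup>2"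
    proof (rule mult_right_mono)
      have "s * (n * K\<^sup>2 + 1) \<le> \<epsilon>" using s(2) d by (simp add: s0_def pos_le_divide_eq)
      have "n * K\<^sup>2 * s * s \<le> n * K\<^sup>2 * s * 1" using s s1 n0 by (intro mult_left_mono) auto
      also have "\<dots> \<le> s * (n * K\<^sup>2 + 1)" using s by (simp add: algebra_simps)
      also have "\<dots> \<le> \<epsilon>" by fact
      finally show "n * K\<^sup>2 * s * s \<le> \<epsilon>" .
    qed simp
    finally show ?thesis by simp
  qed
  ultimately show ?case by blast
next
  case (Suc j)
  \<comment> \<open>Half of \<open>\<epsilon>\<close> goes to the induction hypothesis; the other
    half absorbs the error \<open>s * C * (1 + 1 / \<Lambda>)\<close> through the choice of
    \<open>s0\<close>.\<close>
  define \<alpha> where "\<alpha> = real j * \<rho> + \<epsilon> / 2"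
  define \<Lambda> where "\<Lambda> = real (Suc j) * \<rho> + \<epsilon>"
  define C where "C = 3 * \<alpha> + 4 * \<alpha> * real DIM('a) * (6 * real m)\<^sup>2 + 4 * (6 * real m)\<^sup>2 * (real DIM('a))\<^sup>2 + 4 * (6 * real m)\<^sup>2 * real DIM('a)"
  have \<alpha>0: "\<alpha> \<ge> 0" and \<Lambda>0: "\<Lambda> > 0" using \<rho> Suc.prems by (auto simp: \<alpha>_def \<Lambda>_def add_pos_pos add_nonneg_pos)
  have C0: "C \<ge> 0" unfolding C_def using \<alpha>0 by simp
  obtain s1 where s1: "s1 > 0" "s1 \<le> 1" and IH: "\<And>s P. 0 < s \<Longrightarrow> s \<le> s1 \<Longrightarrow> poly_le j P \<Longrightarrow>
    (\<Sum>b\<in>Basis. (norm (l2_class V (partial_deriv b (\<lambda>x. P x * damp s x ^ m))))\<^sup>2)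
      \<le> \<alpha> * (norm (l2_class V (\<lambda>x. P x * damp s x ^ m)))\<^sup>2"
    using Suc.IH[of "\<epsilon> / 2"] Suc.prems unfolding \<alpha>_def by auto
  define D where "D = C * (1 + 1 / \<Lambda>) + 1"
  have D0: "D > 0" unfolding D_def using C0 \<Lambda>0 by (intro add_nonneg_pos mult_nonneg_nonneg) auto
  define s0 where "s0 = min s1 (\<epsilon> / 2 / D)"
  have "s0 > 0" "s0 \<le> 1" using s1 Suc.prems D0 by (auto simp: s0_def)
  moreover have "(\<Sum>b\<in>Basis. (norm (l2_class V (partial_deriv b (\<lambda>x. P x * damp s x ^ m))))\<^sup>2)
      \<le> \<Lambda> * (norm (l2_class V (\<lambda>x. P x * damp s x ^ m)))\<^sup>2" if s: "0 < s" "s \<le> s0" and P: "poly_le (Suc j) P" for s P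
  proof (rule damped_gradient_step[OF hess P Suc.prems(1) s(1) _ \<alpha>0 _ C_def \<Lambda>0])
    show "s \<le> 1" using s \<open>s0 \<le> 1\<close> by simp
    show "(\<Sum>b\<in>Basis. (norm (l2_class V (partial_deriv b (\<lambda>x. Q x * damp s x ^ m))))\<^sup>2)
      \<le> \<alpha> * (norm (l2_class V (\<lambda>x. Q x * damp s x ^ m)))\<^sup>2" if "poly_le j Q" for Q
      using s that by (intro IH) (auto simp: s0_def)
    have "s * D \<le> \<epsilon> / 2" using s(2) D0 by (simp add: s0_def pos_le_divide_eq)
    moreover have "s * C * (1 + 1 / \<Lambda>) \<le> s * D" using s unfolding D_def by (simp add: algebra_simps)
    ultimately show "\<alpha> + \<rho> + s * C * (1 + 1 / \<Lambda>) \<le> \<Lambda>" unfolding \<alpha>_def \<Lambda>_def by (simp add: algebra_simps)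
  qed
  ultimately show ?case unfolding \<Lambda>_def by blast
qed

end

text \<open>Classes modulo Lebesgue-null sets do not depend on the potential, so the same dimension
  can be used for \<open>V\<close> and for the Gaussian.\<close>

definition poly_space :: "nat \<Rightarrow> 'a::euclidean_space aefun set" where
  "poly_space d = abs_aefun ` Collect (poly_le d)"

lemma poly_le_measurable: "poly_le d P \<Longrightarrow> P \<in> borel_measurable borel"
  by (rule smooth_measurable[OF poly_le_smooth])

text \<open>Monomials are indexed by words in \<open>Basis\<close>, so the same monomial may occur
  several times; this is harmless for a finite spanning set.\<close>

lemma poly_le_monomials:
  fixes f :: "'a::euclidean_space \<Rightarrow> real"
  assumes "poly_le d f"
  shows "\<exists>c. f = (\<lambda>x. \<Sum>xs | set xs \<subseteq> Basis \<and> length xs \<le> d. c xs * prod_list (map ((\<bullet>) x) xs))"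
  using assms
proof (induction d arbitrary: f)
  case 0
  then obtain k where f: "f = (\<lambda>x. k)" by auto
  have "{xs. set xs \<subseteq> (Basis::'a set) \<and> length xs \<le> 0} = {[]}" by auto
  then show ?case by (intro exI[of _ "\<lambda>_. k"]) (simp add: f)
next
  case (Suc d)
  let ?M = "\<lambda>d. {xs. set xs \<subseteq> (Basis::'a set) \<and> length xs \<le> d}"
  have fin: "finite (?M d)" for d by (rule finite_lists_length_le) simp
  obtain k g where g: "\<And>b. b \<in> Basis \<Longrightarrow> poly_le d (g b)" and f: "f = (\<lambda>x. k + (\<Sum>b\<in>Basis. (x \<bullet> b) * g b x))"
    using Suc.prems by auto
  have "\<forall>b\<in>Basis. \<exists>c. g b = (\<lambda>x. \<Sum>xs\<in>?M d. c xs * prod_list (map ((\<bullet>) x) xs))"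
    using Suc.IH[OF g] by blast
  from bchoice[OF this] obtain c where
    c: "\<And>b. b \<in> Basis \<Longrightarrow> g b = (\<lambda>x. \<Sum>xs\<in>?M d. c b xs * prod_list (map ((\<bullet>) x) xs))"
    by blast
  define c' where "c' xs = (case xs of [] \<Rightarrow> k | b # ys \<Rightarrow> c b ys)" for xs
  have eq: "?M (Suc d) = insert [] ((\<lambda>(b, ys). b # ys) ` (Basis \<times> ?M d))"
  proof (intro set_eqI)
    fix xs show "xs \<in> ?M (Suc d) \<longleftrightarrow> xs \<in> insert [] ((\<lambda>(b, ys). b # ys) ` (Basis \<times> ?M d))"
      by (cases xs) auto
  qed
  have inj: "inj_on (\<lambda>(b, ys). b # ys) (Basis \<times> ?M d)" by (auto simp: inj_on_def)
  have "(\<Sum>xs\<in>?M (Suc d). c' xs * prod_list (map ((\<bullet>) x) xs)) = f x" for x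
  proof -
    have "(\<Sum>xs\<in>?M (Suc d). c' xs * prod_list (map ((\<bullet>) x) xs))
      = k + (\<Sum>xs\<in>(\<lambda>(b, ys). b # ys) ` (Basis \<times> ?M d). c' xs * prod_list (map ((\<bullet>) x) xs))"
      unfolding eq using fin by (subst sum.insert) (auto simp: c'_def)
    also have "\<dots> = k + (\<Sum>(b, ys)\<in>Basis \<times> ?M d. c b ys * ((x \<bullet> b) * prod_list (map ((\<bullet>) x) ys)))"
      by (subst sum.reindex[OF inj]) (simp add: c'_def case_prod_beta)
    also have "\<dots> = k + (\<Sum>b\<in>Basis. \<Sum>ys\<in>?M d. c b ys * ((x \<bullet> b) * prod_list (map ((\<bullet>) x) ys)))"
      by (simp only: sum.cartesian_product)
    also have "\<dots> = f x" by (simp add: f c sum_distrib_left mult.left_commute)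
    finally show ?thesis .
  qed
  then show ?case by (intro exI[of _ c']) (simp add: fun_eq_iff)
qed

lemma abs_aefun_zero: "abs_aefun (\<lambda>x. 0) = 0"
  by (simp add: zero_aefun_def)

lemma abs_aefun_sum:
  assumes "\<And>i. i \<in> I \<Longrightarrow> f i \<in> borel_measurable borel"
  shows "abs_aefun (\<lambda>x. \<Sum>i\<in>I. f i x) = (\<Sum>i\<in>I. abs_aefun (f i))"
  using assms
proof (induction I rule: infinite_finite_induct)
  case (insert i I)
  then have "(\<lambda>x. \<Sum>i\<in>I. f i x) \<in> borel_measurable borel" "f i \<in> borel_measurable borel"
    by (auto intro!: borel_measurable_sum)
  then show ?case using insert by (simp add: abs_aefun_add)
qed (simp_all add: abs_aefun_zero)

lemma poly_space_finite_dim: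
  obtains B where "finite B" "poly_space d \<subseteq> span (B :: 'a::euclidean_space aefun set)"
proof -
  let ?M = "{xs. set xs \<subseteq> (Basis::'a set) \<and> length xs \<le> d}"
  let ?m = "\<lambda>xs. abs_aefun (\<lambda>x::'a. prod_list (map ((\<bullet>) x) xs))"
  have [measurable]: "(\<lambda>x::'a. prod_list (map ((\<bullet>) x) xs)) \<in> borel_measurable borel" for xs
    by (induction xs) auto
  have "abs_aefun P \<in> span (?m ` ?M)" if P: "poly_le d P" for P
  proof -
    obtain c where P: "P = (\<lambda>x. \<Sum>xs\<in>?M. c xs * prod_list (map ((\<bullet>) x) xs))"
      using poly_le_monomials[OF P] ..
    have "abs_aefun P = (\<Sum>xs\<in>?M. c xs *\<^sub>R ?m xs)"
      unfolding P by (subst abs_aefun_sum) (simp_all add: abs_aefun_scale)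
    then show ?thesis by (simp only:) (intro span_sum span_scale span_base imageI)
  qed
  moreover have "finite (?m ` ?M)" by (intro finite_imageI finite_lists_length_le) simp
  ultimately show ?thesis using that unfolding poly_space_def by blast
qed

section \<open>Dimension counting and the upper bound for general \<open>V\<close>\<close>

lemma finite_rank_kernel:
  assumes lin: "linear f" and B: "independent B" "finite B" and C: "finite C" "f ` B \<subseteq> span C" "card C < card B"
  shows "\<exists>w\<in>span B. w \<noteq> 0 \<and> f w = 0"
proof (rule ccontr)
  assume "\<not> ?thesis"
  then have inj: "inj_on f (span B)"
    using linear_injective_on_subspace_0[OF lin subspace_span] by auto
  then have "independent (f ` B)" by (rule linear_independent_injective_image[OF lin B(1)])
  then have "card (f ` B) \<le> card C" using independent_span_bound[OF C(1) _ C(2)] by blast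
  moreover have "card (f ` B) = card B" by (rule card_image[OF inj_on_subset[OF inj span_superset]])
  ultimately show False using C(3) by simp
qed

lemma edim_less_imp:
  assumes "edim S < enat k"
  obtains C where "finite C" "C \<subseteq> S" "S \<subseteq> span C" "card C < k"
proof -
  obtain B where B: "finite B" "S \<subseteq> span B" and k: "dim S < k"
    using assms unfolding edim_def by (auto split: if_splits)
  obtain C where C: "C \<subseteq> S" "independent C" "S \<subseteq> span C" "card C = dim S" by (rule basis_exists)
  have "finite C" using independent_span_bound[OF B(1) C(2)] C(1) B(2) by blast
  then show ?thesis using that C k by simp
qed

context
  fixes V :: "'a::euclidean_space \<Rightarrow> real"
  assumes V: "smooth V" and V_int: "integrable lborel (\<lambda>x. exp (- V x))"
begin

text \<open>The map \<open>P \<mapsto> P \<cdot> damp\<close> is injective, so a subspace of \<open>L2\<close> of small dimension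
  is avoided by some damped polynomial.\<close>

lemma damped_polynomial_in_kernel:
  assumes lin: "linear E" and C: "finite C" "range E \<subseteq> span C" "card C < dim (poly_space d :: 'a aefun set)"
    and s: "0 < s" "s \<le> 1"
  obtains P where "poly_le d P" "E (l2_class V (\<lambda>x. P x * damp s x ^ d)) = 0" "l2_class V (\<lambda>x. P x * damp s x ^ d) \<noteq> 0"
proof -
  note M = V_measurable[OF V]
  let ?T = "\<lambda>P. l2_class V (\<lambda>x. P x * damp s x ^ d)"
  obtain B where B: "B \<subseteq> (poly_space d :: 'a aefun set)" "independent B" "poly_space d \<subseteq> span B" "card B = dim (poly_space d :: 'a aefun set)"
    by (rule basis_exists)
  obtain B' where "finite B'" "poly_space d \<subseteq> span (B' :: 'a aefun set)" by (rule poly_space_finite_dim)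
  then have fB: "finite B" using independent_span_bound[of B' B] B(1,2) by blast
  have "\<forall>b\<in>B. \<exists>p. poly_le d p \<and> b = abs_aefun p" using B(1) unfolding poly_space_def by auto
  then obtain p where p: "\<And>b. b \<in> B \<Longrightarrow> poly_le d (p b)" "\<And>b. b \<in> B \<Longrightarrow> b = abs_aefun (p b)" by metis
  \<comment> \<open>Damping is defined on a basis of classes through chosen polynomial
    representatives and extended linearly; \<open>P\<close> below is the combination of
    representatives belonging to \<open>w\<close>.\<close>
  obtain \<phi> where \<phi>: "linear \<phi>" "\<And>b. b \<in> B \<Longrightarrow> \<phi> b = ?T (p b)" using linear_independent_extend[OF B(2), of "\<lambda>b. ?T (p b)"] by blast
  have "linear (\<lambda>w. E (\<phi> w))" using linear_compose[OF \<phi>(1) lin] by (simp add: o_def)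
  moreover have "(\<lambda>w. E (\<phi> w)) ` B \<subseteq> span C" using C(2) by auto
  ultimately obtain w where w: "w \<in> span B" "w \<noteq> 0" "E (\<phi> w) = 0"
    using finite_rank_kernel[OF _ B(2) fB C(1), of "\<lambda>w. E (\<phi> w)"] C(3) B(4) by auto
  obtain c where c: "w = (\<Sum>b\<in>B. c b *\<^sub>R b)" using w(1) unfolding span_finite[OF fB] by auto
  define P where "P x = (\<Sum>b\<in>B. c b * p b x)" for x
  have P: "poly_le d P" unfolding P_def[abs_def] by (intro poly_le_sum poly_le_cmult p)
  have wsq: "weighted_square_integrable V (\<lambda>x. Q x * damp s x ^ d)" if "poly_le d Q" for Q
    by (rule damped_square_integrable(1)[OF V V_int poly_le_mono[OF that] s]) simp
  have wP: "w = abs_aefun P"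
  proof -
    have "abs_aefun P = (\<Sum>b\<in>B. abs_aefun (\<lambda>x. c b * p b x))"
      unfolding P_def[abs_def] using p(1) poly_le_measurable by (intro abs_aefun_sum) (auto intro!: borel_measurable_times)
    also have "\<dots> = (\<Sum>b\<in>B. c b *\<^sub>R b)" 
    proof (intro sum.cong refl)
      fix b assume b: "b \<in> B"
      show "abs_aefun (\<lambda>x. c b * p b x) = c b *\<^sub>R b"
        by (subst p(2)[OF b]) (rule abs_aefun_scale[OF poly_le_measurable[OF p(1)[OF b]]])
    qed
    finally show ?thesis using c by simp
  qed
  have "\<phi> w = (\<Sum>b\<in>B. c b *\<^sub>R ?T (p b))" unfolding c by (simp add: linear_sum[OF \<phi>(1)] linear_scale[OF \<phi>(1)] \<phi>(2))
  also have "\<dots> = (\<Sum>b\<in>B. l2_class V (\<lambda>x. c b * (p b x * damp s x ^ d)))"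
    using p(1) wsq by (intro sum.cong refl l2_class_scale[symmetric, OF M]) auto
  also have "\<dots> = l2_class V (\<lambda>x. \<Sum>b\<in>B. c b * (p b x * damp s x ^ d))"
    using p(1) wsq by (intro l2_class_sum[symmetric, OF V] weighted_square_integrable_scale[OF M]) auto
  also have "(\<lambda>x. \<Sum>b\<in>B. c b * (p b x * damp s x ^ d)) = (\<lambda>x. P x * damp s x ^ d)"
    by (simp add: P_def sum_distrib_right mult.assoc)
  finally have \<phi>w: "\<phi> w = ?T P" .
  have nz: "damp s x \<noteq> 0" for x :: 'a using damp_range(1)[of s x] by simp
  have "?T P \<noteq> 0"
  proof
    assume "?T P = 0"
    then have "l2_class V (\<lambda>x. P x * damp s x ^ d) = l2_class V (\<lambda>x. 0)" by (simp add: l2_class_zero[OF V])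
    then have "AE x in lborel. P x * damp s x ^ d = 0"
      using l2_class_eq_iff[OF M wsq[OF P], of "\<lambda>x. 0"] by (simp add: weighted_square_integrable_def)
    then have "AE x in lborel. P x = 0" by eventually_elim (simp add: nz)
    then have "abs_aefun P = abs_aefun (\<lambda>x. 0)" using poly_le_measurable[OF P] by (simp add: abs_aefun_eq_iff)
    then show False using w(2) wP by (simp add: abs_aefun_zero)
  qed
  then show ?thesis using that[OF P] w(3) \<phi>w by simp
qed

end

lemma range_spectral_projection_finite:
  assumes V: "V \<in> borel_measurable borel" and k: "edim (l2_unweight V ` R) < enat k"
  obtains C where "finite C" "R \<subseteq> span C" "card C < k"
proof -
  obtain D where D: "finite D" "D \<subseteq> l2_unweight V ` R" "l2_unweight V ` R \<subseteq> span D" "card D < k"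
    using k by (rule edim_less_imp)
  obtain C where C: "C \<subseteq> R" "D = l2_unweight V ` C" using D(2) by (auto simp: subset_image_iff)
  have inj: "inj (l2_unweight V)" by (auto intro!: injI l2_unweight_inj[OF V])
  have "R \<subseteq> span C"
  proof
    fix u assume "u \<in> R"
    then have "l2_unweight V u \<in> l2_unweight V ` span C"
      using D(3) C(2) linear_span_image[OF l2_unweight_linear[OF V], of C] by auto
    then show "u \<in> span C" using inj by (auto dest: injD)
  qed
  moreover have "finite C" using D(1) C(2) finite_imageD inj_on_subset[OF inj] by blast
  moreover have "card C = card D" using C(2) card_image[OF inj_on_subset[OF inj], of C] by simp
  ultimately show ?thesis using that D(4) by simp
qed

text \<open>Fewer than \<open>dim (poly_space d)\<close> dimensions in the range of
  \<open>E l\<close> leave a nonzero damped polynomial in its kernel. Its Rayleigh quotient is at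
  most \<open>d * \<rho> + \<epsilon>\<close>, while vectors in that kernel have quotient at least
  \<open>l\<close>. Cutoffs supply domain vectors of the unknown extension on which both bounds
  meet.\<close>

theorem spectral_threshold_le:
  fixes V :: "real ^ 'n \<Rightarrow> real"
  assumes V: "smooth V" and prob: "prob_space (weighted_measure V)" and \<rho>: "\<rho> > 0"
    and hess: "\<And>x v. hessian V x v \<bullet> v \<le> \<rho> * (v \<bullet> v)"
    and k: "edim (spectral_projection V l ` L2 V) < enat k"
    and d: "k \<le> dim (poly_space d :: (real ^ 'n) aefun set)"
  shows "l \<le> real d * \<rho>"
proof (rule field_le_epsilon)
  fix \<epsilon> :: real assume \<epsilon>: "\<epsilon> > 0"
  note M = V_measurable[OF V]
  interpret prob_space "weighted_measure V" by (rule prob)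
  have V_int: "integrable lborel (\<lambda>x. exp (- V x))"
    using integrable_weighted_measure[OF M, of "\<lambda>x. 1"] by simp
  obtain A E where A: "selfadjoint_rel A" "pull_rel V (neg_weighted_laplacian_graph V) \<subseteq> A" "spectral_resolution A E"
    and E: "\<And>l. spectral_projection V l ` L2 V = l2_unweight V ` range (E l)"
    using spectral_projection_model[OF M self_adjoint_extension_exists[OF V] graph_L2[OF V]] by blast
  obtain C where C: "finite C" "range (E l) \<subseteq> span C" "card C < k"
    using range_spectral_projection_finite[OF M k[unfolded E]] by blast
  have lin: "linear (E l)"
    using A(3) by (auto simp: spectral_resolution_def projection_resolution_def intro: projection_op_linear)
  obtain s where s: "0 < s" "s \<le> 1" and ray: "\<And>P. poly_le d P \<Longrightarrow>
    (\<Sum>b\<in>Basis. (norm (l2_class V (partial_deriv b (\<lambda>x. P x * damp s x ^ d))))\<^sup>2)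
      \<le> (real d * \<rho> + \<epsilon>) * (norm (l2_class V (\<lambda>x. P x * damp s x ^ d)))\<^sup>2"
    using damped_rayleigh[OF V V_int hess \<rho> _ \<epsilon>, of d d] by auto
  obtain P where P: "poly_le d P" and EP: "E l (l2_class V (\<lambda>x. P x * damp s x ^ d)) = 0"
    and nz: "l2_class V (\<lambda>x. P x * damp s x ^ d) \<noteq> 0"
    using damped_polynomial_in_kernel[OF V V_int lin C(1,2) _ s, of d] C(3) d by auto
  let ?f = "\<lambda>x. P x * damp s x ^ d"
  have P2: "poly_le (2 * d) P" by (rule poly_le_mono[OF P]) simp
  have w1: "weighted_square_integrable V (partial_deriv b ?f)" if "b \<in> Basis" for b
    by (rule damped_square_integrable(2)[OF V V_int P2 s that])
  obtain g where g: "\<And>n. test_function (g n)" "(\<lambda>n. l2_class V (g n)) \<longlonglongrightarrow> l2_class V ?f"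
    and g1: "\<And>b. b \<in> Basis \<Longrightarrow> (\<lambda>n. l2_class V (partial_deriv b (g n))) \<longlonglongrightarrow> l2_class V (partial_deriv b ?f)"
    by (rule cutoff_approximation[OF V damped_smooth[OF P2] damped_square_integrable(1)[OF V V_int P2 s] w1], assumption) (rule that)
  have gA: "(l2_class V (g n), l2_class V (\<lambda>x. - weighted_laplacian V (g n) x)) \<in> A" for n
    using A(2) g(1) unfolding pull_rel_graph[OF V] by blast
  have "(\<lambda>n. \<Sum>b\<in>Basis. l2_class V (partial_deriv b (g n)) \<bullet> l2_class V (partial_deriv b (g n)))
      \<longlonglongrightarrow> (\<Sum>b\<in>Basis. l2_class V (partial_deriv b ?f) \<bullet> l2_class V (partial_deriv b ?f))"
    by (intro tendsto_intros g1)
  then have q: "(\<lambda>n. l2_class V (\<lambda>x. - weighted_laplacian V (g n) x) \<bullet> l2_class V (g n))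
      \<longlonglongrightarrow> (\<Sum>b\<in>Basis. (norm (l2_class V (partial_deriv b ?f)))\<^sup>2)"
    by (simp add: inner_weighted_laplacian[OF V g(1) g(1)] power2_norm_eq_inner)
  show "l \<le> real d * \<rho> + \<epsilon>"
    by (rule rayleigh_upper_bound[OF A(3) C(1,2) EP nz gA g(2) q])
      (use ray[OF P] in \<open>simp add: power2_norm_eq_inner\<close>)
qed

section \<open>The Gaussian measure\<close>

lemma integrable_gaussian:
  assumes c: "c > 0"
  shows "integrable lborel (\<lambda>x::'a::euclidean_space. exp (- c * (norm x)\<^sup>2))"
proof (rule integrableI_bounded)
  define \<sigma> where "\<sigma> = sqrt (1 / (2 * c))"
  have \<sigma>: "\<sigma> > 0" "\<sigma>\<^sup>2 = 1 / (2 * c)" using c by (auto simp: \<sigma>_def)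
  have "exp (- c * t\<^sup>2) = sqrt (2 * pi * \<sigma>\<^sup>2) * normal_density 0 \<sigma> t" for t
    using c \<sigma> unfolding normal_density_def by (simp add: field_simps)
  then have "integrable lborel (\<lambda>t::real. exp (- c * t\<^sup>2))" using \<sigma>(1) by simp
  then have fin: "(\<integral>\<^sup>+t. ennreal (exp (- c * t\<^sup>2)) \<partial>lborel) < \<infinity>" by (simp add: integrable_iff_bounded)
  have "exp (- c * (norm x)\<^sup>2) = (\<Prod>b\<in>Basis. exp (- c * (x \<bullet> b)\<^sup>2))" for x :: 'a
    unfolding power2_norm_eq_inner
    by (subst euclidean_inner) (simp add: exp_sum[symmetric] sum_distrib_left power2_eq_square sum_negf)
  then have "(\<integral>\<^sup>+x. ennreal (norm (exp (- c * (norm x)\<^sup>2))) \<partial>(lborel :: 'a measure))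
    = (\<integral>\<^sup>+x. (\<Prod>b\<in>Basis. ennreal (exp (- c * (x \<bullet> b)\<^sup>2))) \<partial>(lborel :: 'a measure))"
    by (simp add: prod_ennreal prod_nonneg)
  also have "\<dots> = (\<Prod>b\<in>(Basis::'a set). \<integral>\<^sup>+t. ennreal (exp (- c * t\<^sup>2)) \<partial>lborel)"
    by (rule nn_integral_lborel_prod) auto
  also have "\<dots> < \<infinity>" using fin by (simp add: power_less_top_ennreal)
  finally show "(\<integral>\<^sup>+x. ennreal (norm (exp (- c * (norm x)\<^sup>2))) \<partial>(lborel :: 'a measure)) < \<infinity>" .
qed simp

lemma poly_le_mult: "poly_le d f \<Longrightarrow> poly_le e g \<Longrightarrow> poly_le (d + e) (\<lambda>x. f x * g x)"
proof (induction d arbitrary: f)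
  case 0
  then obtain c where "f = (\<lambda>x. c)" by auto
  then show ?case using 0 poly_le_cmult by simp
next
  case (Suc d)
  then obtain c h where h: "\<And>b. b \<in> Basis \<Longrightarrow> poly_le d (h b)" and f: "f = (\<lambda>x. c + (\<Sum>b\<in>Basis. (x \<bullet> b) * h b x))"
    by auto
  have "(\<lambda>x. f x * g x) = (\<lambda>x. c * g x + (\<Sum>b\<in>Basis. (x \<bullet> b) * (h b x * g x)))"
    by (simp add: f distrib_right sum_distrib_right mult.assoc)
  moreover have "poly_le (Suc d + e) (\<lambda>x. c * g x)" by (rule poly_le_cmult[OF poly_le_mono[OF Suc.prems(2)]]) simp
  moreover have "poly_le (Suc d + e) (\<lambda>x. (x \<bullet> b) * (h b x * g x))" if "b \<in> Basis" for b
    using poly_le_coord[OF Suc.IH[OF h[OF that] Suc.prems(2)] that] by (simp del: poly_le.simps)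
  ultimately show ?case by (simp only:) (intro poly_le_add poly_le_sum)
qed

lemma poly_exp_bound:
  assumes P: "poly_le d P" and c: "c > 0"
  obtains B where "B \<ge> 0" "\<And>x. \<bar>P x\<bar> \<le> B * exp (c * (norm x)\<^sup>2)"
proof -
  obtain C where C: "C \<ge> 0" "\<And>x. \<bar>P x\<bar> \<le> C * (1 + norm x) ^ d" using poly_le_bound[OF P] by blast
  have "\<bar>P x\<bar> \<le> (C * exp ((real d)\<^sup>2 / (4 * c))) * exp (c * (norm x)\<^sup>2)" for x
  proof -
    have "(1 + norm x) ^ d \<le> exp (norm x) ^ d" by (intro power_mono exp_ge_add_one_self) auto
    also have "\<dots> = exp (real d * norm x)" by (simp add: exp_of_nat_mult)
    also have "\<dots> \<le> exp ((real d)\<^sup>2 / (4 * c) + c * (norm x)\<^sup>2)"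
    proof -
      have "0 \<le> (2 * c * norm x - real d)\<^sup>2 / (4 * c)" using c by simp
      also have "\<dots> = (real d)\<^sup>2 / (4 * c) + c * (norm x)\<^sup>2 - real d * norm x"
        using c by (simp add: power2_diff power_mult_distrib field_simps power2_eq_square)
      finally show ?thesis by simp
    qed
    finally have "C * (1 + norm x) ^ d \<le> C * exp ((real d)\<^sup>2 / (4 * c) + c * (norm x)\<^sup>2)"
      using C(1) by (rule mult_left_mono)
    then show ?thesis using C(2)[of x] by (simp add: exp_add mult.assoc)
  qed
  then show ?thesis using that[of "C * exp ((real d)\<^sup>2 / (4 * c))"] C(1) by simp
qed

definition euler :: "('a::euclidean_space \<Rightarrow> real) \<Rightarrow> 'a \<Rightarrow> real" where
  "euler p x = (\<Sum>b\<in>Basis. (x \<bullet> b) * partial_deriv b p x)"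

text \<open>Euler's identity: on the homogeneous part of degree \<open>Suc d\<close> the radial
  operator is multiplication by \<open>Suc d\<close>, so the difference loses that part.\<close>

lemma euler_poly: "poly_le (Suc d) p \<Longrightarrow> poly_le d (\<lambda>x. euler p x - real (Suc d) * p x)"
proof (induction d arbitrary: p)
  have eq: "\<exists>c g. (\<forall>b\<in>Basis. poly_le d (g b)) \<and>
      (\<lambda>x. euler p x - real (Suc d) * p x) = (\<lambda>x. - real (Suc d) * c + (\<Sum>b\<in>Basis. (x \<bullet> b) * (euler (g b) x - real d * g b x)))"
    if p: "poly_le (Suc d) p" for d and p :: "'a \<Rightarrow> real"
  proof -
    obtain c g where g: "\<And>b. b \<in> Basis \<Longrightarrow> poly_le d (g b)" and pe: "p = (\<lambda>x. c + (\<Sum>b\<in>Basis. (x \<bullet> b) * g b x))"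
      using p by auto
    have dp: "partial_deriv v p x = (\<Sum>b\<in>Basis. (x \<bullet> b) * partial_deriv v (g b) x + (v \<bullet> b) * g b x)" for v x
      unfolding pe using poly_partial_eq[OF poly_le_smooth[OF g]] by simp
    have "euler p x = (\<Sum>b\<in>Basis. (x \<bullet> b) * euler (g b) x) + (\<Sum>b\<in>Basis. (x \<bullet> b) * g b x)" for x
    proof -
      have "euler p x = (\<Sum>v\<in>Basis. \<Sum>b\<in>Basis. (x \<bullet> b) * ((x \<bullet> v) * partial_deriv v (g b) x) + ((x \<bullet> v) * (v \<bullet> b)) * g b x)"
        unfolding euler_def dp by (simp add: sum_distrib_left algebra_simps)
      also have "\<dots> = (\<Sum>b\<in>Basis. \<Sum>v\<in>Basis. (x \<bullet> b) * ((x \<bullet> v) * partial_deriv v (g b) x) + ((x \<bullet> v) * (v \<bullet> b)) * g b x)"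
        by (rule sum.swap)
      also have "\<dots> = (\<Sum>b\<in>Basis. (x \<bullet> b) * euler (g b) x + (\<Sum>v\<in>Basis. (x \<bullet> v) * (b \<bullet> v)) * g b x)"
        by (simp add: sum.distrib euler_def sum_distrib_left sum_distrib_right inner_commute)
      also have "\<dots> = (\<Sum>b\<in>Basis. (x \<bullet> b) * euler (g b) x + (x \<bullet> b) * g b x)"
        by (simp only: euclidean_inner[symmetric])
      finally show ?thesis by (simp add: sum.distrib)
    qed
    then have "(\<lambda>x. euler p x - real (Suc d) * p x) = (\<lambda>x. - real (Suc d) * c + (\<Sum>b\<in>Basis. (x \<bullet> b) * (euler (g b) x - real d * g b x)))"
      by (simp add: pe fun_eq_iff right_diff_distrib distrib_left sum_subtractf sum_distrib_left sum.distrib)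
        (simp add: algebra_simps sum_distrib_left sum.distrib)
    then show ?thesis using g by blast
  qed
  {
    case 0
    obtain c g where g: "\<And>b. b \<in> Basis \<Longrightarrow> poly_le 0 (g b)" and e: "(\<lambda>x. euler p x - real (Suc 0) * p x)
      = (\<lambda>x. - real (Suc 0) * c + (\<Sum>b\<in>Basis. (x \<bullet> b) * (euler (g b) x - real 0 * g b x)))" using eq[OF 0] by blast
    have "euler (g b) = (\<lambda>x. 0)" if b: "b \<in> Basis" for b
    proof -
      obtain k where k: "g b = (\<lambda>x. k)" using g[OF b] unfolding poly_le.simps ..
      show ?thesis unfolding k by (simp add: euler_def[abs_def] partial_const)
    qed
    then show ?case unfolding e by (simp add: poly_le_const del: poly_le.simps)
  next
    case (Suc d)
    obtain c g where g: "\<And>b. b \<in> Basis \<Longrightarrow> poly_le (Suc d) (g b)" and e: "(\<lambda>x. euler p x - real (Suc (Suc d)) * p x)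
      = (\<lambda>x. - real (Suc (Suc d)) * c + (\<Sum>b\<in>Basis. (x \<bullet> b) * (euler (g b) x - real (Suc d) * g b x)))" using eq[OF Suc.prems] by blast
    show ?case unfolding e by (intro poly_le_add poly_le_const poly_le_sum poly_le_coord Suc.IH g)
  }
qed

section \<open>The Gaussian operator on polynomials\<close>

context
  fixes \<rho> :: real and V :: "'a::euclidean_space \<Rightarrow> real"
  assumes \<rho>: "\<rho> > 0" and V_def: "V = gaussian_potential \<rho>"
begin

lemma gaussian_weight: "exp (- V x) = exp (real DIM('a) / 2 * ln (\<rho> / (2 * pi))) * exp (- (\<rho> / 2) * (norm x)\<^sup>2)"
  unfolding V_def gaussian_potential_def by (simp add: exp_add[symmetric])

lemma gaussian_eq: "V = (\<lambda>x. (\<rho> / 2) * (norm x)\<^sup>2 + - (real DIM('a) / 2 * ln (\<rho> / (2 * pi))))"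
  unfolding V_def gaussian_potential_def by (simp add: fun_eq_iff)

lemma gaussian_smooth: "smooth V"
  unfolding gaussian_eq by (intro smooth_add smooth_cmult smooth_norm_sq smooth_const)

lemma gaussian_partial: "partial_deriv b V x = \<rho> * (x \<bullet> b)"
proof -
  have "(V has_derivative (\<lambda>h. (\<rho> / 2) * (x \<bullet> h + h \<bullet> x))) (at x)"
    unfolding gaussian_eq power2_norm_eq_inner by (auto intro!: derivative_eq_intros)
  from partial_deriv_eq[OF this] show ?thesis by (simp add: inner_commute)
qed

lemma poly_exp_square_integrable:
  assumes P: "poly_le d P" and t: "t < \<rho> / 4"
  shows "weighted_square_integrable V (\<lambda>x. P x * exp (t * (norm x)\<^sup>2))"
  unfolding weighted_square_integrable_def
proof
  note [measurable] = poly_le_measurable[OF P] V_measurable[OF gaussian_smooth]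
  show "(\<lambda>x. P x * exp (t * (norm x)\<^sup>2)) \<in> borel_measurable borel" by measurable
  \<comment> \<open>After squaring, the exponent is \<open>- 2 * (\<rho> / 4 - t)\<close> times the
    squared norm of \<open>x\<close>; half of this decay is spent on the polynomial factor.\<close>
  define \<delta> where "\<delta> = (\<rho> / 4 - t) / 2"
  define K where "K = exp (real DIM('a) / 2 * ln (\<rho> / (2 * pi)))"
  have \<delta>: "\<delta> > 0" using t by (simp add: \<delta>_def)
  obtain B where B: "B \<ge> 0" "\<And>x. \<bar>P x\<bar> \<le> B * exp (\<delta> * (norm x)\<^sup>2)" by (rule poly_exp_bound[OF P \<delta>]) (rule that)
  show "integrable lborel (\<lambda>x. exp (- V x) * (P x * exp (t * (norm x)\<^sup>2))\<^sup>2)"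
  proof (rule Bochner_Integration.integrable_bound)
    show "integrable lborel (\<lambda>x::'a. (K * B\<^sup>2) * exp (- (\<rho> / 4 - t) * (norm x)\<^sup>2))"
      using t by (intro integrable_mult_right integrable_gaussian) simp
    show "AE x in lborel. norm (exp (- V x) * (P x * exp (t * (norm x)\<^sup>2))\<^sup>2) \<le> norm ((K * B\<^sup>2) * exp (- (\<rho> / 4 - t) * (norm x)\<^sup>2))"
    proof (rule AE_I2)
      fix x :: 'a
      let ?r = "(norm x)\<^sup>2"
      have "(P x)\<^sup>2 \<le> (B * exp (\<delta> * ?r))\<^sup>2" using power_mono[OF B(2)[of x], of 2] by simp
      also have "\<dots> = B\<^sup>2 * exp (2 * \<delta> * ?r)" by (simp add: power_mult_distrib exp_double[symmetric] mult.assoc)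
      finally have "(P x)\<^sup>2 \<le> B\<^sup>2 * exp (2 * \<delta> * ?r)" .
      then have "K * exp (- (\<rho> / 2) * ?r) * exp (2 * t * ?r) * (P x)\<^sup>2 \<le> K * exp (- (\<rho> / 2) * ?r) * exp (2 * t * ?r) * (B\<^sup>2 * exp (2 * \<delta> * ?r))"
        by (intro mult_left_mono) (auto simp: K_def)
      also have "\<dots> = K * B\<^sup>2 * (exp (- (\<rho> / 2) * ?r) * exp (2 * t * ?r) * exp (2 * \<delta> * ?r))" by (simp add: mult_ac)
      also have "exp (- (\<rho> / 2) * ?r) * exp (2 * t * ?r) * exp (2 * \<delta> * ?r) = exp (- (\<rho> / 4 - t) * ?r)"
        unfolding exp_add[symmetric] \<delta>_def by (rule arg_cong[where f=exp]) (simp add: field_simps)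
      finally have "K * exp (- (\<rho> / 2) * ?r) * exp (2 * t * ?r) * (P x)\<^sup>2 \<le> K * B\<^sup>2 * exp (- (\<rho> / 4 - t) * ?r)" .
      moreover have "(exp (t * ?r))\<^sup>2 = exp (2 * t * ?r)" by (simp add: exp_double[symmetric] mult.assoc)
      ultimately show "norm (exp (- V x) * (P x * exp (t * ?r))\<^sup>2) \<le> norm ((K * B\<^sup>2) * exp (- (\<rho> / 4 - t) * ?r))"
        unfolding gaussian_weight K_def[symmetric] by (simp add: power_mult_distrib mult_ac K_def)
    qed
  qed measurable
qed

lemma poly_square_integrable: "poly_le d P \<Longrightarrow> weighted_square_integrable V P"
  using poly_exp_square_integrable[of d P 0] \<rho> by simp

lemma gaussian_laplacian_eq: "- weighted_laplacian V p x = \<rho> * euler p x - (\<Sum>b\<in>Basis. partial_deriv b (partial_deriv b p) x)"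
  unfolding weighted_laplacian_eq gaussian_partial euler_def by (simp add: sum_subtractf sum_distrib_left mult.assoc)

lemma gaussian_laplacian_const: "poly_le 0 p \<Longrightarrow> (\<lambda>x. - weighted_laplacian V p x) = (\<lambda>x. 0)"
  unfolding gaussian_laplacian_eq euler_def by (auto simp: partial_const)

text \<open>Here \<open>- L\<close> is \<open>\<rho>\<close> times the Euler operator minus the
  Laplacian, hence triangular with respect to degree, with diagonal entries \<open>\<rho>\<close>
  times the degree.\<close>

lemma gaussian_laplacian_poly:
  assumes "poly_le (Suc d) p"
  obtains r where "poly_le d r" "(\<lambda>x. - weighted_laplacian V p x) = (\<lambda>x. (real (Suc d) * \<rho>) * p x + r x)"
proof
  let ?r = "\<lambda>x. \<rho> * (euler p x - real (Suc d) * p x) + (-1) * (\<Sum>b\<in>Basis. partial_deriv b (partial_deriv b p) x)"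
  show "poly_le d ?r"
    by (intro poly_le_add poly_le_cmult euler_poly poly_le_sum poly_le_partial' poly_le_partial assms)
  show "(\<lambda>x. - weighted_laplacian V p x) = (\<lambda>x. (real (Suc d) * \<rho>) * p x + ?r x)"
    unfolding gaussian_laplacian_eq by (simp add: algebra_simps fun_eq_iff)
qed

context
  fixes A :: "('a l2 \<times> 'a l2) set"
  assumes A: "selfadjoint_rel A" and sub: "pull_rel V (neg_weighted_laplacian_graph V) \<subseteq> A"
begin

text \<open>Polynomials are not test functions, but their cutoffs converge together with their
  weighted Laplacians, and the graph of any self-adjoint extension is closed.\<close>

lemma polynomial_in_domain:
  assumes p: "poly_le d p"
  shows "(l2_class V p, l2_class V (\<lambda>x. - weighted_laplacian V p x)) \<in> A"
proof -
  note V = gaussian_smooth and M = V_measurable[OF gaussian_smooth]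
  have w1: "weighted_square_integrable V (partial_deriv b p)" for b
    by (rule poly_square_integrable[OF poly_le_partial'[OF p]])
  have wV: "weighted_square_integrable V (\<lambda>x. partial_deriv b V x * p x)" if "b \<in> Basis" for b
    unfolding gaussian_partial mult.assoc
    by (rule poly_square_integrable[OF poly_le_cmult[OF poly_le_coord[OF p that]]])
  obtain r where r: "poly_le d r" "(\<lambda>x. - weighted_laplacian V p x) = (\<lambda>x. (real (Suc d) * \<rho>) * p x + r x)"
    by (rule gaussian_laplacian_poly[OF poly_le_Suc[OF p]]) (rule that)
  have wm: "weighted_square_integrable V (\<lambda>x. - weighted_laplacian V p x)"
    unfolding r(2) by (rule poly_square_integrable[OF poly_le_add[OF poly_le_cmult[OF p] r(1)]])
  have wL: "weighted_square_integrable V (weighted_laplacian V p)"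
    using weighted_square_integrable_scale[OF M wm, of "-1"] by simp
  obtain g where g: "\<And>n. test_function (g n)" "(\<lambda>n. l2_class V (g n)) \<longlonglongrightarrow> l2_class V p"
    and gL: "(\<lambda>n. l2_class V (weighted_laplacian V (g n))) \<longlonglongrightarrow> l2_class V (weighted_laplacian V p)"
    by (rule cutoff_approximation[OF V poly_le_smooth[OF p] poly_square_integrable[OF p] w1]) (rule that, assumption, assumption, use wV wL in blast)
  have neg: "l2_class V (\<lambda>x. - f x) = - l2_class V f" if "weighted_square_integrable V f" for f
    using l2_class_scale[OF M that, of "-1"] by simp
  have "(\<lambda>n. - l2_class V (weighted_laplacian V (g n))) \<longlonglongrightarrow> - l2_class V (weighted_laplacian V p)"
    by (intro tendsto_minus gL)
  moreover have "l2_class V (\<lambda>x. - weighted_laplacian V (g n) x) = - l2_class V (weighted_laplacian V (g n))" for n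
    by (rule neg[OF test_function_square_integrable[OF V test_function_weighted_laplacian[OF V g(1)]]])
  ultimately have lim: "(\<lambda>n. l2_class V (\<lambda>x. - weighted_laplacian V (g n) x)) \<longlonglongrightarrow> l2_class V (\<lambda>x. - weighted_laplacian V p x)"
    by (simp add: neg[OF wL])
  have "(l2_class V (g n), l2_class V (\<lambda>x. - weighted_laplacian V (g n) x)) \<in> A" for n
    using sub g(1) unfolding pull_rel_graph[OF V] by blast
  from selfadjoint_rel_limit[OF A this g(2) lim] show ?thesis .
qed

lemma polynomial_const_kernel: "poly_le 0 p \<Longrightarrow> (l2_class V p, 0) \<in> A"
  using polynomial_in_domain[of 0 p] gaussian_laplacian_const l2_class_zero[OF gaussian_smooth] by metis

lemma polynomial_operator:
  assumes p: "poly_le (Suc d) p"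
  obtains r where "poly_le d r" "(l2_class V p, (real (Suc d) * \<rho>) *\<^sub>R l2_class V p + l2_class V r) \<in> A"
proof -
  note M = V_measurable[OF gaussian_smooth]
  obtain r where r: "poly_le d r" "(\<lambda>x. - weighted_laplacian V p x) = (\<lambda>x. (real (Suc d) * \<rho>) * p x + r x)"
    by (rule gaussian_laplacian_poly[OF p]) (rule that)
  have "l2_class V (\<lambda>x. - weighted_laplacian V p x) = (real (Suc d) * \<rho>) *\<^sub>R l2_class V p + l2_class V r"
    unfolding r(2) using poly_square_integrable[OF p] poly_square_integrable[OF r(1)]
    by (simp only: l2_class_add[OF M weighted_square_integrable_scale[OF M]] l2_class_scale[OF M])
  then show ?thesis using that[OF r(1)] polynomial_in_domain[OF p] by simp
qed

text \<open>Solves \<open>(A - \<mu>) q = p\<close> by back substitution in the degree;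
  \<open>\<mu>\<close> exceeds all diagonal entries of the triangular operator, so each division is
  legitimate.\<close>

lemma polynomial_resolvent:
  assumes "poly_le d p" "\<mu> > real d * \<rho>"
  obtains q where "poly_le d q" "(l2_class V q, \<mu> *\<^sub>R l2_class V q + l2_class V p) \<in> A"
proof -
  note M = V_measurable[OF gaussian_smooth]
  note add = l2_class_add[OF M] and scale = l2_class_scale[OF M] and wscale = weighted_square_integrable_scale[OF M]
  note w = poly_square_integrable
  have "\<exists>q. poly_le d q \<and> (l2_class V q, \<mu> *\<^sub>R l2_class V q + l2_class V p) \<in> A" using assms
  proof (induction d arbitrary: p)
    case 0
    have "\<mu> > 0" using 0 by simp
    have "((- 1 / \<mu>) *\<^sub>R l2_class V p, (- 1 / \<mu>) *\<^sub>R 0) \<in> A"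
      by (rule selfadjoint_rel_scale[OF A polynomial_const_kernel[OF 0(1)]])
    moreover have "\<mu> *\<^sub>R ((- 1 / \<mu>) *\<^sub>R l2_class V p) + l2_class V p = 0" using \<open>\<mu> > 0\<close> by simp
    ultimately have "(l2_class V (\<lambda>x. (- 1 / \<mu>) * p x), \<mu> *\<^sub>R l2_class V (\<lambda>x. (- 1 / \<mu>) * p x) + l2_class V p) \<in> A"
      unfolding scale[OF w[OF 0(1)]] by simp
    then show ?case using poly_le_cmult[OF 0(1), of "- 1 / \<mu>"] by blast
  next
    case (Suc d)
    obtain r where r: "poly_le d r" "(l2_class V p, (real (Suc d) * \<rho>) *\<^sub>R l2_class V p + l2_class V r) \<in> A"
      by (rule polynomial_operator[OF Suc.prems(1)]) (rule that)
    define a where "a = 1 / (real (Suc d) * \<rho> - \<mu>)"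
    have a: "a * (real (Suc d) * \<rho>) = a * \<mu> + 1" using Suc.prems(2) unfolding a_def by (simp add: field_simps)
    have "real d * \<rho> < \<mu>" using Suc.prems(2) \<rho> by (simp add: algebra_simps)
    then obtain q where q: "poly_le d q" "(l2_class V q, \<mu> *\<^sub>R l2_class V q + l2_class V (\<lambda>x. (- a) * r x)) \<in> A"
      using Suc.IH[OF poly_le_cmult[OF r(1), of "- a"]] by blast
    have "(a *\<^sub>R l2_class V p + l2_class V q, a *\<^sub>R ((real (Suc d) * \<rho>) *\<^sub>R l2_class V p + l2_class V r)
        + (\<mu> *\<^sub>R l2_class V q + l2_class V (\<lambda>x. (- a) * r x))) \<in> A"
      by (rule selfadjoint_rel_add[OF A selfadjoint_rel_scale[OF A r(2)] q(2)])
    also have "a *\<^sub>R ((real (Suc d) * \<rho>) *\<^sub>R l2_class V p + l2_class V r) + (\<mu> *\<^sub>R l2_class V q + l2_class V (\<lambda>x. (- a) * r x))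
      = \<mu> *\<^sub>R (a *\<^sub>R l2_class V p + l2_class V q) + l2_class V p"
      unfolding scale[OF w[OF r(1)]] scaleR_add_right scaleR_scaleR a by (simp add: algebra_simps)
    finally have "(l2_class V (\<lambda>x. a * p x + q x), \<mu> *\<^sub>R l2_class V (\<lambda>x. a * p x + q x) + l2_class V p) \<in> A"
      unfolding add[OF wscale[OF w[OF Suc.prems(1)]] w[OF q(1)]] scale[OF w[OF Suc.prems(1)]] .
    then show ?case using poly_le_add[OF poly_le_cmult[OF Suc.prems(1)] poly_le_Suc[OF q(1)]] by blast
  qed
  then show ?thesis using that by blast
qed

text \<open>Subtracting a suitable \<open>q\<close> of lower degree from \<open>p\<close> gives a
  Hermite-type eigenvector with eigenvalue \<open>\<rho>\<close> times the degree bound. Once that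
  exceeds \<open>m\<close>, the vector is annihilated by \<open>E m\<close> and so orthogonal to
  \<open>u\<close>, and the induction disposes of \<open>q\<close>. For \<open>d0 = 0\<close> the
  constants already have eigenvalue 0 above \<open>m\<close>.\<close>

lemma polynomial_orthogonal:
  assumes S: "spectral_resolution A E" and u: "E m u = u" and m: "m < real d0 * \<rho>"
    and orth: "\<And>i p. i < d0 \<Longrightarrow> poly_le i p \<Longrightarrow> u \<bullet> l2_class V p = 0"
    and p: "poly_le d p"
  shows "u \<bullet> l2_class V p = 0"
  using p
proof (induction d arbitrary: p)
  note M = V_measurable[OF gaussian_smooth]
  note w = poly_square_integrable
  have eig: "u \<bullet> h = 0" if "(h, lam *\<^sub>R h) \<in> A" "m < lam" for h lam
  proof -
    have "u \<bullet> h = u \<bullet> E m h"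
      using S u by (auto simp: spectral_resolution_def projection_resolution_def projection_op_def symmetric_op_def) metis
    then show ?thesis using eigenvector_spectral_projection_zero[OF A S that] by simp
  qed
  {
    case 0
    show ?case
    proof (cases "d0 = 0")
      case True
      then show ?thesis using eig[of "l2_class V p" 0] polynomial_const_kernel[OF 0] m by simp
    qed (use orth 0 in blast)
  next
    case (Suc d)
    show ?case
    proof (cases "Suc d < d0")
      case False
      let ?\<mu> = "real (Suc d) * \<rho>"
      obtain r where r: "poly_le d r" "(l2_class V p, ?\<mu> *\<^sub>R l2_class V p + l2_class V r) \<in> A"
        by (rule polynomial_operator[OF Suc.prems(1)]) (rule that)
      have "real d * \<rho> < ?\<mu>" using \<rho> by simp
      then obtain q where q: "poly_le d q" "(l2_class V q, ?\<mu> *\<^sub>R l2_class V q + l2_class V r) \<in> A"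
        by (rule polynomial_resolvent[OF r(1)]) (rule that)
      have "(l2_class V p - l2_class V q, ?\<mu> *\<^sub>R (l2_class V p - l2_class V q)) \<in> A"
        using selfadjoint_rel_diff[OF A r(2) q(2)] by (simp add: scaleR_diff_right)
      moreover have "m < ?\<mu>"
      proof -
        have "real d0 * \<rho> \<le> ?\<mu>" using False \<rho> by (intro mult_right_mono) auto
        then show ?thesis using m by simp
      qed
      ultimately have "u \<bullet> (l2_class V p - l2_class V q) = 0" by (rule eig)
      then show ?thesis using Suc.IH[OF q(1)] by (simp add: inner_diff_right)
    qed (use orth Suc.prems in blast)
  }
qed

end

end

text \<open>An algebra of functions containing every polynomial expression in
  \<open>exp (- t * (norm x)\<^sup>2)\<close> and its products with the coordinates, made for a
  Stone-Weierstrass argument.\<close>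

inductive gauss_poly :: "real \<Rightarrow> ('a::euclidean_space \<Rightarrow> real) \<Rightarrow> bool" for t where
  base: "poly_le d P \<Longrightarrow> gauss_poly t (\<lambda>x. P x * exp (- t * (norm x)\<^sup>2) ^ j)"
| add: "gauss_poly t f \<Longrightarrow> gauss_poly t g \<Longrightarrow> gauss_poly t (\<lambda>x. f x + g x)"

lemma gauss_poly_mult_base:
  assumes P: "poly_le d P" and g: "gauss_poly t g"
  shows "gauss_poly t (\<lambda>x. (P x * exp (- t * (norm x)\<^sup>2) ^ j) * g x)"
  using g
proof induction
  case (base e Q k)
  have "(\<lambda>x. (P x * exp (- t * (norm x)\<^sup>2) ^ j) * (Q x * exp (- t * (norm x)\<^sup>2) ^ k))
    = (\<lambda>x. (P x * Q x) * exp (- t * (norm x)\<^sup>2) ^ (j + k))" by (simp only: power_add mult_ac)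
  then show ?case using gauss_poly.base[OF poly_le_mult[OF P base], of t "j + k"] by simp
next
  case (add f g)
  then show ?case using gauss_poly.add[OF add.IH] by (simp only: distrib_left)
qed

lemma gauss_poly_mult:
  assumes "gauss_poly t f" and g: "gauss_poly t g" shows "gauss_poly t (\<lambda>x. f x * g x)"
  using assms(1)
proof induction
  case (base d P j)
  show ?case by (rule gauss_poly_mult_base[OF base g])
next
  case (add f g)
  then show ?case using gauss_poly.add[OF add.IH] by (simp only: distrib_right)
qed

lemma gauss_poly_compose:
  fixes q :: "real \<times> 'a::euclidean_space \<Rightarrow> real"
  assumes "real_polynomial_function q"
  shows "gauss_poly t (\<lambda>x. q (exp (- t * (norm x)\<^sup>2), exp (- t * (norm x)\<^sup>2) *\<^sub>R x))"
  using assms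
proof induction
  case (linear f)
  then interpret f: bounded_linear f .
  let ?P = "\<lambda>x. f (1, 0) + (\<Sum>b\<in>Basis. (x \<bullet> b) * f (0, b))"
  have P: "poly_le 1 ?P" unfolding One_nat_def by (intro poly_le_add poly_le_const poly_le_sum poly_le_coord)
  have eq: "f (e, e *\<^sub>R x) = ?P x * e ^ 1" for e :: real and x :: 'a
  proof -
    have "f (0, x) = f (\<Sum>b\<in>Basis. (x \<bullet> b) *\<^sub>R (0, b))"
      by (simp add: scaleR_prod_def sum_prod euclidean_representation)
    also have "\<dots> = (\<Sum>b\<in>Basis. (x \<bullet> b) * f (0, b))" by (simp only: f.sum f.scaleR real_scaleR_def)
    finally have 0: "f (0, x) = (\<Sum>b\<in>Basis. (x \<bullet> b) * f (0, b))" .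
    have "(e, e *\<^sub>R x) = e *\<^sub>R ((1, 0) + (0, x))" by (simp add: scaleR_prod_def)
    then have "f (e, e *\<^sub>R x) = e * (f (1, 0) + f (0, x))" by (simp only: f.scaleR f.add real_scaleR_def)
    then show ?thesis unfolding 0 by (simp add: mult.commute)
  qed
  show ?case unfolding eq by (rule gauss_poly.base[OF P])
next
  case (const c)
  show ?case using gauss_poly.base[OF poly_le_const, of t c 0] by simp
next
  case (add f g)
  show ?case by (rule gauss_poly.add[OF add.IH])
next
  case (mult f g)
  show ?case by (rule gauss_poly_mult[OF mult.IH])
qed

text \<open>The map \<open>x \<mapsto> (e, e x)\<close> with \<open>e = exp (- t |x|\<^sup>2)\<close> embeds the space into a compact set, and a
  compactly supported function is the restriction of a continuous function on that set.\<close>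

lemma gauss_poly_approximation:
  fixes \<phi> :: "'a::euclidean_space \<Rightarrow> real"
  assumes \<phi>: "test_function \<phi>" and t: "t > 0" and \<epsilon>: "\<epsilon> > 0"
  obtains g where "gauss_poly t g" "\<And>x. \<bar>\<phi> x - g x\<bar> < \<epsilon>"
proof -
  define e where "e x = exp (- t * (norm x)\<^sup>2)" for x :: 'a
  have "bounded {x. \<phi> x \<noteq> 0}"
    using \<phi> compact_imp_bounded bounded_subset[OF _ closure_subset] unfolding test_function_def by blast
  then obtain R where R: "R > 0" "\<And>x. \<phi> x \<noteq> 0 \<Longrightarrow> norm x \<le> R" unfolding bounded_pos by blast
  \<comment> \<open>The values of \<open>e\<close> at the radii \<open>R\<close> and
    \<open>R + 1\<close>; the ramp \<open>h\<close> is 1 above \<open>s0\<close>, where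
    \<open>\<phi>\<close> lives, and 0 below \<open>s1\<close>.\<close>
  define s0 s1 where "s0 = exp (- t * R\<^sup>2)" and "s1 = exp (- t * (R + 1)\<^sup>2)"
  have "R\<^sup>2 < (R + 1)\<^sup>2" using R by (intro power_strict_mono) auto
  then have s: "0 < s1" "s1 < s0" using t by (auto simp: s0_def s1_def)
  define h where "h s = min 1 (max 0 ((s - s1) / (s0 - s1)))" for s
  \<comment> \<open>The point \<open>x\<close> is recovered as \<open>snd z\<close> divided by
    \<open>fst z\<close>. The maximum with \<open>s1\<close> keeps the division continuous, and
    where it alters the quotient the factor \<open>h\<close> is 0.\<close>
  define F where "F = (\<lambda>z. \<phi> ((1 / max (fst z) s1) *\<^sub>R snd z) * h (fst z))"
  define K where "K = {0..1::real} \<times> cball (0::'a) (1 + 1 / t)"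
  have "compact K" unfolding K_def by (intro compact_Times compact_Icc compact_cball)
  moreover have "continuous_on K F"
  proof -
    have c: "continuous_on UNIV \<phi>" by (rule smooth_continuous[OF test_function_smooth[OF \<phi>]])
    have m: "max r s1 \<noteq> 0" for r using s by (auto simp: max_def)
    have "continuous_on K (\<lambda>z. \<phi> ((1 / max (fst z) s1) *\<^sub>R snd z))"
      by (rule continuous_on_compose2[OF c]) (auto intro!: continuous_intros simp: m)
    moreover have "continuous_on K (\<lambda>z. h (fst z))"
      unfolding h_def using s by (auto intro!: continuous_intros)
    ultimately show ?thesis unfolding F_def by (rule continuous_on_mult)
  qed
  ultimately obtain q where q: "real_polynomial_function q" "\<And>z. z \<in> K \<Longrightarrow> \<bar>F z - q z\<bar> < \<epsilon>"
    using Stone_Weierstrass_real_polynomial_function[OF _ _ \<epsilon>] by metis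
  have e01: "0 < e x" "e x \<le> 1" for x unfolding e_def using t by auto
  \<comment> \<open>The radius \<open>1 + 1 / t\<close> comes from
    \<open>norm x \<le> (1 + 1 / t) * (1 + t * (norm x)\<^sup>2)\<close> together with
    \<open>e x * (1 + t * (norm x)\<^sup>2) \<le> 1\<close>.\<close>
  have inK: "(e x, e x *\<^sub>R x) \<in> K" for x
  proof -
    have "1 + t * (norm x)\<^sup>2 \<le> exp (t * (norm x)\<^sup>2)" by (rule exp_ge_add_one_self)
    then have "e x * (1 + t * (norm x)\<^sup>2) \<le> e x * exp (t * (norm x)\<^sup>2)" using e01(1)[of x] by (intro mult_left_mono) auto
    also have "\<dots> = 1" unfolding e_def by (simp add: exp_add[symmetric])
    finally have 1: "e x * (1 + t * (norm x)\<^sup>2) \<le> 1" .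
    have "norm x \<le> 1 + (norm x)\<^sup>2" using zero_le_power2[of "norm x - 1"] norm_ge_zero[of x] by (simp add: power2_diff del: norm_ge_zero)
    also have "\<dots> \<le> (1 + 1 / t) * (1 + t * (norm x)\<^sup>2)" using t by (simp add: field_simps)
    finally have "e x * norm x \<le> e x * ((1 + 1 / t) * (1 + t * (norm x)\<^sup>2))" using e01(1)[of x] by (intro mult_left_mono) auto
    also have "\<dots> = (1 + 1 / t) * (e x * (1 + t * (norm x)\<^sup>2))" by (simp add: mult_ac)
    also have "\<dots> \<le> (1 + 1 / t) * 1" using 1 t by (intro mult_left_mono) auto
    finally show ?thesis unfolding K_def using e01[of x] by auto
  qed
  have F: "F (e x, e x *\<^sub>R x) = \<phi> x" for x
  proof (cases "\<phi> x = 0")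
    case False
    have "(norm x)\<^sup>2 \<le> R\<^sup>2" using R(2)[OF False] by (intro power_mono) auto
    then have "s0 \<le> e x" unfolding s0_def e_def using t by simp
    then have "h (e x) = 1" "max (e x) s1 = e x" using s unfolding h_def by (auto simp: min_def max_def field_simps)
    then show ?thesis unfolding F_def using e01(1)[of x] by simp
  next
    case True
    show ?thesis
    proof (cases "s1 \<le> e x")
      case le: True
      then have "max (e x) s1 = e x" by simp
      then show ?thesis unfolding F_def using e01(1)[of x] True by simp
    next
      case False
      then have "(e x - s1) / (s0 - s1) \<le> 0" using s by (simp add: divide_le_0_iff)
      then have "h (e x) = 0" unfolding h_def by simp
      then show ?thesis unfolding F_def using True by simp
    qed
  qed
  show ?thesis
  proof (rule that)
    show "gauss_poly t (\<lambda>x. q (e x, e x *\<^sub>R x))" unfolding e_def by (rule gauss_poly_compose[OF q(1)])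
    show "\<bar>\<phi> x - q (e x, e x *\<^sub>R x)\<bar> < \<epsilon>" for x using q(2)[OF inK[of x]] unfolding F .
  qed
qed

section \<open>Completeness of the polynomials in the Gaussian space\<close>

lemma weighted_mult_integrable:
  assumes "weighted_square_integrable V f" "weighted_square_integrable V g" "V \<in> borel_measurable borel"
  shows "integrable lborel (\<lambda>x. exp (- V x) * (f x * g x))"
proof -
  have "integrable lborel (\<lambda>x. (exp (- V x / 2) * f x) * (exp (- V x / 2) * g x))"
    using assms by (intro square_integrable_mult) (auto simp: square_integrable_weight)
  moreover have "(exp (- V x / 2) * f x) * (exp (- V x / 2) * g x) = exp (- V x) * (f x * g x)" for x
    unfolding exp_half_square[symmetric] power2_eq_square by (simp only: mult_ac)
  ultimately show ?thesis by (simp only:)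
qed

definition exp_taylor :: "real \<Rightarrow> nat \<Rightarrow> 'a::euclidean_space \<Rightarrow> real" where
  "exp_taylor t N x = (\<Sum>k<N. (- t * (norm x)\<^sup>2) ^ k / fact k)"

lemma exp_taylor_poly: "poly_le (2 * N) (exp_taylor t N)"
proof -
  have n: "poly_le (2 * k) (\<lambda>x::'a. ((norm x)\<^sup>2) ^ k)" for k
  proof (induction k)
    case (Suc k)
    show ?case using poly_le_norm_sq[OF Suc] by (simp del: poly_le.simps)
  qed (simp add: poly_le_const del: poly_le.simps)
  have "poly_le (2 * N) (\<lambda>x::'a. \<Sum>k<N. ((- t) ^ k / fact k) * ((norm x)\<^sup>2) ^ k)"
    by (intro poly_le_sum poly_le_cmult poly_le_mono[OF n]) simp
  moreover have "exp_taylor t N = (\<lambda>x::'a. \<Sum>k<N. ((- t) ^ k / fact k) * ((norm x)\<^sup>2) ^ k)"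
    by (simp only: exp_taylor_def[abs_def] power_mult_distrib times_divide_eq_left)
  ultimately show ?thesis by simp
qed

lemma exp_taylor_tendsto: "(\<lambda>N. exp_taylor t N x) \<longlonglongrightarrow> exp (- t * (norm x)\<^sup>2)"
  using exp_converges[of "- t * (norm x)\<^sup>2"] unfolding exp_taylor_def sums_def
  by (simp add: divide_inverse mult.commute)

lemma exp_taylor_bound: assumes "t \<ge> 0" shows "\<bar>exp_taylor t N x\<bar> \<le> exp (t * (norm x)\<^sup>2)"
proof -
  let ?r = "t * (norm x)\<^sup>2"
  have "\<bar>exp_taylor t N x\<bar> \<le> (\<Sum>k<N. \<bar>(- t * (norm x)\<^sup>2) ^ k / fact k\<bar>)" unfolding exp_taylor_def by (rule sum_abs)
  also have "\<dots> = (\<Sum>k<N. ?r ^ k /\<^sub>R fact k)" using assms by (simp add: power_abs abs_mult divide_inverse mult.commute)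
  also have "\<dots> \<le> (\<Sum>k. ?r ^ k /\<^sub>R fact k)" using assms by (intro sum_le_suminf summable_exp_generic) auto
  finally show ?thesis by (simp add: exp_def)
qed

context
  fixes \<rho> :: real and V :: "'a::euclidean_space \<Rightarrow> real" and f :: "'a \<Rightarrow> real"
  assumes \<rho>: "\<rho> > 0" and V_def: "V = gaussian_potential \<rho>"
    and f: "weighted_square_integrable V f"
    and orth: "\<And>d P. poly_le d P \<Longrightarrow> l2_class V f \<bullet> l2_class V P = 0"
begin

text \<open>Replace one exponential factor by its Taylor polynomials and pass to the limit; the
  other \<open>j\<close> factors are at most 1. Expanding one factor at a time keeps the majorant at
  \<open>exp (\<rho> / 8 * (norm x)\<^sup>2)\<close>, whatever \<open>j\<close> is, and
  \<open>\<rho> / 8 < \<rho> / 4\<close> makes it square-integrable against the weight.\<close>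

lemma orthogonal_damped_polynomial:
  "poly_le d P \<Longrightarrow> integrable lborel (\<lambda>x. exp (- V x) * (f x * (P x * exp (- (\<rho> / 8) * (norm x)\<^sup>2) ^ j))) \<and>
    (\<integral>x. exp (- V x) * (f x * (P x * exp (- (\<rho> / 8) * (norm x)\<^sup>2) ^ j)) \<partial>lborel) = 0"
proof (induction j arbitrary: d P)
  note M = V_measurable[OF gaussian_smooth[OF \<rho> V_def]]
  {
    case 0
    have w: "weighted_square_integrable V P" by (rule poly_square_integrable[OF \<rho> V_def 0])
    show ?case using weighted_mult_integrable[OF f w M] inner_l2_class[OF M f w] orth[OF 0] by simp
  next
    case (Suc j)
    let ?t = "\<rho> / 8"
    let ?e = "\<lambda>x. exp (- ?t * (norm x)\<^sup>2)"
    let ?s = "\<lambda>N x. exp (- V x) * (f x * ((P x * exp_taylor ?t N x) * ?e x ^ j))"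
    have s: "integrable lborel (?s N)" "(\<integral>x. ?s N x \<partial>lborel) = 0" for N
      using Suc.IH[OF poly_le_mult[OF Suc.prems exp_taylor_poly]] by auto
    have w: "weighted_square_integrable V (\<lambda>x. P x * exp (?t * (norm x)\<^sup>2))"
      by (rule poly_exp_square_integrable[OF \<rho> V_def Suc.prems]) (use \<rho> in simp)
    have [measurable]: "f \<in> borel_measurable borel" using f by (simp add: weighted_square_integrable_def)
    note [measurable] = M poly_le_measurable[OF Suc.prems] poly_le_measurable[OF exp_taylor_poly]
    have lim: "(\<lambda>N. ?s N x) \<longlonglongrightarrow> exp (- V x) * (f x * (P x * ?e x ^ Suc j))" for x
    proof -
      have "(\<lambda>N. ?s N x) \<longlonglongrightarrow> exp (- V x) * (f x * ((P x * ?e x) * ?e x ^ j))"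
        by (intro tendsto_intros exp_taylor_tendsto)
      then show ?thesis by (simp add: mult_ac)
    qed
    have bd: "norm (?s N x) \<le> \<bar>exp (- V x) * (f x * (P x * exp (?t * (norm x)\<^sup>2)))\<bar>" for N x
    proof -
      have "?e x ^ j \<le> 1" using \<rho> by (intro power_le_one) auto
      then have "\<bar>exp_taylor ?t N x\<bar> * ?e x ^ j \<le> exp (?t * (norm x)\<^sup>2) * 1"
        using \<rho> by (intro mult_mono exp_taylor_bound) auto
      then have "\<bar>exp (- V x) * f x * P x\<bar> * (\<bar>exp_taylor ?t N x\<bar> * ?e x ^ j) \<le> \<bar>exp (- V x) * f x * P x\<bar> * (exp (?t * (norm x)\<^sup>2) * 1)"
        by (rule mult_left_mono) simp
      then show ?thesis by (simp add: abs_mult mult_ac power_abs)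
    qed
    have bi: "integrable lborel (\<lambda>x. \<bar>exp (- V x) * (f x * (P x * exp (?t * (norm x)\<^sup>2)))\<bar>)"
      by (rule integrable_abs[OF weighted_mult_integrable[OF f w M]])
    have m1: "(\<lambda>x. exp (- V x) * (f x * (P x * ?e x ^ Suc j))) \<in> borel_measurable lborel" by measurable
    have m2: "?s N \<in> borel_measurable lborel" for N by measurable
    have "(\<lambda>N. \<integral>x. ?s N x \<partial>lborel) \<longlonglongrightarrow> (\<integral>x. exp (- V x) * (f x * (P x * ?e x ^ Suc j)) \<partial>lborel)"
      by (rule integral_dominated_convergence[OF m1 m2 bi AE_I2[OF lim] AE_I2[OF bd]])
    moreover have "integrable lborel (\<lambda>x. exp (- V x) * (f x * (P x * ?e x ^ Suc j)))"
      by (rule integrable_dominated_convergence[OF m1 m2 bi AE_I2[OF lim] AE_I2[OF bd]])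
    ultimately show ?case unfolding s(2) using LIMSEQ_unique[OF _ tendsto_const] by blast
  }
qed

lemma orthogonal_gauss_poly:
  assumes "gauss_poly (\<rho> / 8) g"
  shows "integrable lborel (\<lambda>x. exp (- V x) * (f x * g x)) \<and> (\<integral>x. exp (- V x) * (f x * g x) \<partial>lborel) = 0"
  using assms
proof induction
  case (base d P j)
  then show ?case by (rule orthogonal_damped_polynomial)
next
  case (add g h)
  have "(\<lambda>x. exp (- V x) * (f x * (g x + h x))) = (\<lambda>x. exp (- V x) * (f x * g x) + exp (- V x) * (f x * h x))"
    by (simp only: distrib_left)
  then show ?case using add.IH by simp
qed

text \<open>The function \<open>w = exp (- V) * f\<close> is Lebesgue integrable and orthogonal to
  all \<open>gauss_poly\<close> functions. These approximate test functions uniformly, so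
  \<open>w\<close> is orthogonal to every test function.\<close>

lemma polynomials_complete: "l2_class V f = 0"
proof -
  note V = gaussian_smooth[OF \<rho> V_def] and M = V_measurable[OF gaussian_smooth[OF \<rho> V_def]]
  define w where "w x = exp (- V x) * f x" for x
  have w1: "weighted_square_integrable V (\<lambda>x. 1)" by (rule poly_square_integrable[OF \<rho> V_def poly_le_const])
  have wi: "integrable lborel w" using weighted_mult_integrable[OF f w1 M] by (simp add: w_def[abs_def])
  have "(\<integral>x. w x * \<phi> x \<partial>lborel) = 0" if \<phi>: "test_function \<phi>" for \<phi>
  proof (rule ccontr)
    let ?I = "\<bar>\<integral>x. w x * \<phi> x \<partial>lborel\<bar>" and ?J = "\<integral>x. \<bar>w x\<bar> \<partial>lborel"
    assume "(\<integral>x. w x * \<phi> x \<partial>lborel) \<noteq> 0"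
    then have I: "?I > 0" by simp
    have J: "?J \<ge> 0" by simp
    \<comment> \<open>Chosen so that \<open>\<epsilon> * ?J\<close> falls short of
      \<open>?I\<close>; the added 1 covers \<open>?J = 0\<close>.\<close>
    define \<epsilon> where "\<epsilon> = ?I / (?J + 1)"
    have \<epsilon>: "\<epsilon> > 0" using I J by (simp add: \<epsilon>_def add_nonneg_pos)
    obtain g where g: "gauss_poly (\<rho> / 8) g" "\<And>x. \<bar>\<phi> x - g x\<bar> < \<epsilon>"
      by (rule gauss_poly_approximation[OF \<phi> _ \<epsilon>, of "\<rho> / 8"]) (use \<rho> in simp, rule that)
    have gi: "integrable lborel (\<lambda>x. w x * g x)" "(\<integral>x. w x * g x \<partial>lborel) = 0"
      using orthogonal_gauss_poly[OF g(1)] by (simp_all add: w_def mult.assoc)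
    have \<phi>i: "integrable lborel (\<lambda>x. w x * \<phi> x)"
      using weighted_mult_integrable[OF f test_function_square_integrable[OF V \<phi>] M] by (simp add: w_def mult.assoc)
    have "(\<integral>x. w x * \<phi> x \<partial>lborel) = (\<integral>x. w x * \<phi> x - w x * g x \<partial>lborel)"
      using gi \<phi>i by simp
    also have "\<bar>\<dots>\<bar> \<le> (\<integral>x. \<epsilon> * \<bar>w x\<bar> \<partial>lborel)"
    proof -
      have "norm (\<integral>x. w x * \<phi> x - w x * g x \<partial>lborel) \<le> (\<integral>x. \<epsilon> * \<bar>w x\<bar> \<partial>lborel)"
      proof (rule Bochner_Integration.integral_norm_bound_integral)
        show "norm (w x * \<phi> x - w x * g x) \<le> \<epsilon> * \<bar>w x\<bar>" for x
          unfolding right_diff_distrib[symmetric] real_norm_def abs_mult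
          using mult_left_mono[OF less_imp_le[OF g(2)[of x]] abs_ge_zero[of "w x"]] by (simp add: mult.commute)
      qed (use gi \<phi>i wi in auto)
      then show ?thesis by simp
    qed
    finally have "?I \<le> \<epsilon> * ?J" by simp
    also have "\<dots> < \<epsilon> * (?J + 1)" using \<epsilon> by simp
    also have "\<dots> = ?I" unfolding \<epsilon>_def using J by (simp add: add_nonneg_eq_0_iff)
    finally show False by simp
  qed
  moreover have "square_integrable w"
  proof -
    \<comment> \<open>The Gaussian potential is bounded below, so \<open>exp (- V / 2)\<close> is a
      bounded multiplier.\<close>
    have "weighted_square_integrable V (\<lambda>x. exp (- V x / 2) * f x)"
    proof (rule bounded_mult_square_integrable[OF V f])
      show "(\<lambda>x. exp (- V x / 2)) \<in> borel_measurable borel" using M by measurable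
      show "\<bar>exp (- V x / 2)\<bar> \<le> exp (real DIM('a) / 2 * ln (\<rho> / (2 * pi)) / 2)" for x
        using \<rho> unfolding gaussian_eq[OF \<rho> V_def] by simp
    qed
    then have "square_integrable (\<lambda>x. exp (- V x / 2) * (exp (- V x / 2) * f x))" by (simp add: square_integrable_weight[OF M])
    moreover have "exp (- V x / 2) * (exp (- V x / 2) * f x) = w x" for x
      unfolding w_def exp_half_square[symmetric] power2_eq_square by (simp only: mult.assoc)
    ultimately show ?thesis by (simp only:)
  qed
  ultimately have "AE x in lborel. w x = 0" by (intro orthogonal_to_test_functions)
  then have "AE x in lborel. f x = 0" by eventually_elim (simp add: w_def)
  then have "l2_class V f = l2_class V (\<lambda>x. 0)"
    using l2_class_eq_iff[OF M f, of "\<lambda>x. 0"] by (simp add: weighted_square_integrable_def)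
  then show ?thesis by (simp add: l2_class_zero[OF V])
qed

end

section \<open>Comparison of the spectra\<close>

text \<open>An infinite basis would contain \<open>Suc n\<close> independent vectors, so the bound
  on finite sets excludes the value \<open>\<infinity>\<close>.\<close>

lemma edim_le_rank:
  assumes "\<And>B. finite B \<Longrightarrow> independent B \<Longrightarrow> B \<subseteq> S \<Longrightarrow> card B \<le> n"
  shows "edim S \<le> enat n"
proof -
  obtain B where B: "B \<subseteq> S" "independent B" "S \<subseteq> span B" "card B = dim S" by (rule basis_exists)
  have "finite B"
  proof (rule ccontr)
    assume "infinite B"
    then obtain T where T: "finite T" "card T = Suc n" "T \<subseteq> B" using infinite_arbitrarily_large by blast
    then have "card T \<le> n" using assms[of T] independent_mono[OF B(2) T(3)] B(1) by blast
    then show False using T(2) by simp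
  qed
  then show ?thesis using assms[of B] B unfolding edim_def by auto
qed

lemma independent_preimage:
  assumes f: "linear f" "inj f" and i: "independent (f ` D)" shows "independent D"
proof
  assume "dependent D"
  then obtain a where a: "a \<in> D" "a \<in> span (D - {a})" unfolding dependent_def by blast
  have "f ` (D - {a}) = f ` D - {f a}" using f(2) by (auto dest: injD)
  moreover have "f a \<in> span (f ` (D - {a}))" using a(2) linear_span_image[OF f(1)] by blast
  ultimately show False using i a(1) unfolding dependent_def by auto
qed

text \<open>If the range of \<open>E m\<close> had larger dimension, it would contain a nonzero
  \<open>w\<close> orthogonal to all polynomials of degree below \<open>d\<close>. Such a
  \<open>w\<close> is orthogonal to all polynomials, against completeness. For \<open>d = 0\<close>
  the value \<open>m\<close> is negative and the range trivial; truncated subtraction would count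
  the constants, hence the case distinction.\<close>

theorem gaussian_dimension_bound:
  fixes \<rho> m :: real
  defines "V \<equiv> (gaussian_potential \<rho> :: real ^ 'n \<Rightarrow> real)"
  assumes \<rho>: "\<rho> > 0" and m: "m < real d * \<rho>"
  shows "edim (spectral_projection V m ` L2 V) \<le> enat (if d = 0 then 0 else dim (poly_space (d - 1) :: (real ^ 'n) aefun set))"
proof -
  note Vd = meta_eq_to_obj_eq[OF V_def]
  note V = gaussian_smooth[OF \<rho> Vd] and M = V_measurable[OF gaussian_smooth[OF \<rho> Vd]]
  note lin = l2_unweight_linear[OF M]
  have inj: "inj (l2_unweight V)" by (auto intro!: injI l2_unweight_inj[OF M])
  obtain A E where A: "selfadjoint_rel A" "pull_rel V (neg_weighted_laplacian_graph V) \<subseteq> A" "spectral_resolution A E"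
    and E: "\<And>l. spectral_projection V l ` L2 V = l2_unweight V ` range (E l)"
    using spectral_projection_model[OF M self_adjoint_extension_exists[OF V] graph_L2[OF V]] by blast
  have Elin: "linear (E m)" and EE: "E m (E m u) = E m u" for u
    using A(3) by (auto simp: spectral_resolution_def projection_resolution_def intro: projection_op_linear)
  let ?N = "if d = 0 then 0 else dim (poly_space (d - 1) :: (real ^ 'n) aefun set)"
  obtain C where C: "finite C" "card C \<le> ?N" "\<And>i p. i < d \<Longrightarrow> poly_le i p \<Longrightarrow> l2_class V p \<in> span C"
  proof (cases "d = 0")
    case True
    then show ?thesis using that[of "{}"] by simp
  next
    case False
    let ?R = "l2_class V ` Collect (poly_le (d - 1))"
    have "l2_unweight V ` ?R = poly_space (d - 1)"
      unfolding poly_space_def image_image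
      by (intro image_cong refl) (simp add: l2_unweight_class[OF M poly_square_integrable[OF \<rho> Vd]])
    moreover obtain B where "finite B" "poly_space (d - 1) \<subseteq> span (B :: (real ^ 'n) aefun set)" by (rule poly_space_finite_dim)
    ultimately have "edim (l2_unweight V ` ?R) < enat (Suc ?N)" using False unfolding edim_def by auto
    then obtain C where C: "finite C" "?R \<subseteq> span C" "card C < Suc ?N"
      by (rule range_spectral_projection_finite[OF M]) (rule that)
    show ?thesis
    proof (rule that[OF C(1)])
      show "card C \<le> ?N" using C(3) by simp
      fix i and p :: "real ^ 'n \<Rightarrow> real" assume i: "i < d" and p: "poly_le i p"
      from i have "i \<le> d - 1" by linarith
      with p have "poly_le (d - 1) p" by (rule poly_le_mono)
      then show "l2_class V p \<in> span C" using C(2) by blast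
    qed
  qed
  have "edim (l2_unweight V ` range (E m)) \<le> enat (card C)"
  proof (rule edim_le_rank)
    fix B assume B: "finite B" "independent B" "B \<subseteq> l2_unweight V ` range (E m)"
    obtain D where D: "D \<subseteq> range (E m)" "B = l2_unweight V ` D" using B(3) by (auto simp: subset_image_iff)
    have injD: "inj_on (l2_unweight V) D" by (rule inj_on_subset[OF inj]) simp
    have fD: "finite D" using B(1) D(2) finite_imageD[OF _ injD] by simp
    have cD: "card D = card B" using card_image[OF injD] D(2) by simp
    have iD: "independent D" using independent_preimage[OF lin inj] B(2) D(2) by simp
    show "card B \<le> card C"
    proof (rule ccontr)
      assume "\<not> card B \<le> card C"
      then have lt: "card C < card D" using cD by simp
      \<comment> \<open>\<open>w \<bullet> f w\<close> is the sum of the squares of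
        \<open>w \<bullet> c\<close>, so a kernel vector is orthogonal to \<open>C\<close>.\<close>
      define f where "f u = (\<Sum>c\<in>C. (u \<bullet> c) *\<^sub>R c)" for u :: "(real ^ 'n) l2"
      have "linear f"
        unfolding f_def by (rule linearI) (simp_all add: inner_add_left scaleR_add_left sum.distrib scaleR_sum_right)
      moreover have "f ` D \<subseteq> span C" unfolding f_def by (intro image_subsetI span_sum span_scale span_base)
      ultimately obtain w where w: "w \<in> span D" "w \<noteq> 0" "f w = 0"
        using finite_rank_kernel[OF _ iD fD C(1) _ lt] by blast
      have "subspace (range (E m))" using linear_subspace_image[OF Elin subspace_UNIV] .
      then have "w \<in> range (E m)" using w(1) D(1) span_minimal by blast
      then have Ew: "E m w = w" using EE by auto
      have "(\<Sum>c\<in>C. (w \<bullet> c)\<^sup>2) = w \<bullet> f w"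
        unfolding f_def by (simp add: inner_sum_right power2_eq_square)
      also have "\<dots> = 0" by (simp add: w(3))
      finally have wc: "\<And>c. c \<in> C \<Longrightarrow> w \<bullet> c = 0" using C(1) by (simp add: sum_nonneg_eq_0_iff)
      have "span C \<subseteq> {c. w \<bullet> c = 0}" by (rule span_minimal) (auto simp: wc subspace_def inner_add_right)
      then have wC: "w \<bullet> c = 0" if "c \<in> span C" for c using that by blast
      have orth: "w \<bullet> l2_class V p = 0" if "poly_le i p" for i p
        by (rule polynomial_orthogonal[OF \<rho> Vd A Ew m _ that]) (use wC C(3) in blast)
      obtain h where h: "weighted_square_integrable V h" "w = l2_class V h" by (rule l2_class_cases[OF M])
      have "w = 0" unfolding h(2) by (rule polynomials_complete[OF \<rho> Vd h(1)]) (use orth h(2) in blast)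
      then show False using w(2) by simp
    qed
  qed
  also have "\<dots> \<le> enat ?N" using C(2) by simp
  finally show ?thesis unfolding E .
qed

theorem theorem1p2:
  fixes V :: "real ^ 'n \<Rightarrow> real" and \<rho> :: real
  assumes "\<rho> > 0"
    and "smooth V"
    and "prob_space (weighted_measure V)"
    and "\<And>x v. hessian V x v \<bullet> v \<le> \<rho> * (v \<bullet> v)"
  shows "\<forall>k\<ge>1. spectral_value V k \<le> spectral_value (gaussian_potential \<rho> :: real ^ 'n \<Rightarrow> real) k"
proof (intro allI impI)
  fix k :: nat assume k: "k \<ge> 1"
  let ?P = "\<lambda>d. dim (poly_space d :: (real ^ 'n) aefun set)"
  let ?G = "gaussian_potential \<rho> :: real ^ 'n \<Rightarrow> real"
  \<comment> \<open>Below \<open>d * \<rho>\<close> the Gaussian spectral projection has rank at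
    most the number of independent polynomials of degree \<open>d - 1\<close>, so such
    \<open>m\<close> take part in the supremum.\<close>
  have mem: "ereal m \<le> spectral_value ?G k" if m: "m < real d * \<rho>" and d: "d = 0 \<or> ?P (d - 1) < k" for m d
  proof -
    have "edim (spectral_projection ?G m ` L2 ?G) \<le> enat (if d = 0 then 0 else ?P (d - 1))"
      by (rule gaussian_dimension_bound[OF assms(1) m])
    also have "\<dots> < enat k" using d k by auto
    finally show ?thesis unfolding spectral_value_def by (intro Sup_upper) auto
  qed
  show "spectral_value V k \<le> spectral_value ?G k"
  proof (cases "\<exists>d. k \<le> ?P d")
    case True
    \<comment> \<open>The least degree whose polynomials fill \<open>k\<close> dimensions:
      \<open>d\<close> suffices for the upper bound for \<open>V\<close>, while \<open>d - 1\<close>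
      falls short, giving the lower bound for the Gaussian. Both thresholds are
      \<open>d * \<rho>\<close>.\<close>
    define d where "d = (LEAST d. k \<le> ?P d)"
    have d: "k \<le> ?P d" unfolding d_def by (rule LeastI_ex[OF True])
    have d': "d = 0 \<or> ?P (d - 1) < k" 
      using not_less_Least[of "d - 1" "\<lambda>d. k \<le> ?P d", folded d_def] by (cases d) auto
    have "spectral_value V k \<le> ereal (real d * \<rho>)"
      unfolding spectral_value_def using spectral_threshold_le[OF assms(2,3,1,4) _ d] by (intro Sup_least) auto
    also have "\<dots> \<le> spectral_value ?G k"
    \<comment> \<open>\<open>mem\<close> is available strictly below \<open>d * \<rho>\<close>, so
      the endpoint is reached by density.\<close>
    proof (rule dense_le)
      fix y assume "y < ereal (real d * \<rho>)"
      then show "y \<le> spectral_value ?G k" by (cases y) (auto intro: mem[OF _ d'])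
    qed
    finally show ?thesis .
  next
    case False
    \<comment> \<open>If no degree reaches dimension \<open>k\<close>, \<open>mem\<close> applies
      for every \<open>d\<close> and the Gaussian value is infinite.\<close>
    have "ereal l \<le> spectral_value ?G k" for l
    proof -
      obtain d where "l / \<rho> < real d" using reals_Archimedean2 by blast
      then have "l < real d * \<rho>" using assms(1) by (simp add: pos_divide_less_eq)
      then show ?thesis using False by (intro mem) (auto simp: not_le)
    qed
    then have "spectral_value ?G k = \<infinity>" by (intro ereal_top) simp
    then show ?thesis by simp
  qed
qed

end
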